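(* Let $m\ge 2$ be an integer and let $n\ge 1$ be an odd integer, let $\Bbbk$ be an algebraically closed field with $\operatorname{char}(\Bbbk)\nmid mn$, let $q\in\Bbbk$ be a primitive $n$-th root of unity, and let $\xi\in\Bbbk$ be a primitive $mn$-th root of unity with $\xi^m=q$. Let $D(R_{mn}(q))$ be the Drinfeld double of the Radford Hopf algebra $R_{mn}(q)$ with its canonical universal $R$-matrix $\mathcal{R}$, let $\alpha,\beta\in (R_{mn}(q))^*$ be as defined in the context, and let $u=\sum_i S(y_i)x_i\in D(R_{mn}(q))$, where $\mathcal{R}=\sum_i x_i\otimes y_i$. Then $$u=\frac{1}{mn}\sum_{\substack{0\le i,k\le mn-1\\ 0\le j\le n-1}}(-1)^j\frac{1}{(j)!_q}\,\xi^{-(i+j)k-\frac{j(j-1)m}{2}}\,(\alpha^{-mj-k}\beta^j\bowtie g^ix^j),$$ and: (1) When $m$ is odd, the unique ribbon element in $D(R_{mn}(q))$ (with respect to $\mathcal{R}$) is $$v=u\,(\alpha^{\frac{m(n+1)}{2}}\bowtie g^{\frac{n-1}{2}}).$$ (2) When $m$ is even, the ribbon elements in $D(R_{mn}(q))$ (with respect to $\mathcal{R}$) are $$v_1=u\,(\alpha^{\frac{m(n+1)}{2}}\bowtie g^{\frac{n-1}{2}}),\qquad v_2=u\,(\alpha^{\frac{m(n+1)}{2}}\bowtie g^{\frac{n(m+1)-1}{2}}).$$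
   Context: Radford Hopf algebra: $R_{mn}(q)$ is the Hopf algebra generated as an algebra over $\Bbbk$ by $g,x$ with relations $g^{mn}=1$, $x^n=g^n-1$, $xg=qgx$, and with $\Delta(g)=g\otimes g$, $\Delta(x)=x\otimes g+1\otimes x$, $\varepsilon(g)=1$, $\varepsilon(x)=0$, $S(g)=g^{-1}$, $S(x)=-xg^{-1}$. It has dimension $mn^2$ with basis $\{g^ix^j: 0\le i\le mn-1,\ 0\le j\le n-1\}$. Dual elements: $\{\overline{g^ix^j}\}$ denotes the basis of $(R_{mn}(q))^*$ dual to $\{g^ix^j\}$; $\alpha=\sum_{i=0}^{mn-1}\xi^i\,\overline{g^i}$ and $\beta=\sum_{i=0}^{mn-1}\overline{g^ix}$. Products and powers in $(R_{mn}(q))^*$ are for the convolution product, with identity $\varepsilon$; one has $\alpha^{mn}=\varepsilon$, so negative powers of $\alpha$ make sense. Also $(j)!_q=\prod_{i=1}^{j}(1+q+\dots+q^{i-1})$, with $(0)!_q=1$. Drinfeld double: for a finite-dimensional Hopf algebra $H$ with antipode $S$, $D(H)=(H^* )^{cop}\bowtie H$ is the vector space $H^*\otimes H$ (elements written $f\bowtie a$) with unit $\varepsilon\bowtie 1$ (an element $\varepsilon\bowtie a$ is also written $1\bowtie a$), multiplication $$(f\bowtie a)(p\bowtie b)=\sum f*\bigl(p(S^{-1}(a_3)\,?\,a_1)\bigr)\bowtie a_2b,$$ where $*$ is the convolution product of $H^*$ and $p(S^{-1}(a_3)\,?\,a_1)$ denotes the functional $y\mapsto p(S^{-1}(a_3)ya_1)$;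 comultiplication $\Delta(f\bowtie a)=\sum (f_1\bowtie a_1)\otimes(f_2\bowtie a_2)$, where $\sum f_1(y)f_2(z)=f(zy)$ for all $y,z\in H$; and counit $\varepsilon(f\bowtie a)=\varepsilon(a)f(1)$. Its antipode (also denoted $S$) is the unique one making it a Hopf algebra. Its canonical universal $R$-matrix is $\mathcal{R}=\sum_i(1\bowtie e_i)\otimes(e^i\bowtie 1)$, where $\{e_i\}$ is a basis of $H$ and $\{e^i\}$ is the dual basis of $H^*$. Ribbon elements: for a quasi-triangular Hopf algebra $(A,\mathcal{R})$ with $\mathcal{R}=\sum_i x_i\otimes y_i$ (i.e. $\mathcal R$ is invertible, $\mathcal{R}\Delta(a)=\Delta^{op}(a)\mathcal{R}$ for all $a\in A$, $(\Delta\otimes \mathrm{id})\mathcal{R}=\mathcal{R}_{13}\mathcal{R}_{23}$, $(\mathrm{id}\otimes\Delta)\mathcal{R}=\mathcal{R}_{13}\mathcal{R}_{12}$), put $\mathcal{R}^{op}=\sum_i y_i\otimes x_i$ and $u=\sum_i S(y_i)x_i$. A ribbon element is an invertible central $v\in A$ such that $v^2=uS(u)$, $S(v)=v$, $\varepsilon(v)=1$ and $\Delta(v)=(\mathcal{R}^{op}\mathcal{R})^{-1}(v\otimes v)$.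
   Formalization: In (2), that v1 and v2 are the only ribbon elements is proved for n ≠ 1; for n = 1 and m even this is false, since u(α^{m/2} ⋈ 1) is a further ribbon element; everything else is proved for all odd n ≥ 1. *)

theory Defs
  imports Complex_Main "HOL-Algebra.Group" "HOL-Library.Function_Algebras"
    "HOL-Computational_Algebra.Polynomial"
begin

text \<open>
  Conventions. The ground field is a type \<open>'k\<close> of class \<^class>\<open>field\<close>. A vector space is a subspace
  (the \<^const>\<open>carrier\<close>) of an ambient vector space on a type of class \<^class>\<open>ab_group_add\<close>, so that sums
  are the usual ones; function types carry the pointwise structure of
  \<^theory>\<open>HOL-Library.Function_Algebras\<close> together with \<open>fun_scal\<close> below. The pointwise product of functions
  supplied by that theory is never used: products are those of the records below.
\<close>

section \<open>Algebras and linear maps\<close>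

record ('k, 'a) kalg = "'a monoid" +
  scal :: "'k \<Rightarrow> 'a \<Rightarrow> 'a"

definition fun_scal :: "'k::field \<Rightarrow> ('i \<Rightarrow> 'k) \<Rightarrow> 'i \<Rightarrow> 'k" where
  "fun_scal c f = (\<lambda>i. c * f i)"

definition linear_on ::
  "('k::field, 'a::ab_group_add, 'm) kalg_scheme \<Rightarrow> ('k \<Rightarrow> 'b \<Rightarrow> 'b) \<Rightarrow> ('a \<Rightarrow> 'b::ab_group_add) \<Rightarrow> bool"
  where
  "linear_on A s f \<longleftrightarrow>
     (\<forall>a\<in>carrier A. \<forall>b\<in>carrier A. f (a + b) = f a + f b) \<and>
     (\<forall>c. \<forall>a\<in>carrier A. f (scal A c a) = s c (f a))"

definition bilinear_on ::
  "('k::field, 'a::ab_group_add, 'm) kalg_scheme \<Rightarrow> ('k, 'b::ab_group_add, 'n) kalg_scheme \<Rightarrow>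
   ('k \<Rightarrow> 'c \<Rightarrow> 'c) \<Rightarrow> ('a \<Rightarrow> 'b \<Rightarrow> 'c::ab_group_add) \<Rightarrow> bool" where
  "bilinear_on A B s f \<longleftrightarrow>
     (\<forall>a\<in>carrier A. linear_on B s (f a)) \<and> (\<forall>b\<in>carrier B. linear_on A s (\<lambda>a. f a b))"

locale kalgebra = monoid A
  for A :: "('k::field, 'a::ab_group_add, 'm) kalg_scheme" (structure) +
  assumes vector_space_scal: "vector_space (scal A)"
    and subspace_carrier: "module.subspace (scal A) (carrier A)"
    and bilinear_mult: "bilinear_on A A (scal A) (\<lambda>a b. a \<otimes> b)"

definition is_basis :: "('k::field, 'a::ab_group_add, 'm) kalg_scheme \<Rightarrow> 'a set \<Rightarrow> bool" where
  "is_basis A B \<longleftrightarrow> \<not> module.dependent (scal A) B \<and> module.span (scal A) B = carrier A"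

text \<open>
  The element of the dual basis of \<open>B\<close> that belongs to \<open>b \<in> B\<close>. It vanishes outside the span of \<open>B\<close>, in
  accordance with the convention for \<open>dual_alg\<close> below.
\<close>

definition dual_elt :: "('k::field, 'a::ab_group_add, 'm) kalg_scheme \<Rightarrow> 'a set \<Rightarrow> 'a \<Rightarrow> 'a \<Rightarrow> 'k" where
  "dual_elt A B b = (\<lambda>a. module.representation (scal A) B a b)"


section \<open>Tensor products\<close>

text \<open>
  Over a field, \<open>A \<otimes> B\<close> embeds into the dual of the space of bilinear forms on \<open>A \<times> B\<close>, with \<open>a \<otimes> b\<close>
  acting as evaluation at \<open>(a, b)\<close>. We take this as the construction of the tensor product: it is the
  set of finite sums of the functionals \<open>tens A B a b\<close>.
\<close>

type_synonym ('k, 'a, 'b) tensor = "('a \<Rightarrow> 'b \<Rightarrow> 'k) \<Rightarrow> 'k"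

definition tens ::
  "('k::field, 'a::ab_group_add, 'm) kalg_scheme \<Rightarrow> ('k, 'b::ab_group_add, 'n) kalg_scheme \<Rightarrow>
   'a \<Rightarrow> 'b \<Rightarrow> ('k, 'a, 'b) tensor" where
  "tens A B a b = (\<lambda>f. if bilinear_on A B (*) f then f a b else 0)"

definition is_tensor_repr ::
  "('k::field, 'a::ab_group_add, 'm) kalg_scheme \<Rightarrow> ('k, 'b::ab_group_add, 'n) kalg_scheme \<Rightarrow>
   ('k, 'a, 'b) tensor \<Rightarrow> ('a \<times> 'b) list \<Rightarrow> bool" where
  "is_tensor_repr A B t ps \<longleftrightarrow>
     set ps \<subseteq> carrier A \<times> carrier B \<and> t = (\<Sum>(a, b)\<leftarrow>ps. tens A B a b)"

text \<open>
  \<open>tsum A B t F\<close> is the value \<open>\<Sum> F a b\<close>, where \<open>t = \<Sum> a \<otimes> b\<close> is any representation of \<open>t\<close>. It does not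
  depend on the representation if \<open>F\<close> is bilinear, the only case of interest; with \<open>t = \<Delta>(h)\<close> it
  renders Sweedler's notation.
\<close>

definition tsum ::
  "('k::field, 'a::ab_group_add, 'm) kalg_scheme \<Rightarrow> ('k, 'b::ab_group_add, 'n) kalg_scheme \<Rightarrow>
   ('k, 'a, 'b) tensor \<Rightarrow> ('a \<Rightarrow> 'b \<Rightarrow> 'c::ab_group_add) \<Rightarrow> 'c" where
  "tsum A B t F = (\<Sum>(a, b)\<leftarrow>(SOME ps. is_tensor_repr A B t ps). F a b)"

definition tensor_alg ::
  "('k::field, 'a::ab_group_add, 'm) kalg_scheme \<Rightarrow> ('k, 'b::ab_group_add, 'n) kalg_scheme \<Rightarrow>
   ('k, ('k, 'a, 'b) tensor) kalg" where
  "tensor_alg A B =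
     \<lparr>carrier = {t. \<exists>ps. is_tensor_repr A B t ps},
      monoid.mult = (\<lambda>s t. tsum A B s (\<lambda>a b. tsum A B t (\<lambda>c d.
                tens A B (a \<otimes>\<^bsub>A\<^esub> c) (b \<otimes>\<^bsub>B\<^esub> d)))),
      one = tens A B \<one>\<^bsub>A\<^esub> \<one>\<^bsub>B\<^esub>,
      scal = fun_scal\<rparr>"

definition tflip ::
  "('k::field, 'a::ab_group_add, 'm) kalg_scheme \<Rightarrow> ('k, 'a, 'a) tensor \<Rightarrow> ('k, 'a, 'a) tensor" where
  "tflip A t = tsum A A t (\<lambda>a b. tens A A b a)"

text \<open>The triple tensor product is taken as \<open>A \<otimes> (A \<otimes> A)\<close>.\<close>

definition tens3 ::
  "('k::field, 'a::ab_group_add, 'm) kalg_scheme \<Rightarrow> 'a \<Rightarrow> 'a \<Rightarrow> 'a \<Rightarrow>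
   ('k, 'a, ('k, 'a, 'a) tensor) tensor" where
  "tens3 A a b c = tens A (tensor_alg A A) a (tens A A b c)"

definition tensor3_alg ::
  "('k::field, 'a::ab_group_add, 'm) kalg_scheme \<Rightarrow> ('k, ('k, 'a, ('k, 'a, 'a) tensor) tensor) kalg" where
  "tensor3_alg A = tensor_alg A (tensor_alg A A)"


section \<open>Hopf algebras\<close>

record ('k, 'a) bialg = "('k, 'a) kalg" +
  comult :: "'a \<Rightarrow> ('k, 'a, 'a) tensor"
  counit :: "'a \<Rightarrow> 'k"

locale bialgebra = kalgebra A
  for A :: "('k::field, 'a::ab_group_add, 'm) bialg_scheme" (structure) +
  assumes comult_closed: "a \<in> carrier A \<Longrightarrow> comult A a \<in> carrier (tensor_alg A A)"
    and linear_comult: "linear_on A fun_scal (comult A)"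
    and linear_counit: "linear_on A (*) (counit A)"
    and coassoc: "a \<in> carrier A \<Longrightarrow>
      tsum A A (comult A a) (\<lambda>b c. tsum A A (comult A b) (\<lambda>b1 b2. tens3 A b1 b2 c)) =
      tsum A A (comult A a) (\<lambda>b c. tsum A A (comult A c) (\<lambda>c1 c2. tens3 A b c1 c2))"
    and counit_left: "a \<in> carrier A \<Longrightarrow> tsum A A (comult A a) (\<lambda>b c. scal A (counit A b) c) = a"
    and counit_right: "a \<in> carrier A \<Longrightarrow> tsum A A (comult A a) (\<lambda>b c. scal A (counit A c) b) = a"
    and comult_mult: "\<lbrakk>a \<in> carrier A; b \<in> carrier A\<rbrakk> \<Longrightarrow>
      comult A (a \<otimes> b) = comult A a \<otimes>\<^bsub>tensor_alg A A\<^esub> comult A b"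
    and comult_one: "comult A \<one> = \<one>\<^bsub>tensor_alg A A\<^esub>"
    and counit_mult: "\<lbrakk>a \<in> carrier A; b \<in> carrier A\<rbrakk> \<Longrightarrow>
      counit A (a \<otimes> b) = counit A a * counit A b"
    and counit_one: "counit A \<one> = 1"

definition is_antipode ::
  "('k::field, 'a::ab_group_add, 'm) bialg_scheme \<Rightarrow> ('a \<Rightarrow> 'a) \<Rightarrow> bool" where
  "is_antipode A S \<longleftrightarrow>
     S \<in> carrier A \<rightarrow>\<^sub>E carrier A \<and> linear_on A (scal A) S \<and>
     (\<forall>a\<in>carrier A.
        tsum A A (comult A a) (\<lambda>b c. S b \<otimes>\<^bsub>A\<^esub> c) = scal A (counit A a) \<one>\<^bsub>A\<^esub> \<and>
        tsum A A (comult A a) (\<lambda>b c. b \<otimes>\<^bsub>A\<^esub> S c) = scal A (counit A a) \<one>\<^bsub>A\<^esub>)"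

locale hopf_algebra = bialgebra A
  for A :: "('k::field, 'a::ab_group_add, 'm) bialg_scheme" (structure) +
  assumes ex_antipode: "\<exists>S. is_antipode A S"

text \<open>An antipode of a bialgebra is unique if it exists.\<close>

definition antipode :: "('k::field, 'a::ab_group_add, 'm) bialg_scheme \<Rightarrow> 'a \<Rightarrow> 'a" where
  "antipode A = (THE S. is_antipode A S)"

text \<open>Functionals on \<open>H\<close> are extended by zero outside the carrier; the product is convolution.\<close>

definition on_carrier :: "('a, 'm) partial_object_scheme \<Rightarrow> ('a \<Rightarrow> 'k::zero) \<Rightarrow> 'a \<Rightarrow> 'k" where
  "on_carrier H f = (\<lambda>a. if a \<in> carrier H then f a else 0)"

definition dual_alg ::
  "('k::field, 'a::ab_group_add, 'm) bialg_scheme \<Rightarrow> ('k, 'a \<Rightarrow> 'k) kalg" where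
  "dual_alg H =
     \<lparr>carrier = {f. linear_on H (*) f \<and> (\<forall>a. a \<notin> carrier H \<longrightarrow> f a = 0)},
      monoid.mult = (\<lambda>f p. on_carrier H (\<lambda>a. tsum H H (comult H a) (\<lambda>a1 a2. f a1 * p a2))),
      one = on_carrier H (counit H),
      scal = fun_scal\<rparr>"


section \<open>Quasi-triangular Hopf algebras and ribbon elements\<close>

locale quasitriangular = hopf_algebra A
  for A :: "('k::field, 'a::ab_group_add, 'm) bialg_scheme" (structure)
    and R :: "('k, 'a, 'a) tensor" +
  assumes R_invertible: "R \<in> Units (tensor_alg A A)"
    and R_comult: "a \<in> carrier A \<Longrightarrow>
      R \<otimes>\<^bsub>tensor_alg A A\<^esub> comult A a = tflip A (comult A a) \<otimes>\<^bsub>tensor_alg A A\<^esub> R"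
    and comult_id_R:
      "tsum A A R (\<lambda>x y. tsum A A (comult A x) (\<lambda>x1 x2. tens3 A x1 x2 y)) =
       tsum A A R (\<lambda>x y. tens3 A x \<one> y) \<otimes>\<^bsub>tensor3_alg A\<^esub> tsum A A R (\<lambda>x y. tens3 A \<one> x y)"
    and id_comult_R:
      "tsum A A R (\<lambda>x y. tsum A A (comult A y) (\<lambda>y1 y2. tens3 A x y1 y2)) =
       tsum A A R (\<lambda>x y. tens3 A x \<one> y) \<otimes>\<^bsub>tensor3_alg A\<^esub> tsum A A R (\<lambda>x y. tens3 A x y \<one>)"

definition drinfeld_element ::
  "('k::field, 'a::ab_group_add, 'm) bialg_scheme \<Rightarrow> ('k, 'a, 'a) tensor \<Rightarrow> 'a" where
  "drinfeld_element A R = tsum A A R (\<lambda>x y. antipode A y \<otimes>\<^bsub>A\<^esub> x)"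

definition ribbon_element ::
  "('k::field, 'a::ab_group_add, 'm) bialg_scheme \<Rightarrow> ('k, 'a, 'a) tensor \<Rightarrow> 'a \<Rightarrow> bool" where
  "ribbon_element A R v \<longleftrightarrow>
     quasitriangular A R \<and>
     v \<in> Units A \<and> (\<forall>a\<in>carrier A. v \<otimes>\<^bsub>A\<^esub> a = a \<otimes>\<^bsub>A\<^esub> v) \<and>
     v \<otimes>\<^bsub>A\<^esub> v = drinfeld_element A R \<otimes>\<^bsub>A\<^esub> antipode A (drinfeld_element A R) \<and>
     antipode A v = v \<and>
     counit A v = 1 \<and>
     comult A v =
       inv\<^bsub>tensor_alg A A\<^esub> (tflip A R \<otimes>\<^bsub>tensor_alg A A\<^esub> R) \<otimes>\<^bsub>tensor_alg A A\<^esub> tens A A v v"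


section \<open>The Drinfeld double\<close>

definition bowtie ::
  "('k::field, 'a::ab_group_add, 'm) bialg_scheme \<Rightarrow> ('a \<Rightarrow> 'k) \<Rightarrow> 'a \<Rightarrow> ('k, 'a \<Rightarrow> 'k, 'a) tensor"
  where
  "bowtie H f a = tens (dual_alg H) H f a"

definition double_alg ::
  "('k::field, 'a::ab_group_add, 'm) bialg_scheme \<Rightarrow> ('k, ('k, 'a \<Rightarrow> 'k, 'a) tensor) kalg" where
  "double_alg H =
     \<lparr>carrier = carrier (tensor_alg (dual_alg H) H),
      monoid.mult = (\<lambda>s t.
        tsum (dual_alg H) H s (\<lambda>f a. tsum (dual_alg H) H t (\<lambda>p b.
          tsum H H (comult H a) (\<lambda>a1 a'. tsum H H (comult H a') (\<lambda>a2 a3.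
            bowtie H
              (f \<otimes>\<^bsub>dual_alg H\<^esub>
                 on_carrier H (\<lambda>y. p (inv_into (carrier H) (antipode H) a3 \<otimes>\<^bsub>H\<^esub> y \<otimes>\<^bsub>H\<^esub> a1)))
              (a2 \<otimes>\<^bsub>H\<^esub> b)))))),
      one = bowtie H \<one>\<^bsub>dual_alg H\<^esub> \<one>\<^bsub>H\<^esub>,
      scal = fun_scal\<rparr>"

definition cop_dual_comult ::
  "('k::field, 'a::ab_group_add, 'm) bialg_scheme \<Rightarrow> ('a \<Rightarrow> 'k) \<Rightarrow> ('k, 'a \<Rightarrow> 'k, 'a \<Rightarrow> 'k) tensor"
  where
  "cop_dual_comult H f =
     (THE t. t \<in> carrier (tensor_alg (dual_alg H) (dual_alg H)) \<and>
        (\<forall>y\<in>carrier H. \<forall>z\<in>carrier H.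
           tsum (dual_alg H) (dual_alg H) t (\<lambda>f1 f2. f1 y * f2 z) = f (z \<otimes>\<^bsub>H\<^esub> y)))"

definition drinfeld_double ::
  "('k::field, 'a::ab_group_add, 'm) bialg_scheme \<Rightarrow> ('k, ('k, 'a \<Rightarrow> 'k, 'a) tensor) bialg" where
  "drinfeld_double H =
     \<lparr>carrier = carrier (double_alg H),
      monoid.mult = monoid.mult (double_alg H),
      one = \<one>\<^bsub>double_alg H\<^esub>,
      scal = scal (double_alg H),
      comult = (\<lambda>t. tsum (dual_alg H) H t (\<lambda>f a.
        tsum (dual_alg H) (dual_alg H) (cop_dual_comult H f) (\<lambda>f1 f2.
        tsum H H (comult H a) (\<lambda>a1 a2.
          tens (double_alg H) (double_alg H) (bowtie H f1 a1) (bowtie H f2 a2))))),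
      counit = (\<lambda>t. tsum (dual_alg H) H t (\<lambda>f a. counit H a * f \<one>\<^bsub>H\<^esub>))\<rparr>"

definition double_R ::
  "('k::field, 'a::ab_group_add, 'm) bialg_scheme \<Rightarrow>
   ('k, ('k, 'a \<Rightarrow> 'k, 'a) tensor, ('k, 'a \<Rightarrow> 'k, 'a) tensor) tensor" where
  "double_R H =
     (let B = (SOME B. is_basis H B) in
      \<Sum>e\<in>B. tens (drinfeld_double H) (drinfeld_double H)
        (bowtie H \<one>\<^bsub>dual_alg H\<^esub> e) (bowtie H (dual_elt H B e) \<one>\<^bsub>H\<^esub>))"


section \<open>Algebras given by generators and relations\<close>

text \<open>The free algebra on a type of generators: finitely supported functions on words.\<close>

definition free_alg :: "('k::field, 'c list \<Rightarrow> 'k) kalg" where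
  "free_alg =
     \<lparr>carrier = {f. finite {w. f w \<noteq> 0}},
      monoid.mult = (\<lambda>f h w. \<Sum>(u, v) | u @ v = w. f u * h v),
      one = (\<lambda>w. if w = [] then 1 else 0),
      scal = fun_scal\<rparr>"

definition free_gen :: "'c \<Rightarrow> 'c list \<Rightarrow> 'k::field" where
  "free_gen c = (\<lambda>w. if w = [c] then 1 else 0)"

definition free_eval ::
  "('k::field, 'a::ab_group_add, 'm) kalg_scheme \<Rightarrow> ('c \<Rightarrow> 'a) \<Rightarrow> ('c list \<Rightarrow> 'k) \<Rightarrow> 'a" where
  "free_eval A \<phi> f = (\<Sum>w | f w \<noteq> 0. scal A (f w) (foldr (\<lambda>c a. \<phi> c \<otimes>\<^bsub>A\<^esub> a) w \<one>\<^bsub>A\<^esub>))"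

definition two_sided_ideal :: "('k::field, 'a::ab_group_add, 'm) kalg_scheme \<Rightarrow> 'a set \<Rightarrow> bool" where
  "two_sided_ideal A I \<longleftrightarrow>
     I \<subseteq> carrier A \<and> module.subspace (scal A) I \<and>
     (\<forall>a\<in>carrier A. \<forall>b\<in>I. a \<otimes>\<^bsub>A\<^esub> b \<in> I \<and> b \<otimes>\<^bsub>A\<^esub> a \<in> I)"

definition ideal_generated :: "('k::field, 'a::ab_group_add, 'm) kalg_scheme \<Rightarrow> 'a set \<Rightarrow> 'a set" where
  "ideal_generated A X = \<Inter>{I. two_sided_ideal A I \<and> X \<subseteq> I}"

text \<open>
  \<open>A\<close> is generated by the elements \<open>\<phi> c\<close> with defining relations \<open>r = 0\<close> for \<open>r \<in> rels\<close>, i.e. evaluation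
  induces an isomorphism from the quotient of the free algebra by the ideal generated by \<open>rels\<close>.
\<close>

definition presented_by ::
  "('k::field, 'a::ab_group_add, 'm) kalg_scheme \<Rightarrow> ('c \<Rightarrow> 'a) \<Rightarrow> ('c list \<Rightarrow> 'k) set \<Rightarrow> bool" where
  "presented_by A \<phi> rels \<longleftrightarrow>
     range \<phi> \<subseteq> carrier A \<and>
     free_eval A \<phi> ` carrier free_alg = carrier A \<and>
     {f \<in> carrier free_alg. free_eval A \<phi> f = 0} = ideal_generated free_alg rels"


section \<open>The Radford Hopf algebra\<close>

definition primitive_root_of_unity :: "nat \<Rightarrow> 'k::field \<Rightarrow> bool" where
  "primitive_root_of_unity n z \<longleftrightarrow> z ^ n = 1 \<and> (\<forall>k. 0 < k \<and> k < n \<longrightarrow> z ^ k \<noteq> 1)"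

datatype radford_gen = Gen_g | Gen_x

definition radford_relations :: "nat \<Rightarrow> nat \<Rightarrow> 'k::field \<Rightarrow> (radford_gen list \<Rightarrow> 'k) set" where
  "radford_relations m n q =
     (let F = free_alg; g = free_gen Gen_g; x = free_gen Gen_x in
      {g [^]\<^bsub>F\<^esub> (m * n) - \<one>\<^bsub>F\<^esub>,
       x [^]\<^bsub>F\<^esub> n - (g [^]\<^bsub>F\<^esub> n - \<one>\<^bsub>F\<^esub>),
       x \<otimes>\<^bsub>F\<^esub> g - fun_scal q (g \<otimes>\<^bsub>F\<^esub> x)})"

text \<open>\<open>H\<close> is the Radford Hopf algebra with parameters \<open>m\<close>, \<open>n\<close>, \<open>q\<close> and generators \<open>g\<close>, \<open>x\<close>.\<close>

locale radford_hopf_algebra = hopf_algebra H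
  for H :: "('k::field, 'a::ab_group_add, 'm) bialg_scheme" (structure)
    and m n :: nat and q :: 'k and g x :: 'a +
  assumes presentation:
      "presented_by H (\<lambda>c. case c of Gen_g \<Rightarrow> g | Gen_x \<Rightarrow> x) (radford_relations m n q)"
    and comult_g: "comult H g = tens H H g g"
    and comult_x: "comult H x = tens H H x g + tens H H \<one> x"
    and counit_g: "counit H g = 1"
    and counit_x: "counit H x = 0"
    and antipode_g: "antipode H g = inv g"
    and antipode_x: "antipode H x = - (x \<otimes> inv g)"

definition radford_basis ::
  "('k::field, 'a::ab_group_add, 'm) kalg_scheme \<Rightarrow> nat \<Rightarrow> nat \<Rightarrow> 'a \<Rightarrow> 'a \<Rightarrow> 'a set" where
  "radford_basis H m n g x = {g [^]\<^bsub>H\<^esub> i \<otimes>\<^bsub>H\<^esub> x [^]\<^bsub>H\<^esub> j | i j. i < m * n \<and> j < n}"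

definition radford_alpha ::
  "('k::field, 'a::ab_group_add, 'm) kalg_scheme \<Rightarrow> nat \<Rightarrow> nat \<Rightarrow> 'k \<Rightarrow> 'a \<Rightarrow> 'a \<Rightarrow> 'a \<Rightarrow> 'k" where
  "radford_alpha H m n \<xi> g x =
     (\<Sum>i<m * n. fun_scal (\<xi> ^ i) (dual_elt H (radford_basis H m n g x) (g [^]\<^bsub>H\<^esub> i)))"

text \<open>For \<open>n = 1\<close> the basis has no elements \<open>g\<^sup>i x\<close>; only the power \<open>\<beta>\<^sup>0\<close> occurs in that case.\<close>

definition radford_beta ::
  "('k::field, 'a::ab_group_add, 'm) kalg_scheme \<Rightarrow> nat \<Rightarrow> nat \<Rightarrow> 'a \<Rightarrow> 'a \<Rightarrow> 'a \<Rightarrow> 'k" where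
  "radford_beta H m n g x =
     (\<Sum>i<m * n. dual_elt H (radford_basis H m n g x) (g [^]\<^bsub>H\<^esub> i \<otimes>\<^bsub>H\<^esub> x))"

definition qfact :: "'k::field \<Rightarrow> nat \<Rightarrow> 'k" where
  "qfact q j = (\<Prod>i=1..j. \<Sum>l<i. q ^ l)"

end

theory Submission
  imports Defs
begin

text \<open>
  The vector space \<open>A\<^sup>* \<otimes> A\<close> underlying the double \<open>D(A)\<close> of a
  finite-dimensional Hopf algebra \<open>A\<close> is the space of linear maps \<open>A \<rightarrow> A\<close>,
  with \<open>f \<bowtie> a\<close> acting as \<open>y \<mapsto> f(y) a\<close>. Read this way, the structure of the
  double becomes a calculus with iterated coproducts (\<open>E_mult\<close>, \<open>E2_comult\<close>), in which the
  inverse antipode cancels neighbouring legs. Since every linear identity between elements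
  of the double can be tested on maps, the Hopf algebra axioms, quasitriangularity, and
  all later identities are proved by such cancellations.

  As a map, the Drinfeld element \<open>u\<close> is the inverse antipode (\<open>E_u\<close>). For the Radford Hopf
  algebra this map is explicit on the basis \<open>g\<^sup>l x\<^sup>s\<close>, and discrete Fourier
  inversion over the powers of \<open>\<alpha>\<close>, with \<open>\<beta>\<^sup>j\<close> selecting the degree in
  \<open>x\<close>, turns it into the formula for \<open>u\<close> (\<open>u_formula\<close>).

  For the ribbon elements,
  \<open>\<Delta>(u) = (R\<^sub>2\<^sub>1R)\<^sup>-\<^sup>1 (u \<otimes> u)\<close> (\<open>QQ_comult_u\<close>).
  Hence \<open>u\<^sup>-\<^sup>1 S(u)\<close> is group-like (\<open>SD_u_split\<close>); if \<open>l\<close> is group-like with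
  \<open>S(u) = u l\<^sup>2\<close> and \<open>u l\<close> is central, then \<open>u l\<close> is a ribbon element
  (\<open>ribbon_criterion\<close>); and two ribbon elements differ by a group-like element whose
  square is \<open>1\<close> (\<open>ribbon_difference\<close>). The group-like elements of the double are the
  \<open>\<chi> \<bowtie> h\<close> with a character \<open>\<chi>\<close> and a group-like \<open>h\<close>
  (\<open>D_grouplike_split\<close>).

  In the Radford Hopf algebra the group-like elements are the powers of \<open>g\<close>, and a
  character is determined by its value on \<open>g\<close>. The element \<open>u\<^sup>-\<^sup>1 S(u)\<close> is
  identified by two values only: as a map, \<open>S(u)\<close> is a trace over the algebra (\<open>E_SD_u\<close>),
  and the \<open>q\<close>-binomial theorem together with a telescoping sum evaluates it. The result is
  \<open>S(u) = u (\<alpha>\<^sup>m \<bowtie> g\<^sup>n\<^sup>-\<^sup>1)\<close> (\<open>SD_u\<close>). Since \<open>n\<close> is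
  odd, this group-like element has the square root
  \<open>\<alpha>\<^bsup>m(n+1)/2\<^esup> \<bowtie> g\<^bsup>(n-1)/2\<^esup>\<close>, whose product
  with \<open>u\<close> is central because the root implements the square of the antipode. The
  remaining freedom is a pair \<open>\<chi> \<bowtie> g\<^sup>b\<close> with square \<open>1\<close>. If \<open>m\<close> is odd
  or \<open>n \<noteq> 1\<close>, the value \<open>\<chi>(g)\<close> is a root of unity of odd order, so \<open>\<chi>\<close> is
  trivial, and \<open>mn\<close> divides \<open>2b\<close>; a second solution \<open>b = mn/2\<close> exists exactly when \<open>m\<close> is
  even.
\<close>

section \<open>Vector spaces inside an ambient group\<close>

definition vspace :: "('k::field, 'a::ab_group_add, 'm) kalg_scheme \<Rightarrow> bool" where
  "vspace A \<longleftrightarrow> vector_space (scal A) \<and> module.subspace (scal A) (carrier A)"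

lemma vspace_vs: "vspace A \<Longrightarrow> vector_space (scal A)"
  by (simp add: vspace_def)

lemma kalgebra_vspace: "kalgebra A \<Longrightarrow> vspace A"
  unfolding kalgebra_def kalgebra_axioms_def vspace_def by blast

lemma vspace_closed [simp]:
  assumes "vspace A"
  shows "0 \<in> carrier A"
    and "a \<in> carrier A \<Longrightarrow> b \<in> carrier A \<Longrightarrow> a + b \<in> carrier A"
    and "a \<in> carrier A \<Longrightarrow> scal A c a \<in> carrier A"
    and "a \<in> carrier A \<Longrightarrow> - a \<in> carrier A"
    and "a \<in> carrier A \<Longrightarrow> b \<in> carrier A \<Longrightarrow> a - b \<in> carrier A"
proof -
  interpret V: vector_space "scal A" using assms by (simp add: vspace_def)
  have S: "V.subspace (carrier A)" using assms by (simp add: vspace_def)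
  show "0 \<in> carrier A" using S by (rule V.subspace_0)
  show "a + b \<in> carrier A" if "a \<in> carrier A" "b \<in> carrier A" using S that by (rule V.subspace_add)
  show "scal A c a \<in> carrier A" if "a \<in> carrier A" using S that by (rule V.subspace_scale)
  show "- a \<in> carrier A" if "a \<in> carrier A" using S that by (rule V.subspace_neg)
  show "a - b \<in> carrier A" if "a \<in> carrier A" "b \<in> carrier A" using S that by (rule V.subspace_diff)
qed

lemma vspace_sum_closed:
  assumes "vspace A" "\<And>i. i \<in> I \<Longrightarrow> f i \<in> carrier A"
  shows "sum f I \<in> carrier A"
  using assms by (induction I rule: infinite_finite_induct) auto

lemma vspace_sum_list_closed:
  assumes "vspace A" "\<And>i. i \<in> set xs \<Longrightarrow> f i \<in> carrier A"
  shows "sum_list (map f xs) \<in> carrier A"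
  using assms by (induction xs) auto

lemma vector_space_field: "vector_space ((*) :: 'k::field \<Rightarrow> 'k \<Rightarrow> 'k)"
  by standard (simp_all add: algebra_simps)

lemma vector_space_fun_scal: "vector_space (fun_scal :: 'k::field \<Rightarrow> ('i \<Rightarrow> 'k) \<Rightarrow> _)"
  by standard (simp_all add: fun_scal_def fun_eq_iff algebra_simps)

lemma fun_scal_apply [simp]: "fun_scal c f x = c * f x"
  by (simp add: fun_scal_def)

lemma sum_fun_apply: "(sum F I) x = (\<Sum>i\<in>I. F i x)"
  by (induction I rule: infinite_finite_induct) auto

lemma sum_list_fun_apply: "(sum_list (map F ps)) x = (\<Sum>p\<leftarrow>ps. F p x)"
  by (induction ps) auto

text \<open>
  Linear functionals separate points because a nonzero vector extends to a basis. This
  reduces identities between vectors to identities between scalars.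
\<close>

lemma functionals_separate:
  assumes V: "vector_space s"
    and eq: "\<And>\<phi>. Vector_Spaces.linear s (*) \<phi> \<Longrightarrow> \<phi> x = \<phi> y"
  shows "x = y"
proof -
  interpret V: vector_space s by fact
  interpret F: vector_space "(*) :: 'a \<Rightarrow> 'a \<Rightarrow> 'a" by (rule vector_space_field)
  let ?B = "V.extend_basis {}"
  have I: "V.independent ?B" and S: "V.span ?B = UNIV"
    by (simp_all add: V.independent_extend_basis V.span_extend_basis V.independent_empty)
  have "V.representation ?B x b = V.representation ?B y b" for b
  proof (rule eq)
    show "Vector_Spaces.linear s (*) (\<lambda>z. V.representation ?B z b)"
      by (intro Vector_Spaces.linear.intro module_hom.intro V.module_axioms F.module_axioms
          V.vector_space_axioms F.vector_space_axioms module_hom_axioms.intro)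
        (use I S in \<open>simp_all add: V.representation_add V.representation_scale\<close>)
  qed
  then have "V.representation ?B x = V.representation ?B y" by blast
  then show "x = y"
    using V.sum_nonzero_representation_eq[OF I, of x] V.sum_nonzero_representation_eq[OF I, of y]
    unfolding S by (metis UNIV_I)
qed

lemma linear_onI:
  assumes "\<And>a b. a \<in> carrier A \<Longrightarrow> b \<in> carrier A \<Longrightarrow> f (a + b) = f a + f b"
    and "\<And>c a. a \<in> carrier A \<Longrightarrow> f (scal A c a) = s c (f a)"
  shows "linear_on A s f"
  using assms unfolding linear_on_def by blast

lemma linear_on_add: "linear_on A s f \<Longrightarrow> a \<in> carrier A \<Longrightarrow> b \<in> carrier A \<Longrightarrow> f (a + b) = f a + f b"
  unfolding linear_on_def by blast

lemma linear_on_scal: "linear_on A s f \<Longrightarrow> a \<in> carrier A \<Longrightarrow> f (scal A c a) = s c (f a)"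
  unfolding linear_on_def by blast

lemma linear_on_zero: "linear_on A s f \<Longrightarrow> vspace A \<Longrightarrow> f 0 = 0"
  using linear_on_add[of A s f 0 0] by simp

lemma linear_on_uminus: "linear_on A s f \<Longrightarrow> vspace A \<Longrightarrow> a \<in> carrier A \<Longrightarrow> f (- a) = - f a"
  using linear_on_add[of A s f a "- a"] linear_on_zero[of A s f] by (simp add: eq_neg_iff_add_eq_0 add.commute)

lemma linear_on_diff:
  "linear_on A s f \<Longrightarrow> vspace A \<Longrightarrow> a \<in> carrier A \<Longrightarrow> b \<in> carrier A \<Longrightarrow> f (a - b) = f a - f b"
  using linear_on_add[of A s f a "- b"] linear_on_uminus[of A s f b] by simp

lemma linear_on_sum:
  assumes "linear_on A s f" "vspace A" "\<And>i. i \<in> I \<Longrightarrow> F i \<in> carrier A"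
  shows "f (sum F I) = (\<Sum>i\<in>I. f (F i))"
  using assms(3)
proof (induction I rule: infinite_finite_induct)
  case (insert i I)
  then show ?case using assms(1,2) by (simp add: linear_on_add vspace_sum_closed)
qed (simp_all add: linear_on_zero[OF assms(1,2)])

lemma linear_on_sum_list:
  assumes "linear_on A s f" "vspace A" "\<And>i. i \<in> set xs \<Longrightarrow> F i \<in> carrier A"
  shows "f (sum_list (map F xs)) = (\<Sum>i\<leftarrow>xs. f (F i))"
  using assms(3)
proof (induction xs)
  case (Cons i xs)
  then show ?case using assms(1,2) by (simp add: linear_on_add vspace_sum_list_closed)
qed (simp add: linear_on_zero[OF assms(1,2)])

lemma linear_on_compose_linear:
  "linear_on A s f \<Longrightarrow> Vector_Spaces.linear s s' \<phi> \<Longrightarrow> linear_on A s' (\<lambda>a. \<phi> (f a))"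
  unfolding linear_on_def
  by (simp add: linear_iff_module_hom module_hom.add module_hom.scale)

lemma bilinear_onI:
  assumes "\<And>a. a \<in> carrier A \<Longrightarrow> linear_on B s (f a)"
    and "\<And>b. b \<in> carrier B \<Longrightarrow> linear_on A s (\<lambda>a. f a b)"
  shows "bilinear_on A B s f"
  using assms unfolding bilinear_on_def by blast

lemma bilinear_on_right: "bilinear_on A B s f \<Longrightarrow> a \<in> carrier A \<Longrightarrow> linear_on B s (f a)"
  unfolding bilinear_on_def by blast

lemma bilinear_on_left: "bilinear_on A B s f \<Longrightarrow> b \<in> carrier B \<Longrightarrow> linear_on A s (\<lambda>a. f a b)"
  unfolding bilinear_on_def by blast

lemma bilinear_on_compose_linear:
  "bilinear_on A B s f \<Longrightarrow> Vector_Spaces.linear s s' \<phi> \<Longrightarrow> bilinear_on A B s' (\<lambda>a b. \<phi> (f a b))"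
  unfolding bilinear_on_def by (auto intro: linear_on_compose_linear)

section \<open>Tensor products of vector spaces\<close>

lemma tens_apply: "bilinear_on A B (*) f \<Longrightarrow> tens A B a b f = f a b"
  by (simp add: tens_def)

lemma repr_apply:
  assumes "is_tensor_repr A B t ps" "bilinear_on A B (*) f"
  shows "t f = (\<Sum>(a, b)\<leftarrow>ps. f a b)"
  using assms unfolding is_tensor_repr_def
  by (simp add: sum_list_fun_apply case_prod_unfold tens_apply)

lemma repr_outside:
  assumes "is_tensor_repr A B t ps" "\<not> bilinear_on A B (*) f"
  shows "t f = 0"
  using assms unfolding is_tensor_repr_def
  by (simp add: sum_list_fun_apply case_prod_unfold tens_def)

lemma carrier_tensor: "carrier (tensor_alg A B) = {t. \<exists>ps. is_tensor_repr A B t ps}"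
  by (simp add: tensor_alg_def)

lemma scal_tensor [simp]: "scal (tensor_alg A B) = fun_scal"
  by (simp add: tensor_alg_def)

lemma one_tensor: "\<one>\<^bsub>tensor_alg A B\<^esub> = tens A B \<one>\<^bsub>A\<^esub> \<one>\<^bsub>B\<^esub>"
  by (simp add: tensor_alg_def)

lemma repr_SOME:
  "t \<in> carrier (tensor_alg A B) \<Longrightarrow> is_tensor_repr A B t (SOME ps. is_tensor_repr A B t ps)"
  by (simp add: carrier_tensor) (metis someI)

lemma linear_sum_list:
  assumes "Vector_Spaces.linear s s' \<phi>"
  shows "\<phi> (sum_list (map F ps)) = (\<Sum>p\<leftarrow>ps. \<phi> (F p))"
proof -
  interpret Vector_Spaces.linear s s' \<phi> by fact
  show ?thesis by (induction ps) (simp_all add: add)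
qed

text \<open>
  The sum over a representing list is independent of the list: after composition with a
  functional the summand is a bilinear form, on which the tensor itself can be evaluated,
  and functionals separate points.
\<close>

lemma tsum_repr:
  assumes t: "is_tensor_repr A B t ps" and F: "bilinear_on A B s F" and V: "vector_space s"
  shows "tsum A B t F = (\<Sum>(a, b)\<leftarrow>ps. F a b)"
proof (rule functionals_separate[OF V])
  fix \<phi> assume \<phi>: "Vector_Spaces.linear s (*) \<phi>"
  define qs where "qs = (SOME ps. is_tensor_repr A B t ps)"
  have q: "is_tensor_repr A B t qs" unfolding qs_def using t by (rule someI)
  have b: "bilinear_on A B (*) (\<lambda>a b. \<phi> (F a b))" using F \<phi> by (rule bilinear_on_compose_linear)
  have "\<phi> (tsum A B t F) = (\<Sum>(a, b)\<leftarrow>qs. \<phi> (F a b))"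
    unfolding tsum_def qs_def[symmetric] by (simp add: linear_sum_list[OF \<phi>] case_prod_unfold)
  also have "\<dots> = (\<Sum>(a, b)\<leftarrow>ps. \<phi> (F a b))"
    using repr_apply[OF t b] repr_apply[OF q b] by simp
  also have "\<dots> = \<phi> (\<Sum>(a, b)\<leftarrow>ps. F a b)"
    by (simp add: linear_sum_list[OF \<phi>] case_prod_unfold)
  finally show "\<phi> (tsum A B t F) = \<phi> (\<Sum>(a, b)\<leftarrow>ps. F a b)" .
qed

lemma tsum_field:
  assumes "t \<in> carrier (tensor_alg A B)" "bilinear_on A B (*) f"
  shows "tsum A B t f = t f"
  using repr_apply[OF repr_SOME[OF assms(1)] assms(2)] by (simp add: tsum_def)

lemma tsum_fun_apply: "tsum A B t F i = tsum A B t (\<lambda>a b. F a b i)"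
  unfolding tsum_def by (simp add: sum_list_fun_apply case_prod_unfold)

lemma tsum_cong:
  assumes "t \<in> carrier (tensor_alg A B)"
    and "\<And>a b. a \<in> carrier A \<Longrightarrow> b \<in> carrier B \<Longrightarrow> F a b = G a b"
  shows "tsum A B t F = tsum A B t G"
proof -
  have "set (SOME ps. is_tensor_repr A B t ps) \<subseteq> carrier A \<times> carrier B"
    using repr_SOME[OF assms(1)] by (simp add: is_tensor_repr_def)
  then show ?thesis unfolding tsum_def using assms(2)
    by (intro arg_cong[where f = sum_list] map_cong) auto
qed

lemma tsum_closed:
  assumes "t \<in> carrier (tensor_alg A B)" "vspace C"
    and "\<And>a b. a \<in> carrier A \<Longrightarrow> b \<in> carrier B \<Longrightarrow> F a b \<in> carrier C"
  shows "tsum A B t F \<in> carrier C"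
proof -
  have "set (SOME ps. is_tensor_repr A B t ps) \<subseteq> carrier A \<times> carrier B"
    using repr_SOME[OF assms(1)] by (simp add: is_tensor_repr_def)
  then show ?thesis unfolding tsum_def using assms(2,3)
    by (intro vspace_sum_list_closed) auto
qed

lemma linear_tsum:
  assumes "t \<in> carrier (tensor_alg A B)" "linear_on C s \<phi>" "vspace C"
    and "\<And>a b. a \<in> carrier A \<Longrightarrow> b \<in> carrier B \<Longrightarrow> F a b \<in> carrier C"
  shows "\<phi> (tsum A B t F) = tsum A B t (\<lambda>a b. \<phi> (F a b))"
proof -
  have "set (SOME ps. is_tensor_repr A B t ps) \<subseteq> carrier A \<times> carrier B"
    using repr_SOME[OF assms(1)] by (simp add: is_tensor_repr_def)
  then show ?thesis unfolding tsum_def using assms(2-)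
    by (subst linear_on_sum_list[OF assms(2,3)]) (auto simp: case_prod_unfold)
qed

lemma sum_list_linear_on:
  assumes "vector_space s" "\<And>p. p \<in> set ps \<Longrightarrow> linear_on A s (\<lambda>a. M a p)"
  shows "linear_on A s (\<lambda>a. \<Sum>p\<leftarrow>ps. M a p)"
proof -
  interpret vector_space s by fact
  have "(\<Sum>p\<leftarrow>ps. M (a + b) p) = (\<Sum>p\<leftarrow>ps. M a p) + (\<Sum>p\<leftarrow>ps. M b p)"
    if "a \<in> carrier A" "b \<in> carrier A" for a b
    using assms(2)
  proof (induction ps)
    case (Cons p ps)
    have "M (a + b) p = M a p + M b p" using Cons.prems[of p] that by (auto simp: linear_on_def)
    then show ?case using Cons by simp
  qed simp
  moreover have "(\<Sum>p\<leftarrow>ps. M (scal A c a) p) = s c (\<Sum>p\<leftarrow>ps. M a p)" if "a \<in> carrier A" for c a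
    using assms(2)
  proof (induction ps)
    case (Cons p ps)
    have "M (scal A c a) p = s c (M a p)" using Cons.prems[of p] that by (auto simp: linear_on_def)
    then show ?case using Cons by (simp add: scale_right_distrib)
  qed simp
  ultimately show ?thesis by (intro linear_onI) auto
qed

lemma linear_on_tsum_body:
  assumes "t \<in> carrier (tensor_alg A B)" "vector_space s"
    and "\<And>a b. a \<in> carrier A \<Longrightarrow> b \<in> carrier B \<Longrightarrow> linear_on C s (\<lambda>c. M c a b)"
  shows "linear_on C s (\<lambda>c. tsum A B t (M c))"
proof -
  have "set (SOME ps. is_tensor_repr A B t ps) \<subseteq> carrier A \<times> carrier B"
    using repr_SOME[OF assms(1)] by (simp add: is_tensor_repr_def)
  then show ?thesis unfolding tsum_def using assms(3)
    by (intro sum_list_linear_on[OF assms(2)]) (auto simp: case_prod_unfold)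
qed

lemma tens_closed [simp]:
  "a \<in> carrier A \<Longrightarrow> b \<in> carrier B \<Longrightarrow> tens A B a b \<in> carrier (tensor_alg A B)"
  unfolding carrier_tensor is_tensor_repr_def by (auto intro!: exI[of _ "[(a, b)]"])

lemma bilinear_scal_left:
  assumes "bilinear_on A B s f" "a \<in> carrier A" "b \<in> carrier B"
  shows "f (scal A c a) b = s c (f a b)"
  using linear_on_scal[OF bilinear_on_left[OF assms(1,3)] assms(2)] .

lemma bilinear_scal_right:
  assumes "bilinear_on A B s f" "a \<in> carrier A" "b \<in> carrier B"
  shows "f a (scal B c b) = s c (f a b)"
  using linear_on_scal[OF bilinear_on_right[OF assms(1,2)] assms(3)] .

lemma bilinear_add_left:
  assumes "bilinear_on A B s f" "a \<in> carrier A" "a' \<in> carrier A" "b \<in> carrier B"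
  shows "f (a + a') b = f a b + f a' b"
  using linear_on_add[OF bilinear_on_left[OF assms(1,4)] assms(2,3)] .

lemma bilinear_add_right:
  assumes "bilinear_on A B s f" "a \<in> carrier A" "b \<in> carrier B" "b' \<in> carrier B"
  shows "f a (b + b') = f a b + f a b'"
  using linear_on_add[OF bilinear_on_right[OF assms(1,2)] assms(3,4)] .

lemma bilinear_tens: "bilinear_on A B fun_scal (tens A B)"
proof (intro bilinear_onI linear_onI)
qed (auto simp: tens_def fun_eq_iff bilinear_add_left bilinear_add_right
    bilinear_scal_left bilinear_scal_right)

lemma repr_scal:
  assumes A: "vspace A" and t: "is_tensor_repr A B t ps"
  shows "is_tensor_repr A B (fun_scal c t) (map (\<lambda>(a, b). (scal A c a, b)) ps)"
proof -
  have "fun_scal c (\<Sum>(a, b)\<leftarrow>ps. tens A B a b) f = (\<Sum>(a, b)\<leftarrow>ps. tens A B (scal A c a) b) f"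
    if "set ps \<subseteq> carrier A \<times> carrier B" for f
    using that
  proof (induction ps)
    case (Cons p ps)
    have "tens A B (scal A c (fst p)) (snd p) f = c * tens A B (fst p) (snd p) f"
      using Cons.prems by (auto simp: tens_def bilinear_scal_left)
    with Cons show ?case by (simp add: case_prod_unfold algebra_simps)
  qed simp
  with t A show ?thesis
    unfolding is_tensor_repr_def by (auto simp: comp_def case_prod_unfold fun_eq_iff)
qed

lemma vspace_tensor [simp]:
  fixes A :: "('k::field, 'a::ab_group_add, 'm) kalg_scheme"
    and B :: "('k, 'b::ab_group_add, 'n) kalg_scheme"
  assumes A: "vspace A"
  shows "vspace (tensor_alg A B)"
proof -
  interpret V: vector_space "fun_scal :: 'k \<Rightarrow> (('a \<Rightarrow> 'b \<Rightarrow> 'k) \<Rightarrow> 'k) \<Rightarrow> _"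
    by (rule vector_space_fun_scal)
  have "V.subspace (carrier (tensor_alg A B))"
  proof (rule V.subspaceI)
    show "0 \<in> carrier (tensor_alg A B)"
      unfolding carrier_tensor is_tensor_repr_def by (auto intro!: exI[of _ "[]"])
  next
    fix s t assume "s \<in> carrier (tensor_alg A B)" "t \<in> carrier (tensor_alg A B)"
    then obtain ps qs where "is_tensor_repr A B s ps" "is_tensor_repr A B t qs"
      unfolding carrier_tensor by auto
    then have "is_tensor_repr A B (s + t) (ps @ qs)" unfolding is_tensor_repr_def by auto
    then show "s + t \<in> carrier (tensor_alg A B)" unfolding carrier_tensor by auto
  next
    fix c t assume "t \<in> carrier (tensor_alg A B)"
    then obtain ps where p: "is_tensor_repr A B t ps" unfolding carrier_tensor by auto
    from repr_scal[OF A this] show "fun_scal c t \<in> carrier (tensor_alg A B)" unfolding carrier_tensor by auto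
  qed
  then show ?thesis unfolding vspace_def by (simp add: V.vector_space_axioms)
qed

lemma tensor_induct [consumes 1, case_names zero add]:
  assumes "t \<in> carrier (tensor_alg A B)" "P 0"
    and "\<And>a b t. a \<in> carrier A \<Longrightarrow> b \<in> carrier B \<Longrightarrow> t \<in> carrier (tensor_alg A B) \<Longrightarrow> P t
      \<Longrightarrow> P (tens A B a b + t)"
  shows "P t"
proof -
  have "P (\<Sum>(a, b)\<leftarrow>ps. tens A B a b)" if "set ps \<subseteq> carrier A \<times> carrier B" for ps
    using that
  proof (induction ps)
    case (Cons p ps)
    obtain a b where [simp]: "p = (a, b)" by force
    have "(\<Sum>(a, b)\<leftarrow>ps. tens A B a b) \<in> carrier (tensor_alg A B)"
      using Cons.prems unfolding carrier_tensor is_tensor_repr_def by auto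
    have "P (tens A B a b + (\<Sum>(a, b)\<leftarrow>ps. tens A B a b))"
      using Cons \<open>(\<Sum>(a, b)\<leftarrow>ps. tens A B a b) \<in> _\<close> by (intro assms(3)) simp_all
    then show ?case by (simp del: plus_fun_apply)
  qed (use assms(2) in simp)
  with assms(1) show ?thesis unfolding carrier_tensor is_tensor_repr_def by auto
qed

lemma tensor_linear_eqI:
  assumes "t \<in> carrier (tensor_alg A B)" "vspace A"
    and "linear_on (tensor_alg A B) s f" "linear_on (tensor_alg A B) s g"
    and "\<And>a b. a \<in> carrier A \<Longrightarrow> b \<in> carrier B \<Longrightarrow> f (tens A B a b) = g (tens A B a b)"
  shows "f t = g t"
  using assms(1)
proof (induction rule: tensor_induct)
  case zero
  show ?case
    using linear_on_zero[OF assms(3) vspace_tensor[OF assms(2)]]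
      linear_on_zero[OF assms(4) vspace_tensor[OF assms(2)]] by metis
next
  case (add a b t)
  then show ?case
    using assms(5) linear_on_add[OF assms(3), of "tens A B a b" t]
      linear_on_add[OF assms(4), of "tens A B a b" t] by (simp del: plus_fun_apply)
qed

lemma tensor_eqI:
  assumes "s \<in> carrier (tensor_alg A B)" "t \<in> carrier (tensor_alg A B)"
    and "\<And>f. bilinear_on A B (*) f \<Longrightarrow> s f = t f"
  shows "s = t"
proof
  fix f
  obtain ps qs where "is_tensor_repr A B s ps" "is_tensor_repr A B t qs"
    using assms(1,2) unfolding carrier_tensor by auto
  then show "s f = t f"
    using assms(3) repr_outside[of A B s ps f] repr_outside[of A B t qs f]
    by (cases "bilinear_on A B (*) f") simp_all
qed

lemma tsum_tens [simp]:
  assumes "a \<in> carrier A" "b \<in> carrier B" "bilinear_on A B s F" "vector_space s"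
  shows "tsum A B (tens A B a b) F = F a b"
  using tsum_repr[of A B "tens A B a b" "[(a, b)]" s F] assms by (simp add: is_tensor_repr_def)

lemma linear_on_tsum:
  assumes "vspace A" "bilinear_on A B s F" "vector_space s"
  shows "linear_on (tensor_alg A B) s (\<lambda>t. tsum A B t F)"
proof (rule linear_onI)
  fix t t' assume "t \<in> carrier (tensor_alg A B)" "t' \<in> carrier (tensor_alg A B)"
  then obtain ps qs where p: "is_tensor_repr A B t ps" and q: "is_tensor_repr A B t' qs"
    unfolding carrier_tensor by auto
  then have "is_tensor_repr A B (t + t') (ps @ qs)" unfolding is_tensor_repr_def by auto
  then show "tsum A B (t + t') F = tsum A B t F + tsum A B t' F"
    using tsum_repr[OF _ assms(2,3)] p q by simp
next
  interpret V: vector_space s by fact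
  fix c t assume "t \<in> carrier (tensor_alg A B)"
  then obtain ps where p: "is_tensor_repr A B t ps" unfolding carrier_tensor by auto
  then have r: "is_tensor_repr A B (fun_scal c t) (map (\<lambda>(a, b). (scal A c a, b)) ps)"
    using assms(1) by (rule repr_scal[rotated])
  have "(\<Sum>(a, b)\<leftarrow>ps. F (scal A c a) b) = s c (\<Sum>(a, b)\<leftarrow>ps. F a b)"
    if "set ps \<subseteq> carrier A \<times> carrier B"
    using that
    by (induction ps) (auto simp: V.scale_right_distrib bilinear_scal_left[OF assms(2)])
  with p have "(\<Sum>(a, b)\<leftarrow>ps. F (scal A c a) b) = s c (\<Sum>(a, b)\<leftarrow>ps. F a b)"
    by (simp add: is_tensor_repr_def)
  then show "tsum A B (scal (tensor_alg A B) c t) F = s c (tsum A B t F)"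
    using tsum_repr[OF r assms(2,3)] tsum_repr[OF p assms(2,3)]
    by (simp add: comp_def case_prod_unfold)
qed

text \<open>
  Products on tensor products and on Drinfeld doubles arise from a four-linear map in this
  way.
\<close>

lemma tensor_op:
  assumes A: "vspace A" and C: "vspace C" and s: "vector_space s"
    and 1: "\<And>a b. a \<in> carrier A \<Longrightarrow> b \<in> carrier B \<Longrightarrow> bilinear_on C E s (M a b)"
    and 2: "\<And>c d. c \<in> carrier C \<Longrightarrow> d \<in> carrier E \<Longrightarrow> bilinear_on A B s (\<lambda>a b. M a b c d)"
  shows tensor_op_bilinear: "bilinear_on (tensor_alg A B) (tensor_alg C E) s
      (\<lambda>x y. tsum A B x (\<lambda>a b. tsum C E y (M a b)))"
    and tensor_op_tens: "a \<in> carrier A \<Longrightarrow> b \<in> carrier B \<Longrightarrow> c \<in> carrier C \<Longrightarrow> d \<in> carrier E \<Longrightarrow>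
      tsum A B (tens A B a b) (\<lambda>a b. tsum C E (tens C E c d) (M a b)) = M a b c d"
proof -
  have *: "bilinear_on A B s (\<lambda>a b. tsum C E y (M a b))" if y: "y \<in> carrier (tensor_alg C E)" for y
  proof (rule bilinear_onI)
    show "linear_on B s (\<lambda>b. tsum C E y (M a b))" if "a \<in> carrier A" for a
      using bilinear_on_right[OF 2 that] by (intro linear_on_tsum_body[OF y s]) auto
    show "linear_on A s (\<lambda>a. tsum C E y (M a b))" if "b \<in> carrier B" for b
      using bilinear_on_left[OF 2 that] by (intro linear_on_tsum_body[OF y s]) auto
  qed
  show "bilinear_on (tensor_alg A B) (tensor_alg C E) s
      (\<lambda>x y. tsum A B x (\<lambda>a b. tsum C E y (M a b)))"
  proof (rule bilinear_onI)
    show "linear_on (tensor_alg C E) s (\<lambda>y. tsum A B x (\<lambda>a b. tsum C E y (M a b)))"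
      if "x \<in> carrier (tensor_alg A B)" for x
      using linear_on_tsum[OF C 1 s] by (intro linear_on_tsum_body[OF that s]) auto
    show "linear_on (tensor_alg A B) s (\<lambda>x. tsum A B x (\<lambda>a b. tsum C E y (M a b)))"
      if "y \<in> carrier (tensor_alg C E)" for y
      by (rule linear_on_tsum[OF A *[OF that] s])
  qed
  show "tsum A B (tens A B a b) (\<lambda>a b. tsum C E (tens C E c d) (M a b)) = M a b c d"
    if "a \<in> carrier A" "b \<in> carrier B" "c \<in> carrier C" "d \<in> carrier E"
    using that *[of "tens C E c d"] tsum_tens[OF that(3,4) 1[OF that(1,2)] s] s by simp
qed

section \<open>Tensor products of algebras\<close>

lemma linear_on_comp:
  "linear_on A (scal B) f \<Longrightarrow> (\<And>a. a \<in> carrier A \<Longrightarrow> f a \<in> carrier B) \<Longrightarrow> linear_on B s g \<Longrightarrow>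
    linear_on A s (\<lambda>x. g (f x))"
  by (simp add: linear_on_def)

lemma bilinear_tens_comp:
  assumes "linear_on C (scal A) f" "\<And>c. c \<in> carrier C \<Longrightarrow> f c \<in> carrier A"
    and "linear_on E (scal B) g" "\<And>d. d \<in> carrier E \<Longrightarrow> g d \<in> carrier B"
  shows "bilinear_on C E fun_scal (\<lambda>c d. tens A B (f c) (g d))"
proof (rule bilinear_onI)
  show "linear_on E fun_scal (\<lambda>d. tens A B (f c) (g d))" if "c \<in> carrier C" for c
    using linear_on_comp[OF assms(3,4) bilinear_on_right[OF bilinear_tens assms(2)[OF that]]] .
  show "linear_on C fun_scal (\<lambda>c. tens A B (f c) (g d))" if "d \<in> carrier E" for d
    using linear_on_comp[OF assms(1,2) bilinear_on_left[OF bilinear_tens assms(4)[OF that]]] .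
qed

context kalgebra begin

lemma vsp [simp]: "vspace A"
  using kalgebra_axioms by (rule kalgebra_vspace)

lemma linear_mult_left: "b \<in> carrier A \<Longrightarrow> linear_on A (scal A) (\<lambda>a. a \<otimes> b)"
  using bilinear_mult by (rule bilinear_on_left)

lemma linear_mult_right: "a \<in> carrier A \<Longrightarrow> linear_on A (scal A) (\<lambda>b. a \<otimes> b)"
  using bilinear_mult by (rule bilinear_on_right)

lemma mult_add: "a \<in> carrier A \<Longrightarrow> b \<in> carrier A \<Longrightarrow> c \<in> carrier A \<Longrightarrow> c \<otimes> (a + b) = c \<otimes> a + c \<otimes> b"
  using linear_on_add[OF linear_mult_right] by blast

lemma scal_mult: "a \<in> carrier A \<Longrightarrow> c \<in> carrier A \<Longrightarrow> scal A k a \<otimes> c = scal A k (a \<otimes> c)"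
  using linear_on_scal[OF linear_mult_left] by blast

lemma mult_scal: "a \<in> carrier A \<Longrightarrow> c \<in> carrier A \<Longrightarrow> c \<otimes> scal A k a = scal A k (c \<otimes> a)"
  using linear_on_scal[OF linear_mult_right] by blast

end

lemma mult_tensor:
  "x \<otimes>\<^bsub>tensor_alg A B\<^esub> y =
    tsum A B x (\<lambda>a b. tsum A B y (\<lambda>c d. tens A B (a \<otimes>\<^bsub>A\<^esub> c) (b \<otimes>\<^bsub>B\<^esub> d)))"
  by (simp add: tensor_alg_def)

locale two_kalgebras = A: kalgebra A + B: kalgebra B
  for A :: "('k::field, 'a::ab_group_add, 'm) kalg_scheme"
    and B :: "('k, 'b::ab_group_add, 'n) kalg_scheme"
begin

abbreviation "T \<equiv> tensor_alg A B"

lemma tensor_mult_bilinear: "bilinear_on T T fun_scal (\<lambda>x y. x \<otimes>\<^bsub>T\<^esub> y)"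
  unfolding mult_tensor
  by (rule tensor_op_bilinear)
    (auto intro!: bilinear_tens_comp vector_space_fun_scal A.linear_mult_right B.linear_mult_right
      A.linear_mult_left B.linear_mult_left)

lemma tensor_mult_tens [simp]:
  assumes "a \<in> carrier A" "b \<in> carrier B" "c \<in> carrier A" "d \<in> carrier B"
  shows "tens A B a b \<otimes>\<^bsub>T\<^esub> tens A B c d = tens A B (a \<otimes>\<^bsub>A\<^esub> c) (b \<otimes>\<^bsub>B\<^esub> d)"
  unfolding mult_tensor
  by (rule tensor_op_tens)
    (use assms in \<open>auto intro!: bilinear_tens_comp vector_space_fun_scal A.linear_mult_right
      B.linear_mult_right A.linear_mult_left B.linear_mult_left\<close>)

lemma tensor_mult_closed:
  "x \<in> carrier T \<Longrightarrow> y \<in> carrier T \<Longrightarrow> x \<otimes>\<^bsub>T\<^esub> y \<in> carrier T"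
  unfolding mult_tensor by (intro tsum_closed) auto

lemma kalgebra_tensor: "kalgebra T"
proof (intro kalgebra.intro monoid.intro kalgebra_axioms.intro)
  have linR: "linear_on T fun_scal (\<lambda>x. y \<otimes>\<^bsub>T\<^esub> x)" and linL: "linear_on T fun_scal (\<lambda>x. x \<otimes>\<^bsub>T\<^esub> y)"
    if "y \<in> carrier T" for y
    using bilinear_on_right[OF tensor_mult_bilinear that] bilinear_on_left[OF tensor_mult_bilinear that] .
  have comp: "linear_on T fun_scal (\<lambda>x. g (f x))"
    if "linear_on T fun_scal f" "\<And>x. x \<in> carrier T \<Longrightarrow> f x \<in> carrier T" "linear_on T fun_scal g" for f g
    using linear_on_comp[of T T f fun_scal g] that by simp
  have idl: "linear_on T fun_scal (\<lambda>x. x)" by (simp add: linear_on_def)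
  note ext = tensor_linear_eqI[OF _ A.vsp, where s = fun_scal]
  note c = tensor_mult_closed
  show "x \<otimes>\<^bsub>T\<^esub> y \<in> carrier T" if "x \<in> carrier T" "y \<in> carrier T" for x y
    using that by (rule c)
  show o: "\<one>\<^bsub>T\<^esub> \<in> carrier T" by (simp add: one_tensor)
  show "\<one>\<^bsub>T\<^esub> \<otimes>\<^bsub>T\<^esub> x = x" if "x \<in> carrier T" for x
    by (rule ext[OF that linR[OF o] idl]) (simp add: one_tensor)
  show "x \<otimes>\<^bsub>T\<^esub> \<one>\<^bsub>T\<^esub> = x" if "x \<in> carrier T" for x
    by (rule ext[OF that linL[OF o] idl]) (simp add: one_tensor)
  have 1: "(tens A B a b \<otimes>\<^bsub>T\<^esub> tens A B a' b') \<otimes>\<^bsub>T\<^esub> z = tens A B a b \<otimes>\<^bsub>T\<^esub> (tens A B a' b' \<otimes>\<^bsub>T\<^esub> z)"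
    if z: "z \<in> carrier T" and m: "a \<in> carrier A" "b \<in> carrier B" "a' \<in> carrier A" "b' \<in> carrier B"
    for a b a' b' z
  proof -
    have p: "tens A B a b \<in> carrier T" and q: "tens A B a' b' \<in> carrier T" using m by simp_all
    show ?thesis
      by (rule ext[OF z linR[OF c[OF p q]] comp[OF linR[OF q] c[OF q] linR[OF p]]])
        (use m in \<open>simp_all add: A.m_assoc B.m_assoc\<close>)
  qed
  have 2: "(tens A B a b \<otimes>\<^bsub>T\<^esub> y) \<otimes>\<^bsub>T\<^esub> z = tens A B a b \<otimes>\<^bsub>T\<^esub> (y \<otimes>\<^bsub>T\<^esub> z)"
    if y: "y \<in> carrier T" and z: "z \<in> carrier T" and m: "a \<in> carrier A" "b \<in> carrier B" for a b y z
  proof -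
    have p: "tens A B a b \<in> carrier T" using m by simp
    show ?thesis
      by (rule ext[OF y comp[OF linR[OF p] c[OF p] linL[OF z]] comp[OF linL[OF z] c[OF _ z] linR[OF p]]])
        (use m z 1 in simp_all)
  qed
  show "(x \<otimes>\<^bsub>T\<^esub> y) \<otimes>\<^bsub>T\<^esub> z = x \<otimes>\<^bsub>T\<^esub> (y \<otimes>\<^bsub>T\<^esub> z)"
    if x: "x \<in> carrier T" and y: "y \<in> carrier T" and z: "z \<in> carrier T" for x y z
    by (rule ext[OF x comp[OF linL[OF y] c[OF _ y] linL[OF z]] linL[OF c[OF y z]]])
      (use y z 2 in simp_all)
  show "bilinear_on T T (scal T) (\<lambda>a b. a \<otimes>\<^bsub>T\<^esub> b)" using tensor_mult_bilinear by simp
  show "vector_space (scal T)" "module.subspace (scal T) (carrier T)"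
    using vspace_tensor[OF A.vsp] unfolding vspace_def by auto
qed

end

section \<open>Linear forms and coordinates\<close>

text \<open>
  Closure rules for linear maps and forms are simplification rules, so that multilinearity side
  conditions are discharged by the simplifier.
\<close>

definition lform :: "('k::field, 'a::ab_group_add, 'm) kalg_scheme \<Rightarrow> ('a \<Rightarrow> 'k) \<Rightarrow> bool" where
  "lform A f \<longleftrightarrow> linear_on A (*) f"

definition lmap :: "('k::field, 'a::ab_group_add, 'm) kalg_scheme \<Rightarrow> ('a \<Rightarrow> 'a) \<Rightarrow> bool" where
  "lmap A f \<longleftrightarrow> (\<forall>x\<in>carrier A. f x \<in> carrier A) \<and> linear_on A (scal A) f"

definition bform :: "('k::field, 'a::ab_group_add, 'm) kalg_scheme \<Rightarrow> ('a \<Rightarrow> 'a \<Rightarrow> 'k) \<Rightarrow> bool" where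
  "bform A f \<longleftrightarrow> (\<forall>a\<in>carrier A. lform A (f a)) \<and> (\<forall>b\<in>carrier A. lform A (\<lambda>a. f a b))"

lemma bform_bilinear: "bform A f \<longleftrightarrow> bilinear_on A A (*) f"
  by (simp add: bform_def lform_def bilinear_on_def)

lemma bformI [simp]:
  "(\<And>a. a \<in> carrier A \<Longrightarrow> lform A (f a)) \<Longrightarrow> (\<And>b. b \<in> carrier A \<Longrightarrow> lform A (\<lambda>a. f a b)) \<Longrightarrow> bform A f"
  by (simp add: bform_def)

lemma lform_bform1: "bform A G \<Longrightarrow> lmap A f \<Longrightarrow> c \<in> carrier A \<Longrightarrow> lform A (\<lambda>x. G (f x) c)"
  using linear_on_comp[of A A f "(*)" "\<lambda>x. G x c"] unfolding bform_def lform_def lmap_def by simp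

lemma lform_bform2: "bform A G \<Longrightarrow> lmap A f \<Longrightarrow> c \<in> carrier A \<Longrightarrow> lform A (\<lambda>x. G c (f x))"
  using linear_on_comp[of A A f "(*)" "G c"] unfolding bform_def lform_def lmap_def by simp

lemma lform_comp: "lform A g \<Longrightarrow> lmap A f \<Longrightarrow> lform A (\<lambda>x. g (f x))"
  using linear_on_comp[of A A f "(*)" g] unfolding lform_def lmap_def by simp

lemma lform_mult_left [simp]: "lform A f \<Longrightarrow> lform A (\<lambda>x. f x * c)"
  by (auto simp: lform_def linear_on_def algebra_simps)

lemma lform_mult_right [simp]: "lform A f \<Longrightarrow> lform A (\<lambda>x. c * f x)"
  by (auto simp: lform_def linear_on_def algebra_simps)

lemma lform_sum [simp]: "(\<And>i. i \<in> I \<Longrightarrow> lform A (\<lambda>x. F x i)) \<Longrightarrow> lform A (\<lambda>x. \<Sum>i\<in>I. F x i)"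
  by (induction I rule: infinite_finite_induct) (auto simp: lform_def linear_on_def algebra_simps)

lemma lmap_id [simp]: "lmap A (\<lambda>x. x)"
  by (simp add: lmap_def linear_on_def)

lemma (in kalgebra) lmap_mult_left [simp]: "lmap A f \<Longrightarrow> c \<in> carrier A \<Longrightarrow> lmap A (\<lambda>x. f x \<otimes> c)"
  using linear_on_comp[of A A f "scal A" "\<lambda>x. x \<otimes> c"] linear_mult_left unfolding lmap_def by simp

lemma (in kalgebra) lmap_mult_right [simp]: "lmap A f \<Longrightarrow> c \<in> carrier A \<Longrightarrow> lmap A (\<lambda>x. c \<otimes> f x)"
  using linear_on_comp[of A A f "scal A" "\<lambda>x. c \<otimes> x"] linear_mult_right unfolding lmap_def by simp

locale based_space =
  fixes A :: "('k::field, 'a::ab_group_add, 'm) kalg_scheme" and B :: "'a set"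
  assumes vspace_A [simp]: "vspace A"
    and finite_B [simp]: "finite B"
    and basis_B: "is_basis A B"
begin

interpretation V: vector_space "scal A" by (rule vspace_vs) simp

abbreviation e :: "'a \<Rightarrow> 'a \<Rightarrow> 'k" where "e b \<equiv> dual_elt A B b"

lemma indep_B: "V.independent B" and span_B: "V.span B = carrier A"
  using basis_B by (auto simp: is_basis_def)

lemma B_carrier [simp]: "b \<in> B \<Longrightarrow> b \<in> carrier A"
  using V.span_base[of b B] by (simp add: span_B)

lemma lform_e [simp]: "lform A (e b)"
  unfolding lform_def dual_elt_def
  by (intro linear_onI) (simp_all add: V.representation_add V.representation_scale indep_B span_B)

lemma lform_e_comp [simp]: "lmap A f \<Longrightarrow> lform A (\<lambda>x. e b (f x))"
  by (rule lform_comp) simp_all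

lemma e_delta: "b \<in> B \<Longrightarrow> c \<in> B \<Longrightarrow> e b c = (if b = c then 1 else 0)"
  unfolding dual_elt_def using V.representation_basis[OF indep_B, of c] by auto

lemma e_outside: "a \<notin> carrier A \<Longrightarrow> e b a = 0"
  unfolding dual_elt_def V.representation_def by (simp add: span_B)

lemma expand: "a \<in> carrier A \<Longrightarrow> (\<Sum>b\<in>B. scal A (e b a) b) = a"
  unfolding dual_elt_def
  using V.sum_representation_eq[OF indep_B, of a B] by (simp add: span_B)

lemma linear_expand:
  assumes "linear_on A s f" "a \<in> carrier A"
  shows "(\<Sum>b\<in>B. s (e b a) (f b)) = f a"
proof -
  have "f a = f (\<Sum>b\<in>B. scal A (e b a) b)" using expand[OF assms(2)] by simp
  also have "\<dots> = (\<Sum>b\<in>B. s (e b a) (f b))"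
    by (subst linear_on_sum[OF assms(1)]) (auto intro!: sum.cong simp: linear_on_scal[OF assms(1)])
  finally show ?thesis ..
qed

lemma lform_expand: "lform A f \<Longrightarrow> a \<in> carrier A \<Longrightarrow> (\<Sum>b\<in>B. e b a * f b) = f a"
  unfolding lform_def by (rule linear_expand)

lemma sum_delta: "b \<in> B \<Longrightarrow> (\<Sum>c\<in>B. e c b * F c) = F b"
  by (simp add: e_delta if_distrib[of "\<lambda>x. x * _"] cong: if_cong)

lemma carrier_eqI:
  assumes "x \<in> carrier A" "y \<in> carrier A" "\<And>b. b \<in> B \<Longrightarrow> e b x = e b y"
  shows "x = y"
  using expand[OF assms(1)] expand[OF assms(2)] assms(3) by (metis (mono_tags, lifting) sum.cong)

end

lemma tsum_expand:
  assumes "based_space A B" "based_space C E"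
    and t: "t \<in> carrier (tensor_alg A C)" and F: "bilinear_on A C s F" and s: "vector_space s"
  shows "tsum A C t F =
    (\<Sum>b\<in>B. \<Sum>c\<in>E. s (t (\<lambda>p r. dual_elt A B b p * dual_elt C E c r)) (F b c))"
proof -
  interpret A: based_space A B by fact
  interpret C: based_space C E by fact
  interpret s: vector_space s by fact
  have bil: "bilinear_on A C (*) (\<lambda>p r. A.e b p * C.e c r)" for b c
    using A.lform_e C.lform_e unfolding lform_def linear_on_def bilinear_on_def by (simp add: algebra_simps)
  show ?thesis
  proof (rule tensor_linear_eqI[OF t A.vspace_A linear_on_tsum[OF A.vspace_A F s]])
    show "linear_on (tensor_alg A C) s
        (\<lambda>t. \<Sum>b\<in>B. \<Sum>c\<in>E. s (t (\<lambda>p r. A.e b p * C.e c r)) (F b c))"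
      by (rule linear_onI)
        (simp_all add: s.scale_left_distrib sum.distrib s.scale_sum_right flip: s.scale_scale)
    fix a c assume ac: "a \<in> carrier A" "c \<in> carrier C"
    have "F a c = (\<Sum>b\<in>B. s (A.e b a) (F b c))"
      using A.linear_expand[OF bilinear_on_left[OF F ac(2)] ac(1)] by simp
    also have "\<dots> = (\<Sum>b\<in>B. \<Sum>d\<in>E. s (A.e b a * C.e d c) (F b d))"
    proof (intro sum.cong refl)
      fix b assume "b \<in> B"
      then have "F b c = (\<Sum>d\<in>E. s (C.e d c) (F b d))"
        using C.linear_expand[OF bilinear_on_right[OF F A.B_carrier] ac(2)] by simp
      then show "s (A.e b a) (F b c) = (\<Sum>d\<in>E. s (A.e b a * C.e d c) (F b d))"
        by (simp only: s.scale_sum_right s.scale_scale)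
    qed
    finally show "tsum A C (tens A C a c) F =
        (\<Sum>b\<in>B. \<Sum>d\<in>E. s (tens A C a c (\<lambda>p r. A.e b p * C.e d r)) (F b d))"
      using ac F s bil by (simp add: tens_apply)
  qed
qed

section \<open>Sweedler calculus in a finite-dimensional Hopf algebra\<close>

locale fin_hopf = hopf_algebra A
  for A :: "('k::field, 'a::ab_group_add, 'm) bialg_scheme" (structure) +
  fixes B :: "'a set"
  assumes finite_basis: "finite B" and basis: "is_basis A B"
begin

sublocale based_space A B
  by unfold_locales (simp_all add: finite_basis basis)

text \<open>
  The Sweedler sum \<open>\<Sum> F(a\<^sub>1, a\<^sub>2)\<close> in coordinates. The body is sampled at
  pairs of basis elements only, so that sums can be exchanged and rewritten without
  linearity conditions.
\<close>

definition sw :: "'a \<Rightarrow> ('a \<Rightarrow> 'a \<Rightarrow> 'k) \<Rightarrow> 'k" where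
  "sw a F = (\<Sum>b\<in>B. \<Sum>c\<in>B. comult A a (\<lambda>p r. e b p * e c r) * F b c)"

lemma bform_ee [simp]: "bform A (\<lambda>p r. e b p * e c r)"
  by simp

lemma tsum_sw_gen:
  assumes "a \<in> carrier A" "bilinear_on A A s F" "vector_space s"
  shows "tsum A A (comult A a) F =
    (\<Sum>b\<in>B. \<Sum>c\<in>B. s (comult A a (\<lambda>p r. e b p * e c r)) (F b c))"
  by (rule tsum_expand[OF based_space_axioms based_space_axioms comult_closed[OF assms(1)] assms(2,3)])

lemma tsum_sw: "a \<in> carrier A \<Longrightarrow> bform A F \<Longrightarrow> tsum A A (comult A a) F = sw a F"
  unfolding sw_def bform_bilinear by (rule tsum_sw_gen) (auto simp: vector_space_field)

lemma comult_sw: "a \<in> carrier A \<Longrightarrow> bform A F \<Longrightarrow> comult A a F = sw a F"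
  by (metis tsum_sw tsum_field comult_closed bform_bilinear)

lemma linear_comp_tsum:
  assumes a: "a \<in> carrier A" and F: "bilinear_on A A s F" and s: "vector_space s"
    and C: "vspace C" "scal C = s" "\<And>x y. x \<in> carrier A \<Longrightarrow> y \<in> carrier A \<Longrightarrow> F x y \<in> carrier C"
    and p: "linear_on C (*) \<phi>"
  shows "\<phi> (tsum A A (comult A a) F) = sw a (\<lambda>x y. \<phi> (F x y))"
proof -
  have "bform A (\<lambda>x y. \<phi> (F x y))"
    using F p C linear_on_comp[of A C _ "(*)" \<phi>] unfolding bform_def lform_def bilinear_on_def
    by simp
  then show ?thesis
    by (subst linear_tsum[OF comult_closed[OF a] p C(1,3)]) (auto simp: tsum_sw a)
qed

lemma sw_cong [cong]:
  assumes "a = a'" "\<And>b c. b \<in> B \<Longrightarrow> c \<in> B \<Longrightarrow> F b c = G b c"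
  shows "sw a F = sw a' G"
  unfolding sw_def using assms by (intro sum.cong) auto

lemma sw_sum: "sw a (\<lambda>x y. \<Sum>i\<in>I. F i x y) = (\<Sum>i\<in>I. sw a (F i))"
proof -
  have "sw a (\<lambda>x y. \<Sum>i\<in>I. F i x y) =
      (\<Sum>b\<in>B. \<Sum>c\<in>B. \<Sum>i\<in>I. comult A a (\<lambda>p r. e b p * e c r) * F i b c)"
    unfolding sw_def by (simp add: sum_distrib_left)
  also have "\<dots> = (\<Sum>i\<in>I. sw a (F i))"
    unfolding sw_def by (subst sum.swap[of _ I]) (simp add: sum.swap[of _ I])
  finally show ?thesis .
qed

lemma sw_scale: "sw a (\<lambda>x y. k * F x y) = k * sw a F"
  unfolding sw_def sum_distrib_left by (intro sum.cong refl) (simp add: mult_ac)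

lemma sw_scale': "sw a (\<lambda>x y. F x y * k) = sw a F * k"
  unfolding sw_def sum_distrib_right by (intro sum.cong refl) (simp add: mult_ac)

lemma sw_add: "sw a (\<lambda>x y. F x y + G x y) = sw a F + sw a G"
  unfolding sw_def by (simp add: sum.distrib algebra_simps)

lemma sw_swap: "sw a (\<lambda>x y. sw b (\<lambda>z w. F x y z w)) = sw b (\<lambda>z w. sw a (\<lambda>x y. F x y z w))"
  unfolding sw_def[of b] by (simp add: sw_sum sw_scale)

lemma comult_lform: "lform A (\<lambda>a. comult A a F)"
  using linear_comult unfolding lform_def linear_on_def by simp

lemma lform_sw [simp]: "lmap A f \<Longrightarrow> lform A (\<lambda>x. sw (f x) F)"
  by (rule lform_comp[of A "\<lambda>a. sw a F"]) (simp_all add: sw_def comult_lform)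

lemma lform_sw_body [simp]:
  "(\<And>b c. b \<in> B \<Longrightarrow> c \<in> B \<Longrightarrow> lform C (\<lambda>x. F x b c)) \<Longrightarrow> lform C (\<lambda>x. sw a (F x))"
  by (simp add: sw_def)

lemma lform_counit [simp]: "lmap A f \<Longrightarrow> lform A (\<lambda>x. counit A (f x))"
  by (rule lform_comp[of A "counit A"]) (simp_all add: lform_def linear_counit)

lemma lform_counit' [simp]: "lform A (counit A)"
  by (simp add: lform_def linear_counit)

lemma sw_coassoc_ee:
  assumes a: "a \<in> carrier A"
  shows "sw a (\<lambda>x y. sw x (\<lambda>b c. e k b * (e l c * e j y))) =
    sw a (\<lambda>x y. sw y (\<lambda>c d. e k x * (e l c * e j d)))"
proof -
  define f where "f = (\<lambda>p t. e k p * t (\<lambda>r s. e l r * e j s))"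
  have f: "bilinear_on A (tensor_alg A A) (*) f"
    using lform_e[of k] unfolding f_def bilinear_on_def lform_def linear_on_def
    by (simp add: algebra_simps)
  have t3: "tens3 A x y z f = e k x * (e l y * e j z)"
    if "x \<in> carrier A" "y \<in> carrier A" "z \<in> carrier A" for x y z
    using that bform_ee[of l j] unfolding tens3_def bform_bilinear
    by (subst tens_apply[OF f]) (simp add: f_def tens_apply)
  have cl: "\<And>x. x \<in> carrier A \<Longrightarrow> comult A x \<in> carrier (tensor_alg A A)" by (rule comult_closed)
  have "tsum A A (comult A a) (\<lambda>b c. tsum A A (comult A b) (\<lambda>b1 b2. tens3 A b1 b2 c)) f =
      tsum A A (comult A a) (\<lambda>x y. sw x (\<lambda>b c. e k b * (e l c * e j y)))"
    unfolding tsum_fun_apply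
  proof (rule tsum_cong[OF cl[OF a]])
    fix b c assume b: "b \<in> carrier A" and c: "c \<in> carrier A"
    have "tsum A A (comult A b) (\<lambda>x y. tens3 A x y c f) =
      tsum A A (comult A b) (\<lambda>x y. e k x * (e l y * e j c))"
      using b c by (intro tsum_cong[OF cl]) (auto simp: t3)
    then show "tsum A A (comult A b) (\<lambda>x y. tens3 A x y c f) = sw b (\<lambda>x y. e k x * (e l y * e j c))"
      using b c by (simp add: tsum_sw)
  qed
  also have "\<dots> = sw a (\<lambda>x y. sw x (\<lambda>b c. e k b * (e l c * e j y)))"
    using a by (simp add: tsum_sw)
  finally have 1: "tsum A A (comult A a) (\<lambda>b c. tsum A A (comult A b) (\<lambda>b1 b2. tens3 A b1 b2 c)) f = \<dots>" .
  have "tsum A A (comult A a) (\<lambda>b c. tsum A A (comult A c) (\<lambda>c1 c2. tens3 A b c1 c2)) f =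
      tsum A A (comult A a) (\<lambda>x y. sw y (\<lambda>c d. e k x * (e l c * e j d)))"
    unfolding tsum_fun_apply
  proof (rule tsum_cong[OF cl[OF a]])
    fix b c assume b: "b \<in> carrier A" and c: "c \<in> carrier A"
    have "tsum A A (comult A c) (\<lambda>x y. tens3 A b x y f) =
      tsum A A (comult A c) (\<lambda>x y. e k b * (e l x * e j y))"
      using b c by (intro tsum_cong[OF cl]) (auto simp: t3)
    then show "tsum A A (comult A c) (\<lambda>x y. tens3 A b x y f) = sw c (\<lambda>x y. e k b * (e l x * e j y))"
      using b c by (simp add: tsum_sw)
  qed
  also have "\<dots> = sw a (\<lambda>x y. sw y (\<lambda>c d. e k x * (e l c * e j d)))"
    using a by (simp add: tsum_sw)
  finally show ?thesis using 1 coassoc[OF a] by simp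
qed

text \<open>
  Both sides are determined by the coefficients of the twofold coproduct in the basis,
  which the previous lemma compares.
\<close>

lemma sw_coassoc:
  assumes a: "a \<in> carrier A"
  shows "sw a (\<lambda>x y. sw x (\<lambda>b c. F b c y)) = sw a (\<lambda>x y. sw y (\<lambda>c d. F x c d))"
proof -
  have F: "F b c d = (\<Sum>k\<in>B. \<Sum>l\<in>B. \<Sum>j\<in>B. F k l j * (e k b * (e l c * e j d)))"
    if "b \<in> B" "c \<in> B" "d \<in> B" for b c d
  proof -
    have "(\<Sum>k\<in>B. \<Sum>l\<in>B. \<Sum>j\<in>B. F k l j * (e k b * (e l c * e j d))) =
      (\<Sum>k\<in>B. e k b * (\<Sum>l\<in>B. e l c * (\<Sum>j\<in>B. e j d * F k l j)))"
      by (simp add: sum_distrib_left mult_ac)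
    then show ?thesis using that by (simp add: sum_delta)
  qed
  have "sw a (\<lambda>x y. sw x (\<lambda>b c. F b c y)) =
      sw a (\<lambda>x y. sw x (\<lambda>b c. \<Sum>k\<in>B. \<Sum>l\<in>B. \<Sum>j\<in>B. F k l j * (e k b * (e l c * e j y))))"
    using F by (intro sw_cong refl)
  also have "\<dots> = sw a (\<lambda>x y. sw y (\<lambda>c d. \<Sum>k\<in>B. \<Sum>l\<in>B. \<Sum>j\<in>B. F k l j * (e k x * (e l c * e j d))))"
    by (simp only: sw_sum sw_scale sw_coassoc_ee[OF a])
  also have "\<dots> = sw a (\<lambda>x y. sw y (\<lambda>c d. F x c d))"
    using F by (intro sw_cong refl) simp
  finally show ?thesis .
qed

lemma sw_counit_left:
  assumes a: "a \<in> carrier A" and \<phi>: "lform A \<phi>"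
  shows "sw a (\<lambda>x y. counit A x * \<phi> y) = \<phi> a"
proof -
  have b: "bilinear_on A A (scal A) (\<lambda>b c. scal A (counit A b) c)"
    using linear_counit vspace_vs[OF vspace_A] unfolding bilinear_on_def linear_on_def
    by (simp add: vector_space.vector_space_assms mult.commute)
  have "sw a (\<lambda>x y. counit A x * \<phi> y) = sw a (\<lambda>x y. \<phi> (scal A (counit A x) y))"
    using \<phi> by (intro sw_cong refl) (simp add: lform_def linear_on_def)
  also have "\<dots> = \<phi> (tsum A A (comult A a) (\<lambda>b c. scal A (counit A b) c))"
    using \<phi> by (intro linear_comp_tsum[OF a b, symmetric, where C = A])
      (auto simp: lform_def vspace_vs)
  finally show ?thesis using counit_left[OF a] by simp
qed

lemma sw_counit_right:
  assumes a: "a \<in> carrier A" and \<phi>: "lform A \<phi>"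
  shows "sw a (\<lambda>x y. counit A y * \<phi> x) = \<phi> a"
proof -
  have b: "bilinear_on A A (scal A) (\<lambda>b c. scal A (counit A c) b)"
    using linear_counit vspace_vs[OF vspace_A] unfolding bilinear_on_def linear_on_def
    by (simp add: vector_space.vector_space_assms mult.commute)
  have "sw a (\<lambda>x y. counit A y * \<phi> x) = sw a (\<lambda>x y. \<phi> (scal A (counit A y) x))"
    using \<phi> by (intro sw_cong refl) (simp add: lform_def linear_on_def)
  also have "\<dots> = \<phi> (tsum A A (comult A a) (\<lambda>b c. scal A (counit A c) b))"
    using \<phi> by (intro linear_comp_tsum[OF a b, symmetric, where C = A])
      (auto simp: lform_def vspace_vs)
  finally show ?thesis using counit_right[OF a] by simp
qed

lemma sw_mult:
  assumes a: "a \<in> carrier A" and b: "b \<in> carrier A" and F: "bform A F"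
  shows "sw (a \<otimes> b) F = sw a (\<lambda>x y. sw b (\<lambda>z w. F (x \<otimes> z) (y \<otimes> w)))"
proof -
  note [simp] = lform_bform1[OF F] lform_bform2[OF F]
  have "sw (a \<otimes> b) F = comult A (a \<otimes> b) F" using a b F by (simp add: comult_sw)
  also have "\<dots> = tsum A A (comult A a) (\<lambda>x y. tsum A A (comult A b) (\<lambda>z w. F (x \<otimes> z) (y \<otimes> w)))"
    using F unfolding comult_mult[OF a b] mult_tensor tsum_fun_apply
    by (intro tsum_cong comult_closed a b) (auto simp: tens_apply bform_bilinear)
  also have "\<dots> = tsum A A (comult A a) (\<lambda>x y. sw b (\<lambda>z w. F (x \<otimes> z) (y \<otimes> w)))"
    using b by (intro tsum_cong comult_closed a) (auto simp: tsum_sw)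
  finally show ?thesis using a by (simp add: tsum_sw)
qed

lemma sw_one: "bform A F \<Longrightarrow> sw \<one> F = F \<one> \<one>"
  using comult_sw[of \<one> F] by (simp add: comult_one one_tensor tens_apply bform_bilinear)

end

section \<open>The antipode\<close>

context fin_hopf begin

abbreviation S :: "'a \<Rightarrow> 'a" where "S \<equiv> antipode A"
abbreviation \<epsilon> :: "'a \<Rightarrow> 'k" where "\<epsilon> \<equiv> counit A"

lemma antipode_law_gen:
  assumes S: "is_antipode A S'" and a: "a \<in> carrier A" and p: "lform A \<phi>"
  shows "sw a (\<lambda>x y. \<phi> (S' x \<otimes> y)) = \<epsilon> a * \<phi> \<one>"
    and "sw a (\<lambda>x y. \<phi> (x \<otimes> S' y)) = \<epsilon> a * \<phi> \<one>"
proof -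
  have l: "lmap A S'" using S unfolding is_antipode_def lmap_def by auto
  then have cl: "x \<in> carrier A \<Longrightarrow> S' x \<in> carrier A" for x by (simp add: lmap_def)
  have L: "linear_on A (scal A) f" if "lmap A f" for f using that by (simp add: lmap_def)
  have e1: "\<phi> (scal A (\<epsilon> a) \<one>) = \<epsilon> a * \<phi> \<one>" using p by (simp add: lform_def linear_on_def)
  have b: "bilinear_on A A (scal A) (\<lambda>b c. S' b \<otimes> c)" "bilinear_on A A (scal A) (\<lambda>b c. b \<otimes> S' c)"
    using l cl by (auto intro!: bilinear_onI L lmap_mult_left lmap_mult_right)
  note c = linear_comp_tsum[OF a _ vspace_vs[OF vspace_A] vspace_A refl, symmetric]
  have "sw a (\<lambda>x y. \<phi> (S' x \<otimes> y)) = \<phi> (tsum A A (comult A a) (\<lambda>b c. S' b \<otimes> c))"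
    using p cl by (intro c[OF b(1)]) (auto simp: lform_def)
  with S a e1 show "sw a (\<lambda>x y. \<phi> (S' x \<otimes> y)) = \<epsilon> a * \<phi> \<one>" by (simp add: is_antipode_def)
  have "sw a (\<lambda>x y. \<phi> (x \<otimes> S' y)) = \<phi> (tsum A A (comult A a) (\<lambda>b c. b \<otimes> S' c))"
    using p cl by (intro c[OF b(2)]) (auto simp: lform_def)
  with S a e1 show "sw a (\<lambda>x y. \<phi> (x \<otimes> S' y)) = \<epsilon> a * \<phi> \<one>" by (simp add: is_antipode_def)
qed

text \<open>Convolution inverses of the identity are unique.\<close>

lemma antipode_unique:
  assumes S: "is_antipode A S1" and S': "is_antipode A S2"
  shows "S1 = S2"
proof (rule extensionalityI)
  show "S1 \<in> extensional (carrier A)" "S2 \<in> extensional (carrier A)"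
    using S S' by (auto simp: is_antipode_def PiE_def)
next
  fix a assume a: "a \<in> carrier A"
  have l [simp]: "lmap A S1" "lmap A S2" using S S' unfolding is_antipode_def lmap_def by auto
  then have cl [simp]: "S1 x \<in> carrier A" "S2 x \<in> carrier A" if "x \<in> carrier A" for x
    using that by (auto simp: lmap_def)
  have [simp]: "lform A (\<lambda>x. e b (S1 x))" "lform A (\<lambda>x. e b (S2 x))" for b by simp_all
  have "e b (S1 a) = e b (S2 a)" if "b \<in> B" for b
  proof -
    have "e b (S1 a) = sw a (\<lambda>x y. \<epsilon> y * e b (S1 x))"
      using a by (simp add: sw_counit_right[of a "\<lambda>x. e b (S1 x)"])
    also have "\<dots> = sw a (\<lambda>x y. sw y (\<lambda>z w. e b (S1 x \<otimes> (z \<otimes> S2 w))))"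
      by (rule sw_cong[OF refl])
        (simp add: antipode_law_gen(2)[OF S', where \<phi> = "\<lambda>z. e b (S1 _ \<otimes> z)"])
    also have "\<dots> = sw a (\<lambda>x y. sw x (\<lambda>b' c. e b (S1 b' \<otimes> (c \<otimes> S2 y))))"
      by (simp add: sw_coassoc[OF a])
    also have "\<dots> = sw a (\<lambda>x y. sw x (\<lambda>b' c. e b ((S1 b' \<otimes> c) \<otimes> S2 y)))"
      by (rule sw_cong[OF refl]) (simp add: m_assoc)
    also have "\<dots> = sw a (\<lambda>x y. \<epsilon> x * e b (S2 y))"
      by (rule sw_cong[OF refl])
        (simp add: antipode_law_gen(1)[OF S, where \<phi> = "\<lambda>z. e b (z \<otimes> S2 _)"])
    also have "\<dots> = e b (S2 a)"
      using a by (simp add: sw_counit_left[of a "\<lambda>x. e b (S2 x)"])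
    finally show ?thesis .
  qed
  then show "S1 a = S2 a" using a by (intro carrier_eqI) auto
qed

lemma is_antipode: "is_antipode A S"
proof -
  obtain S' where "is_antipode A S'" using ex_antipode by blast
  then show ?thesis unfolding antipode_def using antipode_unique by (intro theI[of "is_antipode A" S']) auto
qed

lemma antipode_eqI: "is_antipode A S' \<Longrightarrow> S = S'"
  using antipode_unique is_antipode by blast

lemma S_linear: "linear_on A (scal A) S" and S_closed [simp]: "a \<in> carrier A \<Longrightarrow> S a \<in> carrier A"
  using is_antipode by (auto simp: is_antipode_def)

lemma lmap_S [simp]: "lmap A f \<Longrightarrow> lmap A (\<lambda>x. S (f x))"
  using linear_on_comp[of A A f "scal A" S] S_linear unfolding lmap_def by simp

lemma lmap_S' [simp]: "lmap A S"
  by (simp add: lmap_def S_linear)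

lemma sw_S_left: "a \<in> carrier A \<Longrightarrow> lform A \<phi> \<Longrightarrow> sw a (\<lambda>x y. \<phi> (S x \<otimes> y)) = \<epsilon> a * \<phi> \<one>"
  and sw_S_right: "a \<in> carrier A \<Longrightarrow> lform A \<phi> \<Longrightarrow> sw a (\<lambda>x y. \<phi> (x \<otimes> S y)) = \<epsilon> a * \<phi> \<one>"
  using antipode_law_gen[OF is_antipode] by auto

lemma S_one [simp]: "S \<one> = \<one>"
proof (rule carrier_eqI)
  fix b
  have "e b (S \<one>) = sw \<one> (\<lambda>x y. e b (S x \<otimes> y))" by (subst sw_one) simp_all
  then show "e b (S \<one>) = e b \<one>" by (simp add: sw_S_left[where \<phi> = "e b"] counit_one)
qed simp_all

text \<open>Both sides are convolution inverses of the multiplication.\<close>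

lemma S_mult:
  assumes a: "a \<in> carrier A" and b: "b \<in> carrier A"
  shows "S (a \<otimes> b) = S b \<otimes> S a"
proof (rule carrier_eqI)
  fix c
  have "e c (S (a \<otimes> b)) = sw a (\<lambda>a1 a'. \<epsilon> a' * e c (S (a1 \<otimes> b)))"
    using a b by (simp add: sw_counit_right[of a "\<lambda>x. e c (S (x \<otimes> b))"])
  also have "\<dots> = sw a (\<lambda>a1 a'. \<epsilon> a' * sw b (\<lambda>b1 b'. \<epsilon> b' * e c (S (a1 \<otimes> b1))))"
    using b by (intro sw_cong refl)
      (simp add: sw_counit_right[of b "\<lambda>x. e c (S (_ \<otimes> x))"])
  also have "\<dots> = sw a (\<lambda>a1 a'. sw b (\<lambda>b1 b'. sw a' (\<lambda>a2 a3. sw b' (\<lambda>b2 b3.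
      e c (S (a1 \<otimes> b1) \<otimes> (a2 \<otimes> ((b2 \<otimes> S b3) \<otimes> S a3)))))))"
  proof (simp only: sw_scale[symmetric], intro sw_cong refl)
    fix a1 a' b1 b' assume m: "a1 \<in> B" "a' \<in> B" "b1 \<in> B" "b' \<in> B"
    have "sw a' (\<lambda>a2 a3. sw b' (\<lambda>b2 b3. e c (S (a1 \<otimes> b1) \<otimes> (a2 \<otimes> ((b2 \<otimes> S b3) \<otimes> S a3))))) =
      sw a' (\<lambda>a2 a3. \<epsilon> b' * e c (S (a1 \<otimes> b1) \<otimes> (a2 \<otimes> S a3)))"
      using m by (intro sw_cong refl)
        (simp add: sw_S_right[where \<phi> = "\<lambda>z. e c (S (a1 \<otimes> b1) \<otimes> (_ \<otimes> (z \<otimes> S _)))"])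
    also have "\<dots> = \<epsilon> b' * (\<epsilon> a' * e c (S (a1 \<otimes> b1)))"
      using m by (simp add: sw_scale sw_S_right[where \<phi> = "\<lambda>z. e c (S (a1 \<otimes> b1) \<otimes> z)"])
    finally show "\<epsilon> a' * (\<epsilon> b' * e c (S (a1 \<otimes> b1))) =
      sw a' (\<lambda>a2 a3. sw b' (\<lambda>b2 b3. e c (S (a1 \<otimes> b1) \<otimes> (a2 \<otimes> ((b2 \<otimes> S b3) \<otimes> S a3)))))"
      by (simp add: mult_ac)
  qed
  also have "\<dots> = sw a (\<lambda>a1 a'. sw a' (\<lambda>a2 a3. sw b (\<lambda>b1 b'. sw b' (\<lambda>b2 b3.
      e c (S (a1 \<otimes> b1) \<otimes> (a2 \<otimes> ((b2 \<otimes> S b3) \<otimes> S a3)))))))"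
    by (rule sw_cong[OF refl]) (rule sw_swap)
  also have "\<dots> = sw a (\<lambda>p a3. sw p (\<lambda>a1 a2. sw b (\<lambda>r b3. sw r (\<lambda>b1 b2.
      e c (S (a1 \<otimes> b1) \<otimes> (a2 \<otimes> ((b2 \<otimes> S b3) \<otimes> S a3)))))))"
    using a b by (simp add: sw_coassoc)
  also have "\<dots> = sw a (\<lambda>p a3. sw b (\<lambda>r b3. sw p (\<lambda>a1 a2. sw r (\<lambda>b1 b2.
      e c (S (a1 \<otimes> b1) \<otimes> (a2 \<otimes> ((b2 \<otimes> S b3) \<otimes> S a3)))))))"
    by (rule sw_cong[OF refl]) (rule sw_swap)
  also have "\<dots> = sw a (\<lambda>p a3. sw b (\<lambda>r b3. sw (p \<otimes> r) (\<lambda>x y. e c ((S x \<otimes> y) \<otimes> (S b3 \<otimes> S a3)))))"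
    by (rule sw_cong[OF refl]) (simp add: sw_mult m_assoc)
  also have "\<dots> = sw a (\<lambda>p a3. \<epsilon> p * sw b (\<lambda>r b3. \<epsilon> r * e c (S b3 \<otimes> S a3)))"
    by (simp only: sw_scale[symmetric], intro sw_cong refl)
      (simp add: sw_S_left[where \<phi> = "\<lambda>z. e c (z \<otimes> (S _ \<otimes> S _))"] counit_mult)
  also have "\<dots> = sw a (\<lambda>p a3. \<epsilon> p * e c (S b \<otimes> S a3))"
    using b by (intro sw_cong refl) (simp add: sw_counit_left[where \<phi> = "\<lambda>z. e c (S z \<otimes> S _)"])
  also have "\<dots> = e c (S b \<otimes> S a)"
    using a b by (simp add: sw_counit_left[where \<phi> = "\<lambda>z. e c (S b \<otimes> S z)"])
  finally show "e c (S (a \<otimes> b)) = e c (S b \<otimes> S a)" .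
qed (use a b in simp_all)

lemma counit_S [simp]:
  assumes a: "a \<in> carrier A"
  shows "\<epsilon> (S a) = \<epsilon> a"
proof -
  have "\<epsilon> (S a) = sw a (\<lambda>x y. \<epsilon> y * \<epsilon> (S x))"
    using a by (simp add: sw_counit_right[where \<phi> = "\<lambda>x. \<epsilon> (S x)"])
  also have "\<dots> = sw a (\<lambda>x y. \<epsilon> (S x \<otimes> y))"
    by (rule sw_cong[OF refl]) (simp add: counit_mult)
  also have "\<dots> = \<epsilon> a"
    using a by (simp add: sw_S_left[where \<phi> = \<epsilon>] counit_one)
  finally show ?thesis .
qed

text \<open>Both sides are convolution inverses of the comultiplication.\<close>

lemma sw_S:
  assumes a: "a \<in> carrier A" and G: "bform A G"
  shows "sw (S a) G = sw a (\<lambda>x y. G (S y) (S x))"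
proof -
  note [simp] = lform_bform1[OF G] lform_bform2[OF G]
  have "sw (S a) G = sw a (\<lambda>a1 a'. \<epsilon> a' * sw (S a1) G)"
    using a by (simp add: sw_counit_right[where \<phi> = "\<lambda>x. sw (S x) G"])
  also have "\<dots> = sw a (\<lambda>a1 a'. sw (S a1) (\<lambda>s t. sw a' (\<lambda>a2 r. sw r (\<lambda>r' a5. sw r' (\<lambda>a3 a4.
      G (s \<otimes> (a2 \<otimes> S a5)) (t \<otimes> (a3 \<otimes> S a4)))))))"
  proof (simp only: sw_scale[symmetric], intro sw_cong refl)
    fix s t a' assume m: "s \<in> B" "t \<in> B" "a' \<in> B"
    have "sw a' (\<lambda>a2 r. sw r (\<lambda>r' a5. sw r' (\<lambda>a3 a4. G (s \<otimes> (a2 \<otimes> S a5)) (t \<otimes> (a3 \<otimes> S a4))))) =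
      sw a' (\<lambda>a2 r. sw r (\<lambda>r' a5. \<epsilon> r' * G (s \<otimes> (a2 \<otimes> S a5)) t))"
      using m by (intro sw_cong refl)
        (simp add: sw_S_right[where \<phi> = "\<lambda>z. G (s \<otimes> (_ \<otimes> S _)) (t \<otimes> z)"])
    also have "\<dots> = sw a' (\<lambda>a2 r. G (s \<otimes> (a2 \<otimes> S r)) t)"
      using m by (intro sw_cong refl)
        (simp add: sw_counit_left[where \<phi> = "\<lambda>z. G (s \<otimes> (_ \<otimes> S z)) t"])
    also have "\<dots> = \<epsilon> a' * G s t"
      using m by (simp add: sw_S_right[where \<phi> = "\<lambda>z. G (s \<otimes> z) t"])
    finally show "\<epsilon> a' * G s t = sw a' (\<lambda>a2 r. sw r (\<lambda>r' a5. sw r' (\<lambda>a3 a4.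
      G (s \<otimes> (a2 \<otimes> S a5)) (t \<otimes> (a3 \<otimes> S a4)))))" ..
  qed
  also have "\<dots> = sw a (\<lambda>a1 a'. sw (S a1) (\<lambda>s t. sw a' (\<lambda>a2 r. sw r (\<lambda>a3 r'. sw r' (\<lambda>a4 a5.
      G (s \<otimes> (a2 \<otimes> S a5)) (t \<otimes> (a3 \<otimes> S a4)))))))"
    by (rule sw_cong[OF refl]) (simp add: sw_coassoc)
  also have "\<dots> = sw a (\<lambda>a1 a'. sw (S a1) (\<lambda>s t. sw a' (\<lambda>q r. sw q (\<lambda>a2 a3. sw r (\<lambda>a4 a5.
      G (s \<otimes> (a2 \<otimes> S a5)) (t \<otimes> (a3 \<otimes> S a4)))))))"
    by (rule sw_cong[OF refl]) (simp add: sw_coassoc)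
  also have "\<dots> = sw a (\<lambda>a1 a'. sw a' (\<lambda>q r. sw (S a1) (\<lambda>s t. sw q (\<lambda>a2 a3. sw r (\<lambda>a4 a5.
      G (s \<otimes> (a2 \<otimes> S a5)) (t \<otimes> (a3 \<otimes> S a4)))))))"
    by (rule sw_cong[OF refl]) (rule sw_swap)
  also have "\<dots> = sw a (\<lambda>p r. sw p (\<lambda>a1 q. sw (S a1) (\<lambda>s t. sw q (\<lambda>a2 a3. sw r (\<lambda>a4 a5.
      G (s \<otimes> (a2 \<otimes> S a5)) (t \<otimes> (a3 \<otimes> S a4)))))))"
    using a by (simp add: sw_coassoc)
  also have "\<dots> = sw a (\<lambda>p r. sw p (\<lambda>a1 q. sw (S a1 \<otimes> q) (\<lambda>x y. sw r (\<lambda>a4 a5. G (x \<otimes> S a5) (y \<otimes> S a4)))))"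
    by (rule sw_cong[OF refl]) (simp add: sw_mult m_assoc)
  also have "\<dots> = sw a (\<lambda>p r. \<epsilon> p * sw r (\<lambda>a4 a5. G (S a5) (S a4)))"
    by (rule sw_cong[OF refl])
      (simp add: sw_S_left[where \<phi> = "\<lambda>z. sw z (\<lambda>x y. sw _ (\<lambda>a4 a5. G (x \<otimes> S a5) (y \<otimes> S a4)))"] sw_one)
  also have "\<dots> = sw a (\<lambda>x y. G (S y) (S x))"
    using a by (simp add: sw_counit_left[where \<phi> = "\<lambda>z. sw z (\<lambda>a4 a5. G (S a5) (S a4))"])
  finally show ?thesis .
qed

end

text \<open>
  The multiplication of the Drinfeld double involves the inverse of the antipode. For the
  Radford Hopf algebra the antipode is bijective because its square has finite order.
\<close>

locale fin_hopf_bij = fin_hopf A B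
  for A :: "('k::field, 'a::ab_group_add, 'm) bialg_scheme" (structure) and B :: "'a set" +
  assumes bij_S: "bij_betw (antipode A) (carrier A) (carrier A)"
begin

definition T :: "'a \<Rightarrow> 'a" where "T = inv_into (carrier A) (antipode A)"

lemma T_closed [simp]: "a \<in> carrier A \<Longrightarrow> T a \<in> carrier A"
  using bij_S unfolding T_def by (metis bij_betw_def inv_into_into)

lemma ST [simp]: "a \<in> carrier A \<Longrightarrow> S (T a) = a"
  using bij_S unfolding T_def by (simp add: bij_betw_def f_inv_into_f)

lemma TS [simp]: "a \<in> carrier A \<Longrightarrow> T (S a) = a"
  using bij_S unfolding T_def by (simp add: bij_betw_def)

lemma S_inj: "a \<in> carrier A \<Longrightarrow> b \<in> carrier A \<Longrightarrow> S a = S b \<Longrightarrow> a = b"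
  using TS by metis

lemma T_mult: "a \<in> carrier A \<Longrightarrow> b \<in> carrier A \<Longrightarrow> T (a \<otimes> b) = T b \<otimes> T a"
  by (rule S_inj) (simp_all add: S_mult)

lemma T_one [simp]: "T \<one> = \<one>"
  by (rule S_inj) simp_all

lemma lmap_T' [simp]: "lmap A T"
  unfolding lmap_def
proof (intro conjI ballI linear_onI)
  fix a b c assume a: "a \<in> carrier A" and b: "b \<in> carrier A"
  show "T (a + b) = T a + T b"
    using TS[of "T a + T b"] linear_on_add[OF S_linear, of "T a" "T b"] ST[OF a] ST[OF b]
      T_closed[OF a] T_closed[OF b] vspace_closed(2)[OF vspace_A, of "T a" "T b"] by metis
  show "T (scal A c a) = scal A c (T a)"
    using TS[of "scal A c (T a)"] linear_on_scal[OF S_linear, of "T a" c] ST[OF a]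
      T_closed[OF a] vspace_closed(3)[OF vspace_A, of "T a" c] by metis
qed simp

lemma lmap_T [simp]: "lmap A f \<Longrightarrow> lmap A (\<lambda>x. T (f x))"
  using linear_on_comp[of A A f "scal A" T] lmap_T' unfolding lmap_def by simp

lemma counit_T [simp]: "a \<in> carrier A \<Longrightarrow> \<epsilon> (T a) = \<epsilon> a"
  using counit_S[of "T a"] by simp

lemma sw_T:
  assumes a: "a \<in> carrier A" and G: "bform A G"
  shows "sw (T a) G = sw a (\<lambda>x y. G (T y) (T x))"
proof -
  note [simp] = lform_bform1[OF G] lform_bform2[OF G]
  have "sw a (\<lambda>x y. G (T y) (T x)) = sw (S (T a)) (\<lambda>x y. G (T y) (T x))"
    using a by simp
  also have "\<dots> = sw (T a) (\<lambda>x y. G (T (S x)) (T (S y)))"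
    using a by (intro sw_S) simp_all
  also have "\<dots> = sw (T a) G" by (rule sw_cong[OF refl]) simp
  finally show ?thesis ..
qed

text \<open>
  The inverse antipode satisfies the antipode laws with the two legs exchanged. Most
  cancellations in the double are instances of this rule or of the next one.
\<close>

lemma sw_T_right:
  assumes a: "a \<in> carrier A" and p: "lform A \<phi>"
  shows "sw a (\<lambda>x y. \<phi> (y \<otimes> T x)) = \<epsilon> a * \<phi> \<one>"
proof -
  have "sw a (\<lambda>x y. \<phi> (y \<otimes> T x)) = sw a (\<lambda>x y. \<phi> (T (x \<otimes> S y)))"
    by (rule sw_cong[OF refl]) (simp add: T_mult)
  also have "\<dots> = \<epsilon> a * \<phi> \<one>"
    using a by (simp add: sw_S_right[where \<phi> = "\<lambda>z. \<phi> (T z)"] lform_comp[OF p])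
  finally show ?thesis .
qed

lemma sw_T_left:
  assumes a: "a \<in> carrier A" and p: "lform A \<phi>"
  shows "sw a (\<lambda>x y. \<phi> (T y \<otimes> x)) = \<epsilon> a * \<phi> \<one>"
proof -
  have "sw a (\<lambda>x y. \<phi> (T y \<otimes> x)) = sw a (\<lambda>x y. \<phi> (T (S x \<otimes> y)))"
    by (rule sw_cong[OF refl]) (simp add: T_mult)
  also have "\<dots> = \<epsilon> a * \<phi> \<one>"
    using a by (simp add: sw_S_left[where \<phi> = "\<lambda>z. \<phi> (T z)"] lform_comp[OF p])
  finally show ?thesis .
qed

end

section \<open>The dual algebra\<close>

context fin_hopf begin

abbreviation DA :: "('k, 'a \<Rightarrow> 'k) kalg" where "DA \<equiv> dual_alg A"

lemma dual_mem: "f \<in> carrier DA \<longleftrightarrow> lform A f \<and> (\<forall>a. a \<notin> carrier A \<longrightarrow> f a = 0)"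
  by (simp add: dual_alg_def lform_def)

lemma dual_lform [simp]: "f \<in> carrier DA \<Longrightarrow> lform A f"
  by (simp add: dual_mem)

lemma scal_DA [simp]: "scal DA = fun_scal"
  by (simp add: dual_alg_def)

lemma one_DA: "\<one>\<^bsub>DA\<^esub> = on_carrier A \<epsilon>"
  by (simp add: dual_alg_def)

lemma one_DA_apply [simp]: "a \<in> carrier A \<Longrightarrow> \<one>\<^bsub>DA\<^esub> a = \<epsilon> a"
  by (simp add: one_DA on_carrier_def)

lemma on_carrier_mem [simp]: "lform A f \<Longrightarrow> on_carrier A f \<in> carrier DA"
  unfolding dual_mem lform_def linear_on_def on_carrier_def by simp

lemma on_carrier_apply [simp]: "a \<in> carrier A \<Longrightarrow> on_carrier A f a = f a"
  by (simp add: on_carrier_def)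

lemma e_mem [simp]: "e b \<in> carrier DA"
  by (simp add: dual_mem e_outside)

lemma dual_mult_apply [simp]:
  assumes "f \<in> carrier DA" "p \<in> carrier DA" "a \<in> carrier A"
  shows "(f \<otimes>\<^bsub>DA\<^esub> p) a = sw a (\<lambda>x y. f x * p y)"
  using assms by (simp add: dual_alg_def on_carrier_def tsum_sw)

lemma dual_mult_closed:
  assumes "f \<in> carrier DA" "p \<in> carrier DA"
  shows "f \<otimes>\<^bsub>DA\<^esub> p \<in> carrier DA"
proof -
  have "f \<otimes>\<^bsub>DA\<^esub> p = on_carrier A (\<lambda>a. sw a (\<lambda>x y. f x * p y))"
    using assms by (auto simp: dual_alg_def on_carrier_def tsum_sw fun_eq_iff)
  then show ?thesis by (simp add: lform_sw[of "\<lambda>x. x"])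
qed

lemma dual_eqI:
  assumes "f \<in> carrier DA" "p \<in> carrier DA" "\<And>a. a \<in> carrier A \<Longrightarrow> f a = p a"
  shows "f = p"
  using assms by (metis dual_mem ext)

lemma vspace_DA [simp]: "vspace DA"
proof -
  interpret V: vector_space "fun_scal :: 'k \<Rightarrow> ('a \<Rightarrow> 'k) \<Rightarrow> _" by (rule vector_space_fun_scal)
  have "V.subspace (carrier DA)"
    by (intro V.subspaceI) (auto simp: dual_mem lform_def linear_on_def algebra_simps)
  then show ?thesis by (simp add: vspace_def V.vector_space_axioms)
qed

lemma kalgebra_DA: "kalgebra DA"
proof (intro kalgebra.intro monoid.intro kalgebra_axioms.intro)
  show c: "f \<otimes>\<^bsub>DA\<^esub> p \<in> carrier DA" if "f \<in> carrier DA" "p \<in> carrier DA" for f p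
    using that by (rule dual_mult_closed)
  show o: "\<one>\<^bsub>DA\<^esub> \<in> carrier DA" by (simp add: one_DA)
  show "(f \<otimes>\<^bsub>DA\<^esub> p) \<otimes>\<^bsub>DA\<^esub> r = f \<otimes>\<^bsub>DA\<^esub> (p \<otimes>\<^bsub>DA\<^esub> r)"
    if m: "f \<in> carrier DA" "p \<in> carrier DA" "r \<in> carrier DA" for f p r
  proof (rule dual_eqI)
    fix a assume a: "a \<in> carrier A"
    have "((f \<otimes>\<^bsub>DA\<^esub> p) \<otimes>\<^bsub>DA\<^esub> r) a = sw a (\<lambda>x y. sw x (\<lambda>b c. f b * (p c * r y)))"
      using a m c by (simp add: mult.assoc flip: sw_scale')
    also have "\<dots> = (f \<otimes>\<^bsub>DA\<^esub> (p \<otimes>\<^bsub>DA\<^esub> r)) a"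
      using a m c by (simp add: sw_coassoc sw_scale)
    finally show "((f \<otimes>\<^bsub>DA\<^esub> p) \<otimes>\<^bsub>DA\<^esub> r) a = (f \<otimes>\<^bsub>DA\<^esub> (p \<otimes>\<^bsub>DA\<^esub> r)) a" .
  qed (use m c in simp_all)
  show "\<one>\<^bsub>DA\<^esub> \<otimes>\<^bsub>DA\<^esub> f = f" if m: "f \<in> carrier DA" for f
    by (rule dual_eqI) (use m o c in \<open>simp_all add: sw_counit_left\<close>)
  show "f \<otimes>\<^bsub>DA\<^esub> \<one>\<^bsub>DA\<^esub> = f" if m: "f \<in> carrier DA" for f
  proof (rule dual_eqI)
    fix a assume a: "a \<in> carrier A"
    have "(f \<otimes>\<^bsub>DA\<^esub> \<one>\<^bsub>DA\<^esub>) a = sw a (\<lambda>x y. \<epsilon> y * f x)"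
      using a m o by (simp add: mult.commute)
    then show "(f \<otimes>\<^bsub>DA\<^esub> \<one>\<^bsub>DA\<^esub>) a = f a" using a m by (simp add: sw_counit_right)
  qed (use m o c in simp_all)
  show "vector_space (scal DA)" "module.subspace (scal DA) (carrier DA)"
    using vspace_DA unfolding vspace_def by auto
  note cl = vspace_closed[OF vspace_DA]
  show "bilinear_on DA DA (scal DA) (\<lambda>f p. f \<otimes>\<^bsub>DA\<^esub> p)"
  proof (intro bilinear_onI linear_onI)
    fix f p r assume m: "f \<in> carrier DA" "p \<in> carrier DA" "r \<in> carrier DA"
    show "f \<otimes>\<^bsub>DA\<^esub> (p + r) = f \<otimes>\<^bsub>DA\<^esub> p + f \<otimes>\<^bsub>DA\<^esub> r"
      by (rule dual_eqI) (use m c cl in \<open>simp_all add: algebra_simps sw_add\<close>)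
    show "(p + r) \<otimes>\<^bsub>DA\<^esub> f = p \<otimes>\<^bsub>DA\<^esub> f + r \<otimes>\<^bsub>DA\<^esub> f"
      by (rule dual_eqI) (use m c cl in \<open>simp_all add: algebra_simps sw_add\<close>)
  next
    fix f p k assume m: "f \<in> carrier DA" "p \<in> carrier DA"
    have cs: "fun_scal k x \<in> carrier DA" if "x \<in> carrier DA" for x using cl(3)[OF that, of k] by simp
    show "f \<otimes>\<^bsub>DA\<^esub> (scal DA k p) = scal DA k (f \<otimes>\<^bsub>DA\<^esub> p)"
      by (rule dual_eqI) (use m c cs in \<open>simp_all add: mult.left_commute sw_scale\<close>)
    show "(scal DA k p) \<otimes>\<^bsub>DA\<^esub> f = scal DA k (p \<otimes>\<^bsub>DA\<^esub> f)"
      by (rule dual_eqI) (use m c cs in \<open>simp_all add: mult.assoc sw_scale\<close>)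
  qed
qed

sublocale dual: kalgebra DA
  by (rule kalgebra_DA)

lemma dual_expand: "f \<in> carrier DA \<Longrightarrow> (\<Sum>b\<in>B. fun_scal (f b) (e b)) = f"
  using lform_expand[OF dual_lform, of f]
  by (intro dual_eqI)
    (auto simp: sum_fun_apply mult.commute intro!: vspace_sum_closed
      vspace_closed(3)[OF vspace_DA, simplified])

lemma lform_dual_expand:
  assumes F: "lform DA F" and f: "f \<in> carrier DA"
  shows "(\<Sum>b\<in>B. f b * F (e b)) = F f"
proof -
  have "F f = F (\<Sum>b\<in>B. fun_scal (f b) (e b))" using dual_expand[OF f] by simp
  also have "\<dots> = (\<Sum>b\<in>B. f b * F (e b))"
    using F vspace_closed(3)[OF vspace_DA] unfolding lform_def
    by (subst linear_on_sum[of DA "(*)" F]) (auto simp: linear_on_def)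
  finally show ?thesis ..
qed

lemma lform_eval [simp]: "lform DA (\<lambda>f. f y)"
  by (simp add: lform_def linear_on_def)

section \<open>Elements of the double as maps\<close>

abbreviation DT :: "('k, ('k, 'a \<Rightarrow> 'k, 'a) tensor) kalg" where "DT \<equiv> tensor_alg DA A"
abbreviation bow :: "('a \<Rightarrow> 'k) \<Rightarrow> 'a \<Rightarrow> ('k, 'a \<Rightarrow> 'k, 'a) tensor" where "bow \<equiv> bowtie A"

lemma bow_mem [simp]: "f \<in> carrier DA \<Longrightarrow> a \<in> carrier A \<Longrightarrow> bow f a \<in> carrier DT"
  by (simp add: bowtie_def)

text \<open>
  A tensor in \<open>A\<^sup>* \<otimes> A\<close> is a linear map \<open>A \<rightarrow> A\<close>, with
  \<open>f \<otimes> a\<close> acting as \<open>y \<mapsto> f(y) a\<close>. Here \<open>E t y \<phi>\<close> is the value of the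
  form \<open>\<phi>\<close> at the image of \<open>y\<close> under the map of \<open>t\<close>, expanded in the basis.
\<close>

definition E :: "('k, 'a \<Rightarrow> 'k, 'a) tensor \<Rightarrow> 'a \<Rightarrow> ('a \<Rightarrow> 'k) \<Rightarrow> 'k" where
  "E t y \<phi> = (\<Sum>b\<in>B. t (\<lambda>f a. f y * e b a) * \<phi> b)"

lemma bil_eval [simp]: "bilinear_on DA A (*) (\<lambda>f a. f y * e b a)"
  using lform_e[of b] unfolding bilinear_on_def linear_on_def lform_def by (simp add: algebra_simps)

lemma E_cong [cong]:
  assumes "t = t'" "y = y'" "\<And>b. b \<in> B \<Longrightarrow> \<phi> b = \<psi> b"
  shows "E t y \<phi> = E t' y' \<psi>"
  unfolding E_def using assms by (intro sum.cong) auto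

lemma E_bow [simp]:
  assumes "f \<in> carrier DA" "a \<in> carrier A" "lform A \<phi>"
  shows "E (bow f a) y \<phi> = f y * \<phi> a"
proof -
  have "E (bow f a) y \<phi> = f y * (\<Sum>b\<in>B. e b a * \<phi> b)"
    by (simp add: E_def bowtie_def tens_apply mult.assoc sum_distrib_left)
  then show ?thesis using assms by (simp add: lform_expand)
qed

lemma E_add: "E (s + t) y \<phi> = E s y \<phi> + E t y \<phi>"
  by (simp add: E_def sum.distrib algebra_simps)

lemma E_zero: "E 0 y \<phi> = 0"
  by (simp add: E_def)

lemma E_scal: "E (fun_scal c t) y \<phi> = c * E t y \<phi>"
  by (simp add: E_def sum_distrib_left mult.assoc)

lemma E_sum_left: "E (\<Sum>i\<in>I. t i) y \<phi> = (\<Sum>i\<in>I. E (t i) y \<phi>)"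
  by (induction I rule: infinite_finite_induct) (simp_all add: E_add E_zero del: plus_fun_apply zero_fun_apply)

lemma lform_E_left [simp]: "scal C = fun_scal \<Longrightarrow> lform C (\<lambda>t. E t y \<phi>)"
  by (simp add: lform_def linear_on_def E_add E_scal)

lemma lform_E_body [simp]: "(\<And>b. b \<in> B \<Longrightarrow> lform C (\<lambda>x. \<phi> x b)) \<Longrightarrow> lform C (\<lambda>x. E t y (\<phi> x))"
  by (simp add: E_def)

lemma E_sum: "E t y (\<lambda>b. \<Sum>i\<in>I. F i b) = (\<Sum>i\<in>I. E t y (F i))"
  unfolding E_def by (simp add: sum_distrib_left) (rule sum.swap)

lemma E_scale: "E t y (\<lambda>b. k * F b) = k * E t y F"
  unfolding E_def sum_distrib_left by (intro sum.cong refl) (simp add: mult_ac)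

lemma E_scale': "E t y (\<lambda>b. F b * k) = E t y F * k"
  unfolding E_def sum_distrib_right by (intro sum.cong refl) (simp add: mult_ac)

lemma E_sw: "E t y (\<lambda>b. sw a (\<lambda>p q. F b p q)) = sw a (\<lambda>p q. E t y (\<lambda>b. F b p q))"
  unfolding sw_def by (simp add: E_sum E_scale)

lemma E_E: "E t y (\<lambda>b. E s z (\<lambda>c. F b c)) = E s z (\<lambda>c. E t y (\<lambda>b. F b c))"
  unfolding E_def[of s] by (simp add: E_sum E_scale)

lemma lform_E_arg [simp]:
  assumes "t \<in> carrier DT" and "lmap A h"
  shows "lform A (\<lambda>y. E t (h y) \<phi>)"
proof -
  have "lform A (\<lambda>y. t (\<lambda>f a. f y * e b a))" for b
  proof -
    have "lform A (\<lambda>y. tsum DA A t (\<lambda>f a. f y * e b a))"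
      unfolding lform_def using assms(1)
      by (intro linear_on_tsum_body vector_space_field) (auto simp flip: lform_def)
    then show ?thesis using assms(1) by (simp add: tsum_field)
  qed
  then have "lform A (\<lambda>y. E t y \<phi>)" by (simp add: E_def)
  then show ?thesis using assms(2) by (rule lform_comp)
qed

text \<open>A tensor is recovered from its map by summing over the dual bases.\<close>

lemma E_expand:
  assumes t: "t \<in> carrier DT" and F: "bilinear_on DA A (*) F"
  shows "t F = (\<Sum>b\<in>B. E t b (F (e b)))"
proof (rule tensor_linear_eqI[OF t vspace_DA])
  show "linear_on DT (*) (\<lambda>t. t F)" by (simp add: linear_on_def)
  show "linear_on DT (*) (\<lambda>t. \<Sum>b\<in>B. E t b (F (e b)))"
    unfolding lform_def[symmetric] by simp
  fix f a assume f: "f \<in> carrier DA" and a: "a \<in> carrier A"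
  have "lform A (F (e b))" for b
    using bilinear_on_right[OF F e_mem] by (simp add: lform_def)
  then have "(\<Sum>b\<in>B. E (tens DA A f a) b (F (e b))) = (\<Sum>b\<in>B. f b * F (e b) a)"
    using E_bow[OF f a] by (simp add: bowtie_def)
  also have "\<dots> = F f a"
    using bilinear_on_left[OF F a] f by (intro lform_dual_expand) (simp_all add: lform_def)
  finally show "tens DA A f a F = (\<Sum>b\<in>B. E (tens DA A f a) b (F (e b)))"
    using F by (simp add: tens_apply)
qed

lemma DT_eqI:
  assumes "s \<in> carrier DT" "t \<in> carrier DT"
    and "\<And>y \<phi>. y \<in> carrier A \<Longrightarrow> lform A \<phi> \<Longrightarrow> E s y \<phi> = E t y \<phi>"
  shows "s = t"
proof (rule tensor_eqI[OF assms(1,2)])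
  fix F :: "('a \<Rightarrow> 'k) \<Rightarrow> 'a \<Rightarrow> 'k" assume F: "bilinear_on DA A (*) F"
  have "lform A (F (e b))" for b
    using bilinear_on_right[OF F e_mem] by (simp add: lform_def)
  then show "s F = t F" using assms by (simp add: E_expand[OF _ F])
qed

lemma DT_form_eqI:
  assumes "t \<in> carrier DT" "lform DT F" "lform DT G"
    and "\<And>f a. f \<in> carrier DA \<Longrightarrow> a \<in> carrier A \<Longrightarrow> F (bow f a) = G (bow f a)"
  shows "F t = G t"
  by (rule tensor_linear_eqI[OF assms(1) vspace_DA assms(2)[unfolded lform_def] assms(3)[unfolded lform_def]])
    (use assms(4) in \<open>simp add: bowtie_def\<close>)

end

section \<open>Multiplication in the double\<close>

context fin_hopf_bij begin

abbreviation D :: "('k, ('k, 'a \<Rightarrow> 'k, 'a) tensor) bialg" where "D \<equiv> drinfeld_double A"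

lemma carrier_D [simp]: "carrier D = carrier DT"
  and scal_D [simp]: "scal D = fun_scal"
  and one_D: "\<one>\<^bsub>D\<^esub> = bow \<one>\<^bsub>DA\<^esub> \<one>"
  by (simp_all add: drinfeld_double_def double_alg_def)

text \<open>
  The functional \<open>p(S\<^sup>-\<^sup>1(a\<^sub>3) ? a\<^sub>1)\<close> of the multiplication rule
  of the double.
\<close>

definition twist :: "'a \<Rightarrow> 'a \<Rightarrow> ('a \<Rightarrow> 'k) \<Rightarrow> 'a \<Rightarrow> 'k" where
  "twist a3 a1 p = on_carrier A (\<lambda>y. p (T a3 \<otimes> y \<otimes> a1))"

lemma twist_mem [simp]:
  "a3 \<in> carrier A \<Longrightarrow> a1 \<in> carrier A \<Longrightarrow> p \<in> carrier DA \<Longrightarrow> twist a3 a1 p \<in> carrier DA"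
  using lform_comp[of A p] by (simp add: twist_def)

definition dmul :: "('a \<Rightarrow> 'k) \<Rightarrow> 'a \<Rightarrow> ('a \<Rightarrow> 'k) \<Rightarrow> 'a \<Rightarrow> ('k, 'a \<Rightarrow> 'k, 'a) tensor" where
  "dmul f a p b = tsum A A (comult A a) (\<lambda>a1 a'. tsum A A (comult A a') (\<lambda>a2 a3.
            bow (f \<otimes>\<^bsub>DA\<^esub> twist a3 a1 p) (a2 \<otimes> b)))"

lemma mult_D: "s \<otimes>\<^bsub>D\<^esub> t = tsum DA A s (\<lambda>f a. tsum DA A t (dmul f a))"
  unfolding drinfeld_double_def double_alg_def dmul_def twist_def T_def by simp

lemma tsum_zero: "(\<And>x y. F x y = 0) \<Longrightarrow> tsum X Y t F = 0"
  unfolding tsum_def by (simp add: case_prod_unfold)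

text \<open>
  Evaluation on arbitrary forms \<open>F\<close> makes linearity in each of the four arguments a matter
  of the closure rules for linear forms.
\<close>

lemma dmul_apply:
  assumes m: "f \<in> carrier DA" "p \<in> carrier DA" and a: "a \<in> carrier A" and b: "b \<in> carrier A"
  shows "dmul f a p b F = (if bilinear_on DA A (*) F then (\<Sum>c\<in>B. sw a (\<lambda>a1 a'. sw a' (\<lambda>a2 a3.
    sw c (\<lambda>y1 y2. f y1 * p (T a3 \<otimes> y2 \<otimes> a1)) * F (e c) (a2 \<otimes> b)))) else 0)"
proof (cases "bilinear_on DA A (*) F")
  case F: True
  have l1: "lform A (F (e c))" for c
    using bilinear_on_right[OF F e_mem] by (simp add: lform_def)
  note [simp] = lform_comp[OF l1] lform_comp[OF dual_lform[OF m(2)]]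
  have ev: "bow (f \<otimes>\<^bsub>DA\<^esub> twist a3 a1 p) (a2 \<otimes> b) F =
      (\<Sum>c\<in>B. sw c (\<lambda>y1 y2. f y1 * p (T a3 \<otimes> y2 \<otimes> a1)) * F (e c) (a2 \<otimes> b))"
    if "a1 \<in> carrier A" "a2 \<in> carrier A" "a3 \<in> carrier A" for a1 a2 a3
  proof -
    have "bow (f \<otimes>\<^bsub>DA\<^esub> twist a3 a1 p) (a2 \<otimes> b) F = F (f \<otimes>\<^bsub>DA\<^esub> twist a3 a1 p) (a2 \<otimes> b)"
      by (simp add: bowtie_def tens_apply F)
    also have "\<dots> = (\<Sum>c\<in>B. (f \<otimes>\<^bsub>DA\<^esub> twist a3 a1 p) c * F (e c) (a2 \<otimes> b))"
      using that m b bilinear_on_left[OF F]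
      by (intro lform_dual_expand[symmetric]) (simp_all add: lform_def)
    also have "\<dots> = (\<Sum>c\<in>B. sw c (\<lambda>y1 y2. f y1 * p (T a3 \<otimes> y2 \<otimes> a1)) * F (e c) (a2 \<otimes> b))"
      using that m by (intro sum.cong refl) (simp add: twist_def)
    finally show ?thesis .
  qed
  let ?G = "\<lambda>a1 a2 a3. \<Sum>c\<in>B. sw c (\<lambda>y1 y2. f y1 * p (T a3 \<otimes> y2 \<otimes> a1)) * F (e c) (a2 \<otimes> b)"
  have "dmul f a p b F = tsum A A (comult A a) (\<lambda>a1 a'. tsum A A (comult A a') (\<lambda>a2 a3. ?G a1 a2 a3))"
    unfolding dmul_def tsum_fun_apply using a ev by (intro tsum_cong comult_closed) auto
  also have "\<dots> = tsum A A (comult A a) (\<lambda>a1 a'. sw a' (\<lambda>a2 a3. ?G a1 a2 a3))"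
    using a b m by (intro tsum_cong comult_closed tsum_sw) auto
  also have "\<dots> = sw a (\<lambda>a1 a'. sw a' (\<lambda>a2 a3. ?G a1 a2 a3))"
    using a b m by (intro tsum_sw) auto
  finally show ?thesis using F by (simp add: sw_sum)
next
  case False
  then show ?thesis unfolding dmul_def tsum_fun_apply
    by (simp add: tsum_zero bowtie_def tens_def)
qed

lemma dmul_closed [simp]:
  assumes "f \<in> carrier DA" "p \<in> carrier DA" "a \<in> carrier A" "b \<in> carrier A"
  shows "dmul f a p b \<in> carrier DT"
  unfolding dmul_def using assms by (intro tsum_closed comult_closed) auto

lemma linear_on_funI:
  assumes "\<And>i. lform C (\<lambda>x. F x i)"
  shows "linear_on C fun_scal F"
  using assms unfolding lform_def linear_on_def by (auto simp: fun_eq_iff)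

lemma lform_if_zero: "(P \<Longrightarrow> lform C F) \<Longrightarrow> lform C (\<lambda>x. if P then F x else 0)"
  by (auto simp: lform_def linear_on_def)

lemma lform_congI:
  assumes "lform C G" "\<And>x. x \<in> carrier C \<Longrightarrow> F x = G x" "vspace C"
  shows "lform C F"
  using assms unfolding lform_def linear_on_def by simp

lemma
  assumes m: "f \<in> carrier DA" "a \<in> carrier A"
  shows dmul_bilinear2: "bilinear_on DA A fun_scal (dmul f a)"
    and dmul_bilinear1: "bilinear_on DA A fun_scal (\<lambda>p b. dmul p b f a)"
proof -
  have l1: "lform A (F (e c))" if "bilinear_on DA A (*) F" for c F
    using bilinear_on_right[OF that e_mem] by (simp add: lform_def)
  note [simp] = lform_comp[OF l1]
  show "bilinear_on DA A fun_scal (dmul f a)"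
  proof (intro bilinear_onI linear_on_funI)
    fix p F assume p: "p \<in> carrier DA"
    show "lform A (\<lambda>b. dmul f a p b F)"
      by (rule lform_congI[OF _ dmul_apply[OF m(1) p m(2)] vspace_A], rule lform_if_zero) simp
  next
    fix b F assume b: "b \<in> carrier A"
    show "lform DA (\<lambda>p. dmul f a p b F)"
      by (rule lform_congI[OF _ dmul_apply[OF m(1) _ m(2) b] vspace_DA], assumption?, rule lform_if_zero) simp
  qed
  show "bilinear_on DA A fun_scal (\<lambda>p b. dmul p b f a)"
  proof (intro bilinear_onI linear_on_funI)
    fix p F assume p: "p \<in> carrier DA"
    show "lform A (\<lambda>b. dmul p b f a F)"
      by (rule lform_congI[OF _ dmul_apply[OF p m(1) _ m(2)] vspace_A], assumption?, rule lform_if_zero)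
        (simp add: lform_sw[of "\<lambda>x. x"])
  next
    fix b F assume b: "b \<in> carrier A"
    show "lform DA (\<lambda>p. dmul p b f a F)"
      by (rule lform_congI[OF _ dmul_apply[OF _ m(1) b m(2)] vspace_DA], assumption?, rule lform_if_zero) simp
  qed
qed

lemma mult_D_bilinear: "bilinear_on D D fun_scal (\<lambda>s t. s \<otimes>\<^bsub>D\<^esub> t)"
  using tensor_op_bilinear[OF vspace_DA vspace_DA vector_space_fun_scal dmul_bilinear2 dmul_bilinear1]
  unfolding mult_D bilinear_on_def linear_on_def by simp

lemma mult_D_bow:
  assumes "f \<in> carrier DA" "a \<in> carrier A" "p \<in> carrier DA" "b \<in> carrier A"
  shows "bow f a \<otimes>\<^bsub>D\<^esub> bow p b = dmul f a p b"
  unfolding mult_D bowtie_def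
  by (rule tensor_op_tens[OF vspace_DA vspace_DA vector_space_fun_scal dmul_bilinear2 dmul_bilinear1])
    (use assms in auto)

lemma mult_D_closed: "s \<in> carrier DT \<Longrightarrow> t \<in> carrier DT \<Longrightarrow> s \<otimes>\<^bsub>D\<^esub> t \<in> carrier DT"
  unfolding mult_D by (intro tsum_closed) auto

text \<open>
  The map of \<open>(1 \<bowtie> a) t\<close>, which sends \<open>y\<close> to
  \<open>\<Sum> a\<^sub>2 t(S\<^sup>-\<^sup>1(a\<^sub>3) y a\<^sub>1)\<close>.
\<close>

definition La :: "'a \<Rightarrow> ('k, 'a \<Rightarrow> 'k, 'a) tensor \<Rightarrow> 'a \<Rightarrow> ('a \<Rightarrow> 'k) \<Rightarrow> 'k" where
  "La a t y \<phi> = sw a (\<lambda>a1 a'. sw a' (\<lambda>a2 a3. E t (T a3 \<otimes> y \<otimes> a1) (\<lambda>b. \<phi> (a2 \<otimes> b))))"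

lemma lform_La_left [simp]: "lmap A h \<Longrightarrow> lform A (\<lambda>x. La (h x) t y \<phi>)"
  by (simp add: La_def)

lemma lform_La_right [simp]: "t \<in> carrier DT \<Longrightarrow> lmap A h \<Longrightarrow> lform A (\<lambda>x. La a t (h x) \<phi>)"
  by (simp add: La_def)

text \<open>
  The product of two maps is a twisted convolution: the first map is applied to
  \<open>y\<^sub>1\<close>, and its value acts on the second map at \<open>y\<^sub>2\<close>.
\<close>

lemma E_mult:
  assumes s: "s \<in> carrier DT" and t: "t \<in> carrier DT" and y: "y \<in> carrier A" and \<phi>: "lform A \<phi>"
  shows "E (s \<otimes>\<^bsub>D\<^esub> t) y \<phi> = sw y (\<lambda>y1 y2. E s y1 (\<lambda>a. La a t y2 \<phi>))"
proof (rule DT_form_eqI[OF s])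
  have bl: "linear_on DT fun_scal (\<lambda>s. s \<otimes>\<^bsub>D\<^esub> t)" if "t \<in> carrier DT" for t
    using bilinear_on_left[OF mult_D_bilinear, of t] that by (simp add: linear_on_def)
  have br: "linear_on DT fun_scal (\<lambda>t. s \<otimes>\<^bsub>D\<^esub> t)" if "s \<in> carrier DT" for s
    using bilinear_on_right[OF mult_D_bilinear, of s] that by (simp add: linear_on_def)
  show "lform DT (\<lambda>s. E (s \<otimes>\<^bsub>D\<^esub> t) y \<phi>)"
    using bl[OF t] by (simp add: lform_def linear_on_def E_add E_scal)
  show "lform DT (\<lambda>s. sw y (\<lambda>y1 y2. E s y1 (\<lambda>a. La a t y2 \<phi>)))" by simp
  fix f a assume f: "f \<in> carrier DA" and a: "a \<in> carrier A"
  have l: "lform A (\<lambda>a. La a t y2 \<phi>)" for t y2 by (simp add: lform_La_left[of "\<lambda>x. x"])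
  show "E (bow f a \<otimes>\<^bsub>D\<^esub> t) y \<phi> = sw y (\<lambda>y1 y2. E (bow f a) y1 (\<lambda>a. La a t y2 \<phi>))"
  proof (rule DT_form_eqI[OF t])
    show "lform DT (\<lambda>t. E (bow f a \<otimes>\<^bsub>D\<^esub> t) y \<phi>)"
      using br[OF bow_mem[OF f a]] by (simp add: lform_def linear_on_def E_add E_scal)
    show "lform DT (\<lambda>t. sw y (\<lambda>y1 y2. E (bow f a) y1 (\<lambda>a. La a t y2 \<phi>)))" by (simp add: La_def)
    fix p b assume p: "p \<in> carrier DA" and b: "b \<in> carrier A"
    note [simp] = lform_comp[OF \<phi>]
    have "E (bow f a \<otimes>\<^bsub>D\<^esub> bow p b) y \<phi> = (\<Sum>d\<in>B. (\<Sum>c\<in>B. sw a (\<lambda>a1 a'. sw a' (\<lambda>a2 a3.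
      sw c (\<lambda>y1 y2. f y1 * p (T a3 \<otimes> y2 \<otimes> a1)) * (e c y * e d (a2 \<otimes> b))))) * \<phi> d)"
      using f p a b unfolding E_def by (simp add: mult_D_bow dmul_apply)
    also have "\<dots> = sw a (\<lambda>a1 a'. sw a' (\<lambda>a2 a3.
      (\<Sum>c\<in>B. e c y * sw c (\<lambda>y1 y2. f y1 * p (T a3 \<otimes> y2 \<otimes> a1))) * (\<Sum>d\<in>B. e d (a2 \<otimes> b) * \<phi> d)))"
    proof -
      have "(\<Sum>d\<in>B. (\<Sum>c\<in>B. sw a (\<lambda>a1 a'. sw a' (\<lambda>a2 a3.
          K a1 a3 c * (e c y * e d (a2 \<otimes> b))))) * \<phi> d) =
        sw a (\<lambda>a1 a'. sw a' (\<lambda>a2 a3.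
          (\<Sum>c\<in>B. e c y * K a1 a3 c) * (\<Sum>d\<in>B. e d (a2 \<otimes> b) * \<phi> d)))"
        for K :: "'a \<Rightarrow> 'a \<Rightarrow> 'a \<Rightarrow> 'k"
      proof -
        have "(\<Sum>d\<in>B. (\<Sum>c\<in>B. sw a (\<lambda>a1 a'. sw a' (\<lambda>a2 a3.
            K a1 a3 c * (e c y * e d (a2 \<otimes> b))))) * \<phi> d) =
          (\<Sum>d\<in>B. (\<Sum>c\<in>B. sw a (\<lambda>a1 a'. sw a' (\<lambda>a2 a3.
            (e c y * K a1 a3 c) * (e d (a2 \<otimes> b) * \<phi> d)))))"
          by (simp only: sum_distrib_right flip: sw_scale') (simp add: mult_ac)
        then show ?thesis by (simp only: sum_product sw_sum) (rule sum.swap)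
      qed
      then show ?thesis .
    qed
    also have "\<dots> = sw a (\<lambda>a1 a'. sw a' (\<lambda>a2 a3.
      sw y (\<lambda>y1 y2. f y1 * p (T a3 \<otimes> y2 \<otimes> a1)) * \<phi> (a2 \<otimes> b)))"
      using y b \<phi> lform_expand[OF lform_sw[OF lmap_id] y] by (simp add: lform_expand)
    also have "\<dots> = sw a (\<lambda>a1 a'. sw a' (\<lambda>a2 a3.
      sw y (\<lambda>y1 y2. f y1 * (p (T a3 \<otimes> y2 \<otimes> a1) * \<phi> (a2 \<otimes> b)))))"
      by (simp only: mult.assoc flip: sw_scale')
    also have "\<dots> = sw y (\<lambda>y1 y2. f y1 * La a (bow p b) y2 \<phi>)"
      using p b by (simp add: La_def sw_swap[of _ y] sw_scale)
    also have "\<dots> = sw y (\<lambda>y1 y2. E (bow f a) y1 (\<lambda>a. La a (bow p b) y2 \<phi>))"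
      using f a l by (simp add: E_bow)
    finally show "E (bow f a \<otimes>\<^bsub>D\<^esub> bow p b) y \<phi> =
      sw y (\<lambda>y1 y2. E (bow f a) y1 (\<lambda>a. La a (bow p b) y2 \<phi>))" .
  qed
qed

lemma La_one:
  assumes "t \<in> carrier DT" "y \<in> carrier A" "lform A \<phi>"
  shows "La \<one> t y \<phi> = E t y \<phi>"
  using assms by (simp add: La_def sw_one lform_comp[OF assms(3)])

lemma E_one [simp]:
  assumes "y \<in> carrier A" "lform A \<phi>"
  shows "E \<one>\<^bsub>D\<^esub> y \<phi> = \<epsilon> y * \<phi> \<one>"
  using assms by (simp add: one_D)

text \<open>
  The action \<open>La\<close> is multiplicative because the coproduct and the inverse antipode are.
\<close>

lemma La_mult:
  assumes t: "t \<in> carrier DT" and y: "y \<in> carrier A" and \<phi>: "lform A \<phi>"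
    and c: "c \<in> carrier A" and d: "d \<in> carrier A"
  shows "La (c \<otimes> d) t y \<phi> =
    sw c (\<lambda>c1 c'. sw c' (\<lambda>c2 c3. La d t (T c3 \<otimes> y \<otimes> c1) (\<lambda>z. \<phi> (c2 \<otimes> z))))"
proof -
  note [simp] = lform_comp[OF \<phi>]
  have "La (c \<otimes> d) t y \<phi> = sw c (\<lambda>c1 c'. sw d (\<lambda>d1 d'. sw (c' \<otimes> d') (\<lambda>x2 x3.
      E t (T x3 \<otimes> y \<otimes> (c1 \<otimes> d1)) (\<lambda>b. \<phi> (x2 \<otimes> b)))))"
    unfolding La_def using t y c d by (intro sw_mult) simp_all
  also have "\<dots> = sw c (\<lambda>c1 c'. sw d (\<lambda>d1 d'. sw c' (\<lambda>c2 c3. sw d' (\<lambda>d2 d3.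
      E t (T (c3 \<otimes> d3) \<otimes> y \<otimes> (c1 \<otimes> d1)) (\<lambda>b. \<phi> (c2 \<otimes> d2 \<otimes> b))))))"
    using t y c d by (intro sw_cong[OF refl] sw_mult) simp_all
  also have "\<dots> = sw c (\<lambda>c1 c'. sw c' (\<lambda>c2 c3. sw d (\<lambda>d1 d'. sw d' (\<lambda>d2 d3.
      E t (T (c3 \<otimes> d3) \<otimes> y \<otimes> (c1 \<otimes> d1)) (\<lambda>b. \<phi> (c2 \<otimes> d2 \<otimes> b))))))"
    by (rule sw_cong[OF refl]) (rule sw_swap)
  finally show ?thesis using y by (simp add: La_def T_mult m_assoc)
qed

text \<open>
  Moving \<open>a\<close> past a product distributes its coproduct over both factors. The fivefold
  coproduct of \<open>a\<close> occurs on both sides, once through the coproduct of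
  \<open>S\<^sup>-\<^sup>1(a\<^sub>3) y a\<^sub>1\<close> and once through the repeated action;
  associativity of the double follows at once.
\<close>

lemma La_exchange:
  assumes s: "s \<in> carrier DT" and t: "t \<in> carrier DT" and y: "y \<in> carrier A" and \<phi>: "lform A \<phi>"
    and a: "a \<in> carrier A"
  shows "La a (s \<otimes>\<^bsub>D\<^esub> t) y \<phi> = sw y (\<lambda>y1 y2. La a s y1 (\<lambda>c. La c t y2 \<phi>))"
proof -
  note [simp] = lform_comp[OF \<phi>]
  have l: "lform A (\<lambda>z. \<phi> (c \<otimes> z))" if "c \<in> carrier A" for c using that by simp
  have l': "lform A (\<lambda>a. La a t y2 \<psi>)" for y2 \<psi> by (simp add: lform_La_left[of "\<lambda>x. x"])
  have "La a (s \<otimes>\<^bsub>D\<^esub> t) y \<phi> = sw a (\<lambda>a1 a'. sw a' (\<lambda>a2 a3. sw (T a3 \<otimes> y \<otimes> a1) (\<lambda>z1 z2.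
      E s z1 (\<lambda>b. La b t z2 (\<lambda>d. \<phi> (a2 \<otimes> d))))))"
    unfolding La_def[of a] using s t y by (simp add: E_mult)
  also have "\<dots> = sw a (\<lambda>a1 a'. sw a' (\<lambda>a2 a3. sw a3 (\<lambda>r1 r2. sw y (\<lambda>y1 y2. sw a1 (\<lambda>s1 s2.
      E s (T r2 \<otimes> y1 \<otimes> s1) (\<lambda>b. La b t (T r1 \<otimes> y2 \<otimes> s2) (\<lambda>d. \<phi> (a2 \<otimes> d))))))))"
  proof (intro sw_cong[OF refl])
    fix a1 a' a2 a3 assume m: "a1 \<in> B" "a' \<in> B" "a2 \<in> B" "a3 \<in> B"
    have "sw (T a3 \<otimes> y \<otimes> a1) (\<lambda>z1 z2. E s z1 (\<lambda>b. La b t z2 (\<lambda>d. \<phi> (a2 \<otimes> d)))) =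
      sw (T a3 \<otimes> y) (\<lambda>x x'. sw a1 (\<lambda>s1 s2. E s (x \<otimes> s1) (\<lambda>b. La b t (x' \<otimes> s2) (\<lambda>d. \<phi> (a2 \<otimes> d)))))"
      using m s t y by (intro sw_mult) simp_all
    also have "\<dots> = sw (T a3) (\<lambda>r1 r2. sw y (\<lambda>y1 y2. sw a1 (\<lambda>s1 s2.
        E s (r1 \<otimes> y1 \<otimes> s1) (\<lambda>b. La b t (r2 \<otimes> y2 \<otimes> s2) (\<lambda>d. \<phi> (a2 \<otimes> d))))))"
      using m s t y by (intro sw_mult) simp_all
    also have "\<dots> = sw a3 (\<lambda>r1 r2. sw y (\<lambda>y1 y2. sw a1 (\<lambda>s1 s2.
        E s (T r2 \<otimes> y1 \<otimes> s1) (\<lambda>b. La b t (T r1 \<otimes> y2 \<otimes> s2) (\<lambda>d. \<phi> (a2 \<otimes> d))))))"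
      using m s t y by (intro sw_T) simp_all
    finally show "sw (T a3 \<otimes> y \<otimes> a1) (\<lambda>z1 z2. E s z1 (\<lambda>b. La b t z2 (\<lambda>d. \<phi> (a2 \<otimes> d)))) = \<dots>" .
  qed
  also have "\<dots> = sw a (\<lambda>a1 a'. sw a1 (\<lambda>s1 s2. sw y (\<lambda>y1 y2. sw a' (\<lambda>a2 a3. sw a3 (\<lambda>r1 r2.
      E s (T r2 \<otimes> y1 \<otimes> s1) (\<lambda>b. La b t (T r1 \<otimes> y2 \<otimes> s2) (\<lambda>d. \<phi> (a2 \<otimes> d))))))))"
  proof (rule sw_cong[OF refl])
    fix a1 a'
    show "sw a' (\<lambda>a2 a3. sw a3 (\<lambda>r1 r2. sw y (\<lambda>y1 y2. sw a1 (\<lambda>s1 s2.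
        E s (T r2 \<otimes> y1 \<otimes> s1) (\<lambda>b. La b t (T r1 \<otimes> y2 \<otimes> s2) (\<lambda>d. \<phi> (a2 \<otimes> d))))))) =
      sw a1 (\<lambda>s1 s2. sw y (\<lambda>y1 y2. sw a' (\<lambda>a2 a3. sw a3 (\<lambda>r1 r2.
        E s (T r2 \<otimes> y1 \<otimes> s1) (\<lambda>b. La b t (T r1 \<otimes> y2 \<otimes> s2) (\<lambda>d. \<phi> (a2 \<otimes> d)))))))"
      by (simp only: sw_swap[of _ a1]) (simp only: sw_swap[of _ y])
  qed
  also have "\<dots> = sw a (\<lambda>s1 q. sw q (\<lambda>s2 a'. sw y (\<lambda>y1 y2. sw a' (\<lambda>a2 a3. sw a3 (\<lambda>r1 r2.
      E s (T r2 \<otimes> y1 \<otimes> s1) (\<lambda>b. La b t (T r1 \<otimes> y2 \<otimes> s2) (\<lambda>d. \<phi> (a2 \<otimes> d))))))))"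
    by (rule sw_coassoc[OF a])
  also have "\<dots> = sw y (\<lambda>y1 y2. sw a (\<lambda>s1 q. sw q (\<lambda>s2 a'. sw a' (\<lambda>a2 a3. sw a3 (\<lambda>r1 r2.
      E s (T r2 \<otimes> y1 \<otimes> s1) (\<lambda>b. La b t (T r1 \<otimes> y2 \<otimes> s2) (\<lambda>d. \<phi> (a2 \<otimes> d))))))))"
    by (simp only: sw_swap[of _ y])
  finally have 1: "La a (s \<otimes>\<^bsub>D\<^esub> t) y \<phi> = \<dots>" .
  have "sw y (\<lambda>y1 y2. La a s y1 (\<lambda>c. La c t y2 \<phi>)) =
      sw y (\<lambda>y1 y2. sw a (\<lambda>a1 a'. sw a' (\<lambda>a2 a3. sw a2 (\<lambda>p1 p'. sw p' (\<lambda>p2 p3.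
        E s (T a3 \<otimes> y1 \<otimes> a1) (\<lambda>b. La b t (T p3 \<otimes> y2 \<otimes> p1) (\<lambda>z. \<phi> (p2 \<otimes> z))))))))"
    unfolding La_def[of a] using t \<phi> by (simp add: La_mult E_sw)
  also have "\<dots> = sw y (\<lambda>y1 y2. sw a (\<lambda>a1 a'. sw a' (\<lambda>p1 r. sw r (\<lambda>p' a3. sw p' (\<lambda>p2 p3.
        E s (T a3 \<otimes> y1 \<otimes> a1) (\<lambda>b. La b t (T p3 \<otimes> y2 \<otimes> p1) (\<lambda>z. \<phi> (p2 \<otimes> z))))))))"
    by (intro sw_cong[OF refl] sw_coassoc) simp_all
  also have "\<dots> = sw y (\<lambda>y1 y2. sw a (\<lambda>a1 a'. sw a' (\<lambda>p1 r. sw r (\<lambda>p2 q. sw q (\<lambda>p3 a3.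
        E s (T a3 \<otimes> y1 \<otimes> a1) (\<lambda>b. La b t (T p3 \<otimes> y2 \<otimes> p1) (\<lambda>z. \<phi> (p2 \<otimes> z))))))))"
    by (intro sw_cong[OF refl] sw_coassoc) simp_all
  finally show ?thesis using 1 by simp
qed

lemma D_assoc:
  assumes r: "r \<in> carrier DT" and s: "s \<in> carrier DT" and t: "t \<in> carrier DT"
  shows "(r \<otimes>\<^bsub>D\<^esub> s) \<otimes>\<^bsub>D\<^esub> t = r \<otimes>\<^bsub>D\<^esub> (s \<otimes>\<^bsub>D\<^esub> t)"
proof (rule DT_eqI)
  fix y \<phi> assume y: "y \<in> carrier A" and \<phi>: "lform A \<phi>"
  have l: "lform A (\<lambda>a. La a t y2 \<phi>)" for y2 by (simp add: lform_La_left[of "\<lambda>x. x"])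
  have "E ((r \<otimes>\<^bsub>D\<^esub> s) \<otimes>\<^bsub>D\<^esub> t) y \<phi> =
      sw y (\<lambda>x y3. sw x (\<lambda>y1 y2. E r y1 (\<lambda>a. La a s y2 (\<lambda>c. La c t y3 \<phi>))))"
    using r s t y \<phi> l by (simp add: E_mult mult_D_closed)
  also have "\<dots> = sw y (\<lambda>y1 x. sw x (\<lambda>y2 y3. E r y1 (\<lambda>a. La a s y2 (\<lambda>c. La c t y3 \<phi>))))"
    by (rule sw_coassoc[OF y])
  also have "\<dots> = E (r \<otimes>\<^bsub>D\<^esub> (s \<otimes>\<^bsub>D\<^esub> t)) y \<phi>"
    using r s t y \<phi> by (simp add: E_mult mult_D_closed La_exchange E_sw)
  finally show "E ((r \<otimes>\<^bsub>D\<^esub> s) \<otimes>\<^bsub>D\<^esub> t) y \<phi> = E (r \<otimes>\<^bsub>D\<^esub> (s \<otimes>\<^bsub>D\<^esub> t)) y \<phi>" .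
qed (use r s t in \<open>simp_all add: mult_D_closed\<close>)

lemma one_D_closed [simp]: "\<one>\<^bsub>D\<^esub> \<in> carrier DT"
  by (simp add: one_D)

lemma E_mult_hA:
  assumes a: "a \<in> carrier A" and t: "t \<in> carrier DT" and y: "y \<in> carrier A" and \<phi>: "lform A \<phi>"
  shows "E (bow \<one>\<^bsub>DA\<^esub> a \<otimes>\<^bsub>D\<^esub> t) y \<phi> = La a t y \<phi>"
proof -
  have "E (bow \<one>\<^bsub>DA\<^esub> a \<otimes>\<^bsub>D\<^esub> t) y \<phi> = sw y (\<lambda>y1 y2. \<epsilon> y1 * La a t y2 \<phi>)"
    using a t y \<phi> lform_La_left[OF lmap_id, of t _ \<phi>] by (simp add: E_mult)
  also have "\<dots> = La a t y \<phi>"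
    using y t lform_La_right[OF t lmap_id, of a \<phi>] by (simp add: sw_counit_left)
  finally show ?thesis .
qed

lemma E_mult_dual:
  assumes f: "f \<in> carrier DA" and t: "t \<in> carrier DT" and y: "y \<in> carrier A" and \<phi>: "lform A \<phi>"
  shows "E (bow f \<one> \<otimes>\<^bsub>D\<^esub> t) y \<phi> = sw y (\<lambda>y1 y2. f y1 * E t y2 \<phi>)"
  using f t y \<phi> lform_La_left[OF lmap_id, of t _ \<phi>] by (simp add: E_mult La_one)

lemma mult_one_D: "t \<in> carrier DT \<Longrightarrow> \<one>\<^bsub>D\<^esub> \<otimes>\<^bsub>D\<^esub> t = t"
  by (rule DT_eqI) (simp_all add: mult_D_closed E_mult_hA La_one one_D)

lemma E_mult_right_hA:
  assumes a: "a \<in> carrier A" and t: "t \<in> carrier DT" and y: "y \<in> carrier A" and \<phi>: "lform A \<phi>"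
  shows "E (t \<otimes>\<^bsub>D\<^esub> bow \<one>\<^bsub>DA\<^esub> a) y \<phi> = E t y (\<lambda>c. \<phi> (c \<otimes> a))"
proof -
  note [simp] = lform_comp[OF \<phi>]
  have "La c (bow \<one>\<^bsub>DA\<^esub> a) y2 \<phi> = \<epsilon> y2 * \<phi> (c \<otimes> a)" if c: "c \<in> carrier A" and y2: "y2 \<in> carrier A" for c y2
  proof -
    have "La c (bow \<one>\<^bsub>DA\<^esub> a) y2 \<phi> = \<epsilon> y2 * sw c (\<lambda>a1 a'. \<epsilon> a1 * sw a' (\<lambda>a2 a3. \<epsilon> a3 * \<phi> (a2 \<otimes> a)))"
      using a y2 unfolding La_def sw_scale[symmetric]
      by (intro sw_cong[OF refl]) (simp add: counit_mult mult_ac)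
    also have "\<dots> = \<epsilon> y2 * \<phi> (c \<otimes> a)"
      using c a by (simp add: sw_counit_right[where \<phi> = "\<lambda>x. \<phi> (x \<otimes> a)"]
          sw_counit_left[where \<phi> = "\<lambda>x. \<phi> (x \<otimes> a)"])
    finally show ?thesis .
  qed
  then have "E (t \<otimes>\<^bsub>D\<^esub> bow \<one>\<^bsub>DA\<^esub> a) y \<phi> = sw y (\<lambda>y1 y2. \<epsilon> y2 * E t y1 (\<lambda>c. \<phi> (c \<otimes> a)))"
    using a t y \<phi> by (simp add: E_mult E_scale)
  also have "\<dots> = E t y (\<lambda>c. \<phi> (c \<otimes> a))"
    using t y lform_E_arg[OF t lmap_id] by (simp add: sw_counit_right)
  finally show ?thesis .
qed

lemma one_mult_D: "t \<in> carrier DT \<Longrightarrow> t \<otimes>\<^bsub>D\<^esub> \<one>\<^bsub>D\<^esub> = t"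
  by (rule DT_eqI) (simp_all add: mult_D_closed E_mult_right_hA one_D)

lemma kalgebra_D: "kalgebra D"
proof (intro kalgebra.intro monoid.intro kalgebra_axioms.intro)
  show "vector_space (scal D)" "module.subspace (scal D) (carrier D)"
    using vspace_tensor[OF vspace_DA, of A] unfolding vspace_def by auto
  show "bilinear_on D D (scal D) (\<lambda>s t. s \<otimes>\<^bsub>D\<^esub> t)" using mult_D_bilinear by simp
qed (simp_all add: mult_D_closed D_assoc mult_one_D one_mult_D)

sublocale D: kalgebra D
  by (rule kalgebra_D)

lemma vspace_DT [simp]: "vspace DT"
  by (rule vspace_tensor) simp

lemma lform_mult_right_arg: "lform A \<phi> \<Longrightarrow> a \<in> carrier A \<Longrightarrow> lform A (\<lambda>c. \<phi> (c \<otimes> a))"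
  by (rule lform_comp[of A \<phi> "\<lambda>c. c \<otimes> a"]) simp_all

text \<open>The double is generated by its two subalgebras.\<close>

lemma bow_split:
  assumes "f \<in> carrier DA" "a \<in> carrier A"
  shows "bow f \<one> \<otimes>\<^bsub>D\<^esub> bow \<one>\<^bsub>DA\<^esub> a = bow f a"
  by (rule DT_eqI) (use assms in \<open>simp_all add: mult_D_closed E_mult_right_hA lform_mult_right_arg\<close>)

lemma hA_mult:
  assumes "a \<in> carrier A" "b \<in> carrier A"
  shows "bow \<one>\<^bsub>DA\<^esub> a \<otimes>\<^bsub>D\<^esub> bow \<one>\<^bsub>DA\<^esub> b = bow \<one>\<^bsub>DA\<^esub> (a \<otimes> b)"
  by (rule DT_eqI) (use assms in \<open>simp_all add: mult_D_closed E_mult_right_hA lform_mult_right_arg\<close>)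

lemma dual_embed_mult:
  assumes "f \<in> carrier DA" "p \<in> carrier DA"
  shows "bow f \<one> \<otimes>\<^bsub>D\<^esub> bow p \<one> = bow (f \<otimes>\<^bsub>DA\<^esub> p) \<one>"
  by (rule DT_eqI)
    (use assms in \<open>simp_all add: mult_D_closed E_mult_dual mult.assoc flip: sw_scale'\<close>)

lemma linear_bow_left: "a \<in> carrier A \<Longrightarrow> linear_on DA fun_scal (\<lambda>f. bow f a)"
  unfolding bowtie_def by (rule bilinear_on_left[OF bilinear_tens])

lemma linear_bow_right: "f \<in> carrier DA \<Longrightarrow> linear_on A fun_scal (bow f)"
  unfolding bowtie_def by (rule bilinear_on_right[OF bilinear_tens])

lemma lform_bow [simp]:
  assumes "lform D g"
  shows "f \<in> carrier DA \<Longrightarrow> lmap A h \<Longrightarrow> lform A (\<lambda>x. g (bow f (h x)))"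
    and "a \<in> carrier A \<Longrightarrow> lform DA (\<lambda>f. g (bow f a))"
proof -
  show "lform A (\<lambda>x. g (bow f (h x)))" if f: "f \<in> carrier DA" and h: "lmap A h"
  proof -
    have "lform A (\<lambda>x. g (bow f x))"
      using assms linear_on_comp[of A D "bow f" "(*)" g] linear_bow_right[OF f] f
      by (simp add: lform_def)
    then show ?thesis using h by (rule lform_comp)
  qed
  show "lform DA (\<lambda>f. g (bow f a))" if a: "a \<in> carrier A"
    using assms linear_on_comp[of DA D "\<lambda>f. bow f a" "(*)" g] linear_bow_left[OF a] a
    by (simp add: lform_def)
qed

lemma D_form_expand:
  assumes g: "lform D g" and s: "s \<in> carrier DT"
  shows "g s = (\<Sum>i\<in>B. E s i (\<lambda>a. g (bow (e i) a)))"
proof (rule DT_form_eqI[OF s])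
  show "lform DT g" using g by (simp add: lform_def linear_on_def)
  show "lform DT (\<lambda>s. \<Sum>i\<in>B. E s i (\<lambda>a. g (bow (e i) a)))" by simp
  fix f a assume f: "f \<in> carrier DA" and a: "a \<in> carrier A"
  have l: "lform A (\<lambda>x. g (bow (e i) x))" for i
    using lform_bow(1)[OF g e_mem lmap_id] .
  have "(\<Sum>i\<in>B. f i * g (bow (e i) a)) = g (bow f a)"
    using lform_bow(2)[OF g a] f by (rule lform_dual_expand)
  then show "g (bow f a) = (\<Sum>i\<in>B. E (bow f a) i (\<lambda>a. g (bow (e i) a)))"
    using f a l by simp
qed

section \<open>Comultiplication in the double\<close>

abbreviation DD :: "('k, ('k, ('k, 'a \<Rightarrow> 'k, 'a) tensor, ('k, 'a \<Rightarrow> 'k, 'a) tensor) tensor) kalg"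
  where "DD \<equiv> tensor_alg D D"

sublocale DD: two_kalgebras D D ..

sublocale DDA: kalgebra DD
  by (rule DD.kalgebra_tensor)

text \<open>
  The analogue of \<open>E\<close> for two tensor factors: the pair of maps of \<open>X\<close> is applied to \<open>y\<close>
  and \<open>z\<close>, and the form \<open>G\<close> to the two values.
\<close>

definition E2 :: "('k, ('k, 'a \<Rightarrow> 'k, 'a) tensor, ('k, 'a \<Rightarrow> 'k, 'a) tensor) tensor \<Rightarrow> 'a \<Rightarrow> 'a \<Rightarrow>
    ('a \<Rightarrow> 'a \<Rightarrow> 'k) \<Rightarrow> 'k" where
  "E2 X y z G = (\<Sum>b\<in>B. \<Sum>c\<in>B. X (\<lambda>s t. E s y (e b) * E t z (e c)) * G b c)"

lemma E2_add: "E2 (X + Y) y z G = E2 X y z G + E2 Y y z G"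
  by (simp add: E2_def sum.distrib algebra_simps)

lemma E2_zero: "E2 0 y z G = 0"
  by (simp add: E2_def)

lemma E2_scal: "E2 (fun_scal k X) y z G = k * E2 X y z G"
  by (simp add: E2_def sum_distrib_left mult.assoc)

lemma E2_sum_left: "E2 (\<Sum>i\<in>I. X i) y z G = (\<Sum>i\<in>I. E2 (X i) y z G)"
  by (induction I rule: infinite_finite_induct)
    (simp_all add: E2_add E2_zero del: plus_fun_apply zero_fun_apply)

lemma E2_cong [cong]:
  assumes "X = X'" "y = y'" "z = z'" "\<And>b c. b \<in> B \<Longrightarrow> c \<in> B \<Longrightarrow> G b c = G' b c"
  shows "E2 X y z G = E2 X' y' z' G'"
  unfolding E2_def using assms by (intro sum.cong) auto

lemma lform_E2_left [simp]: "scal C = fun_scal \<Longrightarrow> lform C (\<lambda>X. E2 X y z G)"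
  by (simp add: lform_def linear_on_def E2_add E2_scal)

lemma E2_scale: "E2 X y z (\<lambda>b c. k * F b c) = k * E2 X y z F"
  unfolding E2_def sum_distrib_left by (intro sum.cong refl) (simp add: mult_ac)

lemma lform_E2_body [simp]:
  "(\<And>b c. b \<in> B \<Longrightarrow> c \<in> B \<Longrightarrow> lform C (\<lambda>x. G x b c)) \<Longrightarrow> lform C (\<lambda>x. E2 X y z (G x))"
  by (simp add: E2_def)

lemma bform_EE: "bform D (\<lambda>s t. E s y \<phi> * E t z \<psi>)"
  by simp

lemma E_e_sum: "(\<Sum>b\<in>B. E s y (e b) * \<phi> b) = E s y \<phi>"
  unfolding E_scale'[symmetric] E_sum[symmetric] by (rule E_cong) (simp_all add: sum_delta)

lemma E2_tens [simp]:
  assumes "s \<in> carrier DT" "t \<in> carrier DT"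
  shows "E2 (tens D D s t) y z G = E s y (\<lambda>a. E t z (\<lambda>b. G a b))"
proof -
  have "E2 (tens D D s t) y z G = (\<Sum>b\<in>B. E s y (e b) * (\<Sum>c\<in>B. E t z (e c) * G b c))"
    using bform_EE unfolding bform_bilinear
    by (simp add: E2_def tens_apply mult.assoc sum_distrib_left)
  then show ?thesis by (simp add: E_e_sum)
qed

lemma lform_bform_left: "bform D G \<Longrightarrow> s \<in> carrier DT \<Longrightarrow> lform D (G s)"
  and lform_bform_right: "bform D G \<Longrightarrow> t \<in> carrier DT \<Longrightarrow> lform D (\<lambda>s. G s t)"
  by (simp_all add: bform_def)

lemma DD_form_eqI:
  assumes "X \<in> carrier DD" "lform DD F" "lform DD G"
    and "\<And>s t. s \<in> carrier DT \<Longrightarrow> t \<in> carrier DT \<Longrightarrow> F (tens D D s t) = G (tens D D s t)"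
  shows "F X = G X"
  by (rule tensor_linear_eqI[OF assms(1) D.vsp assms(2)[unfolded lform_def] assms(3)[unfolded lform_def]])
    (use assms(4) in simp)

lemma E2_expand:
  assumes X: "X \<in> carrier DD" and G: "bform D G"
  shows "X G = (\<Sum>i\<in>B. \<Sum>j\<in>B. E2 X i j (\<lambda>a c. G (bow (e i) a) (bow (e j) c)))"
proof (rule DD_form_eqI[OF X])
  show "lform DD (\<lambda>X. X G)" by (simp add: lform_def linear_on_def)
  show "lform DD (\<lambda>X. \<Sum>i\<in>B. \<Sum>j\<in>B. E2 X i j (\<lambda>a c. G (bow (e i) a) (bow (e j) c)))" by simp
  fix s t assume s: "s \<in> carrier DT" and t: "t \<in> carrier DT"
  have "G s t = (\<Sum>i\<in>B. E s i (\<lambda>a. G (bow (e i) a) t))"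
    using D_form_expand[OF lform_bform_right[OF G t] s] .
  also have "\<dots> = (\<Sum>i\<in>B. E s i (\<lambda>a. \<Sum>j\<in>B. E t j (\<lambda>c. G (bow (e i) a) (bow (e j) c))))"
    using D_form_expand[OF lform_bform_left[OF G] t] by (intro sum.cong refl E_cong) auto
  also have "\<dots> = (\<Sum>i\<in>B. \<Sum>j\<in>B. E2 (tens D D s t) i j (\<lambda>a c. G (bow (e i) a) (bow (e j) c)))"
    using s t by (simp add: E_sum)
  finally show "tens D D s t G = \<dots>" using G by (simp add: tens_apply bform_bilinear)
qed

lemma DD_eqI:
  assumes "X \<in> carrier DD" "Y \<in> carrier DD"
    and "\<And>y z G. y \<in> carrier A \<Longrightarrow> z \<in> carrier A \<Longrightarrow> bform A G \<Longrightarrow> E2 X y z G = E2 Y y z G"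
  shows "X = Y"
proof (rule tensor_eqI[OF assms(1,2)])
  fix G assume "bilinear_on D D (*) G"
  then have G: "bform D G" by (simp add: bform_bilinear)
  have "bform A (\<lambda>a c. G (bow (e i) a) (bow (e j) c))" for i j
    using lform_bow(1)[OF lform_bform_right[OF G] e_mem lmap_id]
      lform_bow(1)[OF lform_bform_left[OF G] e_mem lmap_id] by simp
  then show "X G = Y G" using assms by (simp add: E2_expand[OF _ G])
qed

text \<open>
  The dual basis gives an explicit tensor with the defining property; it is unique because
  the pairings with \<open>y \<otimes> z\<close> separate the tensors over the dual.
\<close>

lemma cop_dual_comult_eq:
  assumes f: "f \<in> carrier DA"
  shows "cop_dual_comult A f = (\<Sum>i\<in>B. \<Sum>j\<in>B. fun_scal (f (j \<otimes> i)) (tens DA DA (e i) (e j)))"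
    (is "_ = ?t")
  unfolding cop_dual_comult_def
proof (rule the_equality, intro conjI ballI)
  have bil: "bilinear_on DA DA (*) (\<lambda>f1 f2. f1 y * f2 z)" for y z
    by (simp add: bilinear_on_def flip: lform_def)
  note cl = vspace_closed(3)[OF vspace_tensor[OF vspace_DA], simplified]
  show t: "?t \<in> carrier (tensor_alg DA DA)"
    by (intro vspace_sum_closed vspace_tensor cl) auto
  fix y z assume y: "y \<in> carrier A" and z: "z \<in> carrier A"
  have "tsum DA DA ?t (\<lambda>f1 f2. f1 y * f2 z) = ?t (\<lambda>f1 f2. f1 y * f2 z)"
    using t bil by (rule tsum_field)
  also have "\<dots> = (\<Sum>i\<in>B. \<Sum>j\<in>B. f (j \<otimes> i) * (e i y * e j z))"
    using bil by (simp add: sum_fun_apply tens_apply)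
  also have "\<dots> = (\<Sum>i\<in>B. e i y * (\<Sum>j\<in>B. e j z * f (j \<otimes> i)))"
    by (simp add: sum_distrib_left mult_ac)
  also have "\<dots> = f (z \<otimes> y)"
    using y z lform_comp[OF dual_lform[OF f]] by (simp add: lform_expand)
  finally show "tsum DA DA ?t (\<lambda>f1 f2. f1 y * f2 z) = f (z \<otimes> y)" .
next
  have bil: "bilinear_on DA DA (*) (\<lambda>f1 f2. f1 y * f2 z)" for y z
    by (simp add: bilinear_on_def flip: lform_def)
  note cl = vspace_closed(3)[OF vspace_tensor[OF vspace_DA], simplified]
  have t: "?t \<in> carrier (tensor_alg DA DA)"
    by (intro vspace_sum_closed vspace_tensor cl) auto
  fix t' assume t': "t' \<in> carrier (tensor_alg DA DA) \<and> (\<forall>y\<in>carrier A. \<forall>z\<in>carrier A.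
    tsum DA DA t' (\<lambda>f1 f2. f1 y * f2 z) = f (z \<otimes> y))"
  have ex: "t' F = (\<Sum>i\<in>B. \<Sum>j\<in>B. t' (\<lambda>f1 f2. f1 i * f2 j) * F (e i) (e j))"
    if F: "bilinear_on DA DA (*) F" for F
  proof (rule tensor_linear_eqI[OF _ vspace_DA, where f = "\<lambda>t. t F" and
        g = "\<lambda>t. \<Sum>i\<in>B. \<Sum>j\<in>B. t (\<lambda>f1 f2. f1 i * f2 j) * F (e i) (e j)"])
    show "t' \<in> carrier (tensor_alg DA DA)" using t' by simp
    show "linear_on (tensor_alg DA DA) (*) (\<lambda>t. t F)" by (simp add: linear_on_def)
    show "linear_on (tensor_alg DA DA) (*)
        (\<lambda>t'. \<Sum>i\<in>B. \<Sum>j\<in>B. t' (\<lambda>f1 f2. f1 i * f2 j) * F (e i) (e j))"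
      by (simp add: linear_on_def algebra_simps sum.distrib sum_distrib_left)
    fix f1 f2 assume f1: "f1 \<in> carrier DA" and f2: "f2 \<in> carrier DA"
    have "F f1 f2 = (\<Sum>i\<in>B. f1 i * F (e i) f2)"
      using bilinear_on_left[OF F f2] f1 by (intro lform_dual_expand[symmetric]) (auto simp: lform_def)
    also have "\<dots> = (\<Sum>i\<in>B. f1 i * (\<Sum>j\<in>B. f2 j * F (e i) (e j)))"
      using bilinear_on_right[OF F e_mem] f2
      by (intro sum.cong refl arg_cong2[where f = "(*)"] lform_dual_expand[symmetric]) (auto simp: lform_def)
    finally show "tens DA DA f1 f2 F =
        (\<Sum>i\<in>B. \<Sum>j\<in>B. tens DA DA f1 f2 (\<lambda>f1 f2. f1 i * f2 j) * F (e i) (e j))"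
      using F bil by (simp add: tens_apply sum_distrib_left mult.assoc)
  qed
  show "t' = ?t"
  proof (rule tensor_eqI[OF conjunct1[OF t'] t])
    fix F :: "('a \<Rightarrow> 'k) \<Rightarrow> ('a \<Rightarrow> 'k) \<Rightarrow> 'k" assume F: "bilinear_on DA DA (*) F"
    have "t' (\<lambda>f1 f2. f1 i * f2 j) = f (j \<otimes> i)" if "i \<in> B" "j \<in> B" for i j
      using t' that tsum_field[OF conjunct1[OF t'] bil, of i j] by simp
    then show "t' F = ?t F" using ex[OF F] F by (simp add: sum_fun_apply tens_apply)
  qed
qed

lemma tens_double: "tens (double_alg A) (double_alg A) = tens D D"
  unfolding tens_def bilinear_on_def linear_on_def
  by (simp add: drinfeld_double_def double_alg_def)

definition dcom :: "('a \<Rightarrow> 'k) \<Rightarrow> 'a \<Rightarrow>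
    ('k, ('k, 'a \<Rightarrow> 'k, 'a) tensor, ('k, 'a \<Rightarrow> 'k, 'a) tensor) tensor" where
  "dcom f a = tsum DA DA (cop_dual_comult A f) (\<lambda>f1 f2. tsum A A (comult A a) (\<lambda>a1 a2.
          tens D D (bow f1 a1) (bow f2 a2)))"

lemma comult_D: "comult D t = tsum DA A t dcom"
  unfolding drinfeld_double_def dcom_def[abs_def] tens_double[symmetric, unfolded drinfeld_double_def]
  by simp

lemma cop_mem [simp]: "f \<in> carrier DA \<Longrightarrow> cop_dual_comult A f \<in> carrier (tensor_alg DA DA)"
  by (simp add: cop_dual_comult_eq)
    (intro vspace_sum_closed vspace_tensor vspace_closed(3)[OF vspace_tensor[OF vspace_DA], simplified],
      auto)

lemma dcom_apply:
  assumes f: "f \<in> carrier DA" and a: "a \<in> carrier A"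
  shows "dcom f a G = (if bform D G then
    \<Sum>i\<in>B. \<Sum>j\<in>B. f (j \<otimes> i) * sw a (\<lambda>a1 a2. G (bow (e i) a1) (bow (e j) a2)) else 0)"
proof (cases "bform D G")
  case G: True
  note [simp] = lform_bow[OF lform_bform_left[OF G]] lform_bow[OF lform_bform_right[OF G]]
  have [simp]: "lform A (\<lambda>x. G (bow f x) t)" "lform A (\<lambda>x. G t (bow f x))"
    if "f \<in> carrier DA" "t \<in> carrier DT" for f t
    using lform_bow(1)[OF lform_bform_right[OF G that(2)] that(1) lmap_id]
      lform_bow(1)[OF lform_bform_left[OF G that(2)] that(1) lmap_id] by simp_all
  let ?F = "\<lambda>f1 f2. sw a (\<lambda>a1 a2. G (bow f1 a1) (bow f2 a2))"
  have b: "bilinear_on DA DA (*) ?F"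
    by (simp add: bilinear_on_def flip: lform_def)
  have "dcom f a G = tsum DA DA (cop_dual_comult A f) ?F"
    unfolding dcom_def tsum_fun_apply
  proof (rule tsum_cong[OF cop_mem[OF f]])
    fix f1 f2 assume m: "f1 \<in> carrier DA" "f2 \<in> carrier DA"
    have "tsum A A (comult A a) (\<lambda>a1 a2. tens D D (bow f1 a1) (bow f2 a2) G) =
        tsum A A (comult A a) (\<lambda>a1 a2. G (bow f1 a1) (bow f2 a2))"
      using G by (intro tsum_cong comult_closed a) (simp add: tens_apply bform_bilinear)
    also have "\<dots> = sw a (\<lambda>a1 a2. G (bow f1 a1) (bow f2 a2))"
      using a m by (simp add: tsum_sw)
    finally show "tsum A A (comult A a) (\<lambda>a1 a2. tens D D (bow f1 a1) (bow f2 a2) G) = \<dots>" .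
  qed
  also have "\<dots> = cop_dual_comult A f ?F" by (rule tsum_field[OF cop_mem[OF f] b])
  also have "\<dots> = (\<Sum>i\<in>B. \<Sum>j\<in>B. f (j \<otimes> i) * ?F (e i) (e j))"
    using b by (simp add: cop_dual_comult_eq[OF f] sum_fun_apply tens_apply)
  finally show ?thesis using G by simp
next
  case False
  then show ?thesis unfolding dcom_def tsum_fun_apply
    by (simp add: tsum_zero tens_def bform_bilinear)
qed

lemma dcom_closed [simp]: "f \<in> carrier DA \<Longrightarrow> a \<in> carrier A \<Longrightarrow> dcom f a \<in> carrier DD"
  unfolding dcom_def by (intro tsum_closed cop_mem comult_closed vspace_tensor D.vsp) auto

lemma dcom_bilinear: "bilinear_on DA A fun_scal dcom"
proof (intro bilinear_onI linear_on_funI)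
  fix f G assume f: "f \<in> carrier DA"
  show "lform A (\<lambda>a. dcom f a G)"
    by (rule lform_congI[OF _ dcom_apply[OF f] vspace_A], assumption?, rule lform_if_zero)
      (simp add: lform_sw[of "\<lambda>x. x"])
next
  fix a G assume a: "a \<in> carrier A"
  show "lform DA (\<lambda>f. dcom f a G)"
    by (rule lform_congI[OF _ dcom_apply[OF _ a] vspace_DA], assumption?, rule lform_if_zero) simp
qed

lemma comult_D_closed [simp]: "t \<in> carrier DT \<Longrightarrow> comult D t \<in> carrier DD"
  unfolding comult_D by (intro tsum_closed vspace_tensor D.vsp) auto

lemma comult_D_bow: "f \<in> carrier DA \<Longrightarrow> a \<in> carrier A \<Longrightarrow> comult D (bow f a) = dcom f a"
  unfolding comult_D bowtie_def by (rule tsum_tens[OF _ _ dcom_bilinear vector_space_fun_scal])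

lemma comult_D_linear: "linear_on D fun_scal (comult D)"
  using linear_on_tsum[OF vspace_DA dcom_bilinear vector_space_fun_scal]
  unfolding comult_D linear_on_def by simp

text \<open>
  The coproduct of the double in terms of maps: apply \<open>t\<close> to \<open>z y\<close>, then the coproduct of
  \<open>A\<close> to the value. The order of \<open>z\<close> and \<open>y\<close> reflects the opposite coproduct on the dual.
\<close>

lemma E2_comult:
  assumes t: "t \<in> carrier DT" and y: "y \<in> carrier A" and z: "z \<in> carrier A"
  shows "E2 (comult D t) y z G = E t (z \<otimes> y) (\<lambda>a. sw a G)"
proof (rule DT_form_eqI[OF t])
  show "lform DT (\<lambda>t. E2 (comult D t) y z G)"
    using comult_D_linear by (simp add: lform_def linear_on_def E2_add E2_scal)
  show "lform DT (\<lambda>t. E t (z \<otimes> y) (\<lambda>a. sw a G))" by simp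
  fix f a assume f: "f \<in> carrier DA" and a: "a \<in> carrier A"
  have l: "lform A (\<lambda>a. sw a F)" for F using lform_sw[OF lmap_id] .
  have fe: "(\<Sum>i\<in>B. \<Sum>j\<in>B. f (j \<otimes> i) * (e i y * e j z)) = f (z \<otimes> y)"
  proof -
    have "(\<Sum>i\<in>B. \<Sum>j\<in>B. f (j \<otimes> i) * (e i y * e j z)) = (\<Sum>i\<in>B. e i y * (\<Sum>j\<in>B. e j z * f (j \<otimes> i)))"
      by (simp add: sum_distrib_left mult_ac)
    also have "\<dots> = f (z \<otimes> y)"
      using y z lform_comp[OF dual_lform[OF f]] by (simp add: lform_expand)
    finally show ?thesis .
  qed
  have d: "dcom f a (\<lambda>s t. E s y (e b) * E t z (e c)) = f (z \<otimes> y) * sw a (\<lambda>p r. e b p * e c r)" for b c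
  proof -
    have "dcom f a (\<lambda>s t. E s y (e b) * E t z (e c)) =
      (\<Sum>i\<in>B. \<Sum>j\<in>B. f (j \<otimes> i) * sw a (\<lambda>a1 a2. (e i y * e j z) * (e b a1 * e c a2)))"
      using f a by (simp add: dcom_apply bform_EE mult_ac)
    also have "\<dots> = (\<Sum>i\<in>B. \<Sum>j\<in>B. f (j \<otimes> i) * (e i y * e j z)) * sw a (\<lambda>p r. e b p * e c r)"
      by (simp add: sw_scale sum_distrib_right mult.assoc)
    finally show ?thesis using fe by simp
  qed
  have "E2 (comult D (bow f a)) y z G =
      (\<Sum>b\<in>B. \<Sum>c\<in>B. f (z \<otimes> y) * sw a (\<lambda>p r. e b p * e c r) * G b c)"
    unfolding E2_def comult_D_bow[OF f a] d ..
  also have "\<dots> = f (z \<otimes> y) * sw a (\<lambda>p r. \<Sum>b\<in>B. e b p * (\<Sum>c\<in>B. e c r * G b c))"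
    by (simp add: sum_distrib_left sw_sum mult_ac flip: sw_scale)
  also have "\<dots> = f (z \<otimes> y) * sw a G" by (simp add: sum_delta)
  finally show "E2 (comult D (bow f a)) y z G = E (bow f a) (z \<otimes> y) (\<lambda>a. sw a G)"
    using f a l by simp
qed

end

section \<open>The double is a bialgebra\<close>

context fin_hopf_bij begin

text \<open>
  The action \<open>La\<close> of \<open>a\<close> and \<open>a'\<close> on both tensor factors.
\<close>

definition La2 :: "'a \<Rightarrow> 'a \<Rightarrow> ('k, ('k, 'a \<Rightarrow> 'k, 'a) tensor, ('k, 'a \<Rightarrow> 'k, 'a) tensor) tensor \<Rightarrow>
    'a \<Rightarrow> 'a \<Rightarrow> ('a \<Rightarrow> 'a \<Rightarrow> 'k) \<Rightarrow> 'k" where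
  "La2 a a' Y y z G = sw a (\<lambda>a1 r. sw r (\<lambda>a2 a3. sw a' (\<lambda>b1 r'. sw r' (\<lambda>b2 b3.
     E2 Y (T a3 \<otimes> y \<otimes> a1) (T b3 \<otimes> z \<otimes> b1) (\<lambda>b c. G (a2 \<otimes> b) (b2 \<otimes> c))))))"

lemma E2_mult_tens:
  assumes m: "s \<in> carrier DT" "s' \<in> carrier DT" "p \<in> carrier DT" "p' \<in> carrier DT"
    and y: "y \<in> carrier A" and z: "z \<in> carrier A" and G: "bform A G"
  shows "E2 (tens D D s s' \<otimes>\<^bsub>DD\<^esub> tens D D p p') y z G =
    sw y (\<lambda>y1 y2. sw z (\<lambda>z1 z2. E s y1 (\<lambda>a. E s' z1 (\<lambda>a'. La2 a a' (tens D D p p') y2 z2 G))))"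
proof -
  note [simp] = lform_bform1[OF G] lform_bform2[OF G]
  have G1: "lform A (G b)" if "b \<in> carrier A" for b using G that by (simp add: bform_def)
  have "E2 (tens D D s s' \<otimes>\<^bsub>DD\<^esub> tens D D p p') y z G =
      E (s \<otimes>\<^bsub>D\<^esub> p) y (\<lambda>b. E (s' \<otimes>\<^bsub>D\<^esub> p') z (G b))"
    using m by (simp add: mult_D_closed)
  also have "\<dots> = sw y (\<lambda>y1 y2. E s y1 (\<lambda>a. sw a (\<lambda>a1 r. sw r (\<lambda>a2 a3.
      E p (T a3 \<otimes> y2 \<otimes> a1) (\<lambda>b. E (s' \<otimes>\<^bsub>D\<^esub> p') z (G (a2 \<otimes> b)))))))"
    using m y by (simp add: E_mult La_def)
  also have "\<dots> = sw y (\<lambda>y1 y2. E s y1 (\<lambda>a. sw a (\<lambda>a1 r. sw r (\<lambda>a2 a3.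
      E p (T a3 \<otimes> y2 \<otimes> a1) (\<lambda>b. sw z (\<lambda>z1 z2. E s' z1 (\<lambda>a'. sw a' (\<lambda>b1 r'. sw r' (\<lambda>b2 b3.
        E p' (T b3 \<otimes> z2 \<otimes> b1) (\<lambda>c. G (a2 \<otimes> b) (b2 \<otimes> c)))))))))))"
    using m z G1 by (simp add: E_mult La_def)
  also have "\<dots> = sw y (\<lambda>y1 y2. sw z (\<lambda>z1 z2. E s y1 (\<lambda>a. E s' z1 (\<lambda>a'. sw a (\<lambda>a1 r. sw r (\<lambda>a2 a3.
      E p (T a3 \<otimes> y2 \<otimes> a1) (\<lambda>b. sw a' (\<lambda>b1 r'. sw r' (\<lambda>b2 b3.
        E p' (T b3 \<otimes> z2 \<otimes> b1) (\<lambda>c. G (a2 \<otimes> b) (b2 \<otimes> c)))))))))))"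
    by (simp only: E_sw[where a = z] sw_swap[of _ z] E_E[of p _ s'])
      (simp only: E_sw[where t = s'])
  also have "\<dots> = sw y (\<lambda>y1 y2. sw z (\<lambda>z1 z2. E s y1 (\<lambda>a. E s' z1 (\<lambda>a'. La2 a a' (tens D D p p') y2 z2 G))))"
    using m unfolding La2_def by (simp add: E_sw)
  finally show ?thesis .
qed

text \<open>Products in the tensor square of the double, by linearity from pure tensors.\<close>

lemma E2_mult:
  assumes X: "X \<in> carrier DD" and Y: "Y \<in> carrier DD"
    and y: "y \<in> carrier A" and z: "z \<in> carrier A" and G: "bform A G"
  shows "E2 (X \<otimes>\<^bsub>DD\<^esub> Y) y z G =
    sw y (\<lambda>y1 y2. sw z (\<lambda>z1 z2. E2 X y1 z1 (\<lambda>a a'. La2 a a' Y y2 z2 G)))"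
proof (rule DD_form_eqI[OF X, where F = "\<lambda>X. E2 (X \<otimes>\<^bsub>DD\<^esub> Y) y z G"])
  show "lform DD (\<lambda>X. E2 (X \<otimes>\<^bsub>DD\<^esub> Y) y z G)"
    using DDA.linear_mult_left[OF Y] by (simp add: lform_def linear_on_def E2_add E2_scal)
  show "lform DD (\<lambda>X. sw y (\<lambda>y1 y2. sw z (\<lambda>z1 z2. E2 X y1 z1 (\<lambda>a a'. La2 a a' Y y2 z2 G))))"
    by simp
  fix s s' assume s: "s \<in> carrier DT" "s' \<in> carrier DT"
  then have t: "tens D D s s' \<in> carrier DD" by simp
  show "E2 (tens D D s s' \<otimes>\<^bsub>DD\<^esub> Y) y z G =
    sw y (\<lambda>y1 y2. sw z (\<lambda>z1 z2. E2 (tens D D s s') y1 z1 (\<lambda>a a'. La2 a a' Y y2 z2 G)))"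
  proof (rule DD_form_eqI[OF Y, where F = "\<lambda>Y. E2 (tens D D s s' \<otimes>\<^bsub>DD\<^esub> Y) y z G"])
    show "lform DD (\<lambda>Y. E2 (tens D D s s' \<otimes>\<^bsub>DD\<^esub> Y) y z G)"
      using DDA.linear_mult_right[OF t] by (simp add: lform_def linear_on_def E2_add E2_scal)
    show "lform DD (\<lambda>Y. sw y (\<lambda>y1 y2. sw z (\<lambda>z1 z2.
        E2 (tens D D s s') y1 z1 (\<lambda>a a'. La2 a a' Y y2 z2 G))))"
      by (simp add: La2_def)
  qed (use s y z G in \<open>simp add: E2_mult_tens del: DD.tensor_mult_tens\<close>)
qed

lemma comult_tsum:
  assumes t: "t \<in> carrier DT" and G: "bform D G"
  shows "tsum D D (comult D t) G =
    (\<Sum>i\<in>B. \<Sum>j\<in>B. E t (j \<otimes> i) (\<lambda>a. sw a (\<lambda>a1 a2. G (bow (e i) a1) (bow (e j) a2))))"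
  using t G E2_expand[OF comult_D_closed[OF t] G]
  by (simp add: tsum_field bform_bilinear E2_comult)

lemma comult_bow_tsum:
  assumes f: "f \<in> carrier DA" and a: "a \<in> carrier A" and G: "bform D G"
  shows "tsum D D (comult D (bow f a)) G =
    (\<Sum>i\<in>B. \<Sum>j\<in>B. f (j \<otimes> i) * sw a (\<lambda>a1 a2. G (bow (e i) a1) (bow (e j) a2)))"
  using f a G dcom_apply[OF f a, of G] tsum_field[OF comult_D_closed[OF bow_mem[OF f a]], of G]
  by (simp add: bform_bilinear comult_D_bow)

lemma counit_D:
  assumes t: "t \<in> carrier DT"
  shows "counit D t = E t \<one> \<epsilon>"
proof -
  have b: "bilinear_on DA A (*) (\<lambda>f a. \<epsilon> a * f \<one>)"
    by (simp add: bilinear_on_def flip: lform_def)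
  have "counit D t = t (\<lambda>f a. \<epsilon> a * f \<one>)"
    using t b by (simp add: drinfeld_double_def tsum_field)
  also have "\<dots> = (\<Sum>i\<in>B. E t i (\<lambda>a. e i \<one> * \<epsilon> a))"
    using E_expand[OF t b] by (simp add: mult.commute)
  also have "\<dots> = E t \<one> \<epsilon>"
    using lform_expand[OF lform_E_arg[OF t lmap_id]] by (simp add: E_scale)
  finally show ?thesis .
qed

lemma lform_counit_D [simp]: "lform D (counit D)"
  by (rule lform_congI[of _ "\<lambda>t. E t \<one> \<epsilon>"]) (simp_all add: counit_D)

lemma counit_D_mult:
  assumes s: "s \<in> carrier DT" and t: "t \<in> carrier DT"
  shows "counit D (s \<otimes>\<^bsub>D\<^esub> t) = counit D s * counit D t"
proof -
  have La: "La a t \<one> \<epsilon> = \<epsilon> a * E t \<one> \<epsilon>" if a: "a \<in> carrier A" for a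
  proof -
    have "La a t \<one> \<epsilon> = sw a (\<lambda>a1 a'. sw a' (\<lambda>a2 a3. \<epsilon> a2 * E t (T a3 \<otimes> a1) \<epsilon>))"
      unfolding La_def E_scale[symmetric] by (intro sw_cong[OF refl] E_cong refl) (simp_all add: counit_mult)
    also have "\<dots> = sw a (\<lambda>a1 a'. E t (T a' \<otimes> a1) \<epsilon>)"
      using t by (intro sw_cong[OF refl]) (simp add: sw_counit_left[where \<phi> = "\<lambda>x. E t (T x \<otimes> _) \<epsilon>"])
    also have "\<dots> = \<epsilon> a * E t \<one> \<epsilon>"
      using t a lform_E_arg[OF t lmap_id] by (simp add: sw_T_left[where \<phi> = "\<lambda>x. E t x \<epsilon>"])
    finally show ?thesis .
  qed
  have b: "bform A (\<lambda>y1 y2. E s y1 (\<lambda>a. La a t y2 \<epsilon>))"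
    using s t by simp
  have "counit D (s \<otimes>\<^bsub>D\<^esub> t) = E s \<one> (\<lambda>a. La a t \<one> \<epsilon>)"
    using s t b by (simp add: counit_D mult_D_closed E_mult sw_one)
  also have "\<dots> = E s \<one> \<epsilon> * E t \<one> \<epsilon>" by (simp add: La E_scale')
  finally show ?thesis using s t by (simp add: counit_D)
qed

lemma comult_D_one: "comult D \<one>\<^bsub>D\<^esub> = \<one>\<^bsub>DD\<^esub>"
proof (rule DD_eqI)
  fix y z G assume y: "y \<in> carrier A" and z: "z \<in> carrier A" and G: "bform A G"
  have l: "lform A (\<lambda>a. sw a G)" using lform_sw[OF lmap_id] .
  have G1: "lform A (G b)" "lform A (\<lambda>a. G a b)" if "b \<in> carrier A" for b
    using G that by (auto simp: bform_def)
  have "E2 (comult D \<one>\<^bsub>D\<^esub>) y z G = \<epsilon> z * \<epsilon> y * G \<one> \<one>"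
    using y z l G by (simp add: E2_comult counit_mult sw_one)
  also have "\<dots> = E2 \<one>\<^bsub>DD\<^esub> y z G"
    using y z G1 by (simp add: one_tensor)
  finally show "E2 (comult D \<one>\<^bsub>D\<^esub>) y z G = E2 \<one>\<^bsub>DD\<^esub> y z G" .
qed (simp_all add: one_tensor)

text \<open>
  When the coproduct of \<open>a\<close> acts on a coproduct, the third and fourth of the six legs of
  \<open>a\<close> meet as \<open>a\<^sub>4 S\<^sup>-\<^sup>1(a\<^sub>3)\<close> and cancel. This is why the
  coproduct of the double is multiplicative.
\<close>

lemma La2_comult:
  assumes t: "t \<in> carrier DT" and y: "y \<in> carrier A" and z: "z \<in> carrier A" and G: "bform A G"
    and a: "a \<in> carrier A"
  shows "sw a (\<lambda>p p'. La2 p p' (comult D t) y z G) = La a t (z \<otimes> y) (\<lambda>c. sw c G)"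
proof -
  note [simp] = lform_bform1[OF G] lform_bform2[OF G]
  define F where "F a1 a2 w b2 b3 = E t (T b3 \<otimes> z \<otimes> w \<otimes> y \<otimes> a1) (\<lambda>b. sw b (\<lambda>c1 c2. G (a2 \<otimes> c1) (b2 \<otimes> c2)))"
    for a1 a2 w b2 b3
  have "sw a (\<lambda>p p'. La2 p p' (comult D t) y z G) =
      sw a (\<lambda>p p'. sw p (\<lambda>a1 r. sw r (\<lambda>a2 a3. sw p' (\<lambda>b1 r'. sw r' (\<lambda>b2 b3. F a1 a2 (b1 \<otimes> T a3) b2 b3)))))"
    using t y z by (simp add: La2_def E2_comult F_def m_assoc)
  also have "\<dots> = sw a (\<lambda>a1 q. sw q (\<lambda>r p'. sw r (\<lambda>a2 a3. sw p' (\<lambda>b1 r'. sw r' (\<lambda>b2 b3. F a1 a2 (b1 \<otimes> T a3) b2 b3)))))"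
    by (rule sw_coassoc[OF a])
  also have "\<dots> = sw a (\<lambda>a1 q. sw q (\<lambda>a2 q'. sw q' (\<lambda>a3 p'. sw p' (\<lambda>b1 r'. sw r' (\<lambda>b2 b3. F a1 a2 (b1 \<otimes> T a3) b2 b3)))))"
    by (intro sw_cong[OF refl] sw_coassoc) simp
  also have "\<dots> = sw a (\<lambda>a1 q. sw q (\<lambda>a2 q'. sw q' (\<lambda>u r'. sw u (\<lambda>a3 b1. sw r' (\<lambda>b2 b3. F a1 a2 (b1 \<otimes> T a3) b2 b3)))))"
    by (intro sw_cong[OF refl] sw_coassoc[symmetric]) simp
  also have "\<dots> = sw a (\<lambda>a1 q. sw q (\<lambda>a2 q'. sw q' (\<lambda>b2 b3. F a1 a2 \<one> b2 b3)))"
  proof (rule sw_cong[OF refl], rule sw_cong[OF refl])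
    fix a1 q a2 q' assume m: "a1 \<in> B" "a2 \<in> B" "q' \<in> B"
    have l1: "lform A (\<lambda>w. sw r' (F a1 a2 w))" for r'
      unfolding F_def using t y z m by simp
    have l2: "lform A (\<lambda>r. sw r (F a1 a2 \<one>))" by (rule lform_sw) simp
    have "sw q' (\<lambda>u r'. sw u (\<lambda>a3 b1. sw r' (F a1 a2 (b1 \<otimes> T a3)))) = sw q' (\<lambda>u r'. \<epsilon> u * sw r' (F a1 a2 \<one>))"
      using l1 by (intro sw_cong[OF refl]) (simp add: sw_T_right[where \<phi> = "\<lambda>w. sw _ (F a1 a2 w)"])
    also have "\<dots> = sw q' (F a1 a2 \<one>)"
      using m l2 by (simp add: sw_counit_left)
    finally show "sw q' (\<lambda>u r'. sw u (\<lambda>a3 b1. sw r' (F a1 a2 (b1 \<otimes> T a3)))) = sw q' (F a1 a2 \<one>)" .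
  qed
  also have "\<dots> = sw a (\<lambda>a1 q. sw q (\<lambda>w b3. sw w (\<lambda>a2 b2. F a1 a2 \<one> b2 b3)))"
    by (intro sw_cong[OF refl] sw_coassoc[symmetric]) simp
  also have "\<dots> = sw a (\<lambda>a1 q. sw q (\<lambda>w b3. E t (T b3 \<otimes> (z \<otimes> y) \<otimes> a1) (\<lambda>b. sw (w \<otimes> b) G)))"
  proof (intro sw_cong[OF refl])
    fix a1 q w b3 assume m: "a1 \<in> B" "w \<in> B" "b3 \<in> B"
    have "E t (T b3 \<otimes> (z \<otimes> y) \<otimes> a1) (\<lambda>b. sw (w \<otimes> b) G) =
      E t (T b3 \<otimes> (z \<otimes> y) \<otimes> a1) (\<lambda>b. sw w (\<lambda>a2 b2. sw b (\<lambda>c1 c2. G (a2 \<otimes> c1) (b2 \<otimes> c2))))"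
      using m G by (intro E_cong refl sw_mult) auto
    then show "sw w (\<lambda>a2 b2. F a1 a2 \<one> b2 b3) = E t (T b3 \<otimes> (z \<otimes> y) \<otimes> a1) (\<lambda>b. sw (w \<otimes> b) G)"
      using m y z by (simp add: E_sw F_def m_assoc)
  qed
  finally show ?thesis by (simp add: La_def)
qed

lemma comult_D_mult:
  assumes s: "s \<in> carrier DT" and t: "t \<in> carrier DT"
  shows "comult D (s \<otimes>\<^bsub>D\<^esub> t) = comult D s \<otimes>\<^bsub>DD\<^esub> comult D t"
proof (rule DD_eqI)
  fix y z G assume y: "y \<in> carrier A" and z: "z \<in> carrier A" and G: "bform A G"
  have l: "lform A (\<lambda>a. sw a G)" using lform_sw[OF lmap_id] .
  have b: "bform A (\<lambda>w1 w2. E s w1 (\<lambda>a. La a t w2 (\<lambda>c. sw c G)))"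
    using s t by simp
  have "E2 (comult D (s \<otimes>\<^bsub>D\<^esub> t)) y z G =
      sw (z \<otimes> y) (\<lambda>w1 w2. E s w1 (\<lambda>a. La a t w2 (\<lambda>c. sw c G)))"
    using s t y z l by (simp add: E2_comult mult_D_closed E_mult)
  also have "\<dots> = sw y (\<lambda>y1 y2. sw z (\<lambda>z1 z2. E s (z1 \<otimes> y1) (\<lambda>a. La a t (z2 \<otimes> y2) (\<lambda>c. sw c G))))"
    using y z b by (simp add: sw_mult sw_swap[of z y])
  also have "\<dots> = E2 (comult D s \<otimes>\<^bsub>DD\<^esub> comult D t) y z G"
    using s t y z G by (simp add: E2_mult E2_comult La2_comult)
  finally show "E2 (comult D (s \<otimes>\<^bsub>D\<^esub> t)) y z G = E2 (comult D s \<otimes>\<^bsub>DD\<^esub> comult D t) y z G" .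
qed (use s t in \<open>simp_all add: mult_D_closed DD.tensor_mult_closed\<close>)

lemma comult_D_coassoc:
  assumes t: "t \<in> carrier DT"
  shows "tsum D D (comult D t) (\<lambda>b c. tsum D D (comult D b) (\<lambda>b1 b2. tens3 D b1 b2 c)) =
    tsum D D (comult D t) (\<lambda>b c. tsum D D (comult D c) (\<lambda>c1 c2. tens3 D b c1 c2))"
proof
  fix F
  show "tsum D D (comult D t) (\<lambda>b c. tsum D D (comult D b) (\<lambda>b1 b2. tens3 D b1 b2 c)) F =
    tsum D D (comult D t) (\<lambda>b c. tsum D D (comult D c) (\<lambda>c1 c2. tens3 D b c1 c2)) F"
  proof (cases "bilinear_on D DD (*) F")
    case F: True
    define K where "K x y z = F x (tens D D y z)" for x y z
    have t3: "tens3 D x y z F = K x y z"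
      if "x \<in> carrier DT" "y \<in> carrier DT" "z \<in> carrier DT" for x y z
      using that F by (simp add: tens3_def tens_apply K_def)
    have K1: "lform D (\<lambda>x. K x y z)" if "y \<in> carrier DT" "z \<in> carrier DT" for y z
      using bilinear_on_left[OF F, of "tens D D y z"] that by (simp add: K_def lform_def)
    have K2: "lform D (\<lambda>y. K x y z)" if "x \<in> carrier DT" "z \<in> carrier DT" for x z
      using linear_on_comp[of D DD "\<lambda>y. tens D D y z" "(*)" "F x"] that
        bilinear_on_left[OF bilinear_tens, of z D D] bilinear_on_right[OF F, of x]
      by (simp add: K_def lform_def)
    have K3: "lform D (\<lambda>z. K x y z)" if "x \<in> carrier DT" "y \<in> carrier DT" for x y
      using linear_on_comp[of D DD "\<lambda>z. tens D D y z" "(*)" "F x"] that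
        bilinear_on_right[OF bilinear_tens, of y D D] bilinear_on_right[OF F, of x]
      by (simp add: K_def lform_def)
    define K' where "K' k l j x y z = K (bow (e k) x) (bow (e l) y) (bow (e j) z)" for k l j x y z
    have inner: "tsum D D (comult D b) G = (\<Sum>i\<in>B. \<Sum>j\<in>B. E b (j \<otimes> i) (\<lambda>a. sw a (\<lambda>a1 a2. G (bow (e i) a1) (bow (e j) a2))))"
      if "b \<in> carrier DT" "bform D G" for b G using comult_tsum[OF that] .
    have lE: "lform D (\<lambda>b. \<Sum>i\<in>B. \<Sum>j\<in>B. E b (j \<otimes> i) (H i j))" for H by simp
    have L1: "lform D (\<lambda>b. tsum D D (comult D b) G)" if "bform D G" for G
      by (rule lform_congI[OF lE inner[OF _ that]]) simp_all
    have bK12: "bform D (\<lambda>b1 b2. K b1 b2 c)" if "c \<in> carrier DT" for c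
      using that by (intro bformI) (auto intro: K1 K2)
    have bK23: "bform D (\<lambda>b1 b2. K c b1 b2)" if "c \<in> carrier DT" for c
      using that by (intro bformI) (auto intro: K2 K3)
    have bo1: "bform D (\<lambda>b c. tsum D D (comult D b) (\<lambda>b1 b2. K b1 b2 c))"
    proof (rule bformI)
      show "lform D (\<lambda>c. tsum D D (comult D b) (\<lambda>b1 b2. K b1 b2 c))" if "b \<in> carrier D" for b
        unfolding lform_def using that K3
        by (intro linear_on_tsum_body[OF comult_D_closed vector_space_field]) (auto simp: lform_def)
      show "lform D (\<lambda>b. tsum D D (comult D b) (\<lambda>b1 b2. K b1 b2 c))" if "c \<in> carrier D" for c
        using L1 bK12 that by simp
    qed
    have bo2: "bform D (\<lambda>b c. tsum D D (comult D c) (\<lambda>c1 c2. K b c1 c2))"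
    proof (rule bformI)
      show "lform D (\<lambda>b. tsum D D (comult D c) (\<lambda>c1 c2. K b c1 c2))" if "c \<in> carrier D" for c
        unfolding lform_def using that K1
        by (intro linear_on_tsum_body[OF comult_D_closed vector_space_field]) (auto simp: lform_def)
      show "lform D (\<lambda>c. tsum D D (comult D c) (\<lambda>c1 c2. K b c1 c2))" if "b \<in> carrier D" for b
        using L1 bK23 that by simp
    qed
    have lsw: "lform A (\<lambda>a. sw a F)" for F using lform_sw[OF lmap_id] .
    have ex: "(\<Sum>i\<in>B. e i w * E t (j \<otimes> i) \<psi>) = E t (j \<otimes> w) \<psi>"
      "(\<Sum>i\<in>B. e i w * E t (i \<otimes> j) \<psi>) = E t (w \<otimes> j) \<psi>"
      if "w \<in> carrier A" "j \<in> B" for w j \<psi>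
      using lform_expand[OF lform_E_arg[OF t], of "\<lambda>x. j \<otimes> x" w \<psi>]
        lform_expand[OF lform_E_arg[OF t], of "\<lambda>x. x \<otimes> j" w \<psi>] that by simp_all
    have "tsum D D (comult D t) (\<lambda>b c. tsum D D (comult D b) (\<lambda>b1 b2. tens3 D b1 b2 c)) F =
        tsum D D (comult D t) (\<lambda>b c. tsum D D (comult D b) (\<lambda>b1 b2. K b1 b2 c))"
      unfolding tsum_fun_apply using t
      by (intro tsum_cong[OF comult_D_closed]) (auto simp: t3)
    also have "\<dots> = (\<Sum>i\<in>B. \<Sum>j\<in>B. E t (j \<otimes> i) (\<lambda>a. sw a (\<lambda>a1 a2.
        \<Sum>k\<in>B. \<Sum>l\<in>B. e i (l \<otimes> k) * sw a1 (\<lambda>b1 b2. K' k l j b1 b2 a2))))"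
      using t bo1 bK12 lsw by (simp add: comult_tsum K'_def)
    also have "\<dots> = (\<Sum>j\<in>B. \<Sum>k\<in>B. \<Sum>l\<in>B. \<Sum>i\<in>B. e i (l \<otimes> k) * E t (j \<otimes> i) (\<lambda>a. sw a (\<lambda>a1 a2.
        sw a1 (\<lambda>b1 b2. K' k l j b1 b2 a2))))"
    proof -
      have "(\<Sum>i\<in>B. \<Sum>j\<in>B. \<Sum>k\<in>B. \<Sum>l\<in>B. X i j k l) = (\<Sum>j\<in>B. \<Sum>k\<in>B. \<Sum>l\<in>B. \<Sum>i\<in>B. X i j k l)"
        for X :: "'a \<Rightarrow> 'a \<Rightarrow> 'a \<Rightarrow> 'a \<Rightarrow> 'k"
      proof -
        have "(\<Sum>i\<in>B. \<Sum>j\<in>B. \<Sum>k\<in>B. \<Sum>l\<in>B. X i j k l) = (\<Sum>j\<in>B. \<Sum>i\<in>B. \<Sum>k\<in>B. \<Sum>l\<in>B. X i j k l)"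
          by (rule sum.swap)
        also have "\<dots> = (\<Sum>j\<in>B. \<Sum>k\<in>B. \<Sum>i\<in>B. \<Sum>l\<in>B. X i j k l)"
          by (rule sum.cong[OF refl], rule sum.swap)
        also have "\<dots> = (\<Sum>j\<in>B. \<Sum>k\<in>B. \<Sum>l\<in>B. \<Sum>i\<in>B. X i j k l)"
          by (rule sum.cong[OF refl], rule sum.cong[OF refl], rule sum.swap)
        finally show ?thesis .
      qed
      then show ?thesis by (simp only: sw_sum sw_scale E_sum E_scale)
    qed
    also have "\<dots> = (\<Sum>j\<in>B. \<Sum>k\<in>B. \<Sum>l\<in>B. E t (j \<otimes> (l \<otimes> k)) (\<lambda>a. sw a (\<lambda>a1 a2.
        sw a1 (\<lambda>b1 b2. K' k l j b1 b2 a2))))"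
      by (simp add: ex)
    also have "\<dots> = (\<Sum>j\<in>B. \<Sum>k\<in>B. \<Sum>l\<in>B. E t (j \<otimes> l \<otimes> k) (\<lambda>a. sw a (\<lambda>a1 a2.
        sw a2 (\<lambda>b1 b2. K' k l j a1 b1 b2))))"
      by (simp add: m_assoc sw_coassoc)
    finally have 1: "tsum D D (comult D t) (\<lambda>b c. tsum D D (comult D b) (\<lambda>b1 b2. tens3 D b1 b2 c)) F = \<dots>" .
    have "tsum D D (comult D t) (\<lambda>b c. tsum D D (comult D c) (\<lambda>c1 c2. tens3 D b c1 c2)) F =
        tsum D D (comult D t) (\<lambda>b c. tsum D D (comult D c) (\<lambda>c1 c2. K b c1 c2))"
      unfolding tsum_fun_apply using t
      by (intro tsum_cong[OF comult_D_closed]) (auto simp: t3)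
    also have "\<dots> = (\<Sum>k\<in>B. \<Sum>i\<in>B. E t (i \<otimes> k) (\<lambda>a. sw a (\<lambda>a1 a2.
        \<Sum>l\<in>B. \<Sum>j\<in>B. e i (j \<otimes> l) * sw a2 (\<lambda>b1 b2. K' k l j a1 b1 b2))))"
      using t bo2 bK23 lsw by (simp add: comult_tsum K'_def)
    also have "\<dots> = (\<Sum>j\<in>B. \<Sum>k\<in>B. \<Sum>l\<in>B. \<Sum>i\<in>B. e i (j \<otimes> l) * E t (i \<otimes> k) (\<lambda>a. sw a (\<lambda>a1 a2.
        sw a2 (\<lambda>b1 b2. K' k l j a1 b1 b2))))"
    proof -
      have "(\<Sum>k\<in>B. \<Sum>i\<in>B. \<Sum>l\<in>B. \<Sum>j\<in>B. X k i l j) = (\<Sum>j\<in>B. \<Sum>k\<in>B. \<Sum>l\<in>B. \<Sum>i\<in>B. X k i l j)"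
        for X :: "'a \<Rightarrow> 'a \<Rightarrow> 'a \<Rightarrow> 'a \<Rightarrow> 'k"
      proof -
        have "(\<Sum>k\<in>B. \<Sum>i\<in>B. \<Sum>l\<in>B. \<Sum>j\<in>B. X k i l j) = (\<Sum>k\<in>B. \<Sum>l\<in>B. \<Sum>j\<in>B. \<Sum>i\<in>B. X k i l j)"
        proof (rule sum.cong[OF refl])
          fix k
          have "(\<Sum>i\<in>B. \<Sum>l\<in>B. \<Sum>j\<in>B. X k i l j) = (\<Sum>l\<in>B. \<Sum>i\<in>B. \<Sum>j\<in>B. X k i l j)"
            by (rule sum.swap)
          also have "\<dots> = (\<Sum>l\<in>B. \<Sum>j\<in>B. \<Sum>i\<in>B. X k i l j)"
            by (rule sum.cong[OF refl], rule sum.swap)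
          finally show "(\<Sum>i\<in>B. \<Sum>l\<in>B. \<Sum>j\<in>B. X k i l j) = \<dots>" .
        qed
        also have "\<dots> = (\<Sum>k\<in>B. \<Sum>j\<in>B. \<Sum>l\<in>B. \<Sum>i\<in>B. X k i l j)"
          by (rule sum.cong[OF refl], rule sum.swap)
        also have "\<dots> = (\<Sum>j\<in>B. \<Sum>k\<in>B. \<Sum>l\<in>B. \<Sum>i\<in>B. X k i l j)"
          by (rule sum.swap)
        finally show ?thesis .
      qed
      then show ?thesis by (simp only: sw_sum sw_scale E_sum E_scale)
    qed
    also have "\<dots> = (\<Sum>j\<in>B. \<Sum>k\<in>B. \<Sum>l\<in>B. E t (j \<otimes> l \<otimes> k) (\<lambda>a. sw a (\<lambda>a1 a2.
        sw a2 (\<lambda>b1 b2. K' k l j a1 b1 b2))))"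
      by (simp add: ex)
    finally show ?thesis using 1 by simp
  next
    case False
    then show ?thesis unfolding tsum_fun_apply by (simp add: tsum_zero tens3_def tens_def)
  qed
qed

lemma comult_D_counit:
  assumes t: "t \<in> carrier DT"
  shows "tsum D D (comult D t) (\<lambda>b c. scal D (counit D b) c) = t"
    and "tsum D D (comult D t) (\<lambda>b c. scal D (counit D c) b) = t"
proof -
  have cl: "fun_scal k x \<in> carrier DT" if "x \<in> carrier DT" for k x
    using vspace_closed(3)[OF vspace_DT that, of k] by simp
  have lg: "linear_on D (*) (\<lambda>t. E t y \<phi>)" for y \<phi> unfolding lform_def[symmetric] by simp
  note lt = linear_tsum[OF comult_D_closed[OF t] lg D.vsp]
  have ex2: "(\<Sum>i\<in>B. \<Sum>j\<in>B. e i y * (e j z * E t (j \<otimes> i) \<psi>)) = E t (z \<otimes> y) \<psi>"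
    if "y \<in> carrier A" "z \<in> carrier A" for y z \<psi>
    using lform_expand[OF lform_E_arg[OF t], of "\<lambda>x. x \<otimes> _"  z \<psi>]
      lform_expand[OF lform_E_arg[OF t], of "\<lambda>x. z \<otimes> x" y \<psi>] that
    by (simp flip: sum_distrib_left)
  show "tsum D D (comult D t) (\<lambda>b c. scal D (counit D b) c) = t"
  proof (rule DT_eqI)
    show "tsum D D (comult D t) (\<lambda>b c. scal D (counit D b) c) \<in> carrier DT"
      using tsum_closed[OF comult_D_closed[OF t] D.vsp, of "\<lambda>b c. scal D (counit D b) c"] cl by simp
    fix y \<phi> assume y: "y \<in> carrier A" and p: "lform A \<phi>"
    have "E (tsum D D (comult D t) (\<lambda>b c. scal D (counit D b) c)) y \<phi> =
        tsum D D (comult D t) (\<lambda>b c. counit D b * E c y \<phi>)"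
      using cl by (subst lt) (auto simp: E_scal)
    also have "\<dots> = (\<Sum>i\<in>B. \<Sum>j\<in>B. E t (j \<otimes> i) (\<lambda>a. sw a (\<lambda>a1 a2. (e i \<one> * e j y) * (\<epsilon> a1 * \<phi> a2))))"
      using t p by (simp add: comult_tsum counit_D mult_ac)
    also have "\<dots> = (\<Sum>i\<in>B. \<Sum>j\<in>B. e i \<one> * (e j y * E t (j \<otimes> i) (\<lambda>a. sw a (\<lambda>a1 a2. \<epsilon> a1 * \<phi> a2))))"
      by (simp only: sw_scale E_scale mult.assoc)
    also have "\<dots> = E t y \<phi>" using p y by (simp add: ex2 sw_counit_left)
    finally show "E (tsum D D (comult D t) (\<lambda>b c. scal D (counit D b) c)) y \<phi> = E t y \<phi>" .
  qed (rule t)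
  show "tsum D D (comult D t) (\<lambda>b c. scal D (counit D c) b) = t"
  proof (rule DT_eqI)
    show "tsum D D (comult D t) (\<lambda>b c. scal D (counit D c) b) \<in> carrier DT"
      using tsum_closed[OF comult_D_closed[OF t] D.vsp, of "\<lambda>b c. scal D (counit D c) b"] cl by simp
    fix y \<phi> assume y: "y \<in> carrier A" and p: "lform A \<phi>"
    have "E (tsum D D (comult D t) (\<lambda>b c. scal D (counit D c) b)) y \<phi> =
        tsum D D (comult D t) (\<lambda>b c. counit D c * E b y \<phi>)"
      using cl by (subst lt) (auto simp: E_scal)
    also have "\<dots> = (\<Sum>i\<in>B. \<Sum>j\<in>B. E t (j \<otimes> i) (\<lambda>a. sw a (\<lambda>a1 a2. (e i y * e j \<one>) * (\<epsilon> a2 * \<phi> a1))))"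
      using t p by (simp add: comult_tsum counit_D mult_ac)
    also have "\<dots> = (\<Sum>i\<in>B. \<Sum>j\<in>B. e i y * (e j \<one> * E t (j \<otimes> i) (\<lambda>a. sw a (\<lambda>a1 a2. \<epsilon> a2 * \<phi> a1))))"
      by (simp only: sw_scale E_scale mult.assoc)
    also have "\<dots> = E t y \<phi>" using p y by (simp add: ex2 sw_counit_right)
    finally show "E (tsum D D (comult D t) (\<lambda>b c. scal D (counit D c) b)) y \<phi> = E t y \<phi>" .
  qed (rule t)
qed

lemma bialgebra_D: "bialgebra D"
proof (intro bialgebra.intro kalgebra_D bialgebra_axioms.intro)
  show "linear_on D fun_scal (comult D)" by (rule comult_D_linear)
  show "linear_on D (*) (counit D)" using lform_counit_D by (simp add: lform_def)
qed (simp_all add: comult_D_coassoc comult_D_counit[simplified] comult_D_mult comult_D_one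
    counit_D_mult counit_D[OF one_D_closed] counit_one)

end

section \<open>The antipode of the double\<close>

context fin_hopf_bij begin

abbreviation hA :: "'a \<Rightarrow> ('k, 'a \<Rightarrow> 'k, 'a) tensor" where "hA a \<equiv> bow \<one>\<^bsub>DA\<^esub> a"
abbreviation dl :: "('a \<Rightarrow> 'k) \<Rightarrow> ('k, 'a \<Rightarrow> 'k, 'a) tensor" where "dl f \<equiv> bow f \<one>"

text \<open>
  The inverse antipode acting on functionals; it is the antipode of the dual with the
  opposite coproduct.
\<close>

definition fT :: "('a \<Rightarrow> 'k) \<Rightarrow> 'a \<Rightarrow> 'k" where
  "fT f = on_carrier A (\<lambda>y. f (T y))"

lemma fT_mem [simp]: "f \<in> carrier DA \<Longrightarrow> fT f \<in> carrier DA"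
  using lform_comp[of A f T] by (simp add: fT_def)

lemma fT_apply [simp]: "y \<in> carrier A \<Longrightarrow> fT f y = f (T y)"
  by (simp add: fT_def)

lemma fT_one [simp]: "fT \<one>\<^bsub>DA\<^esub> = \<one>\<^bsub>DA\<^esub>"
  by (rule dual_eqI) simp_all

lemma linear_fT: "linear_on DA fun_scal fT"
  by (intro linear_onI) (auto simp: fT_def on_carrier_def fun_eq_iff)

lemma lform_fT [simp]: "lform DA P \<Longrightarrow> lform DA (\<lambda>f. P (fT f))"
  using linear_on_comp[of DA DA fT "(*)" P] linear_fT by (simp add: lform_def)

lemma lform_mult_D [simp]:
  assumes "lform D g"
  shows "t \<in> carrier DT \<Longrightarrow> lform D (\<lambda>s. g (s \<otimes>\<^bsub>D\<^esub> t))"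
    and "t \<in> carrier DT \<Longrightarrow> lform D (\<lambda>s. g (t \<otimes>\<^bsub>D\<^esub> s))"
  using assms linear_on_comp[of D D "\<lambda>s. s \<otimes>\<^bsub>D\<^esub> t" "(*)" g] linear_on_comp[of D D "\<lambda>s. t \<otimes>\<^bsub>D\<^esub> s" "(*)" g]
    D.linear_mult_left[of t] D.linear_mult_right[of t]
  by (auto simp: lform_def mult_D_closed)

text \<open>
  The antipode must be antimultiplicative and restrict to \<open>S\<close> and to \<open>fT\<close> on the two
  subalgebras; this determines its value on
  \<open>f \<bowtie> a = (f \<bowtie> 1)(1 \<bowtie> a)\<close>.
\<close>

definition SDf :: "('a \<Rightarrow> 'k) \<Rightarrow> 'a \<Rightarrow> ('k, 'a \<Rightarrow> 'k, 'a) tensor" where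
  "SDf f a = hA (S a) \<otimes>\<^bsub>D\<^esub> dl (fT f)"

definition SD :: "('k, 'a \<Rightarrow> 'k, 'a) tensor \<Rightarrow> ('k, 'a \<Rightarrow> 'k, 'a) tensor" where
  "SD = restrict (\<lambda>t. tsum DA A t SDf) (carrier DT)"

lemma SDf_mem [simp]: "f \<in> carrier DA \<Longrightarrow> a \<in> carrier A \<Longrightarrow> SDf f a \<in> carrier DT"
  by (simp add: SDf_def mult_D_closed)

lemma SDf_bilinear: "bilinear_on DA A fun_scal SDf"
proof (rule bilinear_onI)
  fix f assume f: "f \<in> carrier DA"
  have "linear_on A fun_scal (\<lambda>a. hA (S a))"
    using linear_on_comp[OF S_linear, of fun_scal "bow \<one>\<^bsub>DA\<^esub>"] linear_bow_right by simp
  then show "linear_on A fun_scal (SDf f)"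
    using linear_on_comp[of A D "\<lambda>a. hA (S a)" fun_scal "\<lambda>s. s \<otimes>\<^bsub>D\<^esub> dl (fT f)"]
      D.linear_mult_left[of "dl (fT f)"] f by (simp add: SDf_def[abs_def])
next
  fix a assume a: "a \<in> carrier A"
  have "linear_on DA fun_scal (\<lambda>f. dl (fT f))"
    using linear_on_comp[of DA DA fT fun_scal "\<lambda>f. dl f"] linear_bow_left linear_fT by simp
  then show "linear_on DA fun_scal (\<lambda>f. SDf f a)"
    using linear_on_comp[of DA D "\<lambda>f. dl (fT f)" fun_scal "\<lambda>s. hA (S a) \<otimes>\<^bsub>D\<^esub> s"]
      D.linear_mult_right[of "hA (S a)"] a by (simp add: SDf_def[abs_def])
qed

lemma SD_bow: "f \<in> carrier DA \<Longrightarrow> a \<in> carrier A \<Longrightarrow> SD (bow f a) = SDf f a"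
  using tsum_tens[OF _ _ SDf_bilinear vector_space_fun_scal, of f a] bow_mem[of f a]
  by (simp add: SD_def bowtie_def)

lemma SD_closed [simp]: "t \<in> carrier DT \<Longrightarrow> SD t \<in> carrier DT"
  unfolding SD_def by (auto intro!: tsum_closed)

lemma SD_linear: "linear_on D fun_scal SD"
proof -
  have "linear_on DT fun_scal (\<lambda>t. tsum DA A t SDf)"
    by (rule linear_on_tsum[OF vspace_DA SDf_bilinear vector_space_fun_scal])
  then show ?thesis
    using vspace_closed[OF vspace_DT] unfolding linear_on_def SD_def by (simp del: plus_fun_apply)
qed

lemma lform_SD [simp]: "lform D g \<Longrightarrow> lform D (\<lambda>t. g (SD t))"
  using linear_on_comp[of D D SD "(*)" g] SD_linear by (simp add: lform_def)

text \<open>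
  The antipode laws of the dual with the opposite coproduct, transposed from the laws of
  the inverse antipode.
\<close>

lemma dual_antipode_sum:
  assumes f: "f \<in> carrier DA" and P: "lform DA P"
  shows "(\<Sum>i\<in>B. \<Sum>j\<in>B. f (j \<otimes> i) * P (fT (e i) \<otimes>\<^bsub>DA\<^esub> e j)) = f \<one> * P \<one>\<^bsub>DA\<^esub>"
    and "(\<Sum>i\<in>B. \<Sum>j\<in>B. f (j \<otimes> i) * P (e i \<otimes>\<^bsub>DA\<^esub> fT (e j))) = f \<one> * P \<one>\<^bsub>DA\<^esub>"
proof -
  have lf: "lform A (\<lambda>x. f (x \<otimes> c))" "lform A (\<lambda>x. f (c \<otimes> x))" if "c \<in> carrier A" for c
    using that lform_comp[OF dual_lform[OF f]] by simp_all
  have ex: "(\<Sum>i\<in>B. \<Sum>j\<in>B. f (j \<otimes> i) * (e i y * e j z)) = f (z \<otimes> y)"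
    if "y \<in> carrier A" "z \<in> carrier A" for y z
  proof -
    have "(\<Sum>i\<in>B. \<Sum>j\<in>B. f (j \<otimes> i) * (e i y * e j z)) = (\<Sum>i\<in>B. e i y * (\<Sum>j\<in>B. e j z * f (j \<otimes> i)))"
      by (simp add: sum_distrib_left mult_ac)
    also have "\<dots> = f (z \<otimes> y)"
      using that lf by (simp add: lform_expand)
    finally show ?thesis .
  qed
  have rearr: "(\<Sum>i\<in>B. \<Sum>j\<in>B. f (j \<otimes> i) * (\<Sum>k\<in>B. sw k (\<lambda>x y. H i j x y) * P (e k))) =
      (\<Sum>k\<in>B. sw k (\<lambda>x y. \<Sum>i\<in>B. \<Sum>j\<in>B. f (j \<otimes> i) * H i j x y) * P (e k))" for H
  proof -
    have "(\<Sum>i\<in>B. \<Sum>j\<in>B. f (j \<otimes> i) * (\<Sum>k\<in>B. sw k (\<lambda>x y. H i j x y) * P (e k))) =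
      (\<Sum>i\<in>B. \<Sum>j\<in>B. \<Sum>k\<in>B. sw k (\<lambda>x y. f (j \<otimes> i) * H i j x y) * P (e k))"
      by (simp add: sum_distrib_left sw_scale mult.assoc)
    also have "\<dots> = (\<Sum>i\<in>B. \<Sum>k\<in>B. \<Sum>j\<in>B. sw k (\<lambda>x y. f (j \<otimes> i) * H i j x y) * P (e k))"
      by (rule sum.cong[OF refl], rule sum.swap)
    also have "\<dots> = (\<Sum>k\<in>B. \<Sum>i\<in>B. \<Sum>j\<in>B. sw k (\<lambda>x y. f (j \<otimes> i) * H i j x y) * P (e k))"
      by (rule sum.swap)
    finally show ?thesis by (simp only: sw_sum sum_distrib_right)
  qed
  have "(\<Sum>i\<in>B. \<Sum>j\<in>B. f (j \<otimes> i) * P (fT (e i) \<otimes>\<^bsub>DA\<^esub> e j)) =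
      (\<Sum>i\<in>B. \<Sum>j\<in>B. f (j \<otimes> i) * (\<Sum>k\<in>B. sw k (\<lambda>x y. e i (T x) * e j y) * P (e k)))"
    using lform_dual_expand[OF P dual.m_closed[OF fT_mem[OF e_mem] e_mem]] by (simp cong: sum.cong)
  also have "\<dots> = (\<Sum>k\<in>B. sw k (\<lambda>x y. f (y \<otimes> T x)) * P (e k))"
    unfolding rearr by (simp add: ex)
  also have "\<dots> = (\<Sum>k\<in>B. \<one>\<^bsub>DA\<^esub> k * (f \<one> * P (e k)))"
    using f by (simp add: sw_T_right mult_ac)
  also have "\<dots> = f \<one> * P \<one>\<^bsub>DA\<^esub>" using P by (intro lform_dual_expand) simp_all
  finally show "(\<Sum>i\<in>B. \<Sum>j\<in>B. f (j \<otimes> i) * P (fT (e i) \<otimes>\<^bsub>DA\<^esub> e j)) = f \<one> * P \<one>\<^bsub>DA\<^esub>" .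
  have "(\<Sum>i\<in>B. \<Sum>j\<in>B. f (j \<otimes> i) * P (e i \<otimes>\<^bsub>DA\<^esub> fT (e j))) =
      (\<Sum>i\<in>B. \<Sum>j\<in>B. f (j \<otimes> i) * (\<Sum>k\<in>B. sw k (\<lambda>x y. e i x * e j (T y)) * P (e k)))"
    using lform_dual_expand[OF P dual.m_closed[OF e_mem fT_mem[OF e_mem]]] by (simp cong: sum.cong)
  also have "\<dots> = (\<Sum>k\<in>B. sw k (\<lambda>x y. f (T y \<otimes> x)) * P (e k))"
    unfolding rearr by (simp add: ex)
  also have "\<dots> = (\<Sum>k\<in>B. \<one>\<^bsub>DA\<^esub> k * (f \<one> * P (e k)))"
    using f by (simp add: sw_T_left mult_ac)
  also have "\<dots> = f \<one> * P \<one>\<^bsub>DA\<^esub>" using P by (intro lform_dual_expand) simp_all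
  finally show "(\<Sum>i\<in>B. \<Sum>j\<in>B. f (j \<otimes> i) * P (e i \<otimes>\<^bsub>DA\<^esub> fT (e j))) = f \<one> * P \<one>\<^bsub>DA\<^esub>" .
qed

lemma counit_D_bow: "f \<in> carrier DA \<Longrightarrow> a \<in> carrier A \<Longrightarrow> counit D (bow f a) = f \<one> * \<epsilon> a"
  by (simp add: counit_D)

text \<open>
  On a pure tensor the inner pair cancels by the antipode law of one subalgebra, and then
  the outer pair by the law of the other.
\<close>

lemma SD_law:
  assumes t: "t \<in> carrier DT" and g: "lform D g"
  shows "tsum D D (comult D t) (\<lambda>b c. g (SD b \<otimes>\<^bsub>D\<^esub> c)) = counit D t * g \<one>\<^bsub>D\<^esub>"
    and "tsum D D (comult D t) (\<lambda>b c. g (b \<otimes>\<^bsub>D\<^esub> SD c)) = counit D t * g \<one>\<^bsub>D\<^esub>"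
proof -
  have b1: "bform D (\<lambda>b c. g (SD b \<otimes>\<^bsub>D\<^esub> c))"
    by (rule bformI) (auto intro: lform_SD[OF lform_mult_D(1)[OF g]] lform_mult_D(2)[OF g SD_closed])
  have b2: "bform D (\<lambda>b c. g (b \<otimes>\<^bsub>D\<^esub> SD c))"
    by (rule bformI) (auto intro: lform_SD[OF lform_mult_D(2)[OF g]] lform_mult_D(1)[OF g SD_closed])
  have lc: "lform DT (\<lambda>t. tsum D D (comult D t) G)" if "bform D G" for G
  proof -
    have "lform DT (\<lambda>t. \<Sum>i\<in>B. \<Sum>j\<in>B. E t (j \<otimes> i) (\<lambda>a. sw a (\<lambda>a1 a2. G (bow (e i) a1) (bow (e j) a2))))"
      by simp
    then show ?thesis by (rule lform_congI) (use that in \<open>simp_all add: comult_tsum\<close>)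
  qed
  have lr: "lform DT (\<lambda>t. counit D t * g \<one>\<^bsub>D\<^esub>)"
    using lform_counit_D by (simp add: lform_def linear_on_def algebra_simps)
  show "tsum D D (comult D t) (\<lambda>b c. g (SD b \<otimes>\<^bsub>D\<^esub> c)) = counit D t * g \<one>\<^bsub>D\<^esub>"
  proof (rule DT_form_eqI[OF t lc[OF b1] lr])
    fix f a assume f: "f \<in> carrier DA" and a: "a \<in> carrier A"
    have K: "g (SD (bow (e i) a1) \<otimes>\<^bsub>D\<^esub> bow (e j) a2) = g (hA (S a1) \<otimes>\<^bsub>D\<^esub> (dl (fT (e i) \<otimes>\<^bsub>DA\<^esub> e j) \<otimes>\<^bsub>D\<^esub> hA a2))"
      if "a1 \<in> carrier A" "a2 \<in> carrier A" for i j a1 a2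
    proof -
      have "SD (bow (e i) a1) \<otimes>\<^bsub>D\<^esub> bow (e j) a2 = (hA (S a1) \<otimes>\<^bsub>D\<^esub> dl (fT (e i))) \<otimes>\<^bsub>D\<^esub> (dl (e j) \<otimes>\<^bsub>D\<^esub> hA a2)"
        using that by (simp add: SD_bow SDf_def bow_split)
      also have "\<dots> = hA (S a1) \<otimes>\<^bsub>D\<^esub> (dl (fT (e i) \<otimes>\<^bsub>DA\<^esub> e j) \<otimes>\<^bsub>D\<^esub> hA a2)"
        using that by (simp add: mult_D_closed D_assoc flip: dual_embed_mult)
      finally show ?thesis by simp
    qed
    have "tsum D D (comult D (bow f a)) (\<lambda>b c. g (SD b \<otimes>\<^bsub>D\<^esub> c)) =
      (\<Sum>i\<in>B. \<Sum>j\<in>B. f (j \<otimes> i) * sw a (\<lambda>a1 a2. g (hA (S a1) \<otimes>\<^bsub>D\<^esub> (dl (fT (e i) \<otimes>\<^bsub>DA\<^esub> e j) \<otimes>\<^bsub>D\<^esub> hA a2))))"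
      using f a b1 by (simp add: comult_bow_tsum K)
    also have "\<dots> = sw a (\<lambda>a1 a2. \<Sum>i\<in>B. \<Sum>j\<in>B. f (j \<otimes> i) *
        g (hA (S a1) \<otimes>\<^bsub>D\<^esub> (dl (fT (e i) \<otimes>\<^bsub>DA\<^esub> e j) \<otimes>\<^bsub>D\<^esub> hA a2)))"
      by (simp only: sw_sum sw_scale)
    also have "\<dots> = sw a (\<lambda>a1 a2. f \<one> * g (hA (S a1) \<otimes>\<^bsub>D\<^esub> (dl \<one>\<^bsub>DA\<^esub> \<otimes>\<^bsub>D\<^esub> hA a2)))"
    proof (rule sw_cong[OF refl])
      fix a1 a2 assume m: "a1 \<in> B" "a2 \<in> B"
      have "lform D (\<lambda>s. g (hA (S a1) \<otimes>\<^bsub>D\<^esub> (s \<otimes>\<^bsub>D\<^esub> hA a2)))"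
        using lform_mult_D(1)[OF lform_mult_D(2)[OF g]] m by simp
      then have "lform DA (\<lambda>p. g (hA (S a1) \<otimes>\<^bsub>D\<^esub> (dl p \<otimes>\<^bsub>D\<^esub> hA a2)))"
        by (rule lform_bow(2)) simp
      then show "(\<Sum>i\<in>B. \<Sum>j\<in>B. f (j \<otimes> i) *
          g (hA (S a1) \<otimes>\<^bsub>D\<^esub> (dl (fT (e i) \<otimes>\<^bsub>DA\<^esub> e j) \<otimes>\<^bsub>D\<^esub> hA a2))) =
        f \<one> * g (hA (S a1) \<otimes>\<^bsub>D\<^esub> (dl \<one>\<^bsub>DA\<^esub> \<otimes>\<^bsub>D\<^esub> hA a2))"
        by (rule dual_antipode_sum(1)[OF f])
    qed
    also have "\<dots> = f \<one> * sw a (\<lambda>a1 a2. g (hA (S a1 \<otimes> a2)))"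
      by (simp add: sw_scale bow_split hA_mult)
    also have "\<dots> = counit D (bow f a) * g \<one>\<^bsub>D\<^esub>"
      using f a lform_bow(1)[OF g _ lmap_id] by (simp add: sw_S_left[where \<phi> = "\<lambda>x. g (hA x)"] counit_D_bow one_D)
    finally show "tsum D D (comult D (bow f a)) (\<lambda>b c. g (SD b \<otimes>\<^bsub>D\<^esub> c)) = counit D (bow f a) * g \<one>\<^bsub>D\<^esub>" .
  qed
  show "tsum D D (comult D t) (\<lambda>b c. g (b \<otimes>\<^bsub>D\<^esub> SD c)) = counit D t * g \<one>\<^bsub>D\<^esub>"
  proof (rule DT_form_eqI[OF t lc[OF b2] lr])
    fix f a assume f: "f \<in> carrier DA" and a: "a \<in> carrier A"
    have K: "g (bow (e i) a1 \<otimes>\<^bsub>D\<^esub> SD (bow (e j) a2)) = g (dl (e i) \<otimes>\<^bsub>D\<^esub> (hA (a1 \<otimes> S a2) \<otimes>\<^bsub>D\<^esub> dl (fT (e j))))"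
      if "a1 \<in> carrier A" "a2 \<in> carrier A" for i j a1 a2
    proof -
      have "bow (e i) a1 \<otimes>\<^bsub>D\<^esub> SD (bow (e j) a2) = (dl (e i) \<otimes>\<^bsub>D\<^esub> hA a1) \<otimes>\<^bsub>D\<^esub> (hA (S a2) \<otimes>\<^bsub>D\<^esub> dl (fT (e j)))"
        using that by (simp add: SD_bow SDf_def bow_split)
      also have "\<dots> = dl (e i) \<otimes>\<^bsub>D\<^esub> (hA (a1 \<otimes> S a2) \<otimes>\<^bsub>D\<^esub> dl (fT (e j)))"
        using that by (simp add: mult_D_closed D_assoc flip: hA_mult)
      finally show ?thesis by simp
    qed
    have "tsum D D (comult D (bow f a)) (\<lambda>b c. g (b \<otimes>\<^bsub>D\<^esub> SD c)) =
      (\<Sum>i\<in>B. \<Sum>j\<in>B. f (j \<otimes> i) * sw a (\<lambda>a1 a2. g (dl (e i) \<otimes>\<^bsub>D\<^esub> (hA (a1 \<otimes> S a2) \<otimes>\<^bsub>D\<^esub> dl (fT (e j))))))"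
      using f a b2 by (simp add: comult_bow_tsum K)
    also have "\<dots> = (\<Sum>i\<in>B. \<Sum>j\<in>B. f (j \<otimes> i) * (\<epsilon> a * g (dl (e i \<otimes>\<^bsub>DA\<^esub> fT (e j)))))"
    proof (intro sum.cong refl)
      fix i j
      have "lform D (\<lambda>s. g (dl (e i) \<otimes>\<^bsub>D\<^esub> (s \<otimes>\<^bsub>D\<^esub> dl (fT (e j)))))"
        using lform_mult_D(1)[OF lform_mult_D(2)[OF g]] by simp
      then have "lform A (\<lambda>x. g (dl (e i) \<otimes>\<^bsub>D\<^esub> (hA x \<otimes>\<^bsub>D\<^esub> dl (fT (e j)))))"
        by (rule lform_bow(1)) simp_all
      then show "f (j \<otimes> i) * sw a (\<lambda>a1 a2. g (dl (e i) \<otimes>\<^bsub>D\<^esub> (hA (a1 \<otimes> S a2) \<otimes>\<^bsub>D\<^esub> dl (fT (e j))))) =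
        f (j \<otimes> i) * (\<epsilon> a * g (dl (e i \<otimes>\<^bsub>DA\<^esub> fT (e j))))"
        using a by (simp add: sw_S_right[where \<phi> = "\<lambda>x. g (dl (e i) \<otimes>\<^bsub>D\<^esub> (hA x \<otimes>\<^bsub>D\<^esub> dl (fT (e j))))"]
            mult_one_D dual_embed_mult flip: one_D)
    qed
    also have "\<dots> = f \<one> * (\<epsilon> a * g (dl \<one>\<^bsub>DA\<^esub>))"
      using lform_bow(2)[OF g, of \<one>] by (intro dual_antipode_sum(2)[OF f]) simp
    also have "\<dots> = counit D (bow f a) * g \<one>\<^bsub>D\<^esub>"
      using f a by (simp add: counit_D_bow one_D)
    finally show "tsum D D (comult D (bow f a)) (\<lambda>b c. g (b \<otimes>\<^bsub>D\<^esub> SD c)) = counit D (bow f a) * g \<one>\<^bsub>D\<^esub>" .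
  qed
qed

lemma is_antipode_SD: "is_antipode D SD"
  unfolding is_antipode_def
proof (intro conjI ballI)
  show "SD \<in> carrier D \<rightarrow>\<^sub>E carrier D" by (auto simp: SD_def intro!: tsum_closed)
  show "linear_on D (scal D) SD" using SD_linear by simp
  fix t assume "t \<in> carrier D"
  then have t: "t \<in> carrier DT" by simp
  have lg: "linear_on D (*) (\<lambda>t. E t y \<phi>)" for y \<phi> unfolding lform_def[symmetric] by simp
  have cl: "fun_scal k \<one>\<^bsub>D\<^esub> \<in> carrier DT" for k
    using vspace_closed(3)[OF vspace_DT one_D_closed] by simp
  show "tsum D D (comult D t) (\<lambda>b c. SD b \<otimes>\<^bsub>D\<^esub> c) = scal D (counit D t) \<one>\<^bsub>D\<^esub>"
  proof (rule DT_eqI)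
    show "tsum D D (comult D t) (\<lambda>b c. SD b \<otimes>\<^bsub>D\<^esub> c) \<in> carrier DT"
      using tsum_closed[OF comult_D_closed[OF t] D.vsp, of "\<lambda>b c. SD b \<otimes>\<^bsub>D\<^esub> c"] by (simp add: mult_D_closed)
    fix y \<phi>
    show "E (tsum D D (comult D t) (\<lambda>b c. SD b \<otimes>\<^bsub>D\<^esub> c)) y \<phi> = E (scal D (counit D t) \<one>\<^bsub>D\<^esub>) y \<phi>"
      using SD_law(1)[OF t, of "\<lambda>t. E t y \<phi>"]
      by (subst linear_tsum[OF comult_D_closed[OF t] lg D.vsp]) (simp_all add: mult_D_closed E_scal)
  qed (simp add: cl)
  show "tsum D D (comult D t) (\<lambda>b c. b \<otimes>\<^bsub>D\<^esub> SD c) = scal D (counit D t) \<one>\<^bsub>D\<^esub>"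
  proof (rule DT_eqI)
    show "tsum D D (comult D t) (\<lambda>b c. b \<otimes>\<^bsub>D\<^esub> SD c) \<in> carrier DT"
      using tsum_closed[OF comult_D_closed[OF t] D.vsp, of "\<lambda>b c. b \<otimes>\<^bsub>D\<^esub> SD c"] by (simp add: mult_D_closed)
    fix y \<phi>
    show "E (tsum D D (comult D t) (\<lambda>b c. b \<otimes>\<^bsub>D\<^esub> SD c)) y \<phi> = E (scal D (counit D t) \<one>\<^bsub>D\<^esub>) y \<phi>"
      using SD_law(2)[OF t, of "\<lambda>t. E t y \<phi>"]
      by (subst linear_tsum[OF comult_D_closed[OF t] lg D.vsp]) (simp_all add: mult_D_closed E_scal)
  qed (simp add: cl)
qed

lemma hopf_algebra_D: "hopf_algebra D"
  by (intro hopf_algebra.intro bialgebra_D hopf_algebra_axioms.intro exI[of _ SD] is_antipode_SD)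

text \<open>
  The double is again finite-dimensional, so that the uniqueness of the antipode applies
  to it.
\<close>

lemma fin_hopf_D: "\<exists>BD. fin_hopf D BD"
proof -
  interpret V: vector_space "fun_scal :: 'k \<Rightarrow> ('k, 'a \<Rightarrow> 'k, 'a) tensor \<Rightarrow> _"
    by (rule vector_space_fun_scal)
  let ?W = "(\<lambda>(b, c). bow (e b) c) ` (B \<times> B)"
  have sub: "V.subspace (carrier DT)" using vspace_DT by (simp add: vspace_def)
  have "carrier DT \<subseteq> V.span ?W"
  proof
    fix t assume t: "t \<in> carrier DT"
    have "t = (\<Sum>b\<in>B. \<Sum>c\<in>B. fun_scal (E t b (e c)) (bow (e b) c))"
    proof (rule DT_eqI[OF t])
      show "(\<Sum>b\<in>B. \<Sum>c\<in>B. fun_scal (E t b (e c)) (bow (e b) c)) \<in> carrier DT"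
        by (intro V.subspace_sum sub V.subspace_scale) auto
      fix y \<phi> assume y: "y \<in> carrier A" and p: "lform A \<phi>"
      have "E t y \<phi> = (\<Sum>b\<in>B. e b y * (\<Sum>c\<in>B. E t b (e c) * \<phi> c))"
        using lform_expand[OF lform_E_arg[OF t lmap_id] y] by (simp add: E_e_sum)
      then show "E t y \<phi> = E (\<Sum>b\<in>B. \<Sum>c\<in>B. fun_scal (E t b (e c)) (bow (e b) c)) y \<phi>"
        using p by (simp add: E_sum_left E_scal sum_distrib_left mult_ac)
    qed
    also have "\<dots> \<in> V.span ?W"
      by (intro V.span_sum V.span_scale V.span_base) auto
    finally show "t \<in> V.span ?W" .
  qed
  moreover have "?W \<subseteq> carrier DT" by auto
  ultimately have W: "V.span ?W = carrier DT"
    using V.span_minimal[OF _ sub] by blast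
  obtain BD where BD: "BD \<subseteq> ?W" "V.independent BD" "?W \<subseteq> V.span BD"
    using V.maximal_independent_subset[of ?W] by blast
  have "V.span BD = carrier DT"
    using W BD V.span_mono[OF BD(1)] V.span_minimal[OF BD(3) V.subspace_span] by auto
  then have "is_basis D BD" using BD(2) by (simp add: is_basis_def)
  moreover have "finite BD" using BD(1) by (rule finite_subset) simp
  ultimately show ?thesis
    by (auto intro!: exI[of _ BD] fin_hopf.intro hopf_algebra_D fin_hopf_axioms.intro)
qed

lemma antipode_D: "antipode D = SD"
proof -
  obtain BD where "fin_hopf D BD" using fin_hopf_D by blast
  then show ?thesis using is_antipode_SD by (rule fin_hopf.antipode_eqI)
qed

lemma SD_hA: "a \<in> carrier A \<Longrightarrow> SD (hA a) = hA (S a)"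
  by (simp add: SD_bow SDf_def one_mult_D flip: one_D)

lemma SD_dl: "f \<in> carrier DA \<Longrightarrow> SD (dl f) = dl (fT f)"
  by (simp add: SD_bow SDf_def mult_one_D flip: one_D)

end

section \<open>The universal R-matrix\<close>

context fin_hopf_bij begin

text \<open>
  The canonical tensor in the basis \<open>B\<close>; it is independent of the basis, see
  \<open>double_R_eq\<close>.
\<close>

definition RR :: "('k, ('k, 'a \<Rightarrow> 'k, 'a) tensor, ('k, 'a \<Rightarrow> 'k, 'a) tensor) tensor" where
  "RR = (\<Sum>b\<in>B. tens D D (hA b) (dl (e b)))"

lemma RR_closed [simp]: "RR \<in> carrier DD"
  unfolding RR_def by (intro vspace_sum_closed vspace_tensor D.vsp) simp

lemma tsum_RR:
  assumes "bilinear_on D D s F" "vector_space s"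
  shows "tsum D D RR F = (\<Sum>b\<in>B. F (hA b) (dl (e b)))"
proof -
  have "tsum D D RR F = (\<Sum>b\<in>B. tsum D D (tens D D (hA b) (dl (e b))) F)"
    unfolding RR_def
    by (rule linear_on_sum[OF linear_on_tsum[OF D.vsp assms]]) (simp_all add: vspace_tensor D.vsp)
  also have "\<dots> = (\<Sum>b\<in>B. F (hA b) (dl (e b)))"
    using assms by (intro sum.cong refl tsum_tens[OF _ _ assms]) simp_all
  finally show ?thesis .
qed

lemma RR_apply: "bform D G \<Longrightarrow> RR G = (\<Sum>b\<in>B. G (hA b) (dl (e b)))"
  unfolding RR_def by (simp add: sum_fun_apply tens_apply bform_bilinear)

lemma lform_E2_arg1 [simp]:
  assumes X: "X \<in> carrier DD" and h: "lmap A h"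
  shows "lform A (\<lambda>y. E2 X (h y) z G)"
proof -
  have "lform A (\<lambda>y. X (\<lambda>s t. E s y (e b) * E t z (e c)))" for b c
  proof -
    have "lform A (\<lambda>y. tsum D D X (\<lambda>s t. E s y (e b) * E t z (e c)))"
      unfolding lform_def using X lform_E_arg[OF _ lmap_id]
      by (intro linear_on_tsum_body vector_space_field) (auto simp flip: lform_def)
    then show ?thesis using tsum_field[OF X] bform_EE by (simp add: bform_bilinear)
  qed
  then have "lform A (\<lambda>y. E2 X y z G)" by (simp add: E2_def)
  then show ?thesis using h by (rule lform_comp)
qed

lemma lform_E2_arg2 [simp]:
  assumes X: "X \<in> carrier DD" and h: "lmap A h"
  shows "lform A (\<lambda>z. E2 X y (h z) G)"
proof -
  have "lform A (\<lambda>z. X (\<lambda>s t. E s y (e b) * E t z (e c)))" for b c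
  proof -
    have "lform A (\<lambda>z. tsum D D X (\<lambda>s t. E s y (e b) * E t z (e c)))"
      unfolding lform_def using X lform_E_arg[OF _ lmap_id]
      by (intro linear_on_tsum_body vector_space_field) (auto simp flip: lform_def)
    then show ?thesis using tsum_field[OF X] bform_EE by (simp add: bform_bilinear)
  qed
  then have "lform A (\<lambda>z. E2 X y z G)" by (simp add: E2_def)
  then show ?thesis using h by (rule lform_comp)
qed

lemma lform_La2 [simp]:
  shows "lmap A h \<Longrightarrow> lform A (\<lambda>x. La2 (h x) a Y y z G)"
    and "lmap A h \<Longrightarrow> lform A (\<lambda>x. La2 a (h x) Y y z G)"
    and "Y \<in> carrier DD \<Longrightarrow> lmap A h \<Longrightarrow> lform A (\<lambda>x. La2 a a' Y (h x) z G)"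
    and "Y \<in> carrier DD \<Longrightarrow> lmap A h \<Longrightarrow> lform A (\<lambda>x. La2 a a' Y y (h x) G)"
  by (simp_all add: La2_def)

lemma E2_RR:
  assumes y: "y \<in> carrier A" and z: "z \<in> carrier A" and G: "bform A G"
  shows "E2 RR y z G = \<epsilon> y * G z \<one>"
proof -
  have G1: "lform A (G b)" "lform A (\<lambda>a. G a b)" if "b \<in> carrier A" for b
    using G that by (auto simp: bform_def)
  have "E2 RR y z G = (\<Sum>b\<in>B. \<epsilon> y * (e b z * G b \<one>))"
    unfolding RR_def E2_sum_left using y z G1 by simp
  also have "\<dots> = \<epsilon> y * G z \<one>"
    using z G1 by (simp add: lform_expand[of "\<lambda>b. G b \<one>"] flip: sum_distrib_left)
  finally show ?thesis .
qed

lemma E2_R_mult: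
  assumes Y: "Y \<in> carrier DD" and y: "y \<in> carrier A" and z: "z \<in> carrier A" and G: "bform A G"
  shows "E2 (RR \<otimes>\<^bsub>DD\<^esub> Y) y z G = sw z (\<lambda>z1 z2. sw z1 (\<lambda>b1 r. sw r (\<lambda>b2 b3.
    E2 Y (T b3 \<otimes> y \<otimes> b1) z2 (\<lambda>c d. G (b2 \<otimes> c) d))))"
proof -
  note [simp] = lform_bform1[OF G] lform_bform2[OF G]
  have "E2 (RR \<otimes>\<^bsub>DD\<^esub> Y) y z G =
      sw y (\<lambda>y1 y2. sw z (\<lambda>z1 z2. \<epsilon> y1 * La2 z1 \<one> Y y2 z2 G))"
    using Y y z G lform_La2(1,2)[OF lmap_id] by (simp add: E2_mult E2_RR)
  also have "\<dots> = sw z (\<lambda>z1 z2. La2 z1 \<one> Y y z2 G)"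
    using Y y lform_La2(3)[OF Y lmap_id] by (simp add: sw_swap[of y] sw_counit_left)
  also have "\<dots> = sw z (\<lambda>z1 z2. sw z1 (\<lambda>b1 r. sw r (\<lambda>b2 b3.
    E2 Y (T b3 \<otimes> y \<otimes> b1) z2 (\<lambda>c d. G (b2 \<otimes> c) d))))"
  proof (intro sw_cong[OF refl])
    fix z1 z2 assume m: "z1 \<in> B" "z2 \<in> B"
    have "sw \<one> (\<lambda>c1 r'. sw r' (\<lambda>c2 c3. E2 Y (T b3 \<otimes> y \<otimes> b1) (T c3 \<otimes> z2 \<otimes> c1) (\<lambda>b c. G (b2 \<otimes> b) (c2 \<otimes> c)))) =
      E2 Y (T b3 \<otimes> y \<otimes> b1) z2 (\<lambda>c d. G (b2 \<otimes> c) d)" if "b1 \<in> B" "b2 \<in> B" "b3 \<in> B" for b1 b2 b3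
      using m Y y that by (simp add: sw_one)
    then show "La2 z1 \<one> Y y z2 G = sw z1 (\<lambda>b1 r. sw r (\<lambda>b2 b3. E2 Y (T b3 \<otimes> y \<otimes> b1) z2 (\<lambda>c d. G (b2 \<otimes> c) d)))"
      by (simp add: La2_def)
  qed
  finally show ?thesis .
qed

text \<open>
  The inverse antipode from the action of \<open>R\<close> meets the coproduct of \<open>t\<close> and cancels one
  pair of legs of \<open>z\<close>.
\<close>

lemma E2_R_comult:
  assumes t: "t \<in> carrier DT" and y: "y \<in> carrier A" and z: "z \<in> carrier A" and G: "bform A G"
  shows "E2 (RR \<otimes>\<^bsub>DD\<^esub> comult D t) y z G =
    sw z (\<lambda>z1 z2. E t (y \<otimes> z1) (\<lambda>a. sw a (\<lambda>a1 a2. G (z2 \<otimes> a1) a2)))"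
proof -
  note [simp] = lform_bform1[OF G] lform_bform2[OF G]
  have "E2 (RR \<otimes>\<^bsub>DD\<^esub> comult D t) y z G = sw z (\<lambda>z1 z2. sw z1 (\<lambda>b1 r. sw r (\<lambda>b2 b3.
    E t ((z2 \<otimes> T b3) \<otimes> (y \<otimes> b1)) (\<lambda>a. sw a (\<lambda>a1 a2. G (b2 \<otimes> a1) a2)))))"
    using t y z G by (simp add: E2_R_mult E2_comult m_assoc)
  also have "\<dots> = sw z (\<lambda>b1 q. sw q (\<lambda>r z2. sw r (\<lambda>b2 b3.
    E t ((z2 \<otimes> T b3) \<otimes> (y \<otimes> b1)) (\<lambda>a. sw a (\<lambda>a1 a2. G (b2 \<otimes> a1) a2)))))"
    by (rule sw_coassoc[OF z])
  also have "\<dots> = sw z (\<lambda>b1 q. sw q (\<lambda>b2 u. sw u (\<lambda>b3 z2.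
    E t ((z2 \<otimes> T b3) \<otimes> (y \<otimes> b1)) (\<lambda>a. sw a (\<lambda>a1 a2. G (b2 \<otimes> a1) a2)))))"
    by (rule sw_cong[OF refl], rule sw_coassoc) simp
  also have "\<dots> = sw z (\<lambda>b1 q. sw q (\<lambda>b2 u. \<epsilon> u *
    E t (y \<otimes> b1) (\<lambda>a. sw a (\<lambda>a1 a2. G (b2 \<otimes> a1) a2))))"
    using t y by (intro sw_cong[OF refl])
      (simp add: sw_T_right[where \<phi> = "\<lambda>w. E t (w \<otimes> (y \<otimes> _)) _"])
  also have "\<dots> = sw z (\<lambda>b1 q. E t (y \<otimes> b1) (\<lambda>a. sw a (\<lambda>a1 a2. G (q \<otimes> a1) a2)))"
    by (rule sw_cong[OF refl])
      (simp add: sw_counit_right[where \<phi> = "\<lambda>x. E t (y \<otimes> _) (\<lambda>a. sw a (\<lambda>a1 a2. G (x \<otimes> a1) a2))"])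
  finally show ?thesis .
qed

lemma tflip_bilinear: "bilinear_on D D fun_scal (\<lambda>a b. tens D D b a)"
  using bilinear_tens[of D D] by (auto simp: bilinear_on_def)

lemma tflip_closed [simp]: "X \<in> carrier DD \<Longrightarrow> tflip D X \<in> carrier DD"
  unfolding tflip_def by (intro tsum_closed vspace_tensor D.vsp) auto

lemma tflip_tens [simp]: "s \<in> carrier DT \<Longrightarrow> t \<in> carrier DT \<Longrightarrow> tflip D (tens D D s t) = tens D D t s"
  unfolding tflip_def by (rule tsum_tens[OF _ _ tflip_bilinear vector_space_fun_scal]) simp_all

lemma tflip_linear: "linear_on DD fun_scal (tflip D)"
  using linear_on_tsum[OF D.vsp tflip_bilinear vector_space_fun_scal] by (simp add: tflip_def[abs_def])

lemma tflip_tflip: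
  assumes X: "X \<in> carrier DD"
  shows "tflip D (tflip D X) = X"
proof (rule tensor_linear_eqI[OF X D.vsp, where s = fun_scal and f = "\<lambda>X. tflip D (tflip D X)" and g = "\<lambda>X. X"])
  show "linear_on DD fun_scal (\<lambda>X. tflip D (tflip D X))"
    using linear_on_comp[of DD DD "tflip D" fun_scal "tflip D"] tflip_linear by simp
  show "linear_on DD fun_scal (\<lambda>X. X)" by (rule linear_onI) simp_all
  show "tflip D (tflip D (tens D D a b)) = tens D D a b" if "a \<in> carrier D" "b \<in> carrier D" for a b
    using that by simp
qed

lemma tflip_mult:
  assumes X: "X \<in> carrier DD" and Y: "Y \<in> carrier DD"
  shows "tflip D (X \<otimes>\<^bsub>DD\<^esub> Y) = tflip D X \<otimes>\<^bsub>DD\<^esub> tflip D Y"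
proof -
  have mr: "linear_on DD fun_scal (\<lambda>y. x \<otimes>\<^bsub>DD\<^esub> y)" and ml: "linear_on DD fun_scal (\<lambda>y. y \<otimes>\<^bsub>DD\<^esub> x)"
    if "x \<in> carrier DD" for x
    using DDA.linear_mult_right[OF that] DDA.linear_mult_left[OF that] by simp_all
  note c = linear_on_comp[of DD DD _ fun_scal, simplified]
  note cl = DD.tensor_mult_closed
  have 1: "tflip D (tens D D s s' \<otimes>\<^bsub>DD\<^esub> Y) = tflip D (tens D D s s') \<otimes>\<^bsub>DD\<^esub> tflip D Y"
    if m: "s \<in> carrier DT" "s' \<in> carrier DT" for s s'
  proof (rule tensor_linear_eqI[OF Y D.vsp, where f = "\<lambda>Y. tflip D (tens D D s s' \<otimes>\<^bsub>DD\<^esub> Y)"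
        and g = "\<lambda>Y. tflip D (tens D D s s') \<otimes>\<^bsub>DD\<^esub> tflip D Y"])
    have t: "tens D D s s' \<in> carrier DD" "tens D D s' s \<in> carrier DD" using m by simp_all
    show "linear_on DD fun_scal (\<lambda>Y. tflip D (tens D D s s' \<otimes>\<^bsub>DD\<^esub> Y))"
      by (rule c[OF mr[OF t(1)] cl[OF t(1)] tflip_linear])
    show "linear_on DD fun_scal (\<lambda>Y. tflip D (tens D D s s') \<otimes>\<^bsub>DD\<^esub> tflip D Y)"
      using c[OF tflip_linear tflip_closed mr[OF t(2)]] m by simp
  qed (use m in \<open>simp add: mult_D_closed\<close>)
  show ?thesis
  proof (rule tensor_linear_eqI[OF X D.vsp, where f = "\<lambda>X. tflip D (X \<otimes>\<^bsub>DD\<^esub> Y)"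
        and g = "\<lambda>X. tflip D X \<otimes>\<^bsub>DD\<^esub> tflip D Y"])
    show "linear_on DD fun_scal (\<lambda>X. tflip D (X \<otimes>\<^bsub>DD\<^esub> Y))"
      by (rule c[OF ml[OF Y] cl[OF _ Y] tflip_linear])
    show "linear_on DD fun_scal (\<lambda>X. tflip D X \<otimes>\<^bsub>DD\<^esub> tflip D Y)"
      by (rule c[OF tflip_linear tflip_closed ml[OF tflip_closed[OF Y]]])
  qed (use 1 in simp)
qed

lemma E2_tflip:
  assumes "X \<in> carrier DD"
  shows "E2 (tflip D X) y z G = E2 X z y (\<lambda>a b. G b a)"
proof (rule DD_form_eqI[OF assms, where F = "\<lambda>X. E2 (tflip D X) y z G"])
  show "lform DD (\<lambda>X. E2 (tflip D X) y z G)"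
    using tflip_linear by (simp add: lform_def linear_on_def E2_add E2_scal)
  show "lform DD (\<lambda>X. E2 X z y (\<lambda>a b. G b a))" by simp
  show "E2 (tflip D (tens D D s t)) y z G = E2 (tens D D s t) z y (\<lambda>a b. G b a)"
    if "s \<in> carrier DT" "t \<in> carrier DT" for s t
    using that by simp (rule E_E)
qed

lemma E2_mult_R:
  assumes X: "X \<in> carrier DD" and y: "y \<in> carrier A" and z: "z \<in> carrier A" and G: "bform A G"
  shows "E2 (X \<otimes>\<^bsub>DD\<^esub> RR) y z G = sw z (\<lambda>z1 z2. E2 X y z1 (\<lambda>a a'. sw a' (\<lambda>b1 r. sw r (\<lambda>b2 b3.
    G (a \<otimes> (T b3 \<otimes> z2 \<otimes> b1)) b2))))"
proof -
  note [simp] = lform_bform1[OF G] lform_bform2[OF G]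
  have La: "La2 a a' RR y2 z2 G = \<epsilon> y2 * sw a' (\<lambda>b1 r. sw r (\<lambda>b2 b3. G (a \<otimes> (T b3 \<otimes> z2 \<otimes> b1)) b2))"
    if m: "a \<in> carrier A" "a' \<in> carrier A" "y2 \<in> carrier A" "z2 \<in> carrier A" for a a' y2 z2
  proof -
    have "La2 a a' RR y2 z2 G = \<epsilon> y2 * sw a (\<lambda>a1 r. \<epsilon> a1 * sw r (\<lambda>a2 a3. \<epsilon> a3 *
        sw a' (\<lambda>b1 r. sw r (\<lambda>b2 b3. G (a2 \<otimes> (T b3 \<otimes> z2 \<otimes> b1)) b2))))"
      using m unfolding La2_def sw_scale[symmetric]
      by (intro sw_cong[OF refl]) (simp add: E2_RR counit_mult mult_ac)
    also have "\<dots> = \<epsilon> y2 * sw a' (\<lambda>b1 r. sw r (\<lambda>b2 b3. G (a \<otimes> (T b3 \<otimes> z2 \<otimes> b1)) b2))"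
      using m
      by (simp add: sw_counit_right[where \<phi> = "\<lambda>x. sw a' (\<lambda>b1 r. sw r (\<lambda>b2 b3. G (x \<otimes> (T b3 \<otimes> z2 \<otimes> b1)) b2))"]
          sw_counit_left[where \<phi> = "\<lambda>x. sw a' (\<lambda>b1 r. sw r (\<lambda>b2 b3. G (x \<otimes> (T b3 \<otimes> z2 \<otimes> b1)) b2))"])
    finally show ?thesis .
  qed
  have "E2 (X \<otimes>\<^bsub>DD\<^esub> RR) y z G = sw y (\<lambda>y1 y2. sw z (\<lambda>z1 z2. \<epsilon> y2 * E2 X y1 z1 (\<lambda>a a'.
      sw a' (\<lambda>b1 r. sw r (\<lambda>b2 b3. G (a \<otimes> (T b3 \<otimes> z2 \<otimes> b1)) b2)))))"
    using X y z G by (simp add: E2_mult La E2_scale)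
  also have "\<dots> = sw z (\<lambda>z1 z2. E2 X y z1 (\<lambda>a a'. sw a' (\<lambda>b1 r. sw r (\<lambda>b2 b3.
    G (a \<otimes> (T b3 \<otimes> z2 \<otimes> b1)) b2))))"
    using X y lform_E2_arg1[OF X lmap_id] by (simp add: sw_swap[of y] sw_counit_right)
  finally show ?thesis .
qed

text \<open>
  Both sides reduce to the same map, since on either side one pair of neighbouring legs
  cancels.
\<close>

lemma R_comult:
  assumes t: "t \<in> carrier DT"
  shows "RR \<otimes>\<^bsub>DD\<^esub> comult D t = tflip D (comult D t) \<otimes>\<^bsub>DD\<^esub> RR"
proof (rule DD_eqI)
  fix y z G assume y: "y \<in> carrier A" and z: "z \<in> carrier A" and G: "bform A G"
  note [simp] = lform_bform1[OF G] lform_bform2[OF G]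
  have H: "sw c (\<lambda>p p'. sw p (\<lambda>b1 r. sw r (\<lambda>b2 b3. G (p' \<otimes> (T b3 \<otimes> z2 \<otimes> b1)) b2))) =
    sw c (\<lambda>b1 b2. G (z2 \<otimes> b1) b2)" if c: "c \<in> carrier A" and z2: "z2 \<in> carrier A" for c z2
  proof -
    have "sw c (\<lambda>p p'. sw p (\<lambda>b1 r. sw r (\<lambda>b2 b3. G (p' \<otimes> (T b3 \<otimes> z2 \<otimes> b1)) b2))) =
      sw c (\<lambda>b1 q. sw q (\<lambda>r p'. sw r (\<lambda>b2 b3. G ((p' \<otimes> T b3) \<otimes> (z2 \<otimes> b1)) b2)))"
      using c z2 by (simp add: sw_coassoc m_assoc)
    also have "\<dots> = sw c (\<lambda>b1 q. sw q (\<lambda>b2 u. sw u (\<lambda>b3 p'. G ((p' \<otimes> T b3) \<otimes> (z2 \<otimes> b1)) b2)))"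
      by (rule sw_cong[OF refl], rule sw_coassoc) simp
    also have "\<dots> = sw c (\<lambda>b1 q. sw q (\<lambda>b2 u. \<epsilon> u * G (z2 \<otimes> b1) b2))"
      using z2 by (intro sw_cong[OF refl])
        (simp add: sw_T_right[where \<phi> = "\<lambda>w. G (w \<otimes> (z2 \<otimes> _)) _"])
    also have "\<dots> = sw c (\<lambda>b1 b2. G (z2 \<otimes> b1) b2)"
      using z2 lform_bform2[OF G lmap_id] by (intro sw_cong[OF refl]) (simp add: sw_counit_right)
    finally show ?thesis .
  qed
  have "E2 (tflip D (comult D t) \<otimes>\<^bsub>DD\<^esub> RR) y z G =
      sw z (\<lambda>z1 z2. E t (y \<otimes> z1) (\<lambda>c. sw c (\<lambda>p p'. sw p (\<lambda>b1 r. sw r (\<lambda>b2 b3. G (p' \<otimes> (T b3 \<otimes> z2 \<otimes> b1)) b2)))))"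
    using t y z G by (simp add: E2_mult_R E2_tflip E2_comult)
  also have "\<dots> = E2 (RR \<otimes>\<^bsub>DD\<^esub> comult D t) y z G"
    using t y z G by (simp add: E2_R_comult H)
  finally show "E2 (RR \<otimes>\<^bsub>DD\<^esub> comult D t) y z G = E2 (tflip D (comult D t) \<otimes>\<^bsub>DD\<^esub> RR) y z G" ..
qed (use t in \<open>simp_all add: DD.tensor_mult_closed\<close>)

text \<open>
  The product of the dual is transposed to the coproduct: the canonical tensor may carry
  the coproduct on its first factor or the product on its second.
\<close>

lemma dual_basis_comult:
  assumes "\<And>x y. x \<in> B \<Longrightarrow> y \<in> B \<Longrightarrow> lform DA (P x y)"
  shows "(\<Sum>b\<in>B. sw b (\<lambda>x y. P x y (e b))) = (\<Sum>b\<in>B. \<Sum>c\<in>B. P b c (e b \<otimes>\<^bsub>DA\<^esub> e c))"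
proof -
  have "(\<Sum>b\<in>B. \<Sum>c\<in>B. P b c (e b \<otimes>\<^bsub>DA\<^esub> e c)) =
      (\<Sum>b\<in>B. \<Sum>c\<in>B. \<Sum>d\<in>B. sw d (\<lambda>x y. e b x * e c y) * P b c (e d))"
    using assms
    by (intro sum.cong refl, subst lform_dual_expand[symmetric]) auto
  also have "\<dots> = (\<Sum>b\<in>B. \<Sum>d\<in>B. \<Sum>c\<in>B. sw d (\<lambda>x y. e b x * (e c y * P b c (e d))))"
    by (rule sum.cong[OF refl], subst sum.swap) (simp add: sw_scale' mult.assoc[symmetric])
  also have "\<dots> = (\<Sum>d\<in>B. \<Sum>b\<in>B. \<Sum>c\<in>B. sw d (\<lambda>x y. e b x * (e c y * P b c (e d))))"
    by (rule sum.swap)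
  also have "\<dots> = (\<Sum>d\<in>B. sw d (\<lambda>x y. \<Sum>b\<in>B. e b x * (\<Sum>c\<in>B. e c y * P b c (e d))))"
    by (simp only: sw_sum sum_distrib_left)
  also have "\<dots> = (\<Sum>d\<in>B. sw d (\<lambda>x y. P x y (e d)))"
    by (intro sum.cong refl sw_cong) (simp add: sum_delta)
  finally show ?thesis ..
qed

lemma bform_bow_left:
  assumes "bform D G"
  shows "lmap A h \<Longrightarrow> f \<in> carrier DA \<Longrightarrow> t \<in> carrier DT \<Longrightarrow> lform A (\<lambda>x. G (bow f (h x)) t)"
    and "lmap A h \<Longrightarrow> f \<in> carrier DA \<Longrightarrow> t \<in> carrier DT \<Longrightarrow> lform A (\<lambda>x. G t (bow f (h x)))"
    and "a \<in> carrier A \<Longrightarrow> t \<in> carrier DT \<Longrightarrow> lform DA (\<lambda>f. G (bow f a) t)"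
    and "a \<in> carrier A \<Longrightarrow> t \<in> carrier DT \<Longrightarrow> lform DA (\<lambda>f. G t (bow f a))"
  using lform_bow[OF lform_bform_right[OF assms]] lform_bow[OF lform_bform_left[OF assms]] by auto

lemma R_invertible: "RR \<in> Units DD"
proof -
  (* The inverse of R is obtained by applying the antipode to the first factor. *)
  define R' where "R' = (\<Sum>b\<in>B. tens D D (hA (S b)) (dl (e b)))"
  have R': "R' \<in> carrier DD"
    unfolding R'_def by (intro vspace_sum_closed vspace_tensor D.vsp) simp
  have tm: "tens D D (hA b) (dl (e c)) \<in> carrier DD" "tens D D (hA (S b)) (dl (e c)) \<in> carrier DD"
    if "b \<in> B" for b c using that by simp_all
  have m1: "RR \<otimes>\<^bsub>DD\<^esub> R' = (\<Sum>b\<in>B. \<Sum>c\<in>B. tens D D (hA (b \<otimes> S c)) (dl (e b \<otimes>\<^bsub>DA\<^esub> e c)))"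
  proof -
    have "RR \<otimes>\<^bsub>DD\<^esub> R' = (\<Sum>b\<in>B. tens D D (hA b) (dl (e b)) \<otimes>\<^bsub>DD\<^esub> R')"
      unfolding RR_def using DDA.linear_mult_left[OF R'] DDA.vsp
      by (intro linear_on_sum[of DD fun_scal "\<lambda>x. x \<otimes>\<^bsub>DD\<^esub> R'"]) (simp_all add: tm)
    also have "\<dots> = (\<Sum>b\<in>B. \<Sum>c\<in>B. tens D D (hA b) (dl (e b)) \<otimes>\<^bsub>DD\<^esub> tens D D (hA (S c)) (dl (e c)))"
      unfolding R'_def using DDA.linear_mult_right[OF tm(1)] DDA.vsp
      by (intro sum.cong refl linear_on_sum[of DD fun_scal "\<lambda>x. _ \<otimes>\<^bsub>DD\<^esub> x"]) (simp_all add: tm)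
    finally show ?thesis by (simp add: hA_mult dual_embed_mult)
  qed
  have m2: "R' \<otimes>\<^bsub>DD\<^esub> RR = (\<Sum>b\<in>B. \<Sum>c\<in>B. tens D D (hA (S b \<otimes> c)) (dl (e b \<otimes>\<^bsub>DA\<^esub> e c)))"
  proof -
    have "R' \<otimes>\<^bsub>DD\<^esub> RR = (\<Sum>b\<in>B. tens D D (hA (S b)) (dl (e b)) \<otimes>\<^bsub>DD\<^esub> RR)"
      unfolding R'_def using DDA.linear_mult_left[OF RR_closed] DDA.vsp
      by (intro linear_on_sum[of DD fun_scal "\<lambda>x. x \<otimes>\<^bsub>DD\<^esub> RR"]) (simp_all add: tm)
    also have "\<dots> = (\<Sum>b\<in>B. \<Sum>c\<in>B. tens D D (hA (S b)) (dl (e b)) \<otimes>\<^bsub>DD\<^esub> tens D D (hA c) (dl (e c)))"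
      unfolding RR_def using DDA.linear_mult_right[OF tm(2)] DDA.vsp
      by (intro sum.cong refl linear_on_sum[of DD fun_scal "\<lambda>x. _ \<otimes>\<^bsub>DD\<^esub> x"]) (simp_all add: tm)
    finally show ?thesis by (simp add: hA_mult dual_embed_mult)
  qed
  have one: "(\<Sum>b\<in>B. \<epsilon> b * G (hA \<one>) (dl (e b))) = \<one>\<^bsub>DD\<^esub> G" if G: "bform D G" for G
  proof -
    have "(\<Sum>b\<in>B. \<epsilon> b * G (hA \<one>) (dl (e b))) = (\<Sum>b\<in>B. \<one>\<^bsub>DA\<^esub> b * G (hA \<one>) (dl (e b)))" by simp
    also have "\<dots> = G (hA \<one>) (dl \<one>\<^bsub>DA\<^esub>)"
      using bform_bow_left(4)[OF G] by (intro lform_dual_expand) simp_all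
    finally show ?thesis using G by (simp add: one_tensor tens_apply bform_bilinear one_D)
  qed
  have "RR \<otimes>\<^bsub>DD\<^esub> R' = \<one>\<^bsub>DD\<^esub>"
  proof (rule tensor_eqI)
    fix G assume "bilinear_on D D (*) G"
    then have G: "bform D G" by (simp add: bform_bilinear)
    have "(RR \<otimes>\<^bsub>DD\<^esub> R') G = (\<Sum>b\<in>B. \<Sum>c\<in>B. G (hA (b \<otimes> S c)) (dl (e b \<otimes>\<^bsub>DA\<^esub> e c)))"
      unfolding m1 using G by (simp add: sum_fun_apply tens_apply bform_bilinear)
    also have "\<dots> = (\<Sum>b\<in>B. sw b (\<lambda>x y. G (hA (x \<otimes> S y)) (dl (e b))))"
      by (rule dual_basis_comult[symmetric]) (simp add: bform_bow_left(4)[OF G])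
    also have "\<dots> = (\<Sum>b\<in>B. \<epsilon> b * G (hA \<one>) (dl (e b)))"
      using bform_bow_left(1)[OF G lmap_id]
      by (intro sum.cong refl) (simp add: sw_S_right[where \<phi> = "\<lambda>x. G (hA x) _"])
    finally show "(RR \<otimes>\<^bsub>DD\<^esub> R') G = \<one>\<^bsub>DD\<^esub> G" using one[OF G] by simp
  qed (simp_all add: R' DD.tensor_mult_closed)
  moreover have "R' \<otimes>\<^bsub>DD\<^esub> RR = \<one>\<^bsub>DD\<^esub>"
  proof (rule tensor_eqI)
    fix G assume "bilinear_on D D (*) G"
    then have G: "bform D G" by (simp add: bform_bilinear)
    have "(R' \<otimes>\<^bsub>DD\<^esub> RR) G = (\<Sum>b\<in>B. \<Sum>c\<in>B. G (hA (S b \<otimes> c)) (dl (e b \<otimes>\<^bsub>DA\<^esub> e c)))"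
      unfolding m2 using G by (simp add: sum_fun_apply tens_apply bform_bilinear)
    also have "\<dots> = (\<Sum>b\<in>B. sw b (\<lambda>x y. G (hA (S x \<otimes> y)) (dl (e b))))"
      by (rule dual_basis_comult[symmetric]) (simp add: bform_bow_left(4)[OF G])
    also have "\<dots> = (\<Sum>b\<in>B. \<epsilon> b * G (hA \<one>) (dl (e b)))"
      using bform_bow_left(1)[OF G lmap_id]
      by (intro sum.cong refl) (simp add: sw_S_left[where \<phi> = "\<lambda>x. G (hA x) _"])
    finally show "(R' \<otimes>\<^bsub>DD\<^esub> RR) G = \<one>\<^bsub>DD\<^esub> G" using one[OF G] by simp
  qed (simp_all add: R' DD.tensor_mult_closed)
  ultimately show ?thesis using R' RR_closed unfolding Units_def by blast
qed

lemma comult_hA_tsum: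
  assumes a: "a \<in> carrier A" and G: "bform D G"
  shows "tsum D D (comult D (hA a)) G = sw a (\<lambda>a1 a2. G (hA a1) (hA a2))"
proof -
  have "tsum D D (comult D (hA a)) G =
      (\<Sum>i\<in>B. \<Sum>j\<in>B. sw a (\<lambda>a1 a2. \<one>\<^bsub>DA\<^esub> i * (\<one>\<^bsub>DA\<^esub> j * G (bow (e i) a1) (bow (e j) a2))))"
    using a G by (simp add: comult_bow_tsum counit_mult mult_ac flip: sw_scale)
  also have "\<dots> = sw a (\<lambda>a1 a2. \<Sum>i\<in>B. \<one>\<^bsub>DA\<^esub> i * (\<Sum>j\<in>B. \<one>\<^bsub>DA\<^esub> j * G (bow (e i) a1) (bow (e j) a2)))"
    by (simp only: sw_sum sum_distrib_left)
  also have "\<dots> = sw a (\<lambda>a1 a2. G (hA a1) (hA a2))"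
  proof (rule sw_cong[OF refl])
    fix a1 a2 assume m: "a1 \<in> B" "a2 \<in> B"
    have "(\<Sum>j\<in>B. \<one>\<^bsub>DA\<^esub> j * G t (bow (e j) a2)) = G t (hA a2)" if "t \<in> carrier DT" for t
      using bform_bow_left(4)[OF G _ that] m by (intro lform_dual_expand) simp_all
    moreover have "(\<Sum>j\<in>B. \<one>\<^bsub>DA\<^esub> j * G (bow (e j) a1) t) = G (hA a1) t" if "t \<in> carrier DT" for t
      using bform_bow_left(3)[OF G _ that] m by (intro lform_dual_expand) simp_all
    ultimately show "(\<Sum>i\<in>B. \<one>\<^bsub>DA\<^esub> i * (\<Sum>j\<in>B. \<one>\<^bsub>DA\<^esub> j * G (bow (e i) a1) (bow (e j) a2))) = G (hA a1) (hA a2)"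
      using m by (simp del: one_DA_apply)
  qed
  finally show ?thesis .
qed

lemma comult_dl_tsum:
  assumes f: "f \<in> carrier DA" and G: "bform D G"
  shows "tsum D D (comult D (dl f)) G = (\<Sum>i\<in>B. \<Sum>j\<in>B. f (j \<otimes> i) * G (dl (e i)) (dl (e j)))"
  using f G bform_bow_left(1,2)[OF G lmap_id] by (simp add: comult_bow_tsum sw_one)

sublocale D3: two_kalgebras D DD ..

lemma tens3_mult:
  assumes "a \<in> carrier DT" "b \<in> carrier DT" "c \<in> carrier DT" "a' \<in> carrier DT" "b' \<in> carrier DT" "c' \<in> carrier DT"
  shows "tens3 D a b c \<otimes>\<^bsub>tensor3_alg D\<^esub> tens3 D a' b' c' =
    tens3 D (a \<otimes>\<^bsub>D\<^esub> a') (b \<otimes>\<^bsub>D\<^esub> b') (c \<otimes>\<^bsub>D\<^esub> c')"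
  unfolding tens3_def tensor3_alg_def using assms by simp

lemma tens3_mem [simp]:
  "a \<in> carrier DT \<Longrightarrow> b \<in> carrier DT \<Longrightarrow> c \<in> carrier DT \<Longrightarrow> tens3 D a b c \<in> carrier (tensor3_alg D)"
  unfolding tens3_def tensor3_alg_def by simp

lemma tens3_linear:
  shows "b \<in> carrier DT \<Longrightarrow> c \<in> carrier DT \<Longrightarrow> linear_on D fun_scal (\<lambda>a. tens3 D a b c)"
    and "a \<in> carrier DT \<Longrightarrow> c \<in> carrier DT \<Longrightarrow> linear_on D fun_scal (\<lambda>b. tens3 D a b c)"
    and "a \<in> carrier DT \<Longrightarrow> b \<in> carrier DT \<Longrightarrow> linear_on D fun_scal (\<lambda>c. tens3 D a b c)"
proof -
  show "linear_on D fun_scal (\<lambda>a. tens3 D a b c)" if "b \<in> carrier DT" "c \<in> carrier DT"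
    unfolding tens3_def using that by (intro bilinear_on_left[OF bilinear_tens]) simp
  show "linear_on D fun_scal (\<lambda>b. tens3 D a b c)" if "a \<in> carrier DT" "c \<in> carrier DT"
    unfolding tens3_def using that
    by (intro linear_on_comp[of D DD "\<lambda>b. tens D D b c" fun_scal "tens D DD a"]
        bilinear_on_right[OF bilinear_tens]) (auto intro: bilinear_on_left[OF bilinear_tens])
  show "linear_on D fun_scal (\<lambda>c. tens3 D a b c)" if "a \<in> carrier DT" "b \<in> carrier DT"
    unfolding tens3_def using that
    by (intro linear_on_comp[of D DD "\<lambda>c. tens D D b c" fun_scal "tens D DD a"]
        bilinear_on_right[OF bilinear_tens]) (auto intro: bilinear_on_right[OF bilinear_tens])
qed

lemma tens3_form:
  assumes "lform (tensor3_alg D) F"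
  shows "b \<in> carrier DT \<Longrightarrow> c \<in> carrier DT \<Longrightarrow> lform D (\<lambda>a. F (tens3 D a b c))"
    and "a \<in> carrier DT \<Longrightarrow> c \<in> carrier DT \<Longrightarrow> lform D (\<lambda>b. F (tens3 D a b c))"
    and "a \<in> carrier DT \<Longrightarrow> b \<in> carrier DT \<Longrightarrow> lform D (\<lambda>c. F (tens3 D a b c))"
  using assms linear_on_comp[of D "tensor3_alg D" _ "(*)" F] tens3_linear
  by (simp_all add: lform_def tensor3_alg_def tens3_def)

lemma tsum_RR_tens3:
  shows "tsum D D RR (\<lambda>x y. tens3 D x \<one>\<^bsub>D\<^esub> y) = (\<Sum>b\<in>B. tens3 D (hA b) \<one>\<^bsub>D\<^esub> (dl (e b)))"
    and "tsum D D RR (\<lambda>x y. tens3 D \<one>\<^bsub>D\<^esub> x y) = (\<Sum>b\<in>B. tens3 D \<one>\<^bsub>D\<^esub> (hA b) (dl (e b)))"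
    and "tsum D D RR (\<lambda>x y. tens3 D x y \<one>\<^bsub>D\<^esub>) = (\<Sum>b\<in>B. tens3 D (hA b) (dl (e b)) \<one>\<^bsub>D\<^esub>)"
  by (rule tsum_RR[where s = fun_scal]; auto intro!: bilinear_onI tens3_linear vector_space_fun_scal)+

lemma sum_tens3_mult:
  assumes "\<And>b. b \<in> B \<Longrightarrow> X b \<in> carrier (tensor3_alg D)" "\<And>b. b \<in> B \<Longrightarrow> Y b \<in> carrier (tensor3_alg D)"
  shows "(\<Sum>b\<in>B. X b) \<otimes>\<^bsub>tensor3_alg D\<^esub> (\<Sum>c\<in>B. Y c) = (\<Sum>b\<in>B. \<Sum>c\<in>B. X b \<otimes>\<^bsub>tensor3_alg D\<^esub> Y c)"
proof -
  interpret A3: kalgebra "tensor3_alg D"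
    unfolding tensor3_alg_def by (rule D3.kalgebra_tensor)
  have Y: "(\<Sum>c\<in>B. Y c) \<in> carrier (tensor3_alg D)" using assms by (intro vspace_sum_closed A3.vsp)
  have "(\<Sum>b\<in>B. X b) \<otimes>\<^bsub>tensor3_alg D\<^esub> (\<Sum>c\<in>B. Y c) = (\<Sum>b\<in>B. X b \<otimes>\<^bsub>tensor3_alg D\<^esub> (\<Sum>c\<in>B. Y c))"
    by (rule linear_on_sum[OF A3.linear_mult_left[OF Y] A3.vsp assms(1)])
  also have "\<dots> = (\<Sum>b\<in>B. \<Sum>c\<in>B. X b \<otimes>\<^bsub>tensor3_alg D\<^esub> Y c)"
    by (intro sum.cong refl linear_on_sum[OF A3.linear_mult_right[OF assms(1)] A3.vsp assms(2)])
  finally show ?thesis .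
qed

lemma lform_eval3:
  assumes "bilinear_on D DD (*) F"
  shows "lform (tensor3_alg D) (\<lambda>X. X F)"
  by (simp add: lform_def linear_on_def tensor3_alg_def)

lemma tens3_outside: "\<not> bilinear_on D DD (*) F \<Longrightarrow> tens3 D a b c F = 0"
  by (simp add: tens3_def tens_def)

text \<open>
  The coproduct restricts to the coproduct of \<open>A\<close> on the first factors of \<open>R\<close>, and moves
  to a product of dual elements on the second.
\<close>

lemma comult_id_R:
  "tsum D D RR (\<lambda>x y. tsum D D (comult D x) (\<lambda>x1 x2. tens3 D x1 x2 y)) =
   tsum D D RR (\<lambda>x y. tens3 D x \<one>\<^bsub>D\<^esub> y) \<otimes>\<^bsub>tensor3_alg D\<^esub> tsum D D RR (\<lambda>x y. tens3 D \<one>\<^bsub>D\<^esub> x y)"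
proof -
  have r: "tsum D D RR (\<lambda>x y. tens3 D x \<one>\<^bsub>D\<^esub> y) \<otimes>\<^bsub>tensor3_alg D\<^esub> tsum D D RR (\<lambda>x y. tens3 D \<one>\<^bsub>D\<^esub> x y) =
      (\<Sum>b\<in>B. \<Sum>c\<in>B. tens3 D (hA b) (hA c) (dl (e b \<otimes>\<^bsub>DA\<^esub> e c)))"
    by (simp add: tsum_RR_tens3 sum_tens3_mult tens3_mult mult_one_D one_mult_D dual_embed_mult)
  show ?thesis
    unfolding r
  proof
    fix F
    show "tsum D D RR (\<lambda>x y. tsum D D (comult D x) (\<lambda>x1 x2. tens3 D x1 x2 y)) F =
      (\<Sum>b\<in>B. \<Sum>c\<in>B. tens3 D (hA b) (hA c) (dl (e b \<otimes>\<^bsub>DA\<^esub> e c))) F"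
    proof (cases "bilinear_on D DD (*) F")
      case F: True
      note lf = tens3_form[OF lform_eval3[OF F]]
      have bf: "bform D (\<lambda>x1 x2. tens3 D x1 x2 y F)" if "y \<in> carrier DT" for y
        using that by (intro bformI) (auto intro: lf)
      have lc: "lform D (\<lambda>t. tsum D D (comult D t) G)" if "bform D G" for G
      proof -
        have "lform D (\<lambda>t. \<Sum>i\<in>B. \<Sum>j\<in>B. E t (j \<otimes> i) (\<lambda>a. sw a (\<lambda>a1 a2. G (bow (e i) a1) (bow (e j) a2))))"
          by simp
        then show ?thesis by (rule lform_congI) (use that in \<open>simp_all add: comult_tsum\<close>)
      qed
      have lb: "lform D (\<lambda>y. tsum D D (comult D x) (\<lambda>x1 x2. tens3 D x1 x2 y F))" if "x \<in> carrier DT" for x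
        unfolding lform_def using that lf(3)
        by (intro linear_on_tsum_body[OF comult_D_closed vector_space_field]) (auto simp: lform_def)
      have "tsum D D RR (\<lambda>x y. tsum D D (comult D x) (\<lambda>x1 x2. tens3 D x1 x2 y)) F =
        tsum D D RR (\<lambda>x y. tsum D D (comult D x) (\<lambda>x1 x2. tens3 D x1 x2 y F))"
        by (simp add: tsum_fun_apply)
      also have "\<dots> = (\<Sum>b\<in>B. tsum D D (comult D (hA b)) (\<lambda>x1 x2. tens3 D x1 x2 (dl (e b)) F))"
        using lc[OF bf] lb
        by (intro tsum_RR[OF _ vector_space_field] bilinear_onI) (auto simp: lform_def)
      also have "\<dots> = (\<Sum>b\<in>B. sw b (\<lambda>x y. tens3 D (hA x) (hA y) (dl (e b)) F))"
        using bf by (simp add: comult_hA_tsum)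
      also have "\<dots> = (\<Sum>b\<in>B. \<Sum>c\<in>B. tens3 D (hA b) (hA c) (dl (e b \<otimes>\<^bsub>DA\<^esub> e c)) F)"
        by (rule dual_basis_comult) (rule lform_bow(2)[OF lf(3)], simp_all)
      finally show ?thesis by (simp add: sum_fun_apply)
    next
      case False
      then show ?thesis unfolding tsum_fun_apply by (simp add: tens3_outside tsum_zero sum_fun_apply)
    qed
  qed
qed

text \<open>
  The coproduct of the dual is transposed to the product of \<open>A\<close>; the opposite order is the
  one in \<open>R\<^sub>1\<^sub>3R\<^sub>1\<^sub>2\<close>.
\<close>

lemma id_comult_R:
  "tsum D D RR (\<lambda>x y. tsum D D (comult D y) (\<lambda>y1 y2. tens3 D x y1 y2)) =
   tsum D D RR (\<lambda>x y. tens3 D x \<one>\<^bsub>D\<^esub> y) \<otimes>\<^bsub>tensor3_alg D\<^esub> tsum D D RR (\<lambda>x y. tens3 D x y \<one>\<^bsub>D\<^esub>)"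
proof -
  have r: "tsum D D RR (\<lambda>x y. tens3 D x \<one>\<^bsub>D\<^esub> y) \<otimes>\<^bsub>tensor3_alg D\<^esub> tsum D D RR (\<lambda>x y. tens3 D x y \<one>\<^bsub>D\<^esub>) =
      (\<Sum>b\<in>B. \<Sum>c\<in>B. tens3 D (hA (b \<otimes> c)) (dl (e c)) (dl (e b)))"
    by (simp add: tsum_RR_tens3 sum_tens3_mult tens3_mult mult_one_D one_mult_D hA_mult)
  show ?thesis
    unfolding r
  proof
    fix F
    show "tsum D D RR (\<lambda>x y. tsum D D (comult D y) (\<lambda>y1 y2. tens3 D x y1 y2)) F =
      (\<Sum>b\<in>B. \<Sum>c\<in>B. tens3 D (hA (b \<otimes> c)) (dl (e c)) (dl (e b))) F"
    proof (cases "bilinear_on D DD (*) F")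
      case F: True
      note lf = tens3_form[OF lform_eval3[OF F]]
      have bf: "bform D (\<lambda>x1 x2. tens3 D y x1 x2 F)" if "y \<in> carrier DT" for y
        using that by (intro bformI) (auto intro: lf)
      have lc: "lform D (\<lambda>t. tsum D D (comult D t) G)" if "bform D G" for G
      proof -
        have "lform D (\<lambda>t. \<Sum>i\<in>B. \<Sum>j\<in>B. E t (j \<otimes> i) (\<lambda>a. sw a (\<lambda>a1 a2. G (bow (e i) a1) (bow (e j) a2))))"
          by simp
        then show ?thesis by (rule lform_congI) (use that in \<open>simp_all add: comult_tsum\<close>)
      qed
      have lb: "lform D (\<lambda>y. tsum D D (comult D x) (\<lambda>x1 x2. tens3 D y x1 x2 F))" if "x \<in> carrier DT" for x
        unfolding lform_def using that lf(1)
        by (intro linear_on_tsum_body[OF comult_D_closed vector_space_field]) (auto simp: lform_def)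
      have lh: "lform A (\<lambda>x. tens3 D (hA x) s t F)" if "s \<in> carrier DT" "t \<in> carrier DT" for s t
        using lform_bow(1)[OF lf(1)[OF that] _ lmap_id] by simp
      have "tsum D D RR (\<lambda>x y. tsum D D (comult D y) (\<lambda>y1 y2. tens3 D x y1 y2)) F =
        tsum D D RR (\<lambda>x y. tsum D D (comult D y) (\<lambda>y1 y2. tens3 D x y1 y2 F))"
        by (simp add: tsum_fun_apply)
      also have "\<dots> = (\<Sum>b\<in>B. tsum D D (comult D (dl (e b))) (\<lambda>y1 y2. tens3 D (hA b) y1 y2 F))"
        using lc[OF bf] lb
        by (intro tsum_RR[OF _ vector_space_field] bilinear_onI) (auto simp: lform_def)
      also have "\<dots> = (\<Sum>b\<in>B. \<Sum>i\<in>B. \<Sum>j\<in>B. e b (j \<otimes> i) * tens3 D (hA b) (dl (e i)) (dl (e j)) F)"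
        using bf by (simp add: comult_dl_tsum)
      also have "\<dots> = (\<Sum>i\<in>B. \<Sum>b\<in>B. \<Sum>j\<in>B. e b (j \<otimes> i) * tens3 D (hA b) (dl (e i)) (dl (e j)) F)"
        by (rule sum.swap)
      also have "\<dots> = (\<Sum>i\<in>B. \<Sum>j\<in>B. \<Sum>b\<in>B. e b (j \<otimes> i) * tens3 D (hA b) (dl (e i)) (dl (e j)) F)"
        by (rule sum.cong[OF refl], rule sum.swap)
      also have "\<dots> = (\<Sum>i\<in>B. \<Sum>j\<in>B. tens3 D (hA (j \<otimes> i)) (dl (e i)) (dl (e j)) F)"
        using lh by (simp add: lform_expand[where f = "\<lambda>b. tens3 D (hA b) _ _ F"])
      also have "\<dots> = (\<Sum>j\<in>B. \<Sum>i\<in>B. tens3 D (hA (j \<otimes> i)) (dl (e i)) (dl (e j)) F)"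
        by (rule sum.swap)
      finally show ?thesis by (simp add: sum_fun_apply)
    next
      case False
      then show ?thesis unfolding tsum_fun_apply by (simp add: tens3_outside tsum_zero sum_fun_apply)
    qed
  qed
qed

theorem quasitriangular_D: "quasitriangular D RR"
  by (intro quasitriangular.intro hopf_algebra_D quasitriangular_axioms.intro)
    (simp_all add: R_invertible R_comult comult_id_R id_comult_R)

end

section \<open>The Drinfeld element\<close>

context fin_hopf_bij begin

text \<open>
  The canonical tensor corresponds to the identity map, so every basis gives the same
  element.
\<close>

lemma double_R_eq: "double_R A = RR"
proof -
  interpret V: vector_space "scal A" by (rule vspace_vs) simp
  define B' where "B' = (SOME B. is_basis A B)"
  have B': "is_basis A B'" unfolding B'_def using basis by (rule someI)
  have "finite B'"
    using V.independent_span_bound[OF finite_B, of B'] V.span_superset[of B'] B' span_B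
    by (auto simp: is_basis_def)
  then interpret B': based_space A B'
    by unfold_locales (simp_all add: B')
  have mem: "B'.e b \<in> carrier DA" for b
    using B'.lform_e by (simp add: dual_mem B'.e_outside)
  have "double_R A = (\<Sum>b\<in>B'. tens D D (hA b) (dl (B'.e b)))"
    unfolding double_R_def B'_def[symmetric] by (simp add: Let_def)
  also have "\<dots> = RR"
  proof (rule tensor_eqI[of _ D D])
    show "(\<Sum>b\<in>B'. tens D D (hA b) (dl (B'.e b))) \<in> carrier DD"
      by (intro vspace_sum_closed vspace_tensor D.vsp) (simp add: mem)
    show "RR \<in> carrier DD" by simp
    fix G assume "bilinear_on D D (*) G"
    then have G: "bform D G" by (simp add: bform_bilinear)
    have "(\<Sum>b\<in>B'. tens D D (hA b) (dl (B'.e b))) G = (\<Sum>b\<in>B'. G (hA b) (dl (B'.e b)))"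
      using G by (simp add: sum_fun_apply tens_apply bform_bilinear)
    also have "\<dots> = (\<Sum>b\<in>B'. \<Sum>c\<in>B. B'.e b c * G (hA b) (dl (e c)))"
    proof (rule sum.cong[OF refl])
      fix b assume "b \<in> B'"
      then have "lform DA (\<lambda>f. G (hA b) (dl f))" by (intro bform_bow_left(4)[OF G]) simp_all
      then show "G (hA b) (dl (B'.e b)) = (\<Sum>c\<in>B. B'.e b c * G (hA b) (dl (e c)))"
        using mem by (rule lform_dual_expand[symmetric])
    qed
    also have "\<dots> = (\<Sum>c\<in>B. \<Sum>b\<in>B'. B'.e b c * G (hA b) (dl (e c)))" by (rule sum.swap)
    also have "\<dots> = (\<Sum>c\<in>B. G (hA c) (dl (e c)))"
    proof (rule sum.cong[OF refl])
      fix c assume "c \<in> B"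
      then show "(\<Sum>b\<in>B'. B'.e b c * G (hA b) (dl (e c))) = G (hA c) (dl (e c))"
        using bform_bow_left(1)[OF G lmap_id] by (intro B'.lform_expand) simp_all
    qed
    finally show "(\<Sum>b\<in>B'. tens D D (hA b) (dl (B'.e b))) G = RR G" by (simp add: RR_apply[OF G])
  qed
  finally show ?thesis .
qed

definition u :: "('k, 'a \<Rightarrow> 'k, 'a) tensor" where "u = drinfeld_element D RR"

lemma u_sum: "u = (\<Sum>b\<in>B. bow (fT (e b)) b)"
proof -
  have b: "bilinear_on D D fun_scal (\<lambda>x y. SD y \<otimes>\<^bsub>D\<^esub> x)"
  proof (rule bilinear_onI)
    show "linear_on D fun_scal (\<lambda>y. SD y \<otimes>\<^bsub>D\<^esub> x)" if "x \<in> carrier D" for x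
      using linear_on_comp[of D D SD fun_scal "\<lambda>y. y \<otimes>\<^bsub>D\<^esub> x"] SD_linear D.linear_mult_left[OF that] by simp
    show "linear_on D fun_scal (\<lambda>x. SD y \<otimes>\<^bsub>D\<^esub> x)" if "y \<in> carrier D" for y
      using D.linear_mult_right[of "SD y"] that by simp
  qed
  have "u = (\<Sum>b\<in>B. SD (dl (e b)) \<otimes>\<^bsub>D\<^esub> hA b)"
    unfolding u_def drinfeld_element_def antipode_D by (rule tsum_RR[OF b vector_space_fun_scal])
  then show ?thesis by (simp add: SD_dl bow_split)
qed

lemma u_closed [simp]: "u \<in> carrier DT"
  unfolding u_sum by (intro vspace_sum_closed vspace_DT) simp

text \<open>As a map, the Drinfeld element is the inverse antipode.\<close>

lemma E_u [simp]: "y \<in> carrier A \<Longrightarrow> lform A \<phi> \<Longrightarrow> E u y \<phi> = \<phi> (T y)"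
  by (simp add: u_sum E_sum_left lform_expand)

text \<open>
  The value \<open>S\<^sup>-\<^sup>1(y\<^sub>1)\<close> acts on \<open>t\<close> at \<open>y\<^sub>2\<close>; its three legs
  produce \<open>y\<^sub>2 S\<^sup>-\<^sup>1(y\<^sub>1)\<close>, which cancels.
\<close>

lemma E_u_mult:
  assumes t: "t \<in> carrier DT" and y: "y \<in> carrier A" and \<phi>: "lform A \<phi>"
  shows "E (u \<otimes>\<^bsub>D\<^esub> t) y \<phi> = sw y (\<lambda>y1 y2. E t (T (T y1)) (\<lambda>b. \<phi> (T y2 \<otimes> b)))"
proof -
  note [simp] = lform_comp[OF \<phi>]
  have "E (u \<otimes>\<^bsub>D\<^esub> t) y \<phi> = sw y (\<lambda>y1 y2. La (T y1) t y2 \<phi>)"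
    using t y \<phi> lform_La_left[OF lmap_id, of t _ \<phi>] by (simp add: E_mult)
  also have "\<dots> = sw y (\<lambda>y1 y2. sw y1 (\<lambda>p q. sw p (\<lambda>p1 p2.
      E t (T (T p1) \<otimes> (y2 \<otimes> T q)) (\<lambda>b. \<phi> (T p2 \<otimes> b)))))"
  proof (rule sw_cong[OF refl])
    fix y1 y2 assume m: "y1 \<in> B" "y2 \<in> B"
    have "La (T y1) t y2 \<phi> = sw y1 (\<lambda>p q. sw (T p) (\<lambda>a2 a3. E t (T a3 \<otimes> y2 \<otimes> T q) (\<lambda>b. \<phi> (a2 \<otimes> b))))"
      unfolding La_def using m t by (intro sw_T) (simp_all add: lform_sw[of "\<lambda>x. x"])
    also have "\<dots> = sw y1 (\<lambda>p q. sw p (\<lambda>p1 p2. E t (T (T p1) \<otimes> y2 \<otimes> T q) (\<lambda>b. \<phi> (T p2 \<otimes> b))))"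
      using m t by (intro sw_cong[OF refl] sw_T) simp_all
    finally show "La (T y1) t y2 \<phi> = sw y1 (\<lambda>p q. sw p (\<lambda>p1 p2.
      E t (T (T p1) \<otimes> (y2 \<otimes> T q)) (\<lambda>b. \<phi> (T p2 \<otimes> b))))" using m by (simp add: m_assoc)
  qed
  also have "\<dots> = sw y (\<lambda>p w. sw w (\<lambda>q y2. sw p (\<lambda>p1 p2.
      E t (T (T p1) \<otimes> (y2 \<otimes> T q)) (\<lambda>b. \<phi> (T p2 \<otimes> b)))))"
    by (rule sw_coassoc[OF y])
  also have "\<dots> = sw y (\<lambda>p w. \<epsilon> w * sw p (\<lambda>p1 p2. E t (T (T p1)) (\<lambda>b. \<phi> (T p2 \<otimes> b))))"
    using t by (intro sw_cong[OF refl])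
      (simp add: sw_T_right[where \<phi> = "\<lambda>z. sw _ (\<lambda>p1 p2. E t (T (T p1) \<otimes> z) (\<lambda>b. \<phi> (T p2 \<otimes> b)))"])
  also have "\<dots> = sw y (\<lambda>y1 y2. E t (T (T y1)) (\<lambda>b. \<phi> (T y2 \<otimes> b)))"
    using y by (intro sw_counit_right lform_sw) simp_all
  finally show ?thesis .
qed

lemma La_u:
  assumes a: "a \<in> carrier A" and y: "y \<in> carrier A" and \<phi>: "lform A \<phi>"
  shows "La a u y \<phi> = \<phi> (T y \<otimes> T (T a))"
proof -
  note [simp] = lform_comp[OF \<phi>]
  have "La a u y \<phi> = sw a (\<lambda>a1 r. sw r (\<lambda>a2 a3. \<phi> ((a2 \<otimes> T a1) \<otimes> (T y \<otimes> T (T a3)))))"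
    using a y by (simp add: La_def T_mult m_assoc)
  also have "\<dots> = sw a (\<lambda>w a3. sw w (\<lambda>a1 a2. \<phi> ((a2 \<otimes> T a1) \<otimes> (T y \<otimes> T (T a3)))))"
    by (rule sw_coassoc[OF a, symmetric])
  also have "\<dots> = sw a (\<lambda>w a3. \<epsilon> w * \<phi> (T y \<otimes> T (T a3)))"
    using y by (intro sw_cong[OF refl])
      (simp add: sw_T_right[where \<phi> = "\<lambda>z. \<phi> (z \<otimes> (T y \<otimes> T (T _)))"])
  also have "\<dots> = \<phi> (T y \<otimes> T (T a))"
    using a y by (simp add: sw_counit_left[where \<phi> = "\<lambda>z. \<phi> (T y \<otimes> T (T z))"])
  finally show ?thesis .
qed

text \<open>The inverse of \<open>u\<close>; as a map it is the square of the antipode.\<close>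

definition ui :: "('k, 'a \<Rightarrow> 'k, 'a) tensor" where
  "ui = (\<Sum>b\<in>B. bow (e b) (S (S b)))"

lemma ui_closed [simp]: "ui \<in> carrier DT"
  unfolding ui_def by (intro vspace_sum_closed vspace_DT) simp

lemma E_ui [simp]: "y \<in> carrier A \<Longrightarrow> lform A \<phi> \<Longrightarrow> E ui y \<phi> = \<phi> (S (S y))"
  using lform_comp[of A \<phi> "\<lambda>b. S (S b)"]
  by (simp add: ui_def E_sum_left lform_expand[where f = "\<lambda>b. \<phi> (S (S b))"])

lemma u_ui: "u \<otimes>\<^bsub>D\<^esub> ui = \<one>\<^bsub>D\<^esub>"
proof (rule DT_eqI)
  fix y \<phi> assume y: "y \<in> carrier A" and \<phi>: "lform A \<phi>"
  note [simp] = lform_comp[OF \<phi>]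
  show "E (u \<otimes>\<^bsub>D\<^esub> ui) y \<phi> = E \<one>\<^bsub>D\<^esub> y \<phi>"
    using y \<phi> by (simp add: E_u_mult sw_T_left)
qed (simp_all add: mult_D_closed)

lemma ui_u: "ui \<otimes>\<^bsub>D\<^esub> u = \<one>\<^bsub>D\<^esub>"
proof (rule DT_eqI)
  fix y \<phi> assume y: "y \<in> carrier A" and \<phi>: "lform A \<phi>"
  note [simp] = lform_comp[OF \<phi>]
  show "E (ui \<otimes>\<^bsub>D\<^esub> u) y \<phi> = E \<one>\<^bsub>D\<^esub> y \<phi>"
    using y \<phi> by (simp add: E_mult La_u sw_T_left)
qed (simp_all add: mult_D_closed)

text \<open>
  Conjugation by \<open>u\<close> is the square of the antipode, here on \<open>A\<close> and in the next lemma on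
  the dual.
\<close>

lemma u_hA: "a \<in> carrier A \<Longrightarrow> u \<otimes>\<^bsub>D\<^esub> hA a = hA (S (S a)) \<otimes>\<^bsub>D\<^esub> u"
proof (rule DT_eqI)
  fix y \<phi> assume a: "a \<in> carrier A" and y: "y \<in> carrier A" and \<phi>: "lform A \<phi>"
  note [simp] = lform_comp[OF \<phi>]
  show "E (u \<otimes>\<^bsub>D\<^esub> hA a) y \<phi> = E (hA (S (S a)) \<otimes>\<^bsub>D\<^esub> u) y \<phi>"
    using a y \<phi> by (simp add: E_mult_right_hA E_mult_hA La_u)
qed (simp_all add: mult_D_closed)

lemma u_dl: "f \<in> carrier DA \<Longrightarrow> u \<otimes>\<^bsub>D\<^esub> dl f = dl (fT (fT f)) \<otimes>\<^bsub>D\<^esub> u"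
proof (rule DT_eqI)
  fix y \<phi> assume f: "f \<in> carrier DA" and y: "y \<in> carrier A" and \<phi>: "lform A \<phi>"
  note [simp] = lform_comp[OF \<phi>]
  show "E (u \<otimes>\<^bsub>D\<^esub> dl f) y \<phi> = E (dl (fT (fT f)) \<otimes>\<^bsub>D\<^esub> u) y \<phi>"
    using f y \<phi> by (simp add: E_u_mult E_mult_dual)
qed (simp_all add: mult_D_closed)

lemma counit_u: "counit D u = 1" and counit_ui: "counit D ui = 1"
  by (simp_all add: counit_D counit_one)

text \<open>The monodromy element \<open>R\<^sub>2\<^sub>1 R\<close>.\<close>

definition QQ :: "('k, ('k, 'a \<Rightarrow> 'k, 'a) tensor, ('k, 'a \<Rightarrow> 'k, 'a) tensor) tensor" where
  "QQ = tflip D RR \<otimes>\<^bsub>DD\<^esub> RR"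

lemma QQ_closed [simp]: "QQ \<in> carrier DD"
  by (simp add: QQ_def DD.tensor_mult_closed)

lemma tflip_one: "tflip D \<one>\<^bsub>DD\<^esub> = \<one>\<^bsub>DD\<^esub>"
  by (simp add: one_tensor)

lemma QQ_unit: "QQ \<in> Units DD"
proof -
  obtain R' where R': "R' \<in> carrier DD" "RR \<otimes>\<^bsub>DD\<^esub> R' = \<one>\<^bsub>DD\<^esub>" "R' \<otimes>\<^bsub>DD\<^esub> RR = \<one>\<^bsub>DD\<^esub>"
    using R_invertible by (auto simp: Units_def)
  have "tflip D RR \<otimes>\<^bsub>DD\<^esub> tflip D R' = \<one>\<^bsub>DD\<^esub>" "tflip D R' \<otimes>\<^bsub>DD\<^esub> tflip D RR = \<one>\<^bsub>DD\<^esub>"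
    using tflip_mult[OF RR_closed R'(1)] tflip_mult[OF R'(1) RR_closed] R'(2,3) tflip_one
    by (simp_all only:)
  then have "tflip D RR \<in> Units DD"
    using R' unfolding Units_def by (auto intro!: bexI[of _ "tflip D R'"])
  then show ?thesis unfolding QQ_def using R_invertible by (rule DDA.Units_m_closed)
qed

text \<open>
  The monodromy commutes with every coproduct, since \<open>R\<close> and \<open>R\<^sub>2\<^sub>1\<close> each
  exchange the coproduct with its opposite.
\<close>

lemma QQ_comult:
  assumes t: "t \<in> carrier DT"
  shows "QQ \<otimes>\<^bsub>DD\<^esub> comult D t = comult D t \<otimes>\<^bsub>DD\<^esub> QQ"
proof -
  have cl: "tflip D (comult D t) \<in> carrier DD" "comult D t \<in> carrier DD" "tflip D RR \<in> carrier DD"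
    using t by simp_all
  have f: "tflip D RR \<otimes>\<^bsub>DD\<^esub> tflip D (comult D t) = comult D t \<otimes>\<^bsub>DD\<^esub> tflip D RR"
  proof -
    have "tflip D RR \<otimes>\<^bsub>DD\<^esub> tflip D (comult D t) = tflip D (RR \<otimes>\<^bsub>DD\<^esub> comult D t)"
      using t by (simp add: tflip_mult)
    also have "\<dots> = tflip D (tflip D (comult D t) \<otimes>\<^bsub>DD\<^esub> RR)" using t by (simp add: R_comult)
    also have "\<dots> = comult D t \<otimes>\<^bsub>DD\<^esub> tflip D RR"
      using t by (simp add: tflip_mult tflip_tflip)
    finally show ?thesis .
  qed
  have "QQ \<otimes>\<^bsub>DD\<^esub> comult D t = tflip D RR \<otimes>\<^bsub>DD\<^esub> (RR \<otimes>\<^bsub>DD\<^esub> comult D t)"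
    unfolding QQ_def using cl by (simp add: DDA.m_assoc)
  also have "\<dots> = (tflip D RR \<otimes>\<^bsub>DD\<^esub> tflip D (comult D t)) \<otimes>\<^bsub>DD\<^esub> RR"
    using t cl by (simp add: R_comult DDA.m_assoc)
  also have "\<dots> = comult D t \<otimes>\<^bsub>DD\<^esub> QQ"
    unfolding f QQ_def using cl by (simp add: DDA.m_assoc)
  finally show ?thesis .
qed

lemma E2_R_comult_u:
  assumes y: "y \<in> carrier A" and z: "z \<in> carrier A" and G: "bform A G"
  shows "E2 (RR \<otimes>\<^bsub>DD\<^esub> comult D u) y z G = sw y (\<lambda>y1 y2. G (T y2) (T z \<otimes> T y1))"
proof -
  note [simp] = lform_bform1[OF G] lform_bform2[OF G]
  have "E2 (RR \<otimes>\<^bsub>DD\<^esub> comult D u) y z G =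
      sw z (\<lambda>z1 z2. sw (T z1 \<otimes> T y) (\<lambda>a1 a2. G (z2 \<otimes> a1) a2))"
    using y z G lform_sw[OF lmap_id] by (simp add: E2_R_comult T_mult)
  also have "\<dots> = sw z (\<lambda>z1 z2. sw z1 (\<lambda>p q. sw y (\<lambda>y1 y2. G ((z2 \<otimes> T q) \<otimes> T y2) (T p \<otimes> T y1))))"
  proof (rule sw_cong[OF refl])
    fix z1 z2 assume m: "z1 \<in> B" "z2 \<in> B"
    have "sw (T z1 \<otimes> T y) (\<lambda>a1 a2. G (z2 \<otimes> a1) a2) =
        sw (T z1) (\<lambda>p q. sw (T y) (\<lambda>r s. G (z2 \<otimes> (p \<otimes> r)) (q \<otimes> s)))"
      using m y by (intro sw_mult) simp_all
    also have "\<dots> = sw z1 (\<lambda>p q. sw (T y) (\<lambda>r s. G (z2 \<otimes> (T q \<otimes> r)) (T p \<otimes> s)))"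
      using m y by (intro sw_T) simp_all
    also have "\<dots> = sw z1 (\<lambda>p q. sw y (\<lambda>y1 y2. G (z2 \<otimes> (T q \<otimes> T y2)) (T p \<otimes> T y1)))"
      using m y by (intro sw_cong[OF refl] sw_T) simp_all
    finally show "sw (T z1 \<otimes> T y) (\<lambda>a1 a2. G (z2 \<otimes> a1) a2) =
        sw z1 (\<lambda>p q. sw y (\<lambda>y1 y2. G ((z2 \<otimes> T q) \<otimes> T y2) (T p \<otimes> T y1)))"
      using m y by (simp add: m_assoc)
  qed
  also have "\<dots> = sw z (\<lambda>p w. sw w (\<lambda>q z2. sw y (\<lambda>y1 y2. G ((z2 \<otimes> T q) \<otimes> T y2) (T p \<otimes> T y1))))"
    by (rule sw_coassoc[OF z])
  also have "\<dots> = sw z (\<lambda>p w. \<epsilon> w * sw y (\<lambda>y1 y2. G (T y2) (T p \<otimes> T y1)))"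
    using y by (intro sw_cong[OF refl])
      (simp add: sw_T_right[where \<phi> = "\<lambda>v. sw y (\<lambda>y1 y2. G (v \<otimes> T y2) (T _ \<otimes> T y1))"])
  also have "\<dots> = sw y (\<lambda>y1 y2. G (T y2) (T z \<otimes> T y1))"
    using y z by (intro sw_counit_right[where \<phi> = "\<lambda>p. sw y (\<lambda>y1 y2. G (T y2) (T p \<otimes> T y1))"]) simp_all
  finally show ?thesis .
qed

text \<open>
  The coproduct of \<open>u\<close>: as a map, \<open>R \<Delta>(u)\<close> has a closed form, and multiplication by
  \<open>R\<^sub>2\<^sub>1\<close> removes the remaining dependence between the two values.
\<close>

theorem QQ_comult_u: "QQ \<otimes>\<^bsub>DD\<^esub> comult D u = tens D D u u"
proof -
  define Y where "Y = RR \<otimes>\<^bsub>DD\<^esub> comult D u"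
  have Y: "Y \<in> carrier DD" by (simp add: Y_def DD.tensor_mult_closed)
  have "tflip D RR \<otimes>\<^bsub>DD\<^esub> Y = tens D D u u"
  proof (rule DD_eqI)
    fix y z G assume y: "y \<in> carrier A" and z: "z \<in> carrier A" and G: "bform A G"
    note [simp] = lform_bform1[OF G] lform_bform2[OF G]
    have bG: "bform A (\<lambda>a b. G b a)" using G by (simp add: bform_def)
    have G1: "lform A (G b)" "lform A (\<lambda>a. G a b)" if "b \<in> carrier A" for b
      using G that by (auto simp: bform_def)
    have "E2 (tflip D RR \<otimes>\<^bsub>DD\<^esub> Y) y z G = E2 (tflip D (RR \<otimes>\<^bsub>DD\<^esub> tflip D Y)) y z G"
      using Y by (simp add: tflip_mult tflip_tflip)
    also have "\<dots> = sw y (\<lambda>y1 y2. sw y1 (\<lambda>b1 r. sw r (\<lambda>b2 b3.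
        E2 Y y2 (T b3 \<otimes> z \<otimes> b1) (\<lambda>d c. G d (b2 \<otimes> c)))))"
      using Y y z bG by (simp add: E2_tflip E2_R_mult DD.tensor_mult_closed)
    also have "\<dots> = sw y (\<lambda>y1 y2. sw y1 (\<lambda>b1 r. sw r (\<lambda>b2 b3. sw y2 (\<lambda>v1 v2.
        G (T v2) (b2 \<otimes> (T b1 \<otimes> (T z \<otimes> T (v1 \<otimes> T b3))))))))"
      unfolding Y_def using z by (simp add: E2_R_comult_u T_mult m_assoc)
    also have "\<dots> = sw y (\<lambda>b1 q. sw q (\<lambda>r y2. sw r (\<lambda>b2 b3. sw y2 (\<lambda>v1 v2.
        G (T v2) (b2 \<otimes> (T b1 \<otimes> (T z \<otimes> T (v1 \<otimes> T b3))))))))"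
      by (rule sw_coassoc[OF y])
    also have "\<dots> = sw y (\<lambda>b1 q. sw q (\<lambda>b2 q'. sw q' (\<lambda>b3 y2. sw y2 (\<lambda>v1 v2.
        G (T v2) (b2 \<otimes> (T b1 \<otimes> (T z \<otimes> T (v1 \<otimes> T b3))))))))"
      by (rule sw_cong[OF refl], rule sw_coassoc) simp
    also have "\<dots> = sw y (\<lambda>b1 q. sw q (\<lambda>b2 q'. sw q' (\<lambda>w v2. sw w (\<lambda>b3 v1.
        G (T v2) (b2 \<otimes> (T b1 \<otimes> (T z \<otimes> T (v1 \<otimes> T b3))))))))"
      by (rule sw_cong[OF refl], rule sw_cong[OF refl], rule sw_coassoc[symmetric]) simp
    also have "\<dots> = sw y (\<lambda>b1 q. sw q (\<lambda>b2 q'. sw q' (\<lambda>w v2. \<epsilon> w *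
        G (T v2) (b2 \<otimes> (T b1 \<otimes> T z)))))"
      using z by (intro sw_cong[OF refl])
        (simp add: sw_T_right[where \<phi> = "\<lambda>v. G (T _) (_ \<otimes> (T _ \<otimes> (T z \<otimes> T v)))"])
    also have "\<dots> = sw y (\<lambda>b1 q. sw q (\<lambda>b2 q'. G (T q') ((b2 \<otimes> T b1) \<otimes> T z)))"
      using z by (intro sw_cong[OF refl])
        (simp add: sw_counit_left[where \<phi> = "\<lambda>v. G (T v) (_ \<otimes> (T _ \<otimes> T z))"] m_assoc)
    also have "\<dots> = sw y (\<lambda>w q'. sw w (\<lambda>b1 b2. G (T q') ((b2 \<otimes> T b1) \<otimes> T z)))"
      by (rule sw_coassoc[OF y, symmetric])
    also have "\<dots> = sw y (\<lambda>w q'. \<epsilon> w * G (T q') (T z))"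
      using z by (intro sw_cong[OF refl])
        (simp add: sw_T_right[where \<phi> = "\<lambda>v. G (T _) (v \<otimes> T z)"])
    also have "\<dots> = G (T y) (T z)"
      using y z by (simp add: sw_counit_left[where \<phi> = "\<lambda>v. G (T v) (T z)"])
    also have "\<dots> = E2 (tens D D u u) y z G" using y z G1 by simp
    finally show "E2 (tflip D RR \<otimes>\<^bsub>DD\<^esub> Y) y z G = E2 (tens D D u u) y z G" .
  qed (simp_all add: Y DD.tensor_mult_closed)
  then show ?thesis unfolding QQ_def Y_def by (simp add: DDA.m_assoc)
qed

section \<open>Grouplike elements of the double\<close>

definition grouplike :: "'a \<Rightarrow> bool" where
  "grouplike h \<longleftrightarrow> h \<in> carrier A \<and> comult A h = tens A A h h \<and> \<epsilon> h = 1"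

definition character :: "('a \<Rightarrow> 'k) \<Rightarrow> bool" where
  "character \<chi> \<longleftrightarrow> \<chi> \<in> carrier DA \<and> \<chi> \<one> = 1 \<and>
    (\<forall>a\<in>carrier A. \<forall>b\<in>carrier A. \<chi> (a \<otimes> b) = \<chi> a * \<chi> b)"

definition D_grouplike :: "('k, 'a \<Rightarrow> 'k, 'a) tensor \<Rightarrow> bool" where
  "D_grouplike t \<longleftrightarrow> t \<in> carrier DT \<and> comult D t = tens D D t t \<and> counit D t = 1"

lemma grouplike_closed [simp]: "grouplike h \<Longrightarrow> h \<in> carrier A"
  by (simp add: grouplike_def)

lemma character_closed [simp]: "character \<chi> \<Longrightarrow> \<chi> \<in> carrier DA"
  by (simp add: character_def)

lemma sw_grouplike: "grouplike h \<Longrightarrow> bform A G \<Longrightarrow> sw h G = G h h"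
  by (metis comult_sw tens_apply bform_bilinear grouplike_def)

lemma grouplike_T:
  assumes "grouplike h"
  shows "T h \<otimes> h = \<one>" and "h \<otimes> T h = \<one>"
proof -
  have "e b (T h \<otimes> h) = e b \<one>" "e b (h \<otimes> T h) = e b \<one>" for b
    using sw_T_left[of h "e b"] sw_T_right[of h "e b"] sw_grouplike[OF assms, of "\<lambda>x y. e b (T y \<otimes> x)"]
      sw_grouplike[OF assms, of "\<lambda>x y. e b (y \<otimes> T x)"] assms by (simp_all add: grouplike_def)
  then show "T h \<otimes> h = \<one>" "h \<otimes> T h = \<one>" using assms by (auto intro: carrier_eqI)
qed

lemma D_grouplike_bow:
  assumes "character \<chi>" "grouplike h"
  shows "D_grouplike (bow \<chi> h)"
  unfolding D_grouplike_def
proof (intro conjI)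
  show "counit D (bow \<chi> h) = 1" using assms by (simp add: counit_D_bow character_def grouplike_def)
  show "comult D (bow \<chi> h) = tens D D (bow \<chi> h) (bow \<chi> h)"
  proof (rule DD_eqI)
    fix y z G assume y: "y \<in> carrier A" and z: "z \<in> carrier A" and G: "bform A G"
    have G1: "lform A (G b)" "lform A (\<lambda>a. G a b)" if "b \<in> carrier A" for b
      using G that by (auto simp: bform_def)
    show "E2 (comult D (bow \<chi> h)) y z G = E2 (tens D D (bow \<chi> h) (bow \<chi> h)) y z G"
      using assms y z G G1 lform_sw[OF lmap_id, of G]
      by (simp add: E2_comult sw_grouplike character_def)
  qed (use assms in simp_all)
qed (use assms in simp)

text \<open>
  For a group-like \<open>t\<close> the formula for its coproduct as a map says
  \<open>\<Delta>(t(zy)) = t(y) \<otimes> t(z)\<close>. Applying the counit to one side shows that the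
  map has rank one, and the same identity makes its two factors a character and a
  group-like element.
\<close>

theorem D_grouplike_split:
  assumes t: "D_grouplike t"
  obtains \<chi> h where "character \<chi>" "grouplike h" "t = bow \<chi> h"
proof -
  have tD: "t \<in> carrier DT" and tc: "comult D t = tens D D t t" and t1: "E t \<one> \<epsilon> = 1"
    using t by (auto simp: D_grouplike_def counit_D)
  have key: "E t (z \<otimes> y) (\<lambda>a. sw a G) = E t y (\<lambda>a. E t z (\<lambda>b. G a b))"
    if "y \<in> carrier A" "z \<in> carrier A" for y z G
    using E2_comult[OF tD that, of G] tD by (simp add: tc)
  (* The two factors of a rank-one map: its composite with the counit and its value at 1. *)
  define \<chi> where "\<chi> = on_carrier A (\<lambda>y. E t y \<epsilon>)"
  define h where "h = (\<Sum>b\<in>B. scal A (E t \<one> (e b)) b)"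
  have \<chi>m: "\<chi> \<in> carrier DA" unfolding \<chi>_def using lform_E_arg[OF tD lmap_id] by simp
  have hm: "h \<in> carrier A" unfolding h_def by (intro vspace_sum_closed vspace_A) simp
  have h: "\<phi> h = E t \<one> \<phi>" if "lform A \<phi>" for \<phi>
  proof -
    have "\<phi> h = (\<Sum>b\<in>B. E t \<one> (e b) * \<phi> b)"
      unfolding h_def using that
      by (subst linear_on_sum[of A "(*)" \<phi>]) (auto simp: lform_def linear_on_def)
    then show ?thesis by (simp add: E_e_sum)
  qed
  have teq: "t = bow \<chi> h"
  proof (rule DT_eqI[OF tD bow_mem[OF \<chi>m hm]])
    fix y \<phi> assume y: "y \<in> carrier A" and p: "lform A \<phi>"
    have "E t y \<phi> = E t (\<one> \<otimes> y) (\<lambda>a. sw a (\<lambda>a1 a2. \<epsilon> a1 * \<phi> a2))"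
      using y p by (simp add: sw_counit_left)
    also have "\<dots> = E t y (\<lambda>a. E t \<one> (\<lambda>b. \<epsilon> a * \<phi> b))" using y by (intro key) simp_all
    also have "\<dots> = \<chi> y * \<phi> h" using y p by (simp add: h E_scale E_scale' \<chi>_def)
    finally show "E t y \<phi> = E (bow \<chi> h) y \<phi>" using \<chi>m hm p by simp
  qed
  have ch: "character \<chi>"
    unfolding character_def
  proof (intro conjI ballI \<chi>m)
    show "\<chi> \<one> = 1" using t1 by (simp add: \<chi>_def)
    fix z y assume m: "z \<in> carrier A" "y \<in> carrier A"
    have "\<chi> (z \<otimes> y) = E t (z \<otimes> y) (\<lambda>a. sw a (\<lambda>a1 a2. \<epsilon> a1 * \<epsilon> a2))"
      using m by (simp add: \<chi>_def sw_counit_left)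
    also have "\<dots> = \<chi> z * \<chi> y" using m by (simp add: key E_scale E_scale' \<chi>_def)
    finally show "\<chi> (z \<otimes> y) = \<chi> z * \<chi> y" .
  qed
  have "grouplike h"
    unfolding grouplike_def
  proof (intro conjI hm)
    show "\<epsilon> h = 1" using t1 h[OF lform_counit'] by simp
    show "comult A h = tens A A h h"
    proof (rule tensor_eqI[OF comult_closed[OF hm] tens_closed[OF hm hm]])
      fix G assume "bilinear_on A A (*) G"
      then have G: "bform A G" by (simp add: bform_bilinear)
      have G1: "lform A (G b)" "lform A (\<lambda>a. G a b)" if "b \<in> carrier A" for b
        using G that by (auto simp: bform_def)
      have l: "lform A (\<lambda>a. sw a G)" using lform_sw[OF lmap_id] .
      have "comult A h G = E t (\<one> \<otimes> \<one>) (\<lambda>a. sw a G)" using G hm h[OF l] by (simp add: comult_sw)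
      also have "\<dots> = E t \<one> (\<lambda>a. E t \<one> (\<lambda>b. G a b))" by (rule key) simp_all
      also have "\<dots> = G h h" using h[OF G1(1), symmetric] h[OF G1(2)[OF hm], symmetric] by simp
      finally show "comult A h G = tens A A h h G" using G by (simp add: tens_apply bform_bilinear)
    qed
  qed
  then show thesis using that ch teq by blast
qed

lemma La_grouplike:
  assumes h: "grouplike h" and t: "t \<in> carrier DT" and y: "y \<in> carrier A" and \<phi>: "lform A \<phi>"
  shows "La h t y \<phi> = E t (T h \<otimes> y \<otimes> h) (\<lambda>b. \<phi> (h \<otimes> b))"
  unfolding La_def using assms lform_comp[OF \<phi>] by (simp add: sw_grouplike)

text \<open>
  Conjugation by a group-like element does not change the value of a character, so the
  twist in the multiplication is trivial here.
\<close>

lemma bow_grouplike_mult: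
  assumes "character \<chi>" "grouplike h" "character \<chi>'" "grouplike h'"
  shows "bow \<chi> h \<otimes>\<^bsub>D\<^esub> bow \<chi>' h' = bow (\<chi> \<otimes>\<^bsub>DA\<^esub> \<chi>') (h \<otimes> h')"
proof (rule DT_eqI)
  fix y \<phi> assume y: "y \<in> carrier A" and \<phi>: "lform A \<phi>"
  note [simp] = lform_comp[OF \<phi>]
  have hh: "\<chi>' (T h \<otimes> y2 \<otimes> h) = \<chi>' y2" if "y2 \<in> carrier A" for y2
  proof -
    have "\<chi>' (T h) * \<chi>' h = 1"
      using assms grouplike_T(1)[of h] by (metis T_closed character_def grouplike_closed)
    then show ?thesis using assms that unfolding character_def by simp
  qed
  have l: "lform A (\<lambda>a. La a t y2 \<phi>)" for t y2 by (simp add: lform_La_left[of "\<lambda>x. x"])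
  have "E (bow \<chi> h \<otimes>\<^bsub>D\<^esub> bow \<chi>' h') y \<phi> = sw y (\<lambda>y1 y2. \<chi> y1 * (\<chi>' y2 * \<phi> (h \<otimes> h')))"
    using assms y \<phi> l by (simp add: E_mult La_grouplike hh)
  also have "\<dots> = E (bow (\<chi> \<otimes>\<^bsub>DA\<^esub> \<chi>') (h \<otimes> h')) y \<phi>"
    using assms y \<phi> by (simp add: mult.assoc[symmetric] sw_scale')
  finally show "E (bow \<chi> h \<otimes>\<^bsub>D\<^esub> bow \<chi>' h') y \<phi> = E (bow (\<chi> \<otimes>\<^bsub>DA\<^esub> \<chi>') (h \<otimes> h')) y \<phi>" .
qed (use assms in \<open>simp_all add: mult_D_closed\<close>)

end

section \<open>Ribbon elements of the double\<close>

context fin_hopf_bij begin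

lemma SD_mult: "s \<in> carrier DT \<Longrightarrow> t \<in> carrier DT \<Longrightarrow> SD (s \<otimes>\<^bsub>D\<^esub> t) = SD t \<otimes>\<^bsub>D\<^esub> SD s"
  and SD_one: "SD \<one>\<^bsub>D\<^esub> = \<one>\<^bsub>D\<^esub>"
  and counit_SD: "t \<in> carrier DT \<Longrightarrow> counit D (SD t) = counit D t"
  and comult_SD_apply: "t \<in> carrier DT \<Longrightarrow> bform D G \<Longrightarrow>
    comult D (SD t) G = comult D t (\<lambda>x y. G (SD y) (SD x))"
proof -
  obtain BD where "fin_hopf D BD" using fin_hopf_D by blast
  then interpret F: fin_hopf D BD .
  show "SD (s \<otimes>\<^bsub>D\<^esub> t) = SD t \<otimes>\<^bsub>D\<^esub> SD s" if "s \<in> carrier DT" "t \<in> carrier DT"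
    using F.S_mult[of s t] that by (simp add: antipode_D)
  show "SD \<one>\<^bsub>D\<^esub> = \<one>\<^bsub>D\<^esub>" using F.S_one by (simp add: antipode_D)
  show "counit D (SD t) = counit D t" if "t \<in> carrier DT" using F.counit_S[of t] that by (simp add: antipode_D)
  show "comult D (SD t) G = comult D t (\<lambda>x y. G (SD y) (SD x))" if t: "t \<in> carrier DT" and G: "bform D G"
  proof -
    have "bform D (\<lambda>x y. G (SD y) (SD x))"
      using lform_SD[OF lform_bform_left[OF G SD_closed]] lform_SD[OF lform_bform_right[OF G SD_closed]]
      by (intro bformI) auto
    then show ?thesis
      using F.comult_sw[of "SD t" G] F.comult_sw[of t "\<lambda>x y. G (SD y) (SD x)"] F.sw_S[of t G] t G
      by (simp add: antipode_D)
  qed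
qed

text \<open>
  The anti-automorphism \<open>(S \<otimes> S) \<circ> flip\<close> of the tensor square.
\<close>

definition theta :: "('k, ('k, 'a \<Rightarrow> 'k, 'a) tensor, ('k, 'a \<Rightarrow> 'k, 'a) tensor) tensor \<Rightarrow>
    ('k, ('k, 'a \<Rightarrow> 'k, 'a) tensor, ('k, 'a \<Rightarrow> 'k, 'a) tensor) tensor" where
  "theta X = tsum D D X (\<lambda>x y. tens D D (SD y) (SD x))"

lemma theta_bilinear: "bilinear_on D D fun_scal (\<lambda>x y. tens D D (SD y) (SD x))"
  using bilinear_tens_comp[of D D SD D D SD] SD_linear by (auto simp: bilinear_on_def)

lemma theta_closed [simp]: "X \<in> carrier DD \<Longrightarrow> theta X \<in> carrier DD"
  unfolding theta_def by (intro tsum_closed vspace_tensor D.vsp) auto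

lemma theta_tens [simp]:
  "s \<in> carrier DT \<Longrightarrow> t \<in> carrier DT \<Longrightarrow> theta (tens D D s t) = tens D D (SD t) (SD s)"
  unfolding theta_def by (rule tsum_tens[OF _ _ theta_bilinear vector_space_fun_scal]) simp_all

lemma theta_linear: "linear_on DD fun_scal theta"
  using linear_on_tsum[OF D.vsp theta_bilinear vector_space_fun_scal] by (simp add: theta_def[abs_def])

lemma theta_comult:
  assumes t: "t \<in> carrier DT"
  shows "theta (comult D t) = comult D (SD t)"
proof (rule tensor_eqI)
  fix G assume "bilinear_on D D (*) G"
  then have G: "bform D G" by (simp add: bform_bilinear)
  have b: "bform D (\<lambda>x y. G (SD y) (SD x))"
    using lform_SD[OF lform_bform_left[OF G SD_closed]] lform_SD[OF lform_bform_right[OF G SD_closed]]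
    by (intro bformI) auto
  have "theta (comult D t) G = tsum D D (comult D t) (\<lambda>x y. G (SD y) (SD x))"
    unfolding theta_def tsum_fun_apply using t G
    by (intro tsum_cong[OF comult_D_closed]) (auto simp: tens_apply bform_bilinear)
  also have "\<dots> = comult D t (\<lambda>x y. G (SD y) (SD x))"
    using tsum_field[OF comult_D_closed[OF t]] b by (simp add: bform_bilinear)
  finally show "theta (comult D t) G = comult D (SD t) G" using t G by (simp add: comult_SD_apply)
qed (use t in simp_all)

lemma theta_mult:
  assumes X: "X \<in> carrier DD" and Y: "Y \<in> carrier DD"
  shows "theta (X \<otimes>\<^bsub>DD\<^esub> Y) = theta Y \<otimes>\<^bsub>DD\<^esub> theta X"
proof -
  have mr: "linear_on DD fun_scal (\<lambda>y. x \<otimes>\<^bsub>DD\<^esub> y)" and ml: "linear_on DD fun_scal (\<lambda>y. y \<otimes>\<^bsub>DD\<^esub> x)"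
    if "x \<in> carrier DD" for x
    using DDA.linear_mult_right[OF that] DDA.linear_mult_left[OF that] by simp_all
  note c = linear_on_comp[of DD DD _ fun_scal, simplified]
  note cl = DD.tensor_mult_closed
  have 1: "theta (tens D D s s' \<otimes>\<^bsub>DD\<^esub> Y) = theta Y \<otimes>\<^bsub>DD\<^esub> theta (tens D D s s')"
    if m: "s \<in> carrier DT" "s' \<in> carrier DT" for s s'
  proof (rule tensor_linear_eqI[OF Y D.vsp, where f = "\<lambda>Y. theta (tens D D s s' \<otimes>\<^bsub>DD\<^esub> Y)"
        and g = "\<lambda>Y. theta Y \<otimes>\<^bsub>DD\<^esub> theta (tens D D s s')"])
    have t: "tens D D s s' \<in> carrier DD" "tens D D (SD s') (SD s) \<in> carrier DD" using m by simp_all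
    show "linear_on DD fun_scal (\<lambda>Y. theta (tens D D s s' \<otimes>\<^bsub>DD\<^esub> Y))"
      by (rule c[OF mr[OF t(1)] cl[OF t(1)] theta_linear])
    show "linear_on DD fun_scal (\<lambda>Y. theta Y \<otimes>\<^bsub>DD\<^esub> theta (tens D D s s'))"
      using c[OF theta_linear theta_closed ml[OF t(2)]] m by simp
  qed (use m in \<open>simp add: mult_D_closed SD_mult\<close>)
  show ?thesis
  proof (rule tensor_linear_eqI[OF X D.vsp, where f = "\<lambda>X. theta (X \<otimes>\<^bsub>DD\<^esub> Y)"
        and g = "\<lambda>X. theta Y \<otimes>\<^bsub>DD\<^esub> theta X"])
    show "linear_on DD fun_scal (\<lambda>X. theta (X \<otimes>\<^bsub>DD\<^esub> Y))"
      by (rule c[OF ml[OF Y] cl[OF _ Y] theta_linear])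
    show "linear_on DD fun_scal (\<lambda>X. theta Y \<otimes>\<^bsub>DD\<^esub> theta X)"
      by (rule c[OF theta_linear theta_closed mr[OF theta_closed[OF Y]]])
  qed (use 1 in simp)
qed

lemma theta_tflip:
  assumes X: "X \<in> carrier DD"
  shows "theta (tflip D X) = tflip D (theta X)"
proof (rule tensor_linear_eqI[OF X D.vsp, where f = "\<lambda>X. theta (tflip D X)" and g = "\<lambda>X. tflip D (theta X)"])
  show "linear_on DD fun_scal (\<lambda>X. theta (tflip D X))" "linear_on DD fun_scal (\<lambda>X. tflip D (theta X))"
    using linear_on_comp[of DD DD "tflip D" fun_scal theta] linear_on_comp[of DD DD theta fun_scal "tflip D"]
      theta_linear tflip_linear by simp_all
qed simp

text \<open>
  The canonical tensor is fixed by \<open>S\<close> on one factor and its inverse transpose on the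
  other.
\<close>

lemma dual_basis_S:
  assumes P1: "\<And>f. f \<in> carrier DA \<Longrightarrow> lform A (\<lambda>x. P x f)"
    and P2: "\<And>x. x \<in> carrier A \<Longrightarrow> lform DA (P x)"
  shows "(\<Sum>b\<in>B. P (S b) (fT (e b))) = (\<Sum>b\<in>B. P b (e b))"
proof -
  have "(\<Sum>b\<in>B. P (S b) (fT (e b))) = (\<Sum>b\<in>B. \<Sum>d\<in>B. e b (T d) * P (S b) (e d))"
    using lform_dual_expand[OF P2 fT_mem[OF e_mem]] by (intro sum.cong refl) simp
  also have "\<dots> = (\<Sum>d\<in>B. \<Sum>b\<in>B. e b (T d) * P (S b) (e d))" by (rule sum.swap)
  also have "\<dots> = (\<Sum>d\<in>B. P (S (T d)) (e d))"
    using lform_comp[OF P1[OF e_mem], of S]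
    by (intro sum.cong refl lform_expand[where f = "\<lambda>b. P (S b) (e _)"]) simp_all
  finally show ?thesis by simp
qed

lemma theta_RR: "theta RR = tflip D RR"
proof (rule tensor_eqI)
  fix G assume "bilinear_on D D (*) G"
  then have G: "bform D G" by (simp add: bform_bilinear)
  have bt: "bilinear_on D D (*) (\<lambda>x y. tens D D (SD y) (SD x) G)"
    using theta_bilinear by (simp add: bilinear_on_def linear_on_def)
  have "theta RR G = (\<Sum>b\<in>B. G (dl (fT (e b))) (hA (S b)))"
    unfolding theta_def tsum_fun_apply tsum_RR[OF bt vector_space_field]
    using G by (simp add: SD_hA SD_dl tens_apply bform_bilinear)
  also have "\<dots> = (\<Sum>b\<in>B. G (dl (e b)) (hA b))"
    using bform_bow_left(2,3)[OF G] by (intro dual_basis_S[where P = "\<lambda>x f. G (dl f) (hA x)"]) simp_all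
  also have "\<dots> = tflip D RR G"
    using tsum_RR[OF tflip_bilinear vector_space_fun_scal] G
    by (simp add: tflip_def sum_fun_apply tens_apply bform_bilinear)
  finally show "theta RR G = tflip D RR G" .
qed simp_all

text \<open>
  The anti-automorphism exchanges \<open>R\<close> and \<open>R\<^sub>2\<^sub>1\<close> and reverses products, so it
  fixes the monodromy.
\<close>

lemma theta_QQ: "theta QQ = QQ"
  unfolding QQ_def by (simp add: theta_mult theta_RR theta_tflip tflip_tflip)

text \<open>
  The element \<open>u\<^sup>-\<^sup>1 S(u)\<close> is group-like: \<open>u\<close> and \<open>S(u)\<close> have the same
  coproduct formula because the monodromy is fixed by \<open>theta\<close> and commutes with all
  coproducts.
\<close>

theorem SD_u_split:
  obtains w where "D_grouplike w" "SD u = u \<otimes>\<^bsub>D\<^esub> w"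
proof
  define w where "w = ui \<otimes>\<^bsub>D\<^esub> SD u"
  have wD: "w \<in> carrier DT" by (simp add: w_def mult_D_closed)
  show uw: "SD u = u \<otimes>\<^bsub>D\<^esub> w"
    by (simp add: w_def u_ui mult_one_D flip: D_assoc)
  have cl: "tens D D u u \<in> carrier DD" "tens D D ui ui \<in> carrier DD" "comult D u \<in> carrier DD"
    "comult D w \<in> carrier DD" "comult D (SD u) \<in> carrier DD" using wD by simp_all
  (* theta maps u (x) u to S(u) (x) S(u), so this is the coproduct formula for S(u). *)
  have "theta (QQ \<otimes>\<^bsub>DD\<^esub> comult D u) = comult D (SD u) \<otimes>\<^bsub>DD\<^esub> QQ"
    by (simp add: theta_mult theta_comult theta_QQ)
  then have 1: "QQ \<otimes>\<^bsub>DD\<^esub> comult D (SD u) = tens D D (SD u) (SD u)"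
    by (simp add: QQ_comult_u QQ_comult)
  have "comult D (SD u) = comult D u \<otimes>\<^bsub>DD\<^esub> comult D w"
    unfolding uw using wD by (simp add: comult_D_mult)
  then have "tens D D (SD u) (SD u) = tens D D u u \<otimes>\<^bsub>DD\<^esub> comult D w"
    using 1 cl by (simp add: DDA.m_assoc flip: QQ_comult_u)
  then have "tens D D ui ui \<otimes>\<^bsub>DD\<^esub> tens D D (SD u) (SD u) = comult D w"
    using cl by (simp add: ui_u one_tensor[symmetric] flip: DDA.m_assoc)
  then have "comult D w = tens D D w w" by (simp add: w_def)
  then show "D_grouplike w"
    unfolding D_grouplike_def using wD by (simp add: w_def counit_D_mult counit_ui counit_SD counit_u)
qed

text \<open>
  Since \<open>S(f \<bowtie> a) = (1 \<bowtie> S a)(f \<circ> S\<^sup>-\<^sup>1 \<bowtie> 1)\<close>,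
  the map of \<open>S(u)\<close> is a sum over dual bases, that is, a trace.
\<close>

lemma E_SD_u:
  assumes y: "y \<in> carrier A" and \<phi>: "lform A \<phi>"
  shows "E (SD u) y \<phi> = (\<Sum>b\<in>B. sw b (\<lambda>a1 r. sw r (\<lambda>a2 a3.
    e b (T a1 \<otimes> (T y \<otimes> T (T a3))) * \<phi> a2)))"
proof -
  have "SD u = (\<Sum>b\<in>B. SD (bow (fT (e b)) b))"
    unfolding u_sum using SD_linear D.vsp by (intro linear_on_sum[of D fun_scal]) simp_all
  then have "E (SD u) y \<phi> = (\<Sum>b\<in>B. La (S b) (dl (fT (fT (e b)))) y \<phi>)"
    using y \<phi> by (simp add: E_sum_left SD_bow SDf_def E_mult_hA)
  also have "\<dots> = (\<Sum>b\<in>B. La b (dl (fT (e b))) y \<phi>)"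
  proof (rule dual_basis_S[where P = "\<lambda>x f. La x (dl (fT f)) y \<phi>"])
    show "lform A (\<lambda>x. La x (dl (fT f)) y \<phi>)" for f by (simp add: lform_La_left[of "\<lambda>x. x"])
    have "lform DA (\<lambda>f. La x (dl f) y \<phi>)" for x
    proof -
      have "lform D (\<lambda>t. La x t y \<phi>)" by (simp add: La_def)
      then show ?thesis by (rule lform_bow(2)) simp
    qed
    then show "lform DA (\<lambda>f. La x (dl (fT f)) y \<phi>)" for x by (rule lform_fT)
  qed
  also have "\<dots> = (\<Sum>b\<in>B. sw b (\<lambda>a1 r. sw r (\<lambda>a2 a3. e b (T a1 \<otimes> (T y \<otimes> T (T a3))) * \<phi> a2)))"
    using y \<phi> by (simp add: La_def lform_comp[OF \<phi>] T_mult)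
  finally show ?thesis .
qed

lemma character_T:
  assumes \<chi>: "character \<chi>" and h: "grouplike h"
  shows "\<chi> (T h) * \<chi> h = 1" and "\<chi> (T (T h)) = \<chi> h"
proof -
  have m: "\<chi> (a \<otimes> b) = \<chi> a * \<chi> b" if "a \<in> carrier A" "b \<in> carrier A" for a b
    using \<chi> that by (simp add: character_def)
  have o: "\<chi> \<one> = 1" using \<chi> by (simp add: character_def)
  show 1: "\<chi> (T h) * \<chi> h = 1" using m[of "T h" h] grouplike_T(1)[OF h] o h by simp
  have "T (T h) \<otimes> T h = \<one>" using grouplike_T(2)[OF h] h by (simp flip: T_mult)
  then have "\<chi> (T (T h)) * \<chi> (T h) = 1" using m[of "T (T h)" "T h"] o h by simp
  then show "\<chi> (T (T h)) = \<chi> h" using 1 by (metis mult.assoc mult.commute mult.right_neutral)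
qed

text \<open>
  Evaluated at a group-like element, the map of \<open>u (\<chi> \<bowtie> h)\<close> separates
  \<open>\<chi>\<close> from \<open>h\<close>. Comparison with the trace of \<open>S(u)\<close> identifies the group-like factor
  of \<open>S(u)\<close>.
\<close>

lemma E_u_bow_grouplike:
  assumes \<chi>: "character \<chi>" and h: "h \<in> carrier A" and y: "grouplike y" and \<phi>: "lform A \<phi>"
  shows "E (u \<otimes>\<^bsub>D\<^esub> bow \<chi> h) y \<phi> = \<chi> y * \<phi> (T y \<otimes> h)"
proof -
  note [simp] = lform_comp[OF \<phi>]
  have [simp]: "lform A (\<lambda>x. \<chi> (T (T x)))"
    using lform_comp[OF dual_lform[OF character_closed[OF \<chi>]], of "\<lambda>x. T (T x)"] by simp
  have "E (u \<otimes>\<^bsub>D\<^esub> bow \<chi> h) y \<phi> = sw y (\<lambda>y1 y2. \<chi> (T (T y1)) * \<phi> (T y2 \<otimes> h))"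
    using h y \<phi> \<chi> by (simp add: E_u_mult)
  also have "\<dots> = \<chi> (T (T y)) * \<phi> (T y \<otimes> h)"
    using h y by (intro sw_grouplike) simp_all
  finally show ?thesis using character_T(2)[OF \<chi> y] by simp
qed

lemma D_grouplike_inverse:
  assumes l: "D_grouplike l"
  shows "SD l \<otimes>\<^bsub>D\<^esub> l = \<one>\<^bsub>D\<^esub>" "l \<otimes>\<^bsub>D\<^esub> SD l = \<one>\<^bsub>D\<^esub>"
proof -
  have lD: "l \<in> carrier DT" using l by (simp add: D_grouplike_def)
  have b1: "bilinear_on D D fun_scal (\<lambda>x y. SD x \<otimes>\<^bsub>D\<^esub> y)"
  proof (rule bilinear_onI)
    show "linear_on D fun_scal (\<lambda>x. SD x \<otimes>\<^bsub>D\<^esub> y)" if "y \<in> carrier D" for y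
      using linear_on_comp[of D D SD fun_scal "\<lambda>x. x \<otimes>\<^bsub>D\<^esub> y"] SD_linear D.linear_mult_left[OF that] by simp
    show "linear_on D fun_scal (\<lambda>y. SD x \<otimes>\<^bsub>D\<^esub> y)" if "x \<in> carrier D" for x
      using D.linear_mult_right[of "SD x"] that by simp
  qed
  have b2: "bilinear_on D D fun_scal (\<lambda>x y. x \<otimes>\<^bsub>D\<^esub> SD y)"
  proof (rule bilinear_onI)
    show "linear_on D fun_scal (\<lambda>y. x \<otimes>\<^bsub>D\<^esub> SD y)" if "x \<in> carrier D" for x
      using linear_on_comp[of D D SD fun_scal "\<lambda>y. x \<otimes>\<^bsub>D\<^esub> y"] SD_linear D.linear_mult_right[OF that] by simp
    show "linear_on D fun_scal (\<lambda>x. x \<otimes>\<^bsub>D\<^esub> SD y)" if "y \<in> carrier D" for y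
      using D.linear_mult_left[of "SD y"] that by simp
  qed
  have "tsum D D (comult D l) (\<lambda>x y. SD x \<otimes>\<^bsub>D\<^esub> y) = \<one>\<^bsub>D\<^esub>"
    "tsum D D (comult D l) (\<lambda>x y. x \<otimes>\<^bsub>D\<^esub> SD y) = \<one>\<^bsub>D\<^esub>"
    using is_antipode_SD l lD by (auto simp: is_antipode_def D_grouplike_def fun_scal_def)
  moreover have "comult D l = tens D D l l" using l by (simp add: D_grouplike_def)
  ultimately show "SD l \<otimes>\<^bsub>D\<^esub> l = \<one>\<^bsub>D\<^esub>" "l \<otimes>\<^bsub>D\<^esub> SD l = \<one>\<^bsub>D\<^esub>"
    using lD tsum_tens[OF _ _ b1 vector_space_fun_scal, of l l] tsum_tens[OF _ _ b2 vector_space_fun_scal, of l l]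
    by simp_all
qed

lemma comult_u: "comult D u = inv\<^bsub>DD\<^esub> QQ \<otimes>\<^bsub>DD\<^esub> tens D D u u"
proof -
  have "inv\<^bsub>DD\<^esub> QQ \<otimes>\<^bsub>DD\<^esub> (QQ \<otimes>\<^bsub>DD\<^esub> comult D u) = comult D u"
    using DDA.Units_l_inv[OF QQ_unit] DDA.Units_inv_closed[OF QQ_unit]
    by (simp flip: DDA.m_assoc)
  then show ?thesis by (simp add: QQ_comult_u)
qed

text \<open>
  The coproduct formula for \<open>u l\<close> is that of \<open>u\<close> because \<open>l\<close> is group-like. The equations
  \<open>S(v) = v\<close> and \<open>v\<^sup>2 = u S(u)\<close> both restate \<open>S(u) = u l\<^sup>2\<close> once \<open>v = u l\<close> is
  central.
\<close>

theorem ribbon_criterion: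
  assumes l: "D_grouplike l"
    and Su: "SD u = u \<otimes>\<^bsub>D\<^esub> (l \<otimes>\<^bsub>D\<^esub> l)"
    and cA: "\<And>a. a \<in> carrier A \<Longrightarrow> (u \<otimes>\<^bsub>D\<^esub> l) \<otimes>\<^bsub>D\<^esub> hA a = hA a \<otimes>\<^bsub>D\<^esub> (u \<otimes>\<^bsub>D\<^esub> l)"
    and cD: "\<And>f. f \<in> carrier DA \<Longrightarrow> (u \<otimes>\<^bsub>D\<^esub> l) \<otimes>\<^bsub>D\<^esub> dl f = dl f \<otimes>\<^bsub>D\<^esub> (u \<otimes>\<^bsub>D\<^esub> l)"
  shows "ribbon_element D (double_R A) (u \<otimes>\<^bsub>D\<^esub> l)"
proof -
  define v where "v = u \<otimes>\<^bsub>D\<^esub> l"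
  have lD: "l \<in> carrier DT" using l by (simp add: D_grouplike_def)
  have vD: "v \<in> carrier DT" using lD by (simp add: v_def mult_D_closed)
  note cl = lD vD u_closed ui_closed SD_closed mult_D_closed
  note li = D_grouplike_inverse[OF l]
  have vi: "v \<otimes>\<^bsub>D\<^esub> (SD l \<otimes>\<^bsub>D\<^esub> ui) = \<one>\<^bsub>D\<^esub>" "(SD l \<otimes>\<^bsub>D\<^esub> ui) \<otimes>\<^bsub>D\<^esub> v = \<one>\<^bsub>D\<^esub>"
  proof -
    have "v \<otimes>\<^bsub>D\<^esub> (SD l \<otimes>\<^bsub>D\<^esub> ui) = u \<otimes>\<^bsub>D\<^esub> ((l \<otimes>\<^bsub>D\<^esub> SD l) \<otimes>\<^bsub>D\<^esub> ui)"
      by (simp add: v_def D_assoc cl)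
    then show "v \<otimes>\<^bsub>D\<^esub> (SD l \<otimes>\<^bsub>D\<^esub> ui) = \<one>\<^bsub>D\<^esub>" by (simp add: li mult_one_D u_ui)
    have "(SD l \<otimes>\<^bsub>D\<^esub> ui) \<otimes>\<^bsub>D\<^esub> v = SD l \<otimes>\<^bsub>D\<^esub> ((ui \<otimes>\<^bsub>D\<^esub> u) \<otimes>\<^bsub>D\<^esub> l)"
      by (simp add: v_def D_assoc cl)
    then show "(SD l \<otimes>\<^bsub>D\<^esub> ui) \<otimes>\<^bsub>D\<^esub> v = \<one>\<^bsub>D\<^esub>" by (simp add: li lD mult_one_D ui_u)
  qed
  have central: "v \<otimes>\<^bsub>D\<^esub> t = t \<otimes>\<^bsub>D\<^esub> v" if t: "t \<in> carrier DT" for t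
  proof (rule tensor_linear_eqI[OF t vspace_DA, where f = "\<lambda>t. v \<otimes>\<^bsub>D\<^esub> t" and g = "\<lambda>t. t \<otimes>\<^bsub>D\<^esub> v" and s = fun_scal])
    show "linear_on DT fun_scal (\<lambda>t. v \<otimes>\<^bsub>D\<^esub> t)" "linear_on DT fun_scal (\<lambda>t. t \<otimes>\<^bsub>D\<^esub> v)"
      using D.linear_mult_right[of v] D.linear_mult_left[of v] vD by (simp_all add: linear_on_def)
    fix f a assume f: "f \<in> carrier DA" and a: "a \<in> carrier A"
    have "v \<otimes>\<^bsub>D\<^esub> (dl f \<otimes>\<^bsub>D\<^esub> hA a) = (v \<otimes>\<^bsub>D\<^esub> dl f) \<otimes>\<^bsub>D\<^esub> hA a"
      using f a by (simp add: D_assoc cl)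
    also have "\<dots> = dl f \<otimes>\<^bsub>D\<^esub> (v \<otimes>\<^bsub>D\<^esub> hA a)"
      using f a cD[OF f] by (simp add: D_assoc cl v_def)
    also have "\<dots> = (dl f \<otimes>\<^bsub>D\<^esub> hA a) \<otimes>\<^bsub>D\<^esub> v"
      using f a cA[OF a] by (simp add: D_assoc cl v_def)
    finally show "v \<otimes>\<^bsub>D\<^esub> tens DA A f a = tens DA A f a \<otimes>\<^bsub>D\<^esub> v"
      using f a by (simp add: bow_split) (simp add: bowtie_def)
  qed
  have sq: "v \<otimes>\<^bsub>D\<^esub> v = u \<otimes>\<^bsub>D\<^esub> SD u"
  proof -
    have "v \<otimes>\<^bsub>D\<^esub> v = u \<otimes>\<^bsub>D\<^esub> (l \<otimes>\<^bsub>D\<^esub> v)" by (simp add: v_def D_assoc cl)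
    also have "\<dots> = u \<otimes>\<^bsub>D\<^esub> (v \<otimes>\<^bsub>D\<^esub> l)" using central[OF lD] by simp
    also have "\<dots> = u \<otimes>\<^bsub>D\<^esub> SD u" unfolding Su by (simp add: v_def D_assoc cl)
    finally show ?thesis .
  qed
  have Sv: "SD v = v"
  proof -
    have "SD v = SD l \<otimes>\<^bsub>D\<^esub> (v \<otimes>\<^bsub>D\<^esub> l)" using lD by (simp add: v_def SD_mult Su D_assoc cl)
    also have "\<dots> = (SD l \<otimes>\<^bsub>D\<^esub> l) \<otimes>\<^bsub>D\<^esub> v" using central[OF lD] by (simp add: D_assoc cl)
    finally show ?thesis by (simp add: li vD mult_one_D)
  qed
  have cv: "comult D v = inv\<^bsub>DD\<^esub> QQ \<otimes>\<^bsub>DD\<^esub> tens D D v v"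
  proof -
    have "comult D v = (inv\<^bsub>DD\<^esub> QQ \<otimes>\<^bsub>DD\<^esub> tens D D u u) \<otimes>\<^bsub>DD\<^esub> tens D D l l"
      using l lD by (simp add: v_def comult_D_mult comult_u D_grouplike_def)
    also have "\<dots> = inv\<^bsub>DD\<^esub> QQ \<otimes>\<^bsub>DD\<^esub> (tens D D u u \<otimes>\<^bsub>DD\<^esub> tens D D l l)"
      using lD DDA.Units_inv_closed[OF QQ_unit] by (intro DDA.m_assoc) simp_all
    finally show ?thesis using lD by (simp add: v_def)
  qed
  have "counit D v = 1" using l lD by (simp add: v_def counit_D_mult counit_u D_grouplike_def)
  moreover have "v \<in> Units D"
    unfolding Units_def using vD vi cl by (auto intro!: bexI[of _ "SD l \<otimes>\<^bsub>D\<^esub> ui"])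
  ultimately show ?thesis
    unfolding ribbon_element_def double_R_eq v_def[symmetric]
    using quasitriangular_D central sq Sv cv by (simp add: antipode_D QQ_def u_def)
qed

text \<open>
  Put \<open>t = v\<^sup>-\<^sup>1 v'\<close>. The common coproduct formula cancels the monodromy, so
  \<open>t\<close> is group-like; the common square \<open>u S(u)\<close> and centrality give \<open>t\<^sup>2 = 1\<close>.
\<close>

theorem ribbon_difference:
  assumes v: "ribbon_element D (double_R A) v" and v': "ribbon_element D (double_R A) v'"
  obtains t where "D_grouplike t" "t \<otimes>\<^bsub>D\<^esub> t = \<one>\<^bsub>D\<^esub>" "v' = v \<otimes>\<^bsub>D\<^esub> t"
proof
  have vU: "v \<in> Units D" and vc: "\<And>t. t \<in> carrier DT \<Longrightarrow> v \<otimes>\<^bsub>D\<^esub> t = t \<otimes>\<^bsub>D\<^esub> v"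
    and vs: "v \<otimes>\<^bsub>D\<^esub> v = u \<otimes>\<^bsub>D\<^esub> SD u" and v1: "counit D v = 1"
    and vcom: "comult D v = inv\<^bsub>DD\<^esub> QQ \<otimes>\<^bsub>DD\<^esub> tens D D v v"
    using v by (simp_all add: ribbon_element_def double_R_eq antipode_D u_def QQ_def)
  have vU': "v' \<in> Units D"
    and vs': "v' \<otimes>\<^bsub>D\<^esub> v' = u \<otimes>\<^bsub>D\<^esub> SD u" and v1': "counit D v' = 1"
    and vcom': "comult D v' = inv\<^bsub>DD\<^esub> QQ \<otimes>\<^bsub>DD\<^esub> tens D D v' v'"
    using v' by (simp_all add: ribbon_element_def double_R_eq antipode_D u_def QQ_def)
  define w where "w = inv\<^bsub>D\<^esub> v"
  have wv: "w \<otimes>\<^bsub>D\<^esub> v = \<one>\<^bsub>D\<^esub>" "v \<otimes>\<^bsub>D\<^esub> w = \<one>\<^bsub>D\<^esub>" and wD: "w \<in> carrier DT"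
    using D.Units_l_inv[OF vU] D.Units_r_inv[OF vU] D.Units_inv_closed[OF vU] by (simp_all add: w_def)
  have vD: "v \<in> carrier DT" and vD': "v' \<in> carrier DT"
    using D.Units_closed[OF vU] D.Units_closed[OF vU'] by simp_all
  define t where "t = w \<otimes>\<^bsub>D\<^esub> v'"
  have tD: "t \<in> carrier DT" using wD vD' by (simp add: t_def mult_D_closed)
  note cl = wD vD vD' tD mult_D_closed
  show vt: "v' = v \<otimes>\<^bsub>D\<^esub> t"
    by (simp add: t_def cl wv mult_one_D flip: D_assoc)
  have cancel: "x = y" if "v \<otimes>\<^bsub>D\<^esub> x = v \<otimes>\<^bsub>D\<^esub> y" "x \<in> carrier DT" "y \<in> carrier DT" for x y
  proof -
    have "x = w \<otimes>\<^bsub>D\<^esub> (v \<otimes>\<^bsub>D\<^esub> x)" if "x \<in> carrier DT" for x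
      using that by (simp add: wv mult_one_D cl flip: D_assoc)
    then show ?thesis using that by metis
  qed
  have "v \<otimes>\<^bsub>D\<^esub> (v \<otimes>\<^bsub>D\<^esub> (t \<otimes>\<^bsub>D\<^esub> t)) = v' \<otimes>\<^bsub>D\<^esub> v'"
  proof -
    have "v' \<otimes>\<^bsub>D\<^esub> v' = v \<otimes>\<^bsub>D\<^esub> ((t \<otimes>\<^bsub>D\<^esub> v) \<otimes>\<^bsub>D\<^esub> t)" by (simp add: vt D_assoc cl)
    also have "\<dots> = v \<otimes>\<^bsub>D\<^esub> ((v \<otimes>\<^bsub>D\<^esub> t) \<otimes>\<^bsub>D\<^esub> t)" by (simp only: vc[OF tD])
    also have "\<dots> = v \<otimes>\<^bsub>D\<^esub> (v \<otimes>\<^bsub>D\<^esub> (t \<otimes>\<^bsub>D\<^esub> t))" by (simp add: D_assoc cl)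
    finally show ?thesis ..
  qed
  also have "\<dots> = v \<otimes>\<^bsub>D\<^esub> (v \<otimes>\<^bsub>D\<^esub> \<one>\<^bsub>D\<^esub>)" unfolding vs' vs[symmetric] one_mult_D[OF vD] ..
  finally have "v \<otimes>\<^bsub>D\<^esub> (v \<otimes>\<^bsub>D\<^esub> (t \<otimes>\<^bsub>D\<^esub> t)) = v \<otimes>\<^bsub>D\<^esub> (v \<otimes>\<^bsub>D\<^esub> \<one>\<^bsub>D\<^esub>)" .
  then have "v \<otimes>\<^bsub>D\<^esub> (t \<otimes>\<^bsub>D\<^esub> t) = v \<otimes>\<^bsub>D\<^esub> \<one>\<^bsub>D\<^esub>" by (rule cancel) (simp_all add: cl)
  then show "t \<otimes>\<^bsub>D\<^esub> t = \<one>\<^bsub>D\<^esub>" by (rule cancel) (simp_all add: cl)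
  have "counit D t = 1" using v1' v1 counit_D_mult[OF vD tD] vt by simp
  moreover have "comult D t = tens D D t t"
  proof -
    have cc: "comult D v \<in> carrier DD" "comult D w \<in> carrier DD" "comult D t \<in> carrier DD"
      "tens D D t t \<in> carrier DD" "tens D D v v \<in> carrier DD" "inv\<^bsub>DD\<^esub> QQ \<in> carrier DD"
      using cl DDA.Units_inv_closed[OF QQ_unit] by simp_all
    have "comult D v \<otimes>\<^bsub>DD\<^esub> comult D t = comult D v'" unfolding vt by (simp add: comult_D_mult cl)
    also have "\<dots> = inv\<^bsub>DD\<^esub> QQ \<otimes>\<^bsub>DD\<^esub> (tens D D v v \<otimes>\<^bsub>DD\<^esub> tens D D t t)"
      unfolding vcom' by (simp add: vt cl)
    also have "\<dots> = comult D v \<otimes>\<^bsub>DD\<^esub> tens D D t t" unfolding vcom using cc by (simp add: DDA.m_assoc)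
    finally have "comult D w \<otimes>\<^bsub>DD\<^esub> (comult D v \<otimes>\<^bsub>DD\<^esub> comult D t) = comult D w \<otimes>\<^bsub>DD\<^esub> (comult D v \<otimes>\<^bsub>DD\<^esub> tens D D t t)"
      by simp
    moreover have "comult D w \<otimes>\<^bsub>DD\<^esub> comult D v = \<one>\<^bsub>DD\<^esub>"
      using comult_D_mult[OF wD vD] by (simp add: wv comult_D_one)
    ultimately show ?thesis using cc by (simp flip: DDA.m_assoc)
  qed
  ultimately show "D_grouplike t" using tD by (simp add: D_grouplike_def)
qed

text \<open>
  Conjugation by \<open>u\<close> is the square of the antipode, so \<open>u (\<chi> \<bowtie> h)\<close> is central
  when conjugation by \<open>\<chi> \<bowtie> h\<close> undoes it. This is that condition on \<open>y\<close>, moved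
  to one side so that it involves no inverse of \<open>\<chi>\<close>; it is multiplicative in \<open>y\<close> and
  has to be checked on generators only.
\<close>

definition implements_S2 :: "('a \<Rightarrow> 'k) \<Rightarrow> 'a \<Rightarrow> 'a \<Rightarrow> bool" where
  "implements_S2 \<chi> h y \<longleftrightarrow> (\<forall>\<psi>. lform A \<psi> \<longrightarrow>
    sw y (\<lambda>y1 y2. \<chi> y1 * \<psi> (T h \<otimes> y2 \<otimes> h)) = sw y (\<lambda>y1 y2. \<psi> (S (S y1)) * \<chi> y2))"

lemma implements_S2_mult:
  assumes \<chi>: "character \<chi>" and h: "grouplike h" and y: "y \<in> carrier A" and z: "z \<in> carrier A"
    and iy: "implements_S2 \<chi> h y" and iz: "implements_S2 \<chi> h z"
  shows "implements_S2 \<chi> h (y \<otimes> z)"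
  unfolding implements_S2_def
proof (intro allI impI)
  fix \<psi> assume \<psi>: "lform A \<psi>"
  note [simp] = lform_comp[OF \<psi>] lform_comp[OF dual_lform[OF character_closed[OF \<chi>]]]
  have \<chi>m: "\<chi> (a \<otimes> b) = \<chi> a * \<chi> b" if "a \<in> carrier A" "b \<in> carrier A" for a b
    using \<chi> that by (simp add: character_def)
  have hm [simp]: "h \<in> carrier A" using h by simp
  have conj: "T h \<otimes> (a \<otimes> b) \<otimes> h = (T h \<otimes> a \<otimes> h) \<otimes> (T h \<otimes> b \<otimes> h)" if "a \<in> carrier A" "b \<in> carrier A" for a b
  proof -
    have "(T h \<otimes> a \<otimes> h) \<otimes> (T h \<otimes> b \<otimes> h) = T h \<otimes> a \<otimes> ((h \<otimes> T h) \<otimes> (b \<otimes> h))"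
      using that by (simp add: m_assoc)
    then show ?thesis using that grouplike_T(2)[OF h] by (simp add: m_assoc)
  qed
  have "sw (y \<otimes> z) (\<lambda>y1 y2. \<chi> y1 * \<psi> (T h \<otimes> y2 \<otimes> h)) =
      sw y (\<lambda>y1 y2. sw z (\<lambda>z1 z2. \<chi> (y1 \<otimes> z1) * \<psi> (T h \<otimes> (y2 \<otimes> z2) \<otimes> h)))"
    using y z \<chi> by (intro sw_mult) simp_all
  also have "\<dots> = sw z (\<lambda>z1 z2. \<chi> z1 * sw y (\<lambda>y1 y2. \<chi> y1 * \<psi> ((T h \<otimes> y2 \<otimes> h) \<otimes> (T h \<otimes> z2 \<otimes> h))))"
    unfolding sw_swap[of y] by (simp add: conj \<chi>m mult_ac flip: sw_scale)
  also have "\<dots> = sw z (\<lambda>z1 z2. \<chi> z1 * sw y (\<lambda>y1 y2. \<psi> (S (S y1) \<otimes> (T h \<otimes> z2 \<otimes> h)) * \<chi> y2))"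
  proof (rule sw_cong[OF refl])
    fix z1 z2 assume "z2 \<in> B"
    then have "lform A (\<lambda>x. \<psi> (x \<otimes> (T h \<otimes> z2 \<otimes> h)))" by simp
    then show "\<chi> z1 * sw y (\<lambda>y1 y2. \<chi> y1 * \<psi> ((T h \<otimes> y2 \<otimes> h) \<otimes> (T h \<otimes> z2 \<otimes> h))) =
        \<chi> z1 * sw y (\<lambda>y1 y2. \<psi> (S (S y1) \<otimes> (T h \<otimes> z2 \<otimes> h)) * \<chi> y2)"
      using iy[unfolded implements_S2_def, rule_format, of "\<lambda>x. \<psi> (x \<otimes> (T h \<otimes> z2 \<otimes> h))"] by (simp only:)
  qed
  also have "\<dots> = sw y (\<lambda>y1 y2. \<chi> y2 * sw z (\<lambda>z1 z2. \<chi> z1 * \<psi> (S (S y1) \<otimes> (T h \<otimes> z2 \<otimes> h))))"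
    by (simp add: sw_swap[of y] mult_ac flip: sw_scale)
  also have "\<dots> = sw y (\<lambda>y1 y2. \<chi> y2 * sw z (\<lambda>z1 z2. \<psi> (S (S y1) \<otimes> S (S z1)) * \<chi> z2))"
  proof (rule sw_cong[OF refl])
    fix y1 y2 assume "y1 \<in> B"
    then have "lform A (\<lambda>x. \<psi> (S (S y1) \<otimes> x))" by simp
    then show "\<chi> y2 * sw z (\<lambda>z1 z2. \<chi> z1 * \<psi> (S (S y1) \<otimes> (T h \<otimes> z2 \<otimes> h))) =
        \<chi> y2 * sw z (\<lambda>z1 z2. \<psi> (S (S y1) \<otimes> S (S z1)) * \<chi> z2)"
      using iz[unfolded implements_S2_def, rule_format, of "\<lambda>x. \<psi> (S (S y1) \<otimes> x)"] by (simp only:)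
  qed
  also have "\<dots> = sw y (\<lambda>y1 y2. sw z (\<lambda>z1 z2. \<psi> (S (S (y1 \<otimes> z1))) * \<chi> (y2 \<otimes> z2)))"
    by (simp add: S_mult \<chi>m mult_ac flip: sw_scale)
  also have "\<dots> = sw (y \<otimes> z) (\<lambda>y1 y2. \<psi> (S (S y1)) * \<chi> y2)"
    using y z \<chi> by (intro sw_mult[symmetric]) simp_all
  finally show "sw (y \<otimes> z) (\<lambda>y1 y2. \<chi> y1 * \<psi> (T h \<otimes> y2 \<otimes> h)) =
      sw (y \<otimes> z) (\<lambda>y1 y2. \<psi> (S (S y1)) * \<chi> y2)" .
qed

text \<open>
  The condition gives the commutation of \<open>\<chi> \<bowtie> h\<close> with the dual directly. On
  \<open>A\<close> the leftover character values combine to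
  \<open>\<chi>(S\<^sup>-\<^sup>1(a\<^sub>3) a\<^sub>2)\<close> and cancel.
\<close>

lemma implements_S2_central:
  assumes \<chi>: "character \<chi>" and h: "grouplike h"
    and star: "\<And>y. y \<in> carrier A \<Longrightarrow> implements_S2 \<chi> h y"
  shows "a \<in> carrier A \<Longrightarrow> (u \<otimes>\<^bsub>D\<^esub> bow \<chi> h) \<otimes>\<^bsub>D\<^esub> hA a = hA a \<otimes>\<^bsub>D\<^esub> (u \<otimes>\<^bsub>D\<^esub> bow \<chi> h)"
    and "f \<in> carrier DA \<Longrightarrow> (u \<otimes>\<^bsub>D\<^esub> bow \<chi> h) \<otimes>\<^bsub>D\<^esub> dl f = dl f \<otimes>\<^bsub>D\<^esub> (u \<otimes>\<^bsub>D\<^esub> bow \<chi> h)"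
proof -
  have hm [simp]: "h \<in> carrier A" and \<chi>D [simp]: "\<chi> \<in> carrier DA" using h \<chi> by simp_all
  note [simp] = lform_comp[OF dual_lform[OF \<chi>D]]
  have \<chi>m: "\<chi> (a \<otimes> b) = \<chi> a * \<chi> b" if "a \<in> carrier A" "b \<in> carrier A" for a b
    using \<chi> that by (simp add: character_def)
  have \<chi>1: "\<chi> \<one> = 1" using \<chi> by (simp add: character_def)
  have st: "sw y (\<lambda>y1 y2. \<chi> y1 * \<psi> (T h \<otimes> y2 \<otimes> h)) = sw y (\<lambda>y1 y2. \<psi> (S (S y1)) * \<chi> y2)"
    if "y \<in> carrier A" "lform A \<psi>" for y \<psi> using star that by (simp add: implements_S2_def)
  have l: "lform A (\<lambda>a. La a t y2 \<phi>)" for t y2 \<phi> by (simp add: lform_La_left[of "\<lambda>x. x"])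
  show "(u \<otimes>\<^bsub>D\<^esub> bow \<chi> h) \<otimes>\<^bsub>D\<^esub> dl f = dl f \<otimes>\<^bsub>D\<^esub> (u \<otimes>\<^bsub>D\<^esub> bow \<chi> h)" if f: "f \<in> carrier DA"
  proof -
    (* u moves past f with a twist by the inverse square of the antipode, so the group-like
       element must move past f with the opposite twist. *)
    define f' where "f' = on_carrier A (\<lambda>y. f (S (S y)))"
    have f': "f' \<in> carrier DA" unfolding f'_def using lform_comp[OF dual_lform[OF f], of "\<lambda>y. S (S y)"] by simp
    have ff: "fT (fT f') = f" by (rule dual_eqI) (use f f' in \<open>simp_all add: f'_def\<close>)
    have x: "bow \<chi> h \<otimes>\<^bsub>D\<^esub> dl f = dl f' \<otimes>\<^bsub>D\<^esub> bow \<chi> h"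
    proof (rule DT_eqI)
      fix y \<phi> assume y: "y \<in> carrier A" and \<phi>: "lform A \<phi>"
      have "E (bow \<chi> h \<otimes>\<^bsub>D\<^esub> dl f) y \<phi> = sw y (\<lambda>y1 y2. \<chi> y1 * f (T h \<otimes> y2 \<otimes> h)) * \<phi> h"
        using f y \<phi> h l by (simp add: E_mult La_grouplike lform_comp[OF \<phi>] mult.assoc flip: sw_scale')
      also have "\<dots> = sw y (\<lambda>y1 y2. f (S (S y1)) * \<chi> y2) * \<phi> h" using y f by (simp add: st)
      also have "\<dots> = E (dl f' \<otimes>\<^bsub>D\<^esub> bow \<chi> h) y \<phi>"
        using f' y \<phi> by (simp add: E_mult_dual mult.assoc flip: sw_scale') (simp add: f'_def)
      finally show "E (bow \<chi> h \<otimes>\<^bsub>D\<^esub> dl f) y \<phi> = E (dl f' \<otimes>\<^bsub>D\<^esub> bow \<chi> h) y \<phi>" .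
    qed (use f f' in \<open>simp_all add: mult_D_closed\<close>)
    have "(u \<otimes>\<^bsub>D\<^esub> bow \<chi> h) \<otimes>\<^bsub>D\<^esub> dl f = u \<otimes>\<^bsub>D\<^esub> (dl f' \<otimes>\<^bsub>D\<^esub> bow \<chi> h)"
      using f by (simp add: D_assoc x)
    also have "\<dots> = (u \<otimes>\<^bsub>D\<^esub> dl f') \<otimes>\<^bsub>D\<^esub> bow \<chi> h" using f' by (simp add: D_assoc)
    also have "\<dots> = dl f \<otimes>\<^bsub>D\<^esub> (u \<otimes>\<^bsub>D\<^esub> bow \<chi> h)" using f f' by (simp add: u_dl ff D_assoc)
    finally show ?thesis .
  qed
  show "(u \<otimes>\<^bsub>D\<^esub> bow \<chi> h) \<otimes>\<^bsub>D\<^esub> hA a = hA a \<otimes>\<^bsub>D\<^esub> (u \<otimes>\<^bsub>D\<^esub> bow \<chi> h)" if a: "a \<in> carrier A"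
  proof -
    (* Likewise on A, where u twists by the square of the antipode. *)
    define a' where "a' = T (T a)"
    have a': "a' \<in> carrier A" and aa: "S (S a') = a" using a by (simp_all add: a'_def)
    have x: "bow \<chi> h \<otimes>\<^bsub>D\<^esub> hA a = hA a' \<otimes>\<^bsub>D\<^esub> bow \<chi> h"
    proof (rule DT_eqI)
      fix y \<phi> assume y: "y \<in> carrier A" and \<phi>: "lform A \<phi>"
      note [simp] = lform_comp[OF \<phi>]
      have hh: "h \<otimes> (T h \<otimes> z) = z" if "z \<in> carrier A" for z
        using that grouplike_T(2)[OF h] by (simp flip: m_assoc)
      have "E (hA a' \<otimes>\<^bsub>D\<^esub> bow \<chi> h) y \<phi> = \<chi> y * sw a' (\<lambda>a1 r. sw r (\<lambda>a2 a3. \<chi> a1 * (\<chi> (T a3) * \<phi> (a2 \<otimes> h))))"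
        using a' y \<phi> by (simp add: E_mult_hA La_def \<chi>m mult_ac flip: sw_scale)
      also have "\<dots> = \<chi> y * sw a' (\<lambda>p a3. sw p (\<lambda>a1 a2. \<chi> a1 * (\<chi> (T a3) * \<phi> (a2 \<otimes> h))))"
        using a' by (simp add: sw_coassoc)
      also have "\<dots> = \<chi> y * sw a' (\<lambda>p a3. \<chi> (T a3) * sw p (\<lambda>a1 a2. \<chi> a1 * \<phi> (h \<otimes> (T h \<otimes> a2 \<otimes> h))))"
        by (simp add: hh m_assoc mult.left_commute flip: sw_scale)
      also have "\<dots> = \<chi> y * sw a' (\<lambda>p a3. \<chi> (T a3) * sw p (\<lambda>p1 p2. \<phi> (h \<otimes> S (S p1)) * \<chi> p2))"
        by (simp add: st[where \<psi> = "\<lambda>x. \<phi> (h \<otimes> x)"])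
      also have "\<dots> = \<chi> y * sw a' (\<lambda>p a3. sw p (\<lambda>p1 p2. \<phi> (h \<otimes> S (S p1)) * \<chi> (T a3 \<otimes> p2)))"
        by (simp add: \<chi>m mult_ac flip: sw_scale)
      also have "\<dots> = \<chi> y * sw a' (\<lambda>p1 w. sw w (\<lambda>p2 a3. \<phi> (h \<otimes> S (S p1)) * \<chi> (T a3 \<otimes> p2)))"
        using a' by (simp add: sw_coassoc)
      also have "\<dots> = \<chi> y * sw a' (\<lambda>p1 w. \<epsilon> w * \<phi> (h \<otimes> S (S p1)))"
        using \<chi>1 by (simp add: sw_scale sw_T_left[where \<phi> = \<chi>] mult.commute[of _ "\<epsilon> _"])
      also have "\<dots> = \<chi> y * \<phi> (h \<otimes> a)"
        using a' by (simp add: sw_counit_right[where \<phi> = "\<lambda>x. \<phi> (h \<otimes> S (S x))"] aa)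
      also have "\<dots> = E (bow \<chi> h \<otimes>\<^bsub>D\<^esub> hA a) y \<phi>" using a y \<phi> by (simp add: E_mult_right_hA)
      finally show "E (bow \<chi> h \<otimes>\<^bsub>D\<^esub> hA a) y \<phi> = E (hA a' \<otimes>\<^bsub>D\<^esub> bow \<chi> h) y \<phi>" ..
    qed (use a a' in \<open>simp_all add: mult_D_closed\<close>)
    have "(u \<otimes>\<^bsub>D\<^esub> bow \<chi> h) \<otimes>\<^bsub>D\<^esub> hA a = u \<otimes>\<^bsub>D\<^esub> (hA a' \<otimes>\<^bsub>D\<^esub> bow \<chi> h)"
      using a by (simp add: D_assoc x)
    also have "\<dots> = (u \<otimes>\<^bsub>D\<^esub> hA a') \<otimes>\<^bsub>D\<^esub> bow \<chi> h" using a' by (simp add: D_assoc)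
    also have "\<dots> = hA a \<otimes>\<^bsub>D\<^esub> (u \<otimes>\<^bsub>D\<^esub> bow \<chi> h)" using a a' by (simp add: u_hA aa D_assoc)
    finally show ?thesis .
  qed
qed

end

section \<open>Free algebras and presentations\<close>

definition word :: "'c list \<Rightarrow> 'c list \<Rightarrow> 'k::field" where
  "word v = (\<lambda>w. if w = v then 1 else 0)"

lemma finite_splits: "finite {(u, v). u @ v = (w :: 'c list)}"
proof (rule finite_subset)
  show "{(u, v). u @ v = w} \<subseteq> (\<lambda>k. (take k w, drop k w)) ` {..length w}"
  proof
    fix p assume "p \<in> {(u, v). u @ v = w}"
    then have "p = (take (length (fst p)) w, drop (length (fst p)) w)" "length (fst p) \<le> length w"
      by auto
    then show "p \<in> (\<lambda>k. (take k w, drop k w)) ` {..length w}" by blast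
  qed
qed simp

lemma word_mult: "word u \<otimes>\<^bsub>free_alg\<^esub> word v = (word (u @ v) :: 'c list \<Rightarrow> 'k::field)"
proof
  fix w
  have "(word u \<otimes>\<^bsub>free_alg\<^esub> word v) w =
      (\<Sum>p\<in>{(u', v'). u' @ v' = w}. if p = (u, v) then 1 else (0 :: 'k))"
    unfolding free_alg_def word_def by (auto intro!: sum.cong)
  also have "\<dots> = word (u @ v) w"
    using finite_splits[of w] by (auto simp: word_def)
  finally show "(word u \<otimes>\<^bsub>free_alg\<^esub> word v) w = (word (u @ v) w :: 'k)" .
qed

lemma word_pow:
  "(free_gen c :: 'c list \<Rightarrow> 'k::field) [^]\<^bsub>free_alg\<^esub> (k :: nat) = word (replicate k c)"
proof (induction k)
  case 0
  show ?case by (simp add: nat_pow_def) (simp add: free_alg_def word_def)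
next
  case (Suc k)
  have "(free_gen c :: 'c list \<Rightarrow> 'k) [^]\<^bsub>free_alg\<^esub> Suc k =
      (free_gen c :: 'c list \<Rightarrow> 'k) [^]\<^bsub>free_alg\<^esub> k \<otimes>\<^bsub>free_alg\<^esub> word [c]"
    by (simp add: nat_pow_def free_gen_def word_def)
  then show ?case by (simp add: Suc word_mult replicate_append_same)
qed

lemma free_gen_word: "free_gen c = word [c]"
  by (simp add: free_gen_def word_def)

lemma free_one_word: "\<one>\<^bsub>free_alg\<^esub> = word []"
  by (simp add: free_alg_def word_def)

text \<open>
  Evaluation in an algebra and the action on a representation both sum a product of free
  algebra elements against a function of words.
\<close>

lemma free_mult_sum:
  fixes f h :: "'c list \<Rightarrow> 'k::field" and F :: "'c list \<Rightarrow> 'k"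
  assumes f: "finite {w. f w \<noteq> 0}" and h: "finite {w. h w \<noteq> 0}"
  shows "finite {w. (f \<otimes>\<^bsub>free_alg\<^esub> h) w \<noteq> 0}"
    and "(\<Sum>w | (f \<otimes>\<^bsub>free_alg\<^esub> h) w \<noteq> 0. (f \<otimes>\<^bsub>free_alg\<^esub> h) w * F w) =
      (\<Sum>u | f u \<noteq> 0. \<Sum>v | h v \<noteq> 0. f u * h v * F (u @ v))"
proof -
  define U V where "U = {w. f w \<noteq> 0}" and "V = {w. h w \<noteq> 0}"
  define W where "W = (\<lambda>(u, v). u @ v) ` (U \<times> V)"
  have fin: "finite (U \<times> V)" "finite W" using f h by (simp_all add: U_def V_def W_def)
  have mult: "(f \<otimes>\<^bsub>free_alg\<^esub> h) w = (\<Sum>(u, v) | (u, v) \<in> U \<times> V \<and> u @ v = w. f u * h v)" for w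
  proof -
    have "(f \<otimes>\<^bsub>free_alg\<^esub> h) w = (\<Sum>p\<in>{(u, v). u @ v = w}. f (fst p) * h (snd p))"
      by (simp add: free_alg_def case_prod_unfold)
    also have "\<dots> = (\<Sum>p\<in>{(u, v). (u, v) \<in> U \<times> V \<and> u @ v = w}. f (fst p) * h (snd p))"
      using finite_splits[of w] by (intro sum.mono_neutral_right) (auto simp: U_def V_def)
    finally show ?thesis by (simp add: case_prod_unfold)
  qed
  have sub: "{w. (f \<otimes>\<^bsub>free_alg\<^esub> h) w \<noteq> 0} \<subseteq> W"
  proof
    fix w assume "w \<in> {w. (f \<otimes>\<^bsub>free_alg\<^esub> h) w \<noteq> 0}"
    then have nz: "(f \<otimes>\<^bsub>free_alg\<^esub> h) w \<noteq> 0" by simp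
    show "w \<in> W"
    proof (rule ccontr)
      assume "w \<notin> W"
      then have e: "{(u, v). (u, v) \<in> U \<times> V \<and> u @ v = w} = {}" by (auto simp: W_def)
      show False using nz unfolding mult e by simp
    qed
  qed
  then show "finite {w. (f \<otimes>\<^bsub>free_alg\<^esub> h) w \<noteq> 0}" using fin(2) finite_subset by blast
  have "(\<Sum>w | (f \<otimes>\<^bsub>free_alg\<^esub> h) w \<noteq> 0. (f \<otimes>\<^bsub>free_alg\<^esub> h) w * F w) = (\<Sum>w\<in>W. (f \<otimes>\<^bsub>free_alg\<^esub> h) w * F w)"
    using fin(2) sub by (intro sum.mono_neutral_left) auto
  also have "\<dots> = (\<Sum>w\<in>W. \<Sum>p | p \<in> U \<times> V \<and> (\<lambda>(u, v). u @ v) p = w. f (fst p) * h (snd p) * F (fst p @ snd p))"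
    unfolding mult sum_distrib_right
    by (intro sum.cong refl) (auto simp: case_prod_unfold)
  also have "\<dots> = (\<Sum>p\<in>U \<times> V. f (fst p) * h (snd p) * F (fst p @ snd p))"
    unfolding W_def using fin(1) by (rule sum.image_gen[symmetric])
  also have "\<dots> = (\<Sum>u\<in>U. \<Sum>v\<in>V. f u * h v * F (u @ v))"
    by (simp add: sum.cartesian_product case_prod_unfold)
  finally show "(\<Sum>w | (f \<otimes>\<^bsub>free_alg\<^esub> h) w \<noteq> 0. (f \<otimes>\<^bsub>free_alg\<^esub> h) w * F w) =
      (\<Sum>u | f u \<noteq> 0. \<Sum>v | h v \<noteq> 0. f u * h v * F (u @ v))" by (simp add: U_def V_def)
qed

text \<open>
  The free algebra acts on functions through one operator for each generator. The elements
  that annihilate a stable set of functions form an ideal; a representation satisfying the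
  relations therefore detects elements that are nonzero in a presented algebra.
\<close>

definition annihilates ::
  "('c \<Rightarrow> ('i \<Rightarrow> 'k::field) \<Rightarrow> 'i \<Rightarrow> 'k) \<Rightarrow> ('i \<Rightarrow> 'k) set \<Rightarrow> ('c list \<Rightarrow> 'k) \<Rightarrow> bool" where
  "annihilates op V f \<longleftrightarrow> (\<forall>\<phi>\<in>V. \<forall>i. (\<Sum>w | f w \<noteq> 0. f w * foldr op w \<phi> i) = 0)"

lemma annihilates_finite:
  assumes "finite W" "\<And>w. w \<notin> W \<Longrightarrow> f w = 0"
  shows "annihilates op V f \<longleftrightarrow> (\<forall>\<phi>\<in>V. \<forall>i. (\<Sum>w\<in>W. f w * foldr op w \<phi> i) = 0)"
proof -
  have "(\<Sum>w | f w \<noteq> 0. f w * foldr op w \<phi> i) = (\<Sum>w\<in>W. f w * foldr op w \<phi> i)" for \<phi> i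
    using assms by (intro sum.mono_neutral_left) auto
  then show ?thesis by (simp add: annihilates_def)
qed

lemma annihilator_ideal:
  fixes op :: "'c \<Rightarrow> ('i \<Rightarrow> 'k::field) \<Rightarrow> 'i \<Rightarrow> 'k"
  assumes add: "\<And>c \<phi> \<psi>. op c (\<phi> + \<psi>) = op c \<phi> + op c \<psi>"
    and scale: "\<And>c k \<phi>. op c (fun_scal k \<phi>) = fun_scal k (op c \<phi>)"
    and stable: "\<And>c \<phi>. \<phi> \<in> V \<Longrightarrow> op c \<phi> \<in> V"
  shows "two_sided_ideal free_alg {f \<in> carrier free_alg. annihilates op V f}"
proof -
  have fin: "f \<in> carrier free_alg \<longleftrightarrow> finite {w. f w \<noteq> 0}" for f :: "'c list \<Rightarrow> 'k"
    by (simp add: free_alg_def)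
  interpret M: vector_space "fun_scal :: 'k \<Rightarrow> ('c list \<Rightarrow> 'k) \<Rightarrow> _" by (rule vector_space_fun_scal)
  have F_stable: "foldr op w \<phi> \<in> V" if "\<phi> \<in> V" for w \<phi>
    using that by (induction w) (auto intro: stable)
  have z: "op c (\<lambda>i. 0) = (\<lambda>i. 0)" for c
    using scale[of c 0 "\<lambda>i. 0"] by (simp add: fun_scal_def)
  have F_add: "foldr op w (\<lambda>i. \<phi> i + \<psi> i) = (\<lambda>i. foldr op w \<phi> i + foldr op w \<psi> i)" for w \<phi> \<psi>
    by (induction w) (simp_all add: add[unfolded plus_fun_def])
  have F_scale: "foldr op w (\<lambda>i. k * \<phi> i) = (\<lambda>i. k * foldr op w \<phi> i)" for w \<phi> k
    by (induction w) (simp_all add: scale[unfolded fun_scal_def])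
  have F_zero: "foldr op w (\<lambda>i. 0) = (\<lambda>i. 0)" for w
    by (induction w) (simp_all add: z)
  have F_sum: "foldr op w (\<lambda>i. \<Sum>v\<in>X. h v * \<phi> v i) = (\<lambda>i. \<Sum>v\<in>X. h v * foldr op w (\<phi> v) i)"
    if "finite X" for X w and h :: "'c list \<Rightarrow> 'k" and \<phi>
    using that by (induction X) (simp_all add: F_zero F_add F_scale)
  have mult: "(\<Sum>w | (f \<otimes>\<^bsub>free_alg\<^esub> h) w \<noteq> 0. (f \<otimes>\<^bsub>free_alg\<^esub> h) w * foldr op w \<phi> i) =
      (\<Sum>u | f u \<noteq> 0. \<Sum>v | h v \<noteq> 0. f u * h v * foldr op u (foldr op v \<phi>) i)"
    if "f \<in> carrier free_alg" "h \<in> carrier free_alg" for f h \<phi> i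
    using free_mult_sum(2)[of f h "\<lambda>w. foldr op w \<phi> i"] that by (simp add: fin)
  show ?thesis
    unfolding two_sided_ideal_def
  proof (intro conjI ballI)
    show "module.subspace (scal free_alg) {f \<in> carrier free_alg. annihilates op V f}"
    proof -
      have "M.subspace {f \<in> carrier free_alg. annihilates op V f}"
      proof (intro M.subspaceI)
        show "0 \<in> {f \<in> carrier (free_alg :: ('k, 'c list \<Rightarrow> 'k) kalg). annihilates op V f}"
          by (simp add: fin annihilates_def)
        fix f h assume fh: "f \<in> {f \<in> carrier free_alg. annihilates op V f}"
          "h \<in> {f \<in> carrier free_alg. annihilates op V f}"
        let ?W = "{w. f w \<noteq> 0} \<union> {w. h w \<noteq> 0}"
        have W: "finite ?W" using fh by (simp add: fin)
        have s: "{w. (f + h) w \<noteq> 0} \<subseteq> ?W" by auto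
        have "annihilates op V (f + h)"
          using fh annihilates_finite[OF W, of f op V] annihilates_finite[OF W, of h op V]
            annihilates_finite[OF W, of "f + h" op V] by (simp add: distrib_right sum.distrib)
        then show "f + h \<in> {f \<in> carrier free_alg. annihilates op V f}"
          using finite_subset[OF s W] by (simp only: fin mem_Collect_eq)
      next
        fix c f assume f: "f \<in> {f \<in> carrier free_alg. annihilates op V f}"
        then have W: "finite {w. f w \<noteq> 0}" by (simp add: fin)
        have s: "{w. fun_scal c f w \<noteq> 0} \<subseteq> {w. f w \<noteq> 0}" by auto
        have "annihilates op V (fun_scal c f)"
          using f annihilates_finite[OF W, of f op V] annihilates_finite[OF W, of "fun_scal c f" op V]
          by (simp add: mult.assoc flip: sum_distrib_left)
        then show "fun_scal c f \<in> {f \<in> carrier free_alg. annihilates op V f}"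
          using finite_subset[OF s W] by (simp only: fin mem_Collect_eq)
      qed
      then show ?thesis by (simp add: free_alg_def)
    qed
    fix a b assume a: "a \<in> carrier (free_alg :: ('k, 'c list \<Rightarrow> 'k) kalg)"
      and "b \<in> {f \<in> carrier free_alg. annihilates op V f}"
    then have b: "b \<in> carrier free_alg" and ann: "\<And>\<phi> i. \<phi> \<in> V \<Longrightarrow> (\<Sum>w | b w \<noteq> 0. b w * foldr op w \<phi> i) = 0"
      by (auto simp: annihilates_def)
    have fb: "finite {w. b w \<noteq> 0}" using b by (simp add: fin)
    have "(\<Sum>u | a u \<noteq> 0. \<Sum>v | b v \<noteq> 0. a u * b v * foldr op u (foldr op v \<phi>) i) = 0"
      if "\<phi> \<in> V" for \<phi> i
    proof -
      have "(\<Sum>v | b v \<noteq> 0. a u * b v * foldr op u (foldr op v \<phi>) i) = 0" for u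
      proof -
        have "(\<Sum>v | b v \<noteq> 0. a u * b v * foldr op u (foldr op v \<phi>) i) =
            a u * foldr op u (\<lambda>i. \<Sum>v | b v \<noteq> 0. b v * foldr op v \<phi> i) i"
          using F_sum[OF fb, of u b "\<lambda>v. foldr op v \<phi>"] by (simp add: sum_distrib_left mult.assoc)
        then show ?thesis using ann[OF that] by (simp add: F_zero)
      qed
      then show ?thesis by simp
    qed
    then show "a \<otimes>\<^bsub>free_alg\<^esub> b \<in> {f \<in> carrier free_alg. annihilates op V f}"
      using a b free_mult_sum(1)[of a b] by (simp add: fin annihilates_def mult[unfolded fin])
    have "(\<Sum>u | b u \<noteq> 0. \<Sum>v | a v \<noteq> 0. b u * a v * foldr op u (foldr op v \<phi>) i) = 0"
      if "\<phi> \<in> V" for \<phi> i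
    proof -
      have "(\<Sum>u | b u \<noteq> 0. \<Sum>v | a v \<noteq> 0. b u * a v * foldr op u (foldr op v \<phi>) i) =
          (\<Sum>v | a v \<noteq> 0. a v * (\<Sum>u | b u \<noteq> 0. b u * foldr op u (foldr op v \<phi>) i))"
        by (subst sum.swap) (simp add: sum_distrib_left mult_ac)
      then show ?thesis using ann[OF F_stable[OF that]] by simp
    qed
    then show "b \<otimes>\<^bsub>free_alg\<^esub> a \<in> {f \<in> carrier free_alg. annihilates op V f}"
      using a b free_mult_sum(1)[of b a] by (simp add: fin annihilates_def mult[unfolded fin])
  qed auto
qed

lemma presented_by_independence:
  assumes P: "presented_by A \<phi> rels"
    and f: "f \<in> carrier free_alg" "free_eval A \<phi> f = 0"
    and I: "two_sided_ideal free_alg I" "rels \<subseteq> I"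
  shows "f \<in> I"
proof -
  have "f \<in> ideal_generated free_alg rels" using P f by (auto simp: presented_by_def)
  then show ?thesis using I by (auto simp: ideal_generated_def)
qed

lemma presented_by_relation:
  assumes P: "presented_by A \<phi> rels" and r: "r \<in> rels"
  shows "free_eval A \<phi> r = 0"
proof -
  have "r \<in> ideal_generated free_alg rels" using r by (auto simp: ideal_generated_def)
  then show ?thesis using P by (auto simp: presented_by_def)
qed

lemma free_eval_finite:
  assumes "vspace A" "finite W" "\<And>w. w \<notin> W \<Longrightarrow> f w = 0"
  shows "free_eval A \<phi> f = (\<Sum>w\<in>W. scal A (f w) (foldr (\<lambda>c a. \<phi> c \<otimes>\<^bsub>A\<^esub> a) w \<one>\<^bsub>A\<^esub>))"
proof -
  interpret V: vector_space "scal A" using assms(1) by (rule vspace_vs)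
  show ?thesis unfolding free_eval_def using assms by (intro sum.mono_neutral_left) auto
qed

section \<open>The PBW basis of the Radford Hopf algebra\<close>

text \<open>
  Left multiplication by \<open>g\<close> and \<open>x\<close> on coordinate vectors: \<open>\<phi> (i, j)\<close> is the
  coefficient of \<open>g\<^sup>i x\<^sup>j\<close>, extended periodically to all integers \<open>i\<close>, which
  makes multiplication by \<open>g\<close> a shift. The case \<open>j = 0\<close> of \<open>x\<close> encodes
  \<open>x\<^sup>n = g\<^sup>n - 1\<close>.
\<close>

definition radford_op :: "nat \<Rightarrow> 'k::field \<Rightarrow> radford_gen \<Rightarrow> (int \<times> nat \<Rightarrow> 'k) \<Rightarrow> int \<times> nat \<Rightarrow> 'k" where
  "radford_op n q c \<phi> = (\<lambda>(i, j). case c of Gen_g \<Rightarrow> \<phi> (i - 1, j)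
     | Gen_x \<Rightarrow> if j = 0 then q powi i * (\<phi> (i - int n, n - 1) - \<phi> (i, n - 1))
        else if j < n then q powi i * \<phi> (i, j - 1) else 0)"

definition radford_space :: "nat \<Rightarrow> nat \<Rightarrow> (int \<times> nat \<Rightarrow> 'k::field) set" where
  "radford_space N n = {\<phi>. (\<forall>i j. \<phi> (i - int N, j) = \<phi> (i, j)) \<and> (\<forall>i j. n \<le> j \<longrightarrow> \<phi> (i, j) = 0)}"

lemma radford_op_pow_g: "(radford_op n q Gen_g ^^ k) \<phi> = (\<lambda>(i, j). \<phi> (i - int k, j))"
  by (induction k arbitrary: \<phi>) (auto simp: radford_op_def fun_eq_iff algebra_simps)

lemma radford_op_pow_x:
  assumes q: "q ^ n = 1" "q \<noteq> 0" and k: "k \<le> n" and \<phi>: "\<And>i j. n \<le> j \<Longrightarrow> \<phi> (i, j) = 0"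
  shows "(radford_op n q Gen_x ^^ k) \<phi> (i, j) = (if n \<le> j then 0
    else if k \<le> j then q powi (i * int k) * \<phi> (i, j - k)
    else q powi (i * int k) * (\<phi> (i - int n, n - k + j) - \<phi> (i, n - k + j)))"
  using k
proof (induction k arbitrary: i j)
  case 0
  then show ?case using \<phi> by simp
next
  case (Suc k)
  have qn: "q powi (int n * z) = 1" for z
    using q by (simp add: power_int_mult)
  have per: "q powi ((i - int n) * int k) = q powi (i * int k)" for i
  proof -
    have "(i - int n) * int k = i * int k - int n * int k" by (simp add: algebra_simps)
    then show ?thesis using q qn by (simp add: power_int_diff)
  qed
  have suc: "q powi i * q powi (i * int k) = q powi (i * int (Suc k))" for i
    using q by (simp add: algebra_simps flip: power_int_add)
  show ?case
  proof (cases "j = 0")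
    case True
    have "(radford_op n q Gen_x ^^ Suc k) \<phi> (i, j) =
        q powi i * ((radford_op n q Gen_x ^^ k) \<phi> (i - int n, n - 1) - (radford_op n q Gen_x ^^ k) \<phi> (i, n - 1))"
      using True by (simp add: radford_op_def)
    also have "\<dots> = q powi i * (q powi ((i - int n) * int k) * \<phi> (i - int n, n - 1 - k) -
        q powi (i * int k) * \<phi> (i, n - 1 - k))"
    proof -
      have "\<not> n \<le> n - 1" "k \<le> n - 1" "k \<le> n" using Suc.prems by auto
      then show ?thesis using Suc.IH[of "i - int n" "n - 1"] Suc.IH[of i "n - 1"] by simp
    qed
    also have "\<dots> = (q powi i * q powi (i * int k)) * (\<phi> (i - int n, n - Suc k) - \<phi> (i, n - Suc k))"
      unfolding per by (simp add: algebra_simps)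
    finally show ?thesis using True Suc.prems unfolding suc by simp
  next
    case False
    have s2: "q powi i * (q powi (i * int k) * X) = q powi (i * int (Suc k)) * X" for X
      by (simp only: suc mult.assoc[symmetric])
    have "(radford_op n q Gen_x ^^ Suc k) \<phi> (i, j) =
        (if j < n then q powi i * (radford_op n q Gen_x ^^ k) \<phi> (i, j - 1) else 0)"
      using False by (simp add: radford_op_def)
    also have "\<dots> = (if n \<le> j then 0
        else if Suc k \<le> j then q powi (i * int (Suc k)) * \<phi> (i, j - Suc k)
        else q powi (i * int (Suc k)) * (\<phi> (i - int n, n - Suc k + j) - \<phi> (i, n - Suc k + j)))"
    proof -
      have a: "n - k + (j - 1) = n - Suc k + j" "k \<le> n" using False Suc.prems by auto
      have b: "k \<le> j - 1 \<longleftrightarrow> Suc k \<le> j" using False by auto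
      show ?thesis
      proof (cases "n \<le> j")
        case nj: False
        then have "\<not> n \<le> j - 1" by simp
        then show ?thesis using Suc.IH[of i "j - 1"] nj a unfolding a b by (simp add: s2 b del: of_nat_Suc)
      qed simp
    qed
    finally show ?thesis .
  qed
qed

lemma radford_space_stable:
  assumes q: "q ^ N = 1" "q \<noteq> 0" and \<phi>: "\<phi> \<in> radford_space N n" and n: "n \<ge> 1"
  shows "radford_op n q c \<phi> \<in> radford_space N n"
proof -
  have qN: "q powi (i - int N) = q powi i" for i using q by (simp add: power_int_diff)
  have p: "\<phi> (i - int N, j) = \<phi> (i, j)" for i j using \<phi> by (simp add: radford_space_def)
  have p1: "\<phi> (i - int N - 1, j) = \<phi> (i - 1, j)" for i j using p[of "i - 1" j] by (simp add: algebra_simps)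
  have p2: "\<phi> (i - int N - int n, j) = \<phi> (i - int n, j)" for i j using p[of "i - int n" j] by (simp add: algebra_simps)
  show ?thesis
    using \<phi> n unfolding radford_space_def by (cases c) (auto simp: radford_op_def qN p p1 p2)
qed

lemma foldr_replicate: "foldr op (replicate k c) \<phi> = (op c ^^ k) \<phi>"
  by (induction k) simp_all

lemma radford_relations_annihilate:
  fixes q :: "'k::field"
  assumes q: "q ^ n = 1" and n: "n \<ge> 1" and m: "m \<ge> 1"
  shows "radford_relations m n q \<subseteq>
    {f \<in> carrier free_alg. annihilates (radford_op n q) (radford_space (m * n) n) f}"
proof
  have q0: "q \<noteq> 0" using q n by (auto simp: power_0_left)
  let ?op = "radford_op n q" and ?V = "radford_space (m * n) n :: (int \<times> nat \<Rightarrow> 'k) set"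
  have fin: "f \<in> carrier free_alg \<longleftrightarrow> finite {w. f w \<noteq> 0}" for f :: "radford_gen list \<Rightarrow> 'k"
    by (simp add: free_alg_def)
  have mem: "f \<in> {f \<in> carrier free_alg. annihilates ?op ?V f}"
    if W: "finite W" "\<And>w. w \<notin> W \<Longrightarrow> f w = 0"
      and z: "\<And>\<phi> i j. \<phi> \<in> ?V \<Longrightarrow> (\<Sum>w\<in>W. f w * foldr ?op w \<phi> (i, j)) = 0" for f W
  proof -
    have "{w. f w \<noteq> 0} \<subseteq> W" using W(2) by blast
    then show ?thesis using W z finite_subset by (auto simp: fin annihilates_finite[OF W])
  qed
  fix r assume "r \<in> radford_relations m n q"
  then consider "r = word (replicate (m * n) Gen_g) - word []"
    | "r = word (replicate n Gen_x) - (word (replicate n Gen_g) - word [])"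
    | "r = word [Gen_x, Gen_g] - fun_scal q (word [Gen_g, Gen_x])"
    by (auto simp: radford_relations_def Let_def word_pow free_one_word)
      (simp add: free_gen_word word_mult)
  then show "r \<in> {f \<in> carrier free_alg. annihilates ?op ?V f}"
  proof cases
    case 1
    show ?thesis
    proof (rule mem[of "{replicate (m * n) Gen_g, []}"])
      fix \<phi> :: "int \<times> nat \<Rightarrow> 'k" and i j assume "\<phi> \<in> ?V"
      then have "foldr ?op (replicate (m * n) Gen_g) \<phi> = \<phi>"
        unfolding foldr_replicate radford_op_pow_g radford_space_def by (auto simp: fun_eq_iff)
      moreover have "replicate (m * n) Gen_g \<noteq> []" using m n by simp
      ultimately show "(\<Sum>w\<in>{replicate (m * n) Gen_g, []}. r w * foldr ?op w \<phi> (i, j)) = 0"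
        by (simp add: 1 word_def)
    qed (auto simp: 1 word_def)
  next
    case 2
    show ?thesis
    proof (rule mem[of "{replicate n Gen_x, replicate n Gen_g, []}"])
      fix \<phi> :: "int \<times> nat \<Rightarrow> 'k" and i j assume \<phi>: "\<phi> \<in> ?V"
      have z: "\<phi> (i, j) = 0" if "n \<le> j" for i j using \<phi> that by (simp add: radford_space_def)
      have "q powi (i * int n) = 1" using q power_int_mult[of q "int n" i] by (simp add: mult.commute)
      then have "foldr ?op (replicate n Gen_x) \<phi> (i, j) = \<phi> (i - int n, j) - \<phi> (i, j)"
        unfolding foldr_replicate using radford_op_pow_x[OF q q0 order_refl, of \<phi> i j] z by simp
      moreover have "foldr ?op (replicate n Gen_g) \<phi> (i, j) = \<phi> (i - int n, j)"
        unfolding foldr_replicate radford_op_pow_g by simp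
      moreover have "replicate n Gen_g \<noteq> replicate n Gen_x" "replicate n Gen_x \<noteq> []" "replicate n Gen_g \<noteq> []"
        using n by simp_all
      ultimately show "(\<Sum>w\<in>{replicate n Gen_x, replicate n Gen_g, []}. r w * foldr ?op w \<phi> (i, j)) = 0"
        by (simp add: 2 word_def)
    qed (auto simp: 2 word_def)
  next
    case 3
    have q1: "q * q powi (i - 1) = q powi i" for i using q0 by (simp add: power_int_diff)
    show ?thesis
    proof (rule mem[of "{[Gen_x, Gen_g], [Gen_g, Gen_x]}"])
      fix \<phi> :: "int \<times> nat \<Rightarrow> 'k" and i j
      have c: "i - int n - 1 = i - 1 - int n" by simp
      have "?op Gen_x (?op Gen_g \<phi>) (i, j) = q * ?op Gen_g (?op Gen_x \<phi>) (i, j)"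
        by (simp add: radford_op_def q1 c flip: mult.assoc)
      then show "(\<Sum>w\<in>{[Gen_x, Gen_g], [Gen_g, Gen_x]}. r w * foldr ?op w \<phi> (i, j)) = 0"
        by (simp add: 3 word_def)
    qed (auto simp: 3 word_def)
  qed
qed

locale radford_setting = radford_hopf_algebra H m n q g x
  for H :: "('k::field, 'a::ab_group_add, 'm) bialg_scheme" (structure)
    and m n :: nat and q :: 'k and g x :: 'a +
  fixes \<xi> :: 'k
  assumes m_pos: "m \<ge> 1" and n_pos: "n \<ge> 1"
    and char: "of_nat (m * n) \<noteq> (0 :: 'k)"
    and prim_q: "primitive_root_of_unity n q"
    and prim_\<xi>: "primitive_root_of_unity (m * n) \<xi>"
    and \<xi>_m: "\<xi> ^ m = q"
begin

abbreviation N :: nat where "N \<equiv> m * n"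
abbreviation RB :: "'a set" where "RB \<equiv> radford_basis H m n g x"

definition pw :: "nat \<Rightarrow> nat \<Rightarrow> 'a" where "pw i j = g [^] i \<otimes> x [^] j"

lemma N_pos: "N \<ge> 1"
  using m_pos n_pos by simp

lemma q_pow_n: "q ^ n = 1" and \<xi>_pow_N: "\<xi> ^ N = 1"
  using prim_q prim_\<xi> by (auto simp: primitive_root_of_unity_def)

lemma q_nz [simp]: "q \<noteq> 0" and \<xi>_nz [simp]: "\<xi> \<noteq> 0"
  using q_pow_n \<xi>_pow_N n_pos N_pos by (auto simp: power_0_left)

lemma \<phi>_range: "range (\<lambda>c. case c of Gen_g \<Rightarrow> g | Gen_x \<Rightarrow> x) \<subseteq> carrier H"
  using presentation by (simp add: presented_by_def)

lemma g_closed [simp]: "g \<in> carrier H" and x_closed [simp]: "x \<in> carrier H"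
proof -
  have "(case c of Gen_g \<Rightarrow> g | Gen_x \<Rightarrow> x) \<in> carrier H" for c using \<phi>_range by blast
  from this[of Gen_g] this[of Gen_x] show "g \<in> carrier H" "x \<in> carrier H" by simp_all
qed

lemma pw_closed [simp]: "pw i j \<in> carrier H"
  by (simp add: pw_def)

abbreviation ev :: "radford_gen list \<Rightarrow> 'a" where
  "ev w \<equiv> foldr (\<lambda>c a. (case c of Gen_g \<Rightarrow> g | Gen_x \<Rightarrow> x) \<otimes> a) w \<one>"

lemma funpow_mult: "c \<in> carrier H \<Longrightarrow> a \<in> carrier H \<Longrightarrow> ((\<otimes>) c ^^ i) a = c [^] i \<otimes> a"
proof (induction i)
  case (Suc i)
  have "((\<otimes>) c ^^ Suc i) a = c \<otimes> (c [^] i \<otimes> a)" using Suc by simp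
  also have "\<dots> = (c \<otimes> c [^] i) \<otimes> a" using Suc.prems by (simp only: m_assoc nat_pow_closed)
  also have "\<dots> = c [^] Suc i \<otimes> a" using Suc.prems by (simp only: nat_pow_Suc2)
  finally show ?case .
qed simp

lemma ev_pw: "ev (replicate i Gen_g @ replicate j Gen_x) = pw i j"
  by (simp add: funpow_mult pw_def)

lemma relation_eval:
  assumes "r \<in> radford_relations m n q" "finite W" "\<And>w. w \<notin> W \<Longrightarrow> r w = 0"
  shows "(\<Sum>w\<in>W. scal H (r w) (ev w)) = 0"
  using presented_by_relation[OF presentation assms(1)] free_eval_finite[OF vsp assms(2), of r] assms(3)
  by simp

lemma rels: "radford_relations m n q = {word (replicate N Gen_g) - word [],
    word (replicate n Gen_x) - (word (replicate n Gen_g) - word []),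
    word [Gen_x, Gen_g] - fun_scal q (word [Gen_g, Gen_x])}"
  by (simp add: radford_relations_def Let_def word_pow free_one_word)
    (simp add: free_gen_word word_mult)

lemma scal_simps [simp]:
  "scal H 1 a = a" "scal H 0 a = 0" "scal H k (scal H l a) = scal H (k * l) a" "scal H (- k) a = - scal H k a"
  "scal H k (- a) = - scal H k a" "scal H k 0 = 0"
proof -
  interpret V: vector_space "scal H" by (rule vspace_vs[OF vsp])
  show "scal H 1 a = a" "scal H 0 a = 0" "scal H k (scal H l a) = scal H (k * l) a"
    "scal H (- k) a = - scal H k a" "scal H k (- a) = - scal H k a" "scal H k 0 = 0" by simp_all
qed

lemma g_pow_N: "g [^] N = \<one>"
proof -
  have "replicate N Gen_g \<noteq> []" using N_pos by simp
  then have "ev (replicate N Gen_g) - ev [] = 0"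
    using relation_eval[of "word (replicate N Gen_g) - word []" "{replicate N Gen_g, []}"]
    by (simp add: rels word_def split: if_splits)
  then show ?thesis by (simp add: funpow_mult)
qed

lemma x_pow_n: "x [^] n = g [^] n - \<one>"
proof -
  have "replicate n Gen_g \<noteq> []" "replicate n Gen_x \<noteq> []" "replicate n Gen_g \<noteq> replicate n Gen_x"
    using n_pos by simp_all
  then have z: "x [^] n + (\<one> - g [^] n) = 0"
    using relation_eval[of "word (replicate n Gen_x) - (word (replicate n Gen_g) - word [])"
        "{replicate n Gen_x, replicate n Gen_g, []}"]
    by (simp add: rels word_def funpow_mult split: if_splits)
  have "x [^] n = (x [^] n + (\<one> - g [^] n)) + (g [^] n - \<one>)" by simp
  then show ?thesis unfolding z by simp
qed

lemma x_g: "x \<otimes> g = scal H q (g \<otimes> x)"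
proof -
  have "ev [Gen_x, Gen_g] - scal H q (ev [Gen_g, Gen_x]) = 0"
    using relation_eval[of "word [Gen_x, Gen_g] - fun_scal q (word [Gen_g, Gen_x])"
        "{[Gen_x, Gen_g], [Gen_g, Gen_x]}"]
    by (simp add: rels word_def split: if_splits)
  then show ?thesis by simp
qed

lemma x_g_pow: "x \<otimes> g [^] i = scal H (q ^ i) (g [^] i \<otimes> x)"
proof (induction i)
  case (Suc i)
  have "x \<otimes> g [^] Suc i = (x \<otimes> g [^] i) \<otimes> g" by (simp add: m_assoc)
  also have "\<dots> = scal H (q ^ i) (g [^] i \<otimes> (x \<otimes> g))"
    by (simp add: Suc scal_mult m_assoc)
  also have "\<dots> = scal H (q ^ Suc i) (g [^] Suc i \<otimes> x)"
    by (simp add: x_g mult_scal m_assoc mult.commute)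
  finally show ?case .
qed simp

lemma x_pow_g_pow: "x [^] j \<otimes> g [^] i = scal H (q ^ (i * j)) (g [^] i \<otimes> x [^] j)"
proof (induction j)
  case (Suc j)
  have "x [^] Suc j \<otimes> g [^] i = x [^] j \<otimes> (x \<otimes> g [^] i)" by (simp add: m_assoc)
  also have "\<dots> = scal H (q ^ i) ((x [^] j \<otimes> g [^] i) \<otimes> x)"
    by (simp add: x_g_pow mult_scal m_assoc)
  also have "\<dots> = scal H (q ^ (i * Suc j)) (g [^] i \<otimes> x [^] Suc j)"
    by (simp add: Suc scal_mult m_assoc power_add)
  finally show ?case .
qed simp

lemma pw_mult: "pw i j \<otimes> pw k l = scal H (q ^ (j * k)) (pw (i + k) (j + l))"
proof -
  have "pw i j \<otimes> pw k l = g [^] i \<otimes> ((x [^] j \<otimes> g [^] k) \<otimes> x [^] l)"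
    by (simp add: pw_def m_assoc)
  also have "\<dots> = scal H (q ^ (j * k)) (g [^] i \<otimes> (g [^] k \<otimes> x [^] j \<otimes> x [^] l))"
    by (simp add: x_pow_g_pow mult_scal scal_mult mult.commute)
  also have "\<dots> = scal H (q ^ (j * k)) ((g [^] i \<otimes> g [^] k) \<otimes> (x [^] j \<otimes> x [^] l))"
    by (simp add: m_assoc)
  finally show ?thesis by (simp add: pw_def nat_pow_mult)
qed

lemma g_pw: "g = pw 1 0" and x_pw: "x = pw 0 1" and one_pw: "\<one> = pw 0 0"
  by (simp_all add: pw_def)

lemma g_pow_pw: "g [^] i = pw i 0"
  by (simp add: pw_def)

lemma g_pow_mod: "g [^] (i mod N) = g [^] i"
proof -
  have "g [^] i = g [^] (N * (i div N) + i mod N)" by simp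
  also have "\<dots> = (g [^] N) [^] (i div N) \<otimes> g [^] (i mod N)"
    by (simp only: nat_pow_mult[symmetric] nat_pow_pow g_closed)
  finally show ?thesis by (simp add: g_pow_N)
qed

lemma pw_mod: "pw (i mod N) j = pw i j"
  by (simp add: pw_def g_pow_mod)

lemma pw_cong: "i mod N = i' mod N \<Longrightarrow> pw i j = pw i' j"
  by (metis pw_mod)

lemma pw_n: "pw i n = pw (i + n) 0 - pw i 0"
proof -
  have "g [^] i \<otimes> (g [^] n - \<one>) = g [^] i \<otimes> g [^] n - g [^] i \<otimes> \<one>"
    by (rule linear_on_diff[OF linear_mult_right vsp]) simp_all
  then show ?thesis by (simp add: pw_def x_pow_n nat_pow_mult)
qed

lemma RB_eq: "RB = (\<lambda>(i, j). pw i j) ` ({..<N} \<times> {..<n})"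
  by (auto simp: radford_basis_def pw_def)

lemma finite_RB: "finite RB"
  by (simp add: RB_eq)

lemma pw_RB: "j < n \<Longrightarrow> pw i j \<in> RB"
  using N_pos pw_mod[of i j] by (auto simp: RB_eq intro!: rev_image_eqI[of "(i mod N, j)"])

text \<open>
  A relation between the monomials lies in the ideal of relations, hence annihilates all
  coordinate vectors. Applied to the coordinates of \<open>1\<close>, the monomials
  \<open>g\<^sup>i x\<^sup>j\<close> give the standard coordinate vectors.
\<close>

lemma pw_independent:
  assumes z: "(\<Sum>i<N. \<Sum>j<n. scal H (c i j) (pw i j)) = 0" and i0: "i0 < N" and j0: "j0 < n"
  shows "c i0 j0 = 0"
proof -
  define W :: "nat \<times> nat \<Rightarrow> radford_gen list" where "W = (\<lambda>(i, j). replicate i Gen_g @ replicate j Gen_x)"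
  define f where "f w = (if w \<in> W ` ({..<N} \<times> {..<n}) then c (length (filter ((=) Gen_g) w)) (length (filter ((=) Gen_x) w)) else 0)" for w
  have len: "length (filter ((=) Gen_g) (W p)) = fst p" "length (filter ((=) Gen_x) (W p)) = snd p" for p
    by (simp_all add: W_def case_prod_unfold)
  have inj: "inj_on W X" for X
    by (rule inj_onI) (metis len prod_eqI)
  have fW: "f (W p) = c (fst p) (snd p)" if "p \<in> {..<N} \<times> {..<n}" for p
    using that by (simp add: f_def len)
  have f0: "w \<notin> W ` ({..<N} \<times> {..<n}) \<Longrightarrow> f w = 0" for w by (simp add: f_def)
  have evW: "ev (W p) = pw (fst p) (snd p)" for p
    using ev_pw[of "fst p" "snd p"] by (simp only: W_def case_prod_unfold)
  have fin: "finite (W ` ({..<N} \<times> {..<n}))" by simp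
  have fmem: "f \<in> carrier free_alg"
    using f0 by (auto simp: free_alg_def intro: finite_subset[OF _ fin])
  have "free_eval H (\<lambda>c. case c of Gen_g \<Rightarrow> g | Gen_x \<Rightarrow> x) f =
      (\<Sum>w\<in>W ` ({..<N} \<times> {..<n}). scal H (f w) (ev w))"
    by (rule free_eval_finite[OF vsp fin f0])
  also have "\<dots> = (\<Sum>p\<in>{..<N} \<times> {..<n}. scal H (c (fst p) (snd p)) (pw (fst p) (snd p)))"
    unfolding sum.reindex[OF inj] comp_def evW by (intro sum.cong refl) (simp only: fW)
  also have "\<dots> = 0" using z by (simp add: sum.cartesian_product case_prod_unfold)
  finally have "free_eval H (\<lambda>c. case c of Gen_g \<Rightarrow> g | Gen_x \<Rightarrow> x) f = 0" .
  moreover have "two_sided_ideal free_alg {f \<in> carrier free_alg. annihilates (radford_op n q) (radford_space N n) f}"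
  proof (rule annihilator_ideal)
    show "radford_op n q c (\<phi> + \<psi>) = radford_op n q c \<phi> + radford_op n q c \<psi>" for c \<phi> \<psi>
      by (cases c) (auto simp: radford_op_def fun_eq_iff algebra_simps)
    show "radford_op n q c (fun_scal k \<phi>) = fun_scal k (radford_op n q c \<phi>)" for c k \<phi>
      by (cases c) (auto simp: radford_op_def fun_eq_iff algebra_simps)
    have "q ^ N = 1" using q_pow_n by (metis mult.commute power_mult power_one)
    then show "\<phi> \<in> radford_space N n \<Longrightarrow> radford_op n q c \<phi> \<in> radford_space N n" for c \<phi>
      using n_pos by (intro radford_space_stable) simp_all
  qed
  moreover have "radford_relations m n q \<subseteq>
    {f \<in> carrier free_alg. annihilates (radford_op n q) (radford_space N n) f}"
    using q_pow_n n_pos m_pos by (rule radford_relations_annihilate)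
  ultimately have ann: "annihilates (radford_op n q) (radford_space N n) f"
    using presented_by_independence[OF presentation fmem] by blast
  (* The coordinate vector of 1. *)
  define \<phi>0 :: "int \<times> nat \<Rightarrow> 'k" where "\<phi>0 = (\<lambda>(i, j). if int N dvd i \<and> j = 0 then 1 else 0)"
  have "int N dvd i - int N \<longleftrightarrow> int N dvd i" for i
    using dvd_add_left_iff[of "int N" "- int N" i] by (simp del: of_nat_mult)
  then have \<phi>0: "\<phi>0 \<in> radford_space N n"
    using n_pos by (auto simp: radford_space_def \<phi>0_def simp del: of_nat_mult)
  have val: "foldr (radford_op n q) (W (i, j)) \<phi>0 (int i0, j0) = (if i = i0 \<and> j = j0 then 1 else 0)"
    if "i < N" "j < n" for i j
  proof -
    have qd: "q powi (z * int j) = 1" if "int N dvd z" for z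
    proof -
      obtain k where "z = int N * k" using \<open>int N dvd z\<close> by (auto simp: dvd_def)
      then have "z * int j = int n * (int m * k * int j)" by simp
      moreover have "q powi (int n * w) = 1" for w
        by (subst power_int_mult) (simp add: q_pow_n)
      ultimately show ?thesis by metis
    qed
    have "foldr (radford_op n q) (W (i, j)) \<phi>0 (int i0, j0) = (radford_op n q Gen_x ^^ j) \<phi>0 (int i0 - int i, j0)"
      by (simp add: W_def foldr_replicate radford_op_pow_g)
    also have "\<dots> = (if j \<le> j0 then q powi ((int i0 - int i) * int j) * \<phi>0 (int i0 - int i, j0 - j)
      else q powi ((int i0 - int i) * int j) * (\<phi>0 (int i0 - int i - int n, n - j + j0) - \<phi>0 (int i0 - int i, n - j + j0)))"
      using that j0 n_pos by (subst radford_op_pow_x[OF q_pow_n]) (auto simp: \<phi>0_def)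
    also have "\<dots> = (if int N dvd int i0 - int i \<and> j = j0 then 1 else 0)"
      using that j0 qd by (auto simp: \<phi>0_def)
    also have "int N dvd int i0 - int i \<longleftrightarrow> i = i0"
    proof
      assume d: "int N dvd int i0 - int i"
      have "\<bar>int i0 - int i\<bar> < int N" using that(1) i0 by linarith
      then have "int i0 - int i = 0" using d zdvd_not_zless[of "\<bar>int i0 - int i\<bar>" "int N"] by force
      then show "i = i0" by simp
    qed simp
    finally show ?thesis .
  qed
  have "annihilates (radford_op n q) (radford_space N n) f \<longleftrightarrow> (\<forall>\<phi>\<in>radford_space N n. \<forall>i.
      (\<Sum>w\<in>W ` ({..<N} \<times> {..<n}). f w * foldr (radford_op n q) w \<phi> i) = 0)"
    by (rule annihilates_finite[OF fin]) (rule f0)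
  then have "(\<Sum>w\<in>W ` ({..<N} \<times> {..<n}). f w * foldr (radford_op n q) w \<phi>0 (int i0, j0)) = 0"
    using ann \<phi>0 by blast
  then have "(\<Sum>p\<in>{..<N} \<times> {..<n}. c (fst p) (snd p) * (if p = (i0, j0) then 1 else 0)) = 0"
    using val by (subst (asm) sum.reindex[OF inj]) (auto simp: fW intro!: sum.cong elim!: trans[rotated])
  then show ?thesis using i0 j0 by (simp add: if_distrib[of "\<lambda>y. _ * y"] cong: if_cong)
qed

lemma inj_pw: "inj_on (\<lambda>(i, j). pw i j) ({..<N} \<times> {..<n})"
proof (rule inj_onI, rule ccontr)
  fix p p' assume p: "p \<in> {..<N} \<times> {..<n}" "p' \<in> {..<N} \<times> {..<n}"
    and eq: "(\<lambda>(i, j). pw i j) p = (\<lambda>(i, j). pw i j) p'" and ne: "p \<noteq> p'"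
  interpret V: vector_space "scal H" by (rule vspace_vs[OF vsp])
  define c where "c i j = (if (i, j) = p then 1 else 0) - (if (i, j) = p' then 1 else (0 :: 'k))" for i j
  have "(\<Sum>i<N. \<Sum>j<n. scal H (c i j) (pw i j)) = (\<Sum>r\<in>{..<N} \<times> {..<n}. scal H (c (fst r) (snd r)) (pw (fst r) (snd r)))"
    by (simp add: sum.cartesian_product case_prod_unfold)
  also have "\<dots> = (\<Sum>r\<in>{..<N} \<times> {..<n}. (if r = p then pw (fst r) (snd r) else 0)) -
      (\<Sum>r\<in>{..<N} \<times> {..<n}. (if r = p' then pw (fst r) (snd r) else 0))"
    unfolding sum_subtractf[symmetric]
    by (intro sum.cong refl) (auto simp: c_def V.scale_left_diff_distrib)
  also have "\<dots> = 0" using p eq by (simp add: case_prod_unfold)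
  finally have "c (fst p) (snd p) = 0" using p by (intro pw_independent) auto
  then show False using ne by (simp add: c_def)
qed

lemma sum_RB: "(\<Sum>b\<in>RB. F b) = (\<Sum>i<N. \<Sum>j<n. F (pw i j))"
  unfolding RB_eq by (subst sum.reindex[OF inj_pw]) (simp add: sum.cartesian_product case_prod_unfold)

text \<open>
  The span of the monomials contains \<open>1\<close> and is stable under left multiplication by the
  generators.
\<close>

lemma basis_RB: "is_basis H RB"
proof -
  interpret V: vector_space "scal H" by (rule vspace_vs[OF vsp])
  have sub: "V.subspace (carrier H)" using vsp by (simp add: vspace_def)
  have RBc: "RB \<subseteq> carrier H" by (auto simp: RB_eq)
  have SC: "V.span RB \<subseteq> carrier H" using RBc sub by (rule V.span_minimal)
  have "V.independent RB"
  proof (rule V.independent_if_scalars_zero[OF finite_RB])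
    fix f b assume s: "(\<Sum>b\<in>RB. scal H (f b) b) = 0" and b: "b \<in> RB"
    then obtain i j where "i < N" "j < n" "b = pw i j" by (auto simp: RB_eq)
    then show "f b = 0" using s pw_independent[of "\<lambda>i j. f (pw i j)" i j] by (simp add: sum_RB)
  qed
  moreover have "V.span RB = carrier H"
  proof
    show "V.span RB \<subseteq> carrier H" by (rule SC)
    have pwS: "pw i j \<in> V.span RB" if "j \<le> n" for i j
    proof (cases "j = n")
      case True
      have "pw (i + n) 0 \<in> V.span RB" "pw i 0 \<in> V.span RB"
        using pw_RB[of 0] n_pos by (auto intro: V.span_base)
      then show ?thesis unfolding True pw_n by (rule V.span_diff)
    next
      case False
      then show ?thesis using that pw_RB by (auto intro: V.span_base)
    qed
    have act: "(case c of Gen_g \<Rightarrow> g | Gen_x \<Rightarrow> x) \<otimes> a \<in> V.span RB" if "a \<in> V.span RB" for c a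
    proof -
      let ?y = "case c of Gen_g \<Rightarrow> g | Gen_x \<Rightarrow> x"
      have y: "?y \<in> carrier H" by (cases c) simp_all
      have "a \<in> carrier H \<and> ?y \<otimes> a \<in> V.span RB"
        using that
      proof (rule V.span_induct)
        show "V.subspace {a. a \<in> carrier H \<and> ?y \<otimes> a \<in> V.span RB}"
        proof (rule V.subspaceI)
          have "?y \<otimes> 0 = 0" using linear_on_zero[OF linear_mult_right[OF y] vsp] .
          then show "0 \<in> {a. a \<in> carrier H \<and> ?y \<otimes> a \<in> V.span RB}" by (simp add: V.span_zero)
        qed (use y in \<open>auto simp: mult_add mult_scal V.span_add V.span_scale\<close>)
        fix b assume "b \<in> RB"
        then obtain i j where b: "b = pw i j" "j < n" by (auto simp: RB_eq)
        have "g \<otimes> b = pw (Suc i) j" "x \<otimes> b = scal H (q ^ i) (pw i (Suc j))"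
          unfolding b by (subst g_pw, subst pw_mult, simp) (subst x_pw, subst pw_mult, simp)
        then show "b \<in> carrier H \<and> ?y \<otimes> b \<in> V.span RB"
          using b pwS by (cases c) (auto intro: V.span_scale)
      qed
      then show ?thesis by simp
    qed
    have evS: "ev w \<in> V.span RB" for w
      using pwS[of 0 0] act by (induction w) (auto simp flip: one_pw)
    show "carrier H \<subseteq> V.span RB"
    proof
      fix a assume "a \<in> carrier H"
      then obtain f where "a = free_eval H (\<lambda>c. case c of Gen_g \<Rightarrow> g | Gen_x \<Rightarrow> x) f"
        using presentation unfolding presented_by_def by blast
      then show "a \<in> V.span RB" unfolding free_eval_def
        using evS by (auto intro!: V.span_sum V.span_scale)
    qed
  qed
  ultimately show ?thesis by (simp add: is_basis_def)
qed

sublocale fin_hopf H RB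
  by unfold_locales (simp_all add: finite_RB basis_RB)

lemma e_pw: "i < N \<Longrightarrow> j < n \<Longrightarrow> i' < N \<Longrightarrow> j' < n \<Longrightarrow> e (pw i j) (pw i' j') = (if i = i' \<and> j = j' then 1 else 0)"
  using e_delta[OF pw_RB pw_RB, of j j' i i'] inj_pw by (auto simp: inj_on_def)

lemma lform_eq_on_pw:
  assumes "lform H \<phi>" "lform H \<psi>" "a \<in> carrier H"
    and "\<And>i j. i < N \<Longrightarrow> j < n \<Longrightarrow> \<phi> (pw i j) = \<psi> (pw i j)"
  shows "\<phi> a = \<psi> a"
proof -
  have "(\<Sum>b\<in>RB. e b a * \<phi> b) = (\<Sum>b\<in>RB. e b a * \<psi> b)"
    using assms(4) by (intro sum.cong refl) (auto simp: RB_eq)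
  then show ?thesis using assms(1-3) by (simp add: lform_expand)
qed

lemma linear_eq_on_pw:
  assumes f: "linear_on H s f" and f': "linear_on H s f'" and a: "a \<in> carrier H"
    and eq: "\<And>i j. i < N \<Longrightarrow> j < n \<Longrightarrow> f (pw i j) = f' (pw i j)"
  shows "f a = f' a"
proof -
  have "(\<Sum>b\<in>RB. s (e b a) (f b)) = (\<Sum>b\<in>RB. s (e b a) (f' b))"
    using eq by (intro sum.cong refl) (auto simp: RB_eq)
  then show ?thesis using linear_expand[OF f a] linear_expand[OF f' a] by simp
qed

section \<open>The antipode of the Radford Hopf algebra\<close>

definition gi :: 'a where "gi = g [^] (N - 1)"

lemma gi_closed [simp]: "gi \<in> carrier H"
  by (simp add: gi_def)

lemma gi_g: "gi \<otimes> g = \<one>" and g_gi: "g \<otimes> gi = \<one>"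
proof -
  obtain k where k: "N = Suc k" using N_pos by (cases N) auto
  then have e: "N - 1 = k" by simp
  show "gi \<otimes> g = \<one>" using g_pow_N unfolding gi_def e by (simp add: k)
  show "g \<otimes> gi = \<one>" using g_pow_N nat_pow_Suc2[OF g_closed, of k] unfolding gi_def e by (simp only: k)
qed

lemma inv_g: "inv g = gi"
  by (rule inv_unique'[symmetric]) (simp_all add: gi_g g_gi)

lemma S_g: "S g = gi" and S_x: "S x = - (x \<otimes> gi)"
  using antipode_g antipode_x by (simp_all add: inv_g)

lemma S_gi: "S gi = g"
proof -
  have "S gi \<otimes> gi = \<one>" using S_mult[of g gi] by (simp add: g_gi S_g)
  then have "(S gi \<otimes> gi) \<otimes> g = g" by simp
  then show ?thesis by (simp add: m_assoc gi_g)
qed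

lemma g_x_gi: "g \<otimes> (x \<otimes> gi) = scal H (inverse q) x"
proof -
  have "x = x \<otimes> (g \<otimes> gi)" by (simp add: g_gi)
  also have "\<dots> = scal H q (g \<otimes> x \<otimes> gi)" by (simp add: x_g scal_mult flip: m_assoc)
  finally have "scal H (inverse q) x = scal H (inverse q * q) (g \<otimes> x \<otimes> gi)" by (metis scal_simps(3))
  then show ?thesis by (simp add: m_assoc)
qed

lemma SS_g: "S (S g) = g"
  by (simp add: S_g S_gi)

lemma SS_x: "S (S x) = scal H (inverse q) x"
proof -
  have "S (S x) = - (S (x \<otimes> gi))"
    by (simp add: S_x linear_on_uminus[OF S_linear])
  also have "S (x \<otimes> gi) = g \<otimes> (- (x \<otimes> gi))" by (simp add: S_mult S_gi S_x)
  also have "\<dots> = - (g \<otimes> (x \<otimes> gi))" by (rule linear_on_uminus[OF linear_mult_right]) simp_all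
  finally show ?thesis by (simp add: g_x_gi)
qed

lemma SS_mult: "a \<in> carrier H \<Longrightarrow> b \<in> carrier H \<Longrightarrow> S (S (a \<otimes> b)) = S (S a) \<otimes> S (S b)"
  by (simp add: S_mult)

lemma SS_pow: "a \<in> carrier H \<Longrightarrow> S (S (a [^] (k::nat))) = S (S a) [^] k"
  by (induction k) (simp_all add: SS_mult)

lemma scal_pow: "a \<in> carrier H \<Longrightarrow> scal H c a [^] (k::nat) = scal H (c ^ k) (a [^] k)"
  by (induction k) (simp_all add: scal_mult mult_scal mult.commute)

lemma SS_pw: "S (S (pw i j)) = scal H (inverse q ^ j) (pw i j)"
  by (simp add: pw_def SS_mult SS_pow SS_g SS_x scal_pow mult_scal)

lemma SS_linear: "linear_on H (scal H) (\<lambda>a. S (S a))"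
  using linear_on_comp[OF S_linear S_closed S_linear] .

text \<open>
  On \<open>g\<^sup>i x\<^sup>j\<close> the square of the antipode is multiplication by
  \<open>q\<^sup>-\<^sup>j\<close>, and \<open>q\<^sup>n = 1\<close>.
\<close>

lemma S_power_id: "a \<in> carrier H \<Longrightarrow> ((\<lambda>a. S (S a)) ^^ n) a = a"
proof -
  have cl: "((\<lambda>a. S (S a)) ^^ k) a \<in> carrier H" if "a \<in> carrier H" for k a
    using that by (induction k) auto
  have lin: "linear_on H (scal H) (((\<lambda>a. S (S a)) ^^ k))" for k
  proof (induction k)
    case 0 then show ?case by (simp add: linear_on_def)
  next
    case (Suc k)
    then show ?case using linear_on_comp[OF Suc cl SS_linear] by simp
  qed
  have sc: "((\<lambda>a. S (S a)) ^^ k) (pw i j) = scal H (inverse q ^ (j * k)) (pw i j)" for i j k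
    by (induction k) (simp_all add: linear_on_scal[OF SS_linear] SS_pw power_add mult.commute)
  have one: "inverse q ^ (j * n) = 1" for j
  proof -
    have "inverse q ^ (j * n) = (inverse q ^ n) ^ j" by (simp only: power_mult[symmetric] mult.commute)
    then show ?thesis using q_pow_n by (simp add: power_inverse)
  qed
  show "((\<lambda>a. S (S a)) ^^ n) a = a" if "a \<in> carrier H"
    using linear_eq_on_pw[OF lin[of n] _ that, of "\<lambda>a. a"] by (simp add: sc one linear_on_def)
qed

lemma bij_S': "bij_betw S (carrier H) (carrier H)"
proof -
  obtain k where k: "n = Suc k" using n_pos by (cases n) auto
  have cl: "((\<lambda>a. S (S a)) ^^ k) a \<in> carrier H" if "a \<in> carrier H" for k a
    using that by (induction k) auto
  have id: "S (S (((\<lambda>a. S (S a)) ^^ k) a)) = a" if "a \<in> carrier H" for a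
    using S_power_id[OF that] by (simp add: k)
  have comm: "((\<lambda>a. S (S a)) ^^ k) (S a) = S (((\<lambda>a. S (S a)) ^^ k) a)" for k a
    by (induction k) simp_all
  show ?thesis
    by (rule bij_betwI[where g = "\<lambda>a. S (((\<lambda>a. S (S a)) ^^ k) a)"])
      (use id cl in \<open>auto simp: comm\<close>)
qed

sublocale fin_hopf_bij H RB
  by unfold_locales (rule bij_S')

end

section \<open>Roots of unity and Gaussian binomials\<close>

lemma primitive_root_inj:
  fixes q :: "'k::field"
  assumes "primitive_root_of_unity n q" "n \<ge> 1" "s < n" "t < n" "q ^ s = q ^ t"
  shows "s = t"
proof -
  have q0: "q \<noteq> 0" using assms by (auto simp: primitive_root_of_unity_def power_0_left)
  have "False" if "s < t" "t < n" "q ^ s = q ^ t" for s t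
  proof -
    have "q ^ s * q ^ (t - s) = q ^ t" using that(1) by (simp flip: power_add)
    then have "q ^ s * q ^ (t - s) = q ^ s * 1" using that(3) by simp
    then have "q ^ (t - s) = 1" using q0 by simp
    then show False using assms(1) that by (auto simp: primitive_root_of_unity_def)
  qed
  then show ?thesis using assms by (metis linorder_neqE_nat)
qed

text \<open>
  The powers of \<open>q\<close> are \<open>n\<close> distinct roots of a polynomial of degree less than \<open>n\<close>, the
  difference of the two sides.
\<close>

lemma primitive_root_prod:
  fixes q z :: "'k::field"
  assumes q: "primitive_root_of_unity n q" and n: "n \<ge> 1"
  shows "(\<Prod>s<n. z - q ^ s) = z ^ n - 1"
proof -
  define p :: "'k poly" where "p = (\<Prod>s<n. [:- (q ^ s), 1:])"
  define r :: "'k poly" where "r = monom 1 n - 1"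
  have pp: "poly p z = (\<Prod>s<n. z - q ^ s)" for z by (simp add: p_def poly_prod)
  have pr: "poly r z = z ^ n - 1" for z by (simp add: r_def poly_monom)
  have dp: "degree p = n" by (simp add: p_def degree_prod_eq_sum_degree)
  have lp: "coeff p n = 1" using dp lead_coeff_prod[of "\<lambda>s. [:- (q ^ s), 1:]" "{..<n}"] by (simp add: p_def)
  have dr: "degree r \<le> n" unfolding r_def by (rule degree_diff_le) (simp_all add: degree_monom_le)
  have lr: "coeff r n = 1" using n by (simp add: r_def coeff_1)
  have "p - r = 0"
  proof (rule ccontr)
    assume ne: "p - r \<noteq> 0"
    have "degree (p - r) \<le> n" using dp dr by (intro degree_diff_le) simp_all
    then have d: "degree (p - r) \<le> n - 1" using lp lr by (intro coeff_0_degree_minus_1) simp_all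
    have "(\<lambda>s. q ^ s) ` {..<n} \<subseteq> {z. poly (p - r) z = 0}"
    proof
      fix z assume "z \<in> (\<lambda>s. q ^ s) ` {..<n}"
      then obtain s where s: "s < n" "z = q ^ s" by auto
      have "z ^ n = (q ^ n) ^ s" by (simp only: s power_mult[symmetric] mult.commute)
      then have "z ^ n = 1" using q by (simp add: primitive_root_of_unity_def)
      moreover have "(\<Prod>s<n. z - q ^ s) = 0" using s by (auto simp: prod_zero_iff)
      ultimately show "z \<in> {z. poly (p - r) z = 0}" by (simp add: pp pr)
    qed
    then have "card ((\<lambda>s. q ^ s) ` {..<n}) \<le> card {z. poly (p - r) z = 0}"
      using poly_roots_finite[OF ne] by (intro card_mono) simp_all
    also have "\<dots> \<le> degree (p - r)" by (rule card_poly_roots_bound[OF ne])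
    finally have "card ((\<lambda>s. q ^ s) ` {..<n}) \<le> n - 1" using d by simp
    moreover have "inj_on (\<lambda>s. q ^ s) {..<n}"
      using primitive_root_inj[OF q n] by (auto simp: inj_on_def)
    ultimately show False using n by (simp add: card_image)
  qed
  then have "p = r" by simp
  then show ?thesis using pp pr by metis
qed

text \<open>
  Gaussian binomial coefficients by their \<open>q\<close>-Pascal recursion, in the form in which they
  occur in the coproduct of \<open>x\<^sup>j\<close>.
\<close>

fun qbinom :: "'k::field \<Rightarrow> nat \<Rightarrow> nat \<Rightarrow> 'k" where
  "qbinom q 0 a = (if a = 0 then 1 else 0)"
| "qbinom q (Suc j) a = qbinom q j a + (if a = 0 then 0 else q ^ (Suc j - a) * qbinom q j (a - 1))"

lemma qbinom_zero: "j < a \<Longrightarrow> qbinom q j a = 0"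
  by (induction j arbitrary: a) auto

lemma qbinom_0 [simp]: "qbinom q j 0 = 1"
  by (induction j) auto

lemma qbinom_self: "qbinom q j j = 1"
  by (induction j) (auto simp: qbinom_zero)

lemma qbinom_Suc_self: "qbinom q (Suc j) j = (\<Sum>l<Suc j. q ^ l)"
proof (induction j)
  case (Suc j)
  have "qbinom q (Suc (Suc j)) (Suc j) = qbinom q (Suc j) (Suc j) + q * qbinom q (Suc j) j"
    by (simp del: qbinom.simps(2) add: qbinom.simps(2)[of q "Suc j" "Suc j"])
  then show ?case unfolding qbinom_self Suc
    by (simp add: sum.lessThan_Suc_shift[of _ "Suc j"] sum_distrib_left del: sum.lessThan_Suc)
qed simp

text \<open>
  Induction on \<open>j\<close>: the \<open>q\<close>-Pascal rule shifts the summation index and produces the factor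
  \<open>1 - z q\<^sup>j\<close>.
\<close>

lemma qbinom_theorem:
  "(\<Sum>a\<le>j. qbinom q j a * (-1) ^ a * q ^ (a * (a - 1) div 2) * z ^ a) = (\<Prod>s<j. 1 - z * q ^ s)"
proof (induction j)
  case (Suc j)
  define c where "c a = (-1) ^ a * q ^ (a * (a - 1) div 2) * z ^ a" for a
  have cS: "c (Suc a) = - (q ^ a * z * c a)" for a
  proof -
    have "Suc a * a div 2 = a * (a - 1) div 2 + a"
      by (cases a) (simp_all add: algebra_simps)
    then show ?thesis by (simp add: c_def power_add)
  qed
  have IH: "(\<Sum>a\<le>j. qbinom q j a * c a) = (\<Prod>s<j. 1 - z * q ^ s)"
    using Suc by (simp add: c_def mult.assoc)
  have "(\<Sum>a\<le>Suc j. qbinom q (Suc j) a * c a) =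
      (\<Sum>a\<le>Suc j. qbinom q j a * c a) + (\<Sum>a\<le>Suc j. (if a = 0 then 0 else q ^ (Suc j - a) * qbinom q j (a - 1)) * c a)"
    by (simp add: distrib_right sum.distrib del: sum.atMost_Suc)
  also have "(\<Sum>a\<le>Suc j. qbinom q j a * c a) = (\<Sum>a\<le>j. qbinom q j a * c a)"
    by (simp add: qbinom_zero)
  also have "(\<Sum>a\<le>Suc j. (if a = 0 then 0 else q ^ (Suc j - a) * qbinom q j (a - 1)) * c a) =
      (\<Sum>a\<le>j. q ^ (j - a) * qbinom q j a * c (Suc a))"
    by (simp add: sum.atMost_Suc_shift del: sum.atMost_Suc)
  also have "\<dots> = (\<Sum>a\<le>j. - (z * q ^ j) * (qbinom q j a * c a))"
  proof (rule sum.cong[OF refl])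
    fix a assume "a \<in> {..j}"
    then have "q ^ (j - a) * q ^ a = q ^ j" by (simp flip: power_add)
    then have "(q ^ (j - a) * q ^ a) * (z * (qbinom q j a * c a)) = q ^ j * (z * (qbinom q j a * c a))" by simp
    then show "q ^ (j - a) * qbinom q j a * c (Suc a) = - (z * q ^ j) * (qbinom q j a * c a)"
      by (simp add: cS mult_ac)
  qed
  also have "\<dots> = - (z * q ^ j) * (\<Sum>a\<le>j. qbinom q j a * c a)" by (rule sum_distrib_left[symmetric])
  finally show ?case unfolding IH by (simp add: c_def mult.assoc algebra_simps del: qbinom.simps sum.atMost_Suc)
qed simp

text \<open>
  The \<open>j\<close>-th summand times \<open>z\<close> is the difference of two consecutive products.
\<close>

lemma qbinom_telescope:
  "z * (\<Sum>j<n. q ^ j * (\<Prod>s<j. 1 - z * q ^ s)) = 1 - (\<Prod>s<n. 1 - z * (q :: 'k::field) ^ s)"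
  by (induction n) (simp_all add: algebra_simps)

section \<open>Coproducts and dual elements of the Radford Hopf algebra\<close>

context radford_setting begin

lemma grouplike_g: "grouplike g"
  by (simp add: grouplike_def comult_g counit_g)

lemma grouplike_one: "grouplike \<one>"
  by (simp add: grouplike_def comult_one counit_one one_tensor)

lemma grouplike_mult:
  assumes "grouplike a" "grouplike b"
  shows "grouplike (a \<otimes> b)"
proof -
  interpret HH: two_kalgebras H H ..
  show ?thesis using assms by (simp add: grouplike_def comult_mult counit_mult)
qed

lemma grouplike_pow: "grouplike (g [^] (i :: nat))"
  by (induction i) (simp_all add: grouplike_one grouplike_mult grouplike_g)

lemma sw_x: "bform H F \<Longrightarrow> sw x F = F x g + F \<one> x"
  using comult_sw[of x F] by (simp add: comult_x tens_apply bform_bilinear)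

lemma lform_scal: "lform H \<phi> \<Longrightarrow> a \<in> carrier H \<Longrightarrow> \<phi> (scal H c a) = c * \<phi> a"
  by (simp add: lform_def linear_on_def)

lemma bform_lforms: "bform H F \<Longrightarrow> a \<in> carrier H \<Longrightarrow> lform H (F a)"
  "bform H F \<Longrightarrow> a \<in> carrier H \<Longrightarrow> lform H (\<lambda>b. F b a)"
  by (simp_all add: bform_def)

lemma pw_times_x: "pw i j \<otimes> x = pw i (Suc j)"
  using pw_mult[of i j 0 1, folded x_pw] by simp

lemma pw_times_g: "pw i j \<otimes> g = scal H (q ^ j) (pw (Suc i) j)"
  using pw_mult[of i j 1 0, folded g_pw] by simp

text \<open>
  The two summands of \<open>\<Delta>(x)\<close> commute up to \<open>q\<close>, so the coproduct of \<open>x\<^sup>j\<close> is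
  a \<open>q\<close>-binomial expansion.
\<close>

lemma sw_x_pow:
  assumes F: "bform H F"
  shows "sw (x [^] j) F = (\<Sum>a\<le>j. qbinom q j a * F (pw 0 a) (pw a (j - a)))"
  using F
proof (induction j arbitrary: F)
  case 0
  then show ?case by (simp add: sw_one flip: one_pw)
next
  case (Suc j)
  note [simp] = lform_bform1[OF Suc.prems] lform_bform2[OF Suc.prems]
  define G where "G a = F (pw 0 a) (pw a (Suc j - a))" for a
  have "sw (x [^] Suc j) F = sw (x [^] j) (\<lambda>y z. F (y \<otimes> x) (z \<otimes> g) + F y (z \<otimes> x))"
    using Suc.prems by (simp add: sw_mult sw_x)
  also have "\<dots> = (\<Sum>a\<le>j. qbinom q j a * (F (pw 0 a \<otimes> x) (pw a (j - a) \<otimes> g) + F (pw 0 a) (pw a (j - a) \<otimes> x)))"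
  proof (rule Suc.IH)
    have "lform H (\<lambda>z. F (y \<otimes> x) (z \<otimes> g) + F y (z \<otimes> x))" "lform H (\<lambda>y. F (y \<otimes> x) (z \<otimes> g) + F y (z \<otimes> x))"
      if "y \<in> carrier H" "z \<in> carrier H" for y z
    proof -
      have "lform H (\<lambda>z. F (y \<otimes> x) (z \<otimes> g))" "lform H (\<lambda>z. F y (z \<otimes> x))"
        "lform H (\<lambda>y. F (y \<otimes> x) (z \<otimes> g))" "lform H (\<lambda>y. F y (z \<otimes> x))" using that by simp_all
      then show "lform H (\<lambda>z. F (y \<otimes> x) (z \<otimes> g) + F y (z \<otimes> x))" "lform H (\<lambda>y. F (y \<otimes> x) (z \<otimes> g) + F y (z \<otimes> x))"
        by (simp_all add: lform_def linear_on_def algebra_simps)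
    qed
    then show "bform H (\<lambda>y z. F (y \<otimes> x) (z \<otimes> g) + F y (z \<otimes> x))"
      by (intro bformI) auto
  qed
  also have "\<dots> = (\<Sum>a\<le>j. qbinom q j a * (q ^ (j - a) * G (Suc a) + G a))"
  proof (intro sum.cong refl arg_cong2[where f = "(*)"] arg_cong2[where f = "(+)"])
    fix a assume "a \<in> {..j}"
    have "pw 0 a \<otimes> x = pw 0 (Suc a)" by (rule pw_times_x)
    moreover have "pw a (j - a) \<otimes> g = scal H (q ^ (j - a)) (pw (Suc a) (j - a))" by (rule pw_times_g)
    ultimately show "F (pw 0 a \<otimes> x) (pw a (j - a) \<otimes> g) = q ^ (j - a) * G (Suc a)"
      using lform_scal[OF bform_lforms(1)[OF Suc.prems]] by (simp add: G_def)
    have "pw a (j - a) \<otimes> x = pw a (Suc (j - a))" by (rule pw_times_x)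
    then show "F (pw 0 a) (pw a (j - a) \<otimes> x) = G a" using \<open>a \<in> {..j}\<close> by (simp add: G_def Suc_diff_le)
  qed
  also have "\<dots> = (\<Sum>a\<le>j. q ^ (j - a) * qbinom q j a * G (Suc a)) + (\<Sum>a\<le>j. qbinom q j a * G a)"
    by (simp add: distrib_left sum.distrib mult_ac)
  also have "(\<Sum>a\<le>j. qbinom q j a * G a) = (\<Sum>a\<le>Suc j. qbinom q j a * G a)" by (simp add: qbinom_zero)
  also have "(\<Sum>a\<le>j. q ^ (j - a) * qbinom q j a * G (Suc a)) =
      (\<Sum>a\<le>Suc j. (if a = 0 then 0 else q ^ (Suc j - a) * qbinom q j (a - 1)) * G a)"
    by (simp add: sum.atMost_Suc_shift del: sum.atMost_Suc)
  also have "\<dots> + (\<Sum>a\<le>Suc j. qbinom q j a * G a) = (\<Sum>a\<le>Suc j. qbinom q (Suc j) a * G a)"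
    by (simp add: distrib_right sum.distrib add.commute del: sum.atMost_Suc)
  finally show ?case by (simp add: G_def)
qed

lemma sw_pw:
  assumes F: "bform H F"
  shows "sw (pw i j) F = (\<Sum>a\<le>j. qbinom q j a * F (pw i a) (pw (i + a) (j - a)))"
proof -
  note [simp] = lform_bform1[OF F] lform_bform2[OF F]
  have "sw (pw i j) F = sw (g [^] i) (\<lambda>y z. sw (x [^] j) (\<lambda>v w. F (y \<otimes> v) (z \<otimes> w)))"
    unfolding pw_def using F by (intro sw_mult) simp_all
  also have "\<dots> = sw (x [^] j) (\<lambda>v w. F (g [^] i \<otimes> v) (g [^] i \<otimes> w))"
    by (intro sw_grouplike grouplike_pow) simp
  also have "\<dots> = (\<Sum>a\<le>j. qbinom q j a * F (pw i 0 \<otimes> pw 0 a) (pw i 0 \<otimes> pw a (j - a)))"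
    unfolding g_pow_pw by (rule sw_x_pow) simp
  finally show ?thesis by (simp add: pw_mult)
qed

abbreviation \<alpha> :: "'a \<Rightarrow> 'k" where "\<alpha> \<equiv> radford_alpha H m n \<xi> g x"
abbreviation \<beta> :: "'a \<Rightarrow> 'k" where "\<beta> \<equiv> radford_beta H m n g x"

lemma dual_sum_closed: "(\<And>i. i \<in> I \<Longrightarrow> f i \<in> carrier DA) \<Longrightarrow> (\<Sum>i\<in>I. f i) \<in> carrier DA"
  by (rule vspace_sum_closed[OF vspace_DA])

lemma dual_scal_closed: "f \<in> carrier DA \<Longrightarrow> fun_scal c f \<in> carrier DA"
  using vspace_closed(3)[OF vspace_DA, of f c] by simp

lemma alpha_closed [simp]: "\<alpha> \<in> carrier DA" and beta_closed [simp]: "\<beta> \<in> carrier DA"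
  unfolding radford_alpha_def radford_beta_def
  by (intro dual_sum_closed dual_scal_closed e_mem)+

lemma \<xi>_mod: "\<xi> ^ (i mod N) = \<xi> ^ i"
proof -
  have "\<xi> ^ i = \<xi> ^ (N * (i div N) + i mod N)" by simp
  also have "\<dots> = (\<xi> ^ N) ^ (i div N) * \<xi> ^ (i mod N)" by (simp only: power_add power_mult)
  finally show ?thesis by (simp add: \<xi>_pow_N)
qed

lemma mod_N: "i mod N < N"
  using N_pos by simp

lemma alpha_pw:
  assumes j: "j < n"
  shows "\<alpha> (pw i j) = (if j = 0 then \<xi> ^ i else 0)"
proof -
  have "\<alpha> (pw i j) = (\<Sum>k<N. \<xi> ^ k * e (pw k 0) (pw (i mod N) j))"
    by (simp add: radford_alpha_def sum_fun_apply g_pow_pw pw_mod)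
  also have "\<dots> = (\<Sum>k<N. if k = i mod N then (if j = 0 then \<xi> ^ k else 0) else 0)"
    using j mod_N n_pos by (intro sum.cong refl) (auto simp: e_pw)
  also have "\<dots> = (if j = 0 then \<xi> ^ (i mod N) else 0)" using mod_N by simp
  finally show ?thesis by (simp add: \<xi>_mod)
qed

lemma beta_pw:
  assumes j: "j < n" and n: "n \<ge> 2"
  shows "\<beta> (pw i j) = (if j = 1 then 1 else 0)"
proof -
  have "g [^] k \<otimes> x = pw k 1" for k by (simp add: pw_def)
  then have "\<beta> (pw i j) = (\<Sum>k<N. e (pw k 1) (pw (i mod N) j))"
    by (simp add: radford_beta_def sum_fun_apply pw_mod)
  also have "\<dots> = (\<Sum>k<N. if k = i mod N then (if j = 1 then 1 else 0) else 0)"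
    using j mod_N n by (intro sum.cong refl) (auto simp: e_pw)
  also have "\<dots> = (if j = 1 then 1 else 0)" using mod_N by simp
  finally show ?thesis .
qed

lemma counit_pw: "\<epsilon> (pw i j) = (if j = 0 then 1 else 0)"
proof -
  have "\<epsilon> (a [^] (k::nat)) = \<epsilon> a ^ k" if "a \<in> carrier H" for a k
    using that by (induction k) (simp_all add: counit_one counit_mult mult.commute)
  then show ?thesis by (simp add: pw_def counit_mult counit_g counit_x power_0_left)
qed

lemma dual_mult_pw:
  assumes "f \<in> carrier DA" "p \<in> carrier DA"
  shows "(f \<otimes>\<^bsub>DA\<^esub> p) (pw i j) = (\<Sum>a\<le>j. qbinom q j a * (f (pw i a) * p (pw (i + a) (j - a))))"
  using assms by (simp add: sw_pw)

lemma dual_eq_on_pw: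
  assumes "f \<in> carrier DA" "p \<in> carrier DA" "\<And>i j. i < N \<Longrightarrow> j < n \<Longrightarrow> f (pw i j) = p (pw i j)"
  shows "f = p"
  by (rule dual_eqI[OF assms(1,2)], rule lform_eq_on_pw[OF dual_lform[OF assms(1)] dual_lform[OF assms(2)] _ assms(3)])

lemma dual_mult_pw_left:
  assumes "f \<in> carrier DA" "p \<in> carrier DA" and "\<And>i a. a < n \<Longrightarrow> f (pw i a) = (if a = 0 then c i else 0)" and j: "j < n"
  shows "(f \<otimes>\<^bsub>DA\<^esub> p) (pw i j) = c i * p (pw i j)"
proof -
  have "(f \<otimes>\<^bsub>DA\<^esub> p) (pw i j) = (\<Sum>a\<le>j. if a = 0 then c i * p (pw i j) else 0)"
    unfolding dual_mult_pw[OF assms(1,2)] using j assms(3) by (intro sum.cong refl) auto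
  then show ?thesis by simp
qed

lemma alpha_pow: "j < n \<Longrightarrow> (\<alpha> [^]\<^bsub>DA\<^esub> (s::nat)) (pw i j) = (if j = 0 then \<xi> ^ (s * i) else 0)"
proof (induction s arbitrary: i j)
  case 0
  then show ?case by (simp add: counit_pw)
next
  case (Suc s)
  have "(\<alpha> [^]\<^bsub>DA\<^esub> Suc s) (pw i j) = \<xi> ^ (s * i) * \<alpha> (pw i j)"
    unfolding dual.nat_pow_Suc using Suc by (intro dual_mult_pw_left[where c = "\<lambda>i. \<xi> ^ (s * i)"]) simp_all
  then show ?case using Suc.prems by (simp add: alpha_pw power_add mult.commute)
qed

text \<open>
  The functional \<open>\<beta>\<close> is supported in degree one in \<open>x\<close>, and degrees add under
  convolution.
\<close>

lemma beta_pow: "t < n \<Longrightarrow> j < n \<Longrightarrow> (\<beta> [^]\<^bsub>DA\<^esub> (t::nat)) (pw i j) = (if j = t then qfact q t else 0)"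
proof (induction t arbitrary: i j)
  case 0
  then show ?case by (simp add: counit_pw qfact_def)
next
  case (Suc t)
  have "(\<beta> [^]\<^bsub>DA\<^esub> Suc t) (pw i j) =
      (\<Sum>a\<le>j. qbinom q j a * ((\<beta> [^]\<^bsub>DA\<^esub> t) (pw i a) * \<beta> (pw (i + a) (j - a))))"
    unfolding dual.nat_pow_Suc by (rule dual_mult_pw) simp_all
  also have "\<dots> = (\<Sum>a\<le>j. if a = t then (if j = Suc t then qbinom q (Suc t) t * qfact q t else 0) else 0)"
    using Suc by (intro sum.cong refl) (auto simp: beta_pw)
  also have "\<dots> = (if j = Suc t then qbinom q (Suc t) t * qfact q t else 0)" by simp
  also have "qbinom q (Suc t) t * qfact q t = qfact q (Suc t)"
    unfolding qbinom_Suc_self by (simp add: qfact_def mult.commute)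
  finally show ?case .
qed

text \<open>The degree in \<open>x\<close> of a basis element is less than \<open>n\<close>.\<close>

lemma beta_pow_n:
  assumes n: "n \<ge> 2"
  shows "\<beta> [^]\<^bsub>DA\<^esub> n = (\<lambda>a. 0)"
proof -
  obtain t where t: "n = Suc t" using n by (cases n) auto
  then have tn: "t < n" "n \<le> Suc t" by simp_all
  have z: "(\<lambda>a. 0) \<in> carrier DA" by (simp add: dual_mem lform_def linear_on_def)
  show ?thesis
  proof (rule dual_eq_on_pw[OF dual.nat_pow_closed[OF beta_closed] z])
    fix i j assume "i < N" "j < n"
    have "(\<beta> [^]\<^bsub>DA\<^esub> Suc t) (pw i j) =
        (\<Sum>a\<le>j. qbinom q j a * ((\<beta> [^]\<^bsub>DA\<^esub> t) (pw i a) * \<beta> (pw (i + a) (j - a))))"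
      unfolding dual.nat_pow_Suc by (rule dual_mult_pw) simp_all
    also have "\<dots> = 0" using \<open>j < n\<close> n tn by (intro sum.neutral) (auto simp: beta_pow beta_pw)
    finally show "(\<beta> [^]\<^bsub>DA\<^esub> n) (pw i j) = 0" by (simp add: t)
  qed
qed

lemma alpha_pow_N: "\<alpha> [^]\<^bsub>DA\<^esub> (N * k) = \<one>\<^bsub>DA\<^esub>"
proof -
  have "\<xi> ^ (N * k * i) = 1" for i
    by (subst mult.assoc, subst power_mult) (simp only: \<xi>_pow_N power_one)
  then show ?thesis by (intro dual_eq_on_pw) (auto simp: alpha_pow counit_pw)
qed

text \<open>Integer exponents of \<open>\<xi>\<close> matter only modulo its order.\<close>

lemma \<xi>_cong:
  assumes "int N dvd a - b"
  shows "\<xi> powi a = \<xi> powi b"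
proof -
  obtain k where "a - b = int N * k" using assms by (auto simp: dvd_def)
  then have "a = b + int N * k" by simp
  moreover have "\<xi> powi (int N * k) = 1"
    by (subst power_int_mult) (simp add: \<xi>_pow_N del: of_nat_mult)
  ultimately show ?thesis by (simp add: power_int_add del: of_nat_mult)
qed

lemma \<xi>_eq_one_iff: "\<xi> powi z = 1 \<longleftrightarrow> int N dvd z"
proof
  assume "int N dvd z"
  then show "\<xi> powi z = 1" using \<xi>_cong[of z 0] by simp
next
  assume z: "\<xi> powi z = 1"
  define r where "r = nat (z mod int N)"
  have r: "int r = z mod int N" "r < N" using N_pos unfolding r_def by (simp_all add: nat_less_iff del: of_nat_mult)
  have "\<xi> powi (z mod int N) = \<xi> powi z" by (rule \<xi>_cong) (simp add: mod_eq_dvd_iff[symmetric])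
  then have "\<xi> ^ r = 1" using z r(1) by (metis power_int_of_nat)
  then have "r = 0" using prim_\<xi> r(2) by (auto simp: primitive_root_of_unity_def)
  then show "int N dvd z" using r(1) by (simp add: dvd_eq_mod_eq_0 del: of_nat_mult)
qed

lemma alpha_ipow:
  "\<alpha> [^]\<^bsub>DA\<^esub> (z::int) \<in> carrier DA"
  "j < n \<Longrightarrow> (\<alpha> [^]\<^bsub>DA\<^esub> (z::int)) (pw i j) = (if j = 0 then \<xi> powi (z * int i) else 0)"
proof -
  have "\<alpha> [^]\<^bsub>DA\<^esub> z \<in> carrier DA \<and> (\<forall>i j. j < n \<longrightarrow> (\<alpha> [^]\<^bsub>DA\<^esub> z) (pw i j) = (if j = 0 then \<xi> powi (z * int i) else 0))"
  proof (cases "z < 0")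
    case True
    define k where "k = nat (- z)"
    have zk: "z = - int k" using True by (simp add: k_def)
    have s: "k + k * (N - 1) = N * k"
      using N_pos by (cases N) (simp_all add: algebra_simps)
    have "\<alpha> [^]\<^bsub>DA\<^esub> k \<otimes>\<^bsub>DA\<^esub> \<alpha> [^]\<^bsub>DA\<^esub> (k * (N - 1)) = \<one>\<^bsub>DA\<^esub>"
      "\<alpha> [^]\<^bsub>DA\<^esub> (k * (N - 1)) \<otimes>\<^bsub>DA\<^esub> \<alpha> [^]\<^bsub>DA\<^esub> k = \<one>\<^bsub>DA\<^esub>"
      using s by (simp_all add: dual.nat_pow_mult alpha_pow_N add.commute del: mult_Suc_right)
    then have inv: "inv\<^bsub>DA\<^esub> (\<alpha> [^]\<^bsub>DA\<^esub> k) = \<alpha> [^]\<^bsub>DA\<^esub> (k * (N - 1))"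
      by (intro dual.inv_unique'[symmetric]) simp_all
    have "\<alpha> [^]\<^bsub>DA\<^esub> z = \<alpha> [^]\<^bsub>DA\<^esub> (k * (N - 1))"
      using True by (simp add: int_pow_def2 inv flip: k_def)
    moreover have "\<xi> ^ (k * (N - 1) * i) = \<xi> powi (z * int i)" for i
    proof -
      have "int N dvd int (k * (N - 1) * i) - z * int i"
      proof -
        have "int k + int (k * (N - 1)) = int N * int k"
          using arg_cong[OF s, of int] by (simp only: of_nat_add of_nat_mult)
        then have h: "int (k * (N - 1)) = int N * int k - int k" by (metis add_diff_cancel_left')
        have "int (k * (N - 1) * i) - z * int i = int N * (int k * int i)"
          unfolding of_nat_mult[of "k * (N - 1)" i] h zk by (simp add: algebra_simps)
        then show ?thesis by simp
      qed
      then show ?thesis using \<xi>_cong[of "int (k * (N - 1) * i)" "z * int i"] by (simp only: power_int_of_nat)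
    qed
    ultimately show ?thesis by (simp add: alpha_pow)
  next
    case False
    then obtain k where "z = int k" by (metis nonneg_int_cases linorder_not_less)
    then show ?thesis by (simp add: int_pow_int alpha_pow flip: power_int_of_nat)
  qed
  then show "\<alpha> [^]\<^bsub>DA\<^esub> z \<in> carrier DA"
    "j < n \<Longrightarrow> (\<alpha> [^]\<^bsub>DA\<^esub> z) (pw i j) = (if j = 0 then \<xi> powi (z * int i) else 0)" by auto
qed

lemma alpha_beta_pw:
  assumes "t < n" "j < n"
  shows "(\<alpha> [^]\<^bsub>DA\<^esub> (z::int) \<otimes>\<^bsub>DA\<^esub> \<beta> [^]\<^bsub>DA\<^esub> t) (pw i j) = (if j = t then \<xi> powi (z * int i) * qfact q t else 0)"
  using dual_mult_pw_left[OF alpha_ipow(1)[of z] dual.nat_pow_closed[OF beta_closed, of t], where c = "\<lambda>i. \<xi> powi (z * int i)"]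
    assms alpha_ipow(2) by (simp add: beta_pow)

lemma orthogonality: "(\<Sum>k<N. \<xi> powi (w * int k)) = (if int N dvd w then of_nat N else 0)"
proof (cases "int N dvd w")
  case True
  then have "\<xi> powi (w * int k) = 1" for k by (simp add: \<xi>_eq_one_iff del: of_nat_mult)
  then show ?thesis using True by simp
next
  case False
  define z where "z = \<xi> powi w"
  have z1: "z \<noteq> 1" using False \<xi>_eq_one_iff by (simp add: z_def)
  have pk: "\<xi> powi (w * int k) = z ^ k" for k unfolding z_def by (subst power_int_mult) simp
  have "z ^ N = 1" using pk[of N] \<xi>_eq_one_iff[of "w * int N"] by simp
  then have "(\<Sum>k<N. z ^ k) = 0" using z1 sum_gp_strict[of z N] by simp
  then show ?thesis using False by (simp add: pk)
qed

lemma qfact_nz: "j < n \<Longrightarrow> qfact q j \<noteq> 0"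
proof -
  assume j: "j < n"
  have "(\<Sum>l<i. q ^ l) \<noteq> 0" if "i \<in> {1..j}" for i
  proof (cases "q = 1")
    case True
    then have "n = 1"
      using prim_q n_pos by (cases "1 < n") (auto simp: primitive_root_of_unity_def dest!: spec[of _ 1])
    then show ?thesis using that j by simp
  next
    case False
    have "q ^ i \<noteq> 1" using prim_q that j by (auto simp: primitive_root_of_unity_def)
    then show ?thesis using False sum_gp_strict[of q i] by simp
  qed
  then show "qfact q j \<noteq> 0" by (simp add: qfact_def)
qed

lemma T_g: "T g = gi"
  using TS[of gi] by (simp add: S_gi)

lemma T_x: "T x = - pw (N - 1) 1"
proof -
  have gx: "gi \<otimes> x = pw (N - 1) 1" by (simp add: gi_def pw_def)
  have "S (- (gi \<otimes> x)) = - (S x \<otimes> S gi)" by (simp add: linear_on_uminus[OF S_linear] S_mult)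
  also have "S x \<otimes> S gi = - ((x \<otimes> gi) \<otimes> g)"
    unfolding S_x S_gi by (rule linear_on_uminus[OF linear_mult_left]) simp_all
  also have "(x \<otimes> gi) \<otimes> g = x" by (simp add: m_assoc gi_g)
  finally have "S (- (gi \<otimes> x)) = x" by simp
  then show ?thesis using TS[of "- (gi \<otimes> x)"] by (simp add: gx)
qed

lemma int_mult_pred_N: "int (a * (N - 1)) = int N * int a - int a"
proof -
  have "a + a * (N - 1) = N * a" using N_pos by (cases N) (simp_all add: algebra_simps)
  from arg_cong[OF this, of int] have "int a + int (a * (N - 1)) = int N * int a"
    by (simp only: of_nat_add of_nat_mult)
  then show ?thesis by (metis add_diff_cancel_left')
qed

lemma q_\<xi>: "q ^ k = \<xi> powi (int m * int k)"
  by (simp add: power_int_mult \<xi>_m)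

text \<open>
  The triangular exponent collects the factors from reordering
  \<open>(g\<^sup>-\<^sup>1x)\<^sup>s\<close>.
\<close>

lemma T_pw: "T (pw l s) = scal H ((-1) ^ s * \<xi> powi (- int (m * l * s) - int (s * (s - 1) * m div 2))) (pw ((l + s) * (N - 1)) s)"
proof (induction s)
  case 0
  have "T (g [^] l) = pw (l * (N - 1)) 0"
  proof (induction l)
    case (Suc l)
    have "T (g [^] Suc l) = gi \<otimes> T (g [^] l)" by (simp add: T_mult T_g)
    also have "\<dots> = pw (N - 1) 0 \<otimes> pw (l * (N - 1)) 0" unfolding Suc gi_def by (simp only: g_pow_pw)
    finally show ?case by (simp add: pw_mult)
  qed (simp flip: one_pw)
  then show ?case by (simp add: pw_def)
next
  case (Suc s)
  let ?k = "(l + s) * (N - 1)"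
  let ?c = "(-1) ^ s * \<xi> powi (- int (m * l * s) - int (s * (s - 1) * m div 2))"
  have ps: "pw l (Suc s) = pw l s \<otimes> x" by (simp add: pw_def m_assoc)
  have "T (pw l (Suc s)) = (- pw (N - 1) 1) \<otimes> scal H ?c (pw ?k s)"
    unfolding ps by (simp add: T_mult T_x Suc)
  also have "\<dots> = - (pw (N - 1) 1 \<otimes> scal H ?c (pw ?k s))"
    by (rule linear_on_uminus[OF linear_mult_left]) simp_all
  also have "\<dots> = scal H (- ?c * q ^ ?k) (pw (N - 1 + ?k) (Suc s))"
    by (simp add: mult_scal pw_mult)
  also have "N - 1 + ?k = (l + Suc s) * (N - 1)" by simp
  also have "- ?c * q ^ ?k = (-1) ^ Suc s * \<xi> powi (- int (m * l * Suc s) - int (Suc s * (Suc s - 1) * m div 2))"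
  proof -
    have h: "Suc s * (Suc s - 1) * m div 2 = s * (s - 1) * m div 2 + s * m"
    proof -
      have "Suc s * (Suc s - 1) * m = s * (s - 1) * m + (s * m) * 2"
        by (cases s) (simp_all add: algebra_simps)
      then show ?thesis by simp
    qed
    have "q ^ ?k = \<xi> powi (- (int m * int (l + s)))"
      unfolding q_\<xi>
    proof (rule \<xi>_cong)
      have "int m * int ?k - - (int m * int (l + s)) = int N * (int m * int (l + s))"
        unfolding int_mult_pred_N by (simp add: algebra_simps)
      then show "int N dvd int m * int ?k - - (int m * int (l + s))" by simp
    qed
    then have "?c * q ^ ?k = (-1) ^ s * \<xi> powi (- int (m * l * s) - int (s * (s - 1) * m div 2) - int m * int (l + s))"
      by (simp add: power_int_add power_int_diff power_int_minus divide_inverse)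
    also have "- int (m * l * s) - int (s * (s - 1) * m div 2) - int m * int (l + s) =
        - int (m * l * Suc s) - int (Suc s * (Suc s - 1) * m div 2)"
      unfolding h by (simp add: algebra_simps)
    finally show ?thesis by simp
  qed
  finally show ?case .
qed

text \<open>
  Comparison of values on the basis \<open>g\<^sup>l x\<^sup>s\<close>: the powers of \<open>\<beta>\<close> select
  the degree \<open>s\<close>, and the sum over \<open>k\<close> selects the power of \<open>g\<close> that occurs in the inverse
  antipode of \<open>g\<^sup>l x\<^sup>s\<close>.
\<close>

theorem u_formula:
  "u = scal D (1 / of_nat N) (\<Sum>i<N. \<Sum>k<N. \<Sum>j<n.
     scal D ((-1) ^ j * (1 / qfact q j) * \<xi> powi (- int ((i + j) * k) - int (j * (j - 1) * m div 2)))
       (bow (\<alpha> [^]\<^bsub>DA\<^esub> (- int (m * j) - int k) \<otimes>\<^bsub>DA\<^esub> \<beta> [^]\<^bsub>DA\<^esub> j) (g [^] i \<otimes> x [^] j)))"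
  (is "u = scal D _ ?S")
proof -
  define C where "C i k j = (-1) ^ j * (1 / qfact q j) * \<xi> powi (- int ((i + j) * k) - int (j * (j - 1) * m div 2))" for i k j
  define f where "f k j = \<alpha> [^]\<^bsub>DA\<^esub> (- int (m * j) - int k) \<otimes>\<^bsub>DA\<^esub> \<beta> [^]\<^bsub>DA\<^esub> j" for k j
  have fm: "f k j \<in> carrier DA" for k j unfolding f_def by (simp add: alpha_ipow(1))
  define R where "R = scal D (1 / of_nat N) (\<Sum>i<N. \<Sum>k<N. \<Sum>j<n. scal D (C i k j) (bow (f k j) (pw i j)))"
  have Rm: "R \<in> carrier DT"
    unfolding R_def scal_D
    by (intro vspace_closed(3)[OF D.vsp, simplified] vspace_sum_closed[OF D.vsp, simplified]) (simp_all add: fm)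
  have "u = R"
  proof (rule DT_eqI[OF u_closed Rm])
    fix y \<phi> assume y: "y \<in> carrier H" and \<phi>: "lform H \<phi>"
    show "E u y \<phi> = E R y \<phi>"
    proof (rule lform_eq_on_pw[OF _ _ y])
      show "lform H (\<lambda>y. E u y \<phi>)" "lform H (\<lambda>y. E R y \<phi>)"
        using Rm by (simp_all add: lform_E_arg[OF _ lmap_id])
      fix l s assume l: "l < N" and s: "s < n"
      define i0 where "i0 = (l + s) * (N - 1) mod N"
      have i0: "i0 < N" unfolding i0_def by (rule mod_N)
      have i0_iff: "int N dvd - int (i + s + l) \<longleftrightarrow> i = i0" if "i < N" for i
      proof -
        have e: "int ((l + s) * (N - 1)) = int N * int (l + s) - int (l + s)"
          by (rule int_mult_pred_N)
        have "int N dvd - int (i + s + l) \<longleftrightarrow> int N dvd int i - int ((l + s) * (N - 1))"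
        proof -
          have "int i - int ((l + s) * (N - 1)) = - (- int (i + s + l)) + int N * (- int (l + s))"
            unfolding e by (simp add: algebra_simps)
          then show ?thesis using dvd_add_left_iff[of "int N" "int N * (- int (l + s))" "- (- int (i + s + l))"]
            by (metis dvd_minus_iff dvd_triv_left)
        qed
        also have "\<dots> \<longleftrightarrow> int i mod int N = int ((l + s) * (N - 1)) mod int N"
          by (rule mod_eq_dvd_iff[symmetric])
        also have "\<dots> \<longleftrightarrow> i mod N = (l + s) * (N - 1) mod N" by (simp only: zmod_int[symmetric] of_nat_eq_iff)
        finally show ?thesis using that by (simp add: i0_def)
      qed
      define c where "c = (-1) ^ s * \<xi> powi (- int (m * l * s) - int (s * (s - 1) * m div 2))"
      have "E R (pw l s) \<phi> = (1 / of_nat N) * (\<Sum>i<N. \<Sum>k<N. \<Sum>j<n. C i k j * (f k j (pw l s) * \<phi> (pw i j)))"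
        unfolding R_def using \<phi> by (simp add: E_scal E_sum_left fm)
      also have "(\<Sum>i<N. \<Sum>k<N. \<Sum>j<n. C i k j * (f k j (pw l s) * \<phi> (pw i j))) =
          (\<Sum>i<N. \<Sum>k<N. c * \<xi> powi (- int (i + s + l) * int k) * \<phi> (pw i s))"
      proof (intro sum.cong refl)
        fix i k
        have "(\<Sum>j<n. C i k j * (f k j (pw l s) * \<phi> (pw i j))) =
            (\<Sum>j<n. if j = s then C i k s * (\<xi> powi ((- int (m * s) - int k) * int l) * qfact q s * \<phi> (pw i s)) else 0)"
          using s unfolding f_def by (intro sum.cong refl) (auto simp: alpha_beta_pw simp del: dual_mult_apply)
        also have "\<dots> = C i k s * (\<xi> powi ((- int (m * s) - int k) * int l) * qfact q s * \<phi> (pw i s))"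
          using s by simp
        also have "\<dots> = (-1) ^ s * (\<xi> powi (- int ((i + s) * k) - int (s * (s - 1) * m div 2)) *
            \<xi> powi ((- int (m * s) - int k) * int l)) * \<phi> (pw i s)"
          using qfact_nz[OF s] by (simp add: C_def field_simps)
        also have "\<xi> powi (- int ((i + s) * k) - int (s * (s - 1) * m div 2)) * \<xi> powi ((- int (m * s) - int k) * int l) =
            \<xi> powi ((- int (m * l * s) - int (s * (s - 1) * m div 2)) + - int (i + s + l) * int k)"
          by (subst power_int_add[symmetric]) (simp_all add: algebra_simps)
        also have "\<dots> = \<xi> powi (- int (m * l * s) - int (s * (s - 1) * m div 2)) * \<xi> powi (- int (i + s + l) * int k)"
          by (rule power_int_add) simp
        finally show "(\<Sum>j<n. C i k j * (f k j (pw l s) * \<phi> (pw i j))) = c * \<xi> powi (- int (i + s + l) * int k) * \<phi> (pw i s)"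
          by (simp add: c_def mult.assoc)
      qed
      also have "\<dots> = (\<Sum>i<N. c * (\<Sum>k<N. \<xi> powi (- int (i + s + l) * int k)) * \<phi> (pw i s))"
        by (simp only: sum_distrib_left sum_distrib_right)
      also have "\<dots> = (\<Sum>i<N. if i = i0 then c * of_nat N * \<phi> (pw i s) else 0)"
        unfolding orthogonality using i0_iff by (intro sum.cong refl) auto
      also have "\<dots> = c * of_nat N * \<phi> (pw i0 s)" using i0 by simp
      also have "(1 / of_nat N) * (c * of_nat N * \<phi> (pw i0 s)) = c * \<phi> (pw i0 s)"
        using char by simp
      also have "\<dots> = E u (pw l s) \<phi>"
        using \<phi> by (simp add: T_pw lform_scal c_def i0_def pw_mod)
      finally show "E u (pw l s) \<phi> = E R (pw l s) \<phi>" ..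
    qed
  qed
  then show ?thesis by (simp only: R_def C_def f_def pw_def)
qed

end

section \<open>The trace of the Drinfeld element\<close>

context radford_setting begin

lemma TT_pw: "T (T (pw i k)) = scal H (q ^ k) (pw i k)"
proof -
  have TTSS: "T (T (S (S z))) = z" if "z \<in> carrier H" for z using that by simp
  have "S (S (scal H (q ^ k) (pw i k))) = scal H (q ^ k * inverse q ^ k) (pw i k)"
    by (simp add: linear_on_scal[OF SS_linear] SS_pw)
  also have "q ^ k * inverse q ^ k = 1" by (simp flip: power_mult_distrib)
  finally have "S (S (scal H (q ^ k) (pw i k))) = pw i k" by simp
  then show ?thesis using TTSS[of "scal H (q ^ k) (pw i k)"] by simp
qed

text \<open>
  The exponents of \<open>\<xi>\<close> are multiples of \<open>m\<close>, so that the scalar is a power of \<open>q\<close>;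
  this form suits the \<open>q\<close>-binomial theorem.
\<close>

lemma T_pw_inverse: "T (pw l s) = scal H ((-1) ^ s * (inverse q ^ (l * s) * inverse q ^ (s * (s - 1) div 2))) (pw ((l + s) * (N - 1)) s)"
proof -
  have "s * (s - 1) * m div 2 = m * (s * (s - 1) div 2)"
  proof -
    have "even (s * (s - 1))" by (cases "even s") auto
    from div_mult_swap[OF this, of m] show ?thesis by (simp only: mult.commute)
  qed
  then have "- int (m * l * s) - int (s * (s - 1) * m div 2) = int m * (- int (l * s + s * (s - 1) div 2))"
    by (simp add: algebra_simps)
  then have "\<xi> powi (- int (m * l * s) - int (s * (s - 1) * m div 2)) = q powi (- int (l * s + s * (s - 1) div 2))"
    by (simp only: power_int_mult power_int_of_nat \<xi>_m)
  also have "\<dots> = inverse q ^ (l * s + s * (s - 1) div 2)"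
    by (simp only: power_int_minus power_int_of_nat power_inverse)
  finally show ?thesis by (simp only: T_pw power_add)
qed

lemma q_triangle: "q ^ (a * a) = q ^ a * (q ^ (a * (a - 1) div 2) * q ^ (a * (a - 1) div 2))"
proof -
  have "a * a = a + (a * (a - 1) div 2 + a * (a - 1) div 2)"
    by (cases a) (simp_all add: algebra_simps flip: mult_2)
  then show ?thesis by (metis power_add)
qed

text \<open>
  The diagonal coefficient of one summand of the coproduct. It vanishes unless \<open>l\<close> is the
  exponent of \<open>g\<^sup>-\<^sup>r\<close>, and otherwise the powers of \<open>q\<close> recombine to a summand
  of the \<open>q\<close>-binomial theorem with \<open>z = \<xi> q\<^sup>-\<^sup>r\<close>.
\<close>

lemma trace_summand:
  assumes a: "a \<le> j" and j: "j < n" and l: "l < N" and r: "r \<le> 1"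
  shows "e (pw l j) (T (pw l a) \<otimes> (T (pw r 0) \<otimes> T (T (pw (l + a) (j - a))))) * \<xi> ^ (l + a) =
    (if l = r * (N - 1) mod N then q ^ j * \<xi> ^ l * ((-1) ^ a * q ^ (a * (a - 1) div 2) * (\<xi> * inverse q ^ r) ^ a) else 0)"
proof -
  define t where "t = a * (a - 1) div 2"
  have ex: "pw ((l + a) * (N - 1) + (r * (N - 1) + (l + a))) j = pw (r * (N - 1)) j"
  proof (rule pw_cong)
    have "(l + a) * (N - 1) + (l + a) = (l + a) * N" using N_pos by (cases N) simp_all
    then have "(l + a) * (N - 1) + (r * (N - 1) + (l + a)) = r * (N - 1) + (l + a) * N" by linarith
    then show "((l + a) * (N - 1) + (r * (N - 1) + (l + a))) mod N = r * (N - 1) mod N" by (simp only: mod_mult_self1)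
  qed
  have qt: "q ^ (a * a) = q ^ a * (q ^ t * q ^ t)" unfolding t_def by (rule q_triangle)
  have qq: "q ^ (a * (r * (N - Suc 0))) = inverse q ^ (a * r)"
  proof -
    have "q ^ N = 1" by (subst mult.commute, subst power_mult) (simp add: q_pow_n)
    then have "q ^ (N - 1) * q = 1" using N_pos by (metis power_minus_mult less_le_trans zero_less_one)
    then have "q ^ (N - 1) = inverse q" by (metis inverse_unique mult.commute)
    then have "q ^ ((N - 1) * (r * a)) = inverse q ^ (r * a)" by (simp only: power_mult)
    then show ?thesis by (simp add: mult_ac)
  qed
  define c where "c = (-1) ^ a * (inverse q ^ (l * a) * inverse q ^ t) * (q ^ (j - a) * q ^ (a * (r * (N - 1) + (l + a))))"
  have "T (pw l a) \<otimes> (T (pw r 0) \<otimes> T (T (pw (l + a) (j - a)))) = scal H c (pw (r * (N - 1)) j)"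
    unfolding TT_pw unfolding T_pw_inverse t_def[symmetric]
    using a by (simp add: scal_mult mult_scal pw_mult ex[unfolded One_nat_def] c_def mult_ac)
  then have "e (pw l j) (T (pw l a) \<otimes> (T (pw r 0) \<otimes> T (T (pw (l + a) (j - a))))) = c * e (pw l j) (pw (r * (N - 1) mod N) j)"
    by (simp add: pw_mod lform_scal)
  also have "\<dots> = (if l = r * (N - 1) mod N then c else 0)"
    using l j mod_N by (simp add: e_pw)
  finally have 1: "e (pw l j) (T (pw l a) \<otimes> (T (pw r 0) \<otimes> T (T (pw (l + a) (j - a))))) * \<xi> ^ (l + a) =
      (if l = r * (N - 1) mod N then c * \<xi> ^ (l + a) else 0)" by simp
  have "c = (-1) ^ a * (inverse q ^ (l * a) * q ^ (l * a)) * (inverse q ^ t * q ^ t) * (q ^ (j - a) * q ^ a) * q ^ t * inverse q ^ (r * a)"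
    unfolding c_def by (simp add: distrib_left power_add qt qq mult_ac)
  also have "\<dots> = (-1) ^ a * q ^ j * q ^ t * inverse q ^ (r * a)"
    using a by (simp flip: power_mult_distrib power_add)
  finally have "c * \<xi> ^ (l + a) = q ^ j * \<xi> ^ l * ((-1) ^ a * q ^ t * (\<xi> * inverse q ^ r) ^ a)"
    by (simp add: power_add power_mult_distrib mult_ac flip: power_mult)
  then show ?thesis unfolding 1 t_def by (rule arg_cong[where f = "\<lambda>w. if _ then w else _"])
qed

text \<open>
  The trace of \<open>S(u)\<close> paired with \<open>g\<^sup>r\<close> and \<open>\<alpha>\<close>. By the \<open>q\<close>-binomial theorem
  its diagonal entries are the products \<open>\<Prod>\<^bsub>s<j\<^esub> (1 - z q\<^sup>s)\<close>,
  and their weighted sum telescopes. The values at \<open>r = 0\<close> and \<open>r = 1\<close> suffice for what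
  follows.
\<close>

lemma E_SD_u_alpha:
  assumes r: "r \<le> 1"
  shows "E (SD u) (pw r 0) \<alpha> = inverse \<xi> ^ r * (\<xi> * inverse q ^ r) ^ (n - 1)"
proof -
  define z where "z = \<xi> * inverse q ^ r"
  define l0 where "l0 = r * (N - 1) mod N"
  have l0: "l0 < N" unfolding l0_def by (rule mod_N)
  have z0: "z \<noteq> 0" by (simp add: z_def)
  note [simp] = lform_comp[OF dual_lform[OF alpha_closed]] lform_comp[OF dual_lform[OF e_mem]]
  have inner: "sw (pw l j) (\<lambda>a1 rr. sw rr (\<lambda>a2 a3. e (pw l j) (T a1 \<otimes> (T (pw r 0) \<otimes> T (T a3))) * \<alpha> a2)) =
      (if l = l0 then q ^ j * \<xi> ^ l * (\<Prod>s<j. 1 - z * q ^ s) else 0)" if l: "l < N" and j: "j < n" for l j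
  proof -
    let ?F = "\<lambda>a1 a3. e (pw l j) (T a1 \<otimes> (T (pw r 0) \<otimes> T (T a3)))"
    have "sw (pw l j) (\<lambda>a1 rr. sw rr (\<lambda>a2 a3. ?F a1 a3 * \<alpha> a2)) =
        (\<Sum>a\<le>j. qbinom q j a * sw (pw (l + a) (j - a)) (\<lambda>a2 a3. ?F (pw l a) a3 * \<alpha> a2))"
      by (rule sw_pw) simp
    also have "\<dots> = (\<Sum>a\<le>j. qbinom q j a * (?F (pw l a) (pw (l + a) (j - a)) * \<xi> ^ (l + a)))"
    proof (intro sum.cong refl arg_cong2[where f = "(*)"])
      fix a assume a: "a \<in> {..j}"
      (* Of the second coproduct only the term of degree 0 in x survives under alpha. *)
      have "sw (pw (l + a) (j - a)) (\<lambda>a2 a3. ?F (pw l a) a3 * \<alpha> a2) =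
          (\<Sum>c\<le>j - a. qbinom q (j - a) c * (?F (pw l a) (pw (l + a + c) (j - a - c)) * \<alpha> (pw (l + a) c)))"
        by (rule sw_pw) simp
      also have "\<dots> = (\<Sum>c\<le>j - a. if c = 0 then ?F (pw l a) (pw (l + a) (j - a)) * \<xi> ^ (l + a) else 0)"
        using j by (intro sum.cong refl) (auto simp: alpha_pw)
      finally show "sw (pw (l + a) (j - a)) (\<lambda>a2 a3. ?F (pw l a) a3 * \<alpha> a2) =
          ?F (pw l a) (pw (l + a) (j - a)) * \<xi> ^ (l + a)" by simp
    qed
    also have "\<dots> = (\<Sum>a\<le>j. if l = l0 then q ^ j * \<xi> ^ l * (qbinom q j a * (-1) ^ a * q ^ (a * (a - 1) div 2) * z ^ a) else 0)"
    proof (intro sum.cong refl)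
      fix a assume "a \<in> {..j}"
      then show "qbinom q j a * (?F (pw l a) (pw (l + a) (j - a)) * \<xi> ^ (l + a)) =
          (if l = l0 then q ^ j * \<xi> ^ l * (qbinom q j a * (-1) ^ a * q ^ (a * (a - 1) div 2) * z ^ a) else 0)"
        using trace_summand[OF _ j l r, of a] by (simp add: l0_def z_def mult_ac)
    qed
    also have "\<dots> = (if l = l0 then q ^ j * \<xi> ^ l * (\<Prod>s<j. 1 - z * q ^ s) else 0)"
      unfolding qbinom_theorem[symmetric] by (simp add: sum_distrib_left)
    finally show ?thesis .
  qed
  have "E (SD u) (pw r 0) \<alpha> = (\<Sum>l<N. \<Sum>j<n. if l = l0 then q ^ j * \<xi> ^ l * (\<Prod>s<j. 1 - z * q ^ s) else 0)"
    by (simp add: E_SD_u sum_RB inner)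
  also have "\<dots> = (\<Sum>l<N. if l = l0 then \<xi> ^ l * (\<Sum>j<n. q ^ j * (\<Prod>s<j. 1 - z * q ^ s)) else 0)"
    by (intro sum.cong refl) (simp add: sum_distrib_left mult_ac)
  also have "\<dots> = \<xi> ^ l0 * (\<Sum>j<n. q ^ j * (\<Prod>s<j. 1 - z * q ^ s))" using l0 by simp
  also have "(\<Sum>j<n. q ^ j * (\<Prod>s<j. 1 - z * q ^ s)) = z ^ (n - 1)"
  proof -
    (* The product over all n-th roots of unity is 1 - z^n, so only one power of z remains. *)
    have "(\<Prod>s<n. 1 - z * q ^ s) = (\<Prod>s<n. z * (inverse z - q ^ s))"
      using z0 by (intro prod.cong refl) (simp add: algebra_simps)
    also have "\<dots> = z ^ n * (inverse z ^ n - 1)"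
      by (simp add: prod.distrib primitive_root_prod[OF prim_q n_pos])
    also have "\<dots> = 1 - z ^ n" using z0 by (simp add: algebra_simps flip: power_mult_distrib)
    finally have "z * (\<Sum>j<n. q ^ j * (\<Prod>s<j. 1 - z * q ^ s)) = z ^ n"
      unfolding qbinom_telescope by simp
    also have "z ^ n = z * z ^ (n - 1)" using n_pos by (cases n) simp_all
    finally show ?thesis using z0 by simp
  qed
  also have "\<xi> ^ l0 = inverse \<xi> ^ r"
  proof -
    have "\<xi> ^ (N - 1) * \<xi> = 1" using N_pos \<xi>_pow_N by (metis power_minus_mult less_le_trans zero_less_one)
    then have "\<xi> ^ (N - 1) = inverse \<xi>" by (metis inverse_unique mult.commute)
    then show ?thesis unfolding l0_def \<xi>_mod by (subst mult.commute, subst power_mult) simp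
  qed
  finally show ?thesis by (simp add: z_def)
qed

section \<open>Group-like elements and characters of the Radford Hopf algebra\<close>

lemma dual_pow_grouplike: "grouplike h \<Longrightarrow> f \<in> carrier DA \<Longrightarrow> (f [^]\<^bsub>DA\<^esub> (k::nat)) h = f h ^ k"
proof (induction k)
  case (Suc k)
  then show ?case by (simp add: sw_grouplike)
qed (simp add: grouplike_def)

text \<open>
  Evaluation at a group-like element is multiplicative on the dual and \<open>\<beta>\<close> is
  nilpotent.
\<close>

lemma beta_pow_grouplike:
  assumes h: "grouplike h" and j: "j < n"
  shows "(\<beta> [^]\<^bsub>DA\<^esub> j) h = (if j = 0 then 1 else 0)"
proof (cases "j = 0")
  case False
  then have "\<beta> h ^ n = 0"
    using dual_pow_grouplike[OF h beta_closed, of n] beta_pow_n j by (simp add: zero_fun_def)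
  then show ?thesis using False dual_pow_grouplike[OF h beta_closed, of j] by simp
qed (use h in \<open>simp add: grouplike_def\<close>)

text \<open>
  Fourier inversion: the dual basis is a combination of the products
  \<open>\<alpha>\<^sup>s \<beta>\<^sup>j\<close>, so a group-like element is determined by the values
  of \<open>\<alpha>\<close> and \<open>\<beta>\<close> on it.
\<close>

lemma e_pw_alpha_beta:
  assumes i: "i < N" and j: "j < n"
  shows "e (pw i j) = (\<Sum>s<N. fun_scal (\<xi> powi (- int i * int s) / (of_nat N * qfact q j))
    (\<alpha> [^]\<^bsub>DA\<^esub> int s \<otimes>\<^bsub>DA\<^esub> \<beta> [^]\<^bsub>DA\<^esub> j))"
proof (rule dual_eq_on_pw)
  fix l t assume l: "l < N" and t: "t < n"
  have "(\<Sum>s<N. \<xi> powi (- int i * int s) / (of_nat N * qfact q j) *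
      (if t = j then \<xi> powi (int s * int l) * qfact q j else 0)) =
      (\<Sum>s<N. if t = j then \<xi> powi ((int l - int i) * int s) / of_nat N else 0)"
  proof (intro sum.cong refl)
    fix s
    have "\<xi> powi ((int l - int i) * int s) = \<xi> powi (- int i * int s + int s * int l)"
      by (simp add: algebra_simps)
    also have "\<dots> = \<xi> powi (- int i * int s) * \<xi> powi (int s * int l)" by (rule power_int_add) simp
    finally show "\<xi> powi (- int i * int s) / (of_nat N * qfact q j) * (if t = j then \<xi> powi (int s * int l) * qfact q j else 0) =
        (if t = j then \<xi> powi ((int l - int i) * int s) / of_nat N else 0)"
      using qfact_nz[OF j] by simp
  qed
  also have "\<dots> = (if t = j then (\<Sum>s<N. \<xi> powi ((int l - int i) * int s)) / of_nat N else 0)"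
    by (simp add: sum_divide_distrib)
  also have "\<dots> = (if l = i \<and> t = j then 1 else 0)"
  proof -
    have "int N dvd int l - int i \<longleftrightarrow> l = i"
    proof -
      have "int N dvd int l - int i \<longleftrightarrow> int l mod int N = int i mod int N" by (rule mod_eq_dvd_iff[symmetric])
      also have "\<dots> \<longleftrightarrow> l mod N = i mod N" by (simp only: zmod_int[symmetric] of_nat_eq_iff)
      finally show ?thesis using i l by simp
    qed
    then show ?thesis unfolding orthogonality using char by simp
  qed
  finally show "e (pw i j) (pw l t) = (\<Sum>s<N. fun_scal (\<xi> powi (- int i * int s) / (of_nat N * qfact q j))
    (\<alpha> [^]\<^bsub>DA\<^esub> int s \<otimes>\<^bsub>DA\<^esub> \<beta> [^]\<^bsub>DA\<^esub> j)) (pw l t)"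
    using i j l t by (simp add: e_pw sum_fun_apply alpha_beta_pw eq_commute del: dual_mult_apply)
qed (simp_all add: dual_sum_closed dual_scal_closed alpha_ipow(1))

lemma grouplike_eqI:
  assumes h: "grouplike h" and h': "grouplike h'" and eq: "\<alpha> h = \<alpha> h'"
  shows "h = h'"
proof (rule carrier_eqI)
  fix b assume "b \<in> RB"
  then obtain i j where ij: "i < N" "j < n" "b = pw i j" by (auto simp: RB_eq)
  have "e (pw i j) k = (\<Sum>s<N. \<xi> powi (- int i * int s) / (of_nat N * qfact q j) * (\<alpha> k ^ s * (if j = 0 then 1 else 0)))"
    if "grouplike k" for k
    unfolding e_pw_alpha_beta[OF ij(1,2)] using that ij
    by (simp add: sum_fun_apply sw_grouplike dual_pow_grouplike[OF _ alpha_closed] beta_pow_grouplike int_pow_int)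
  then show "e b h = e b h'" using h h' eq by (simp add: ij(3))
qed (use h h' in simp_all)

lemma alpha_g_pow: "\<alpha> (g [^] (b::nat)) = \<xi> ^ b"
  using n_pos by (simp add: g_pow_pw alpha_pw)

text \<open>
  Since \<open>\<alpha>\<^sup>N = \<epsilon>\<close>, the value of \<open>\<alpha>\<close> on \<open>h\<close> is a power of
  \<open>\<xi>\<close>, hence equal to its value on a power of \<open>g\<close>.
\<close>

lemma grouplike_is_g_pow:
  assumes h: "grouplike h"
  obtains b where "b < N" "h = g [^] b"
proof -
  have "\<alpha> h ^ N = 1"
    using dual_pow_grouplike[OF h alpha_closed, of N] alpha_pow_N[of 1] h by (simp add: grouplike_def)
  then have "(\<Prod>s<N. \<alpha> h - \<xi> ^ s) = 0"
    using primitive_root_prod[OF prim_\<xi>, of "\<alpha> h"] N_pos by simp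
  then obtain b where b: "b < N" "\<alpha> h = \<xi> ^ b" by auto
  have "h = g [^] b" by (rule grouplike_eqI[OF h grouplike_pow]) (simp add: b alpha_g_pow)
  then show thesis using b that by blast
qed

lemma character_g_nz: "character \<chi> \<Longrightarrow> \<chi> g \<noteq> 0"
  using g_gi unfolding character_def by (metis g_closed gi_closed mult_zero_left zero_neq_one)

lemma character_pow: "character \<chi> \<Longrightarrow> a \<in> carrier H \<Longrightarrow> \<chi> (a [^] (k::nat)) = \<chi> a ^ k"
  by (induction k) (simp_all add: character_def mult.commute)

text \<open>
  The relation \<open>x g = q g x\<close> forces it, as \<open>q \<noteq> 1\<close> and \<open>\<chi>(g)\<close> is invertible.
\<close>

lemma character_x:
  assumes \<chi>: "character \<chi>" and n: "n \<ge> 2"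
  shows "\<chi> x = 0"
proof -
  have "\<chi> (x \<otimes> g) = q * \<chi> (g \<otimes> x)" using \<chi> by (simp add: x_g lform_scal)
  then have "\<chi> x * \<chi> g = q * (\<chi> g * \<chi> x)" using \<chi> by (simp add: character_def)
  then have "(1 - q) * (\<chi> g * \<chi> x) = 0" by (simp add: algebra_simps)
  moreover have "q \<noteq> 1" using prim_q n by (auto simp: primitive_root_of_unity_def dest!: spec[of _ 1])
  ultimately show ?thesis using character_g_nz[OF \<chi>] by simp
qed

lemma character_pw:
  assumes \<chi>: "character \<chi>" and j: "j < n"
  shows "\<chi> (pw i j) = (if j = 0 then \<chi> g ^ i else 0)"
proof -
  have "\<chi> (pw i j) = \<chi> g ^ i * \<chi> x ^ j"
    using \<chi> character_pow[OF \<chi>] by (simp add: pw_def character_def)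
  then show ?thesis using character_x[OF \<chi>] j by (cases "j = 0") auto
qed

lemma character_eqI:
  assumes "character \<chi>" "character \<chi>'" "\<chi> g = \<chi>' g"
  shows "\<chi> = \<chi>'"
  using assms by (intro dual_eq_on_pw) (simp_all add: character_pw)

lemma character_one: "character \<one>\<^bsub>DA\<^esub>"
  by (simp add: character_def counit_one counit_mult)

lemma character_mult:
  assumes \<chi>: "character \<chi>" and \<psi>: "character \<psi>"
  shows "character (\<chi> \<otimes>\<^bsub>DA\<^esub> \<psi>)"
  unfolding character_def
proof (intro conjI ballI)
  show "\<chi> \<otimes>\<^bsub>DA\<^esub> \<psi> \<in> carrier DA" using \<chi> \<psi> by simp
  show "(\<chi> \<otimes>\<^bsub>DA\<^esub> \<psi>) \<one> = 1" using \<chi> \<psi> by (simp add: sw_grouplike grouplike_one character_def)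
  fix a b assume a: "a \<in> carrier H" and b: "b \<in> carrier H"
  note [simp] = lform_comp[OF dual_lform[OF character_closed[OF \<chi>]]] lform_comp[OF dual_lform[OF character_closed[OF \<psi>]]]
  have m: "\<chi> (a \<otimes> b) = \<chi> a * \<chi> b" "\<psi> (a \<otimes> b) = \<psi> a * \<psi> b" if "a \<in> carrier H" "b \<in> carrier H" for a b
    using \<chi> \<psi> that by (simp_all add: character_def)
  have "(\<chi> \<otimes>\<^bsub>DA\<^esub> \<psi>) (a \<otimes> b) = sw a (\<lambda>x y. sw b (\<lambda>z w. \<chi> (x \<otimes> z) * \<psi> (y \<otimes> w)))"
    using a b \<chi> \<psi> by (simp add: sw_mult)
  also have "\<dots> = sw a (\<lambda>x y. sw b (\<lambda>z w. (\<chi> x * \<psi> y) * (\<chi> z * \<psi> w)))"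
    by (rule sw_cong[OF refl], rule sw_cong[OF refl]) (simp add: m)
  also have "\<dots> = (\<chi> \<otimes>\<^bsub>DA\<^esub> \<psi>) a * (\<chi> \<otimes>\<^bsub>DA\<^esub> \<psi>) b"
    using a b \<chi> \<psi> by (simp add: sw_scale sw_scale')
  finally show "(\<chi> \<otimes>\<^bsub>DA\<^esub> \<psi>) (a \<otimes> b) = (\<chi> \<otimes>\<^bsub>DA\<^esub> \<psi>) a * (\<chi> \<otimes>\<^bsub>DA\<^esub> \<psi>) b" .
qed

lemma character_pow_closed: "character \<chi> \<Longrightarrow> character (\<chi> [^]\<^bsub>DA\<^esub> (k::nat))"
  by (induction k) (simp_all add: character_one character_mult)

section \<open>Ribbon elements of the double of the Radford Hopf algebra\<close>

text \<open>
  The group-like factor of \<open>S(u)\<close> is some \<open>\<chi> \<bowtie> h\<close>. The trace at \<open>1\<close> gives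
  \<open>\<alpha>(h)\<close> and the trace at \<open>g\<close> gives \<open>\<chi>(g)\<close>; these values determine both. That
  \<open>\<alpha>\<^sup>m\<close> is a character comes out of the comparison.
\<close>

lemma SD_u:
  shows "character (\<alpha> [^]\<^bsub>DA\<^esub> m)" and "SD u = u \<otimes>\<^bsub>D\<^esub> bow (\<alpha> [^]\<^bsub>DA\<^esub> m) (g [^] (n - 1))"
proof -
  obtain w where w: "D_grouplike w" "SD u = u \<otimes>\<^bsub>D\<^esub> w" by (rule SD_u_split)
  obtain \<chi> h where \<chi>: "character \<chi>" and h: "grouplike h" and wb: "w = bow \<chi> h"
    using D_grouplike_split[OF w(1)] .
  have tr: "\<chi> (pw r 0) * \<alpha> (T (pw r 0) \<otimes> h) = inverse \<xi> ^ r * (\<xi> * inverse q ^ r) ^ (n - 1)" if "r \<le> 1" for r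
    using E_u_bow_grouplike[OF \<chi> grouplike_closed[OF h] grouplike_pow[of r], of \<alpha>] E_SD_u_alpha[OF that] w(2) wb
    by (simp add: g_pow_pw)
  (* The trace at 1 determines h, and then the trace at g determines the character. *)
  have "\<alpha> h = \<xi> ^ (n - 1)"
    using tr[of 0] \<chi> h by (simp add: character_def flip: one_pw)
  then have h': "h = g [^] (n - 1)"
    by (intro grouplike_eqI[OF h grouplike_pow]) (simp add: alpha_g_pow)
  have "T g \<otimes> g [^] (n - 1) = g [^] (N - 1 + (n - 1))" by (simp add: T_g gi_def nat_pow_mult)
  then have 1: "\<chi> g * \<xi> ^ (N - 1 + (n - 1)) = inverse \<xi> * (\<xi> * inverse q) ^ (n - 1)"
    using tr[of 1] unfolding h' g_pw[symmetric] by (simp add: alpha_g_pow)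
  have "\<xi> ^ (N - 1) * \<xi> = 1" using N_pos \<xi>_pow_N by (metis power_minus_mult less_le_trans zero_less_one)
  then have "\<xi> ^ (N - 1) = inverse \<xi>" by (metis inverse_unique mult.commute)
  then have "\<chi> g = inverse q ^ (n - 1)" using 1 by (simp add: power_add power_mult_distrib)
  moreover have "q ^ (n - 1) * q = 1" using n_pos q_pow_n by (metis power_minus_mult less_le_trans zero_less_one)
  then have "q = inverse (q ^ (n - 1))" by (metis inverse_unique)
  ultimately have cg: "\<chi> g = q" by (simp add: power_inverse)
  have "\<chi> = \<alpha> [^]\<^bsub>DA\<^esub> m"
  proof (rule dual_eq_on_pw)
    fix i j assume "i < N" "j < n"
    then show "\<chi> (pw i j) = (\<alpha> [^]\<^bsub>DA\<^esub> m) (pw i j)"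
      using \<chi> by (simp add: character_pw cg alpha_pow power_mult \<xi>_m)
  qed (use \<chi> in simp_all)
  then show "character (\<alpha> [^]\<^bsub>DA\<^esub> m)" "SD u = u \<otimes>\<^bsub>D\<^esub> bow (\<alpha> [^]\<^bsub>DA\<^esub> m) (g [^] (n - 1))"
    using \<chi> w(2) wb h' by simp_all
qed

text \<open>
  The generators suffice. On \<open>g\<close> both sides agree by commutativity; on \<open>x\<close> the left side
  carries the factor \<open>q\<^sup>b\<close> from moving \<open>g\<^sup>b\<close> past \<open>x\<close>, and the right side
  \<open>q\<^sup>-\<^sup>1 \<chi>(g)\<close>.
\<close>

lemma implements_S2_pw:
  assumes \<chi>: "character \<chi>" and cg: "\<chi> g = q ^ Suc b" and j: "j < n"
  shows "implements_S2 \<chi> (g [^] b) (pw i j)"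
proof -
  have o: "\<chi> \<one> = 1" using \<chi> by (simp add: character_def)
  have Tb: "T (g [^] b) \<otimes> g [^] b = \<one>" by (rule grouplike_T(1)[OF grouplike_pow])
  have one: "implements_S2 \<chi> (g [^] b) \<one>"
    unfolding implements_S2_def
  proof (intro allI impI)
    fix \<psi> assume \<psi>: "lform H \<psi>"
    note [simp] = lform_comp[OF \<psi>]
    show "sw \<one> (\<lambda>y1 y2. \<chi> y1 * \<psi> (T (g [^] b) \<otimes> y2 \<otimes> g [^] b)) = sw \<one> (\<lambda>y1 y2. \<psi> (S (S y1)) * \<chi> y2)"
      using \<chi> \<psi> by (simp add: sw_grouplike[OF grouplike_one] Tb)
  qed
  have ig: "implements_S2 \<chi> (g [^] b) g"
    unfolding implements_S2_def
  proof (intro allI impI)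
    fix \<psi> assume \<psi>: "lform H \<psi>"
    note [simp] = lform_comp[OF \<psi>]
    have "T (g [^] b) \<otimes> g \<otimes> g [^] b = (T (g [^] b) \<otimes> g [^] b) \<otimes> g"
      using nat_pow_comm[of g b 1] by (simp add: m_assoc)
    then have "T (g [^] b) \<otimes> g \<otimes> g [^] b = g" by (simp add: Tb)
    then show "sw g (\<lambda>y1 y2. \<chi> y1 * \<psi> (T (g [^] b) \<otimes> y2 \<otimes> g [^] b)) = sw g (\<lambda>y1 y2. \<psi> (S (S y1)) * \<chi> y2)"
      using \<chi> \<psi> by (simp add: sw_grouplike[OF grouplike_g] SS_g)
  qed
  have ix: "implements_S2 \<chi> (g [^] b) x" if n: "n \<ge> 2"
    unfolding implements_S2_def
  proof (intro allI impI)
    fix \<psi> assume \<psi>: "lform H \<psi>"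
    note [simp] = lform_comp[OF \<psi>]
    have "T (g [^] b) \<otimes> x \<otimes> g [^] b = scal H (q ^ b) ((T (g [^] b) \<otimes> g [^] b) \<otimes> x)"
      by (simp add: m_assoc x_g_pow mult_scal)
    then have "T (g [^] b) \<otimes> x \<otimes> g [^] b = scal H (q ^ b) x" by (simp add: Tb)
    then show "sw x (\<lambda>y1 y2. \<chi> y1 * \<psi> (T (g [^] b) \<otimes> y2 \<otimes> g [^] b)) = sw x (\<lambda>y1 y2. \<psi> (S (S y1)) * \<chi> y2)"
      using \<chi> \<psi> by (simp add: sw_x SS_x character_x[OF \<chi> n] o lform_scal cg mult.commute)
  qed
  note mul = implements_S2_mult[OF \<chi> grouplike_pow]
  have "implements_S2 \<chi> (g [^] b) (g [^] i)" for i :: nat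
    by (induction i) (simp_all add: one mul ig)
  moreover have "implements_S2 \<chi> (g [^] b) (x [^] j)"
  proof (cases "j = 0")
    case False
    then have "n \<ge> 2" using j by simp
    then have "implements_S2 \<chi> (g [^] b) (x [^] k)" for k :: nat
      by (induction k) (simp_all add: one mul ix)
    then show ?thesis .
  qed (simp add: one)
  ultimately show ?thesis unfolding pw_def by (intro mul) simp_all
qed

lemma implements_S2_all:
  assumes \<chi>: "character \<chi>" and cg: "\<chi> g = q ^ Suc b" and y: "y \<in> carrier H"
  shows "implements_S2 \<chi> (g [^] b) y"
  unfolding implements_S2_def
proof (intro allI impI)
  fix \<psi> assume \<psi>: "lform H \<psi>"
  show "sw y (\<lambda>y1 y2. \<chi> y1 * \<psi> (T (g [^] b) \<otimes> y2 \<otimes> g [^] b)) = sw y (\<lambda>y1 y2. \<psi> (S (S y1)) * \<chi> y2)"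
    (is "sw y ?F = sw y ?G")
  proof (rule lform_eq_on_pw[where \<phi> = "\<lambda>y. sw y ?F" and \<psi> = "\<lambda>y. sw y ?G"])
    fix i j assume "j < n"
    then show "sw (pw i j) ?F = sw (pw i j) ?G"
      using implements_S2_pw[OF \<chi> cg, of j i] \<psi> unfolding implements_S2_def by blast
  qed (simp_all add: y)
qed

text \<open>
  The two conditions on \<open>b\<close> say that the square of the group-like element is
  \<open>\<alpha>\<^sup>m \<bowtie> g\<^sup>n\<^sup>-\<^sup>1\<close> and that it implements the square
  of the antipode; they hold for both exponents \<open>b\<close> in the theorem.
\<close>

lemma ribbon_bow:
  assumes n: "odd n" and b: "2 * b mod N = (n - 1) mod N" and qb: "q ^ Suc b = q ^ ((n + 1) div 2)"
  shows "ribbon_element D (double_R H) (u \<otimes>\<^bsub>D\<^esub> bow (\<alpha> [^]\<^bsub>DA\<^esub> (m * (n + 1) div 2)) (g [^] b))"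
proof -
  define k where "k = (n + 1) div 2"
  define \<chi> where "\<chi> = \<alpha> [^]\<^bsub>DA\<^esub> (m * (n + 1) div 2)"
  have k: "m * (n + 1) div 2 = m * k" "k + k = n + 1" using n by (auto simp: k_def div_mult_swap elim!: oddE)
  have \<chi>k: "\<chi> = (\<alpha> [^]\<^bsub>DA\<^esub> m) [^]\<^bsub>DA\<^esub> k" unfolding \<chi>_def k by (simp add: dual.nat_pow_pow)
  have \<chi>: "character \<chi>" unfolding \<chi>k by (rule character_pow_closed[OF SD_u(1)])
  have "\<chi> (pw 1 0) = \<xi> ^ (m * k * 1)"
    unfolding \<chi>_def k using n_pos by (subst alpha_pow) simp_all
  then have cg: "\<chi> g = q ^ Suc b" unfolding g_pw[symmetric] qb k_def[symmetric] by (simp add: power_mult \<xi>_m)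
  have "\<chi> \<otimes>\<^bsub>DA\<^esub> \<chi> = \<alpha> [^]\<^bsub>DA\<^esub> (N * 1 + m)"
    unfolding \<chi>_def k using k(2) by (simp add: dual.nat_pow_mult flip: distrib_left) (simp add: algebra_simps)
  also have "\<dots> = \<alpha> [^]\<^bsub>DA\<^esub> m"
    by (simp only: dual.nat_pow_mult[symmetric] alpha_closed alpha_pow_N) simp
  finally have \<chi>\<chi>: "\<chi> \<otimes>\<^bsub>DA\<^esub> \<chi> = \<alpha> [^]\<^bsub>DA\<^esub> m" .
  have "g [^] b \<otimes> g [^] b = g [^] (2 * b)" by (simp add: nat_pow_mult mult_2)
  also have "\<dots> = g [^] (n - 1)" using b g_pow_mod by metis
  finally have gg: "g [^] b \<otimes> g [^] b = g [^] (n - 1)" .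
  have "ribbon_element D (double_R H) (u \<otimes>\<^bsub>D\<^esub> bow \<chi> (g [^] b))"
  proof (rule ribbon_criterion)
    show "D_grouplike (bow \<chi> (g [^] b))" by (rule D_grouplike_bow[OF \<chi> grouplike_pow])
    show "SD u = u \<otimes>\<^bsub>D\<^esub> (bow \<chi> (g [^] b) \<otimes>\<^bsub>D\<^esub> bow \<chi> (g [^] b))"
      by (simp add: bow_grouplike_mult[OF \<chi> grouplike_pow \<chi> grouplike_pow] \<chi>\<chi> gg SD_u(2))
  qed (auto intro: implements_S2_central[OF \<chi> grouplike_pow implements_S2_all[OF \<chi> cg]])
  then show ?thesis by (simp only: \<chi>_def)
qed

text \<open>
  Two ribbon elements differ by some \<open>\<chi> \<bowtie> g\<^sup>b\<close> with square \<open>1\<close>. Then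
  \<open>\<chi>(g)\<^sup>2 = 1\<close>, and \<open>\<chi>(g)\<close> also has odd order, so \<open>\<chi>\<close> is trivial; and
  \<open>N\<close> divides \<open>2 b\<close> with \<open>b < N\<close>.
\<close>

lemma ribbon_unique:
  assumes n: "odd n" and mn: "odd m \<or> n \<noteq> 1"
    and v: "ribbon_element D (double_R H) v" and v': "ribbon_element D (double_R H) v'"
  shows "v' = v \<otimes>\<^bsub>D\<^esub> bow \<one>\<^bsub>DA\<^esub> \<one> \<or> even m \<and> v' = v \<otimes>\<^bsub>D\<^esub> bow \<one>\<^bsub>DA\<^esub> (g [^] (N div 2))"
proof -
  obtain t where t: "D_grouplike t" "t \<otimes>\<^bsub>D\<^esub> t = \<one>\<^bsub>D\<^esub>" "v' = v \<otimes>\<^bsub>D\<^esub> t"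
    using ribbon_difference[OF v v'] .
  obtain \<chi> h where \<chi>: "character \<chi>" and h: "grouplike h" and tb: "t = bow \<chi> h"
    using D_grouplike_split[OF t(1)] .
  obtain b where b: "b < N" "h = g [^] b" using grouplike_is_g_pow[OF h] .
  have sq: "bow (\<chi> \<otimes>\<^bsub>DA\<^esub> \<chi>) (h \<otimes> h) = bow \<one>\<^bsub>DA\<^esub> \<one>"
    using t(2) by (simp add: tb bow_grouplike_mult[OF \<chi> h \<chi> h] one_D)
  have 1: "(\<chi> \<otimes>\<^bsub>DA\<^esub> \<chi>) y * \<phi> (h \<otimes> h) = \<one>\<^bsub>DA\<^esub> y * \<phi> \<one>" if "lform H \<phi>" for y \<phi>
    using arg_cong[OF sq, of "\<lambda>t. E t y \<phi>"] that \<chi> h by (simp del: dual_mult_apply one_DA_apply)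
  have "\<chi> g * \<chi> g = 1"
    using 1[of "\<one>\<^bsub>DA\<^esub>" g] \<chi> h
    by (simp add: sw_grouplike grouplike_g counit_mult counit_g counit_one grouplike_def[of h])
  then have c2: "\<chi> g ^ 2 = 1" by (simp add: power2_eq_square)
  have "\<chi> g ^ n = 1 \<or> odd N \<and> \<chi> g ^ N = 1"
  proof (cases "n = 1")
    case True
    (* For n = 1 a character need not kill x; instead the order of g is odd. *)
    have "\<chi> (g [^] N) = 1" unfolding g_pow_N using \<chi> by (simp add: character_def)
    then show ?thesis using mn True n \<chi> by (simp add: character_pow)
  next
    case False
    (* The relation x^n = g^n - 1 under a character that kills x. *)
    then have "\<chi> (x [^] n) = 0" using n_pos character_x[OF \<chi>] by (simp add: character_pow[OF \<chi>])
    then have "\<chi> (g [^] n) - \<chi> \<one> = 0"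
      unfolding x_pow_n using linear_on_diff[of H "(*)" \<chi> "g [^] n" \<one>] \<chi> by (simp add: lform_def[symmetric])
    then show ?thesis using \<chi> by (simp add: character_pow[OF \<chi>] character_def)
  qed
  then obtain k where k: "odd k" "\<chi> g ^ k = 1" using n by blast
  then obtain l where "k = 2 * l + 1" by (auto elim: oddE)
  then have "\<chi> g = 1" using k(2) c2 by (simp add: power_mult)
  then have \<chi>1: "\<chi> = \<one>\<^bsub>DA\<^esub>"
    by (intro character_eqI[OF \<chi> character_one]) (simp add: counit_g)
  have "\<alpha> (h \<otimes> h) = \<alpha> \<one>" using 1[of \<alpha> \<one>] \<chi> by (simp add: sw_grouplike grouplike_one character_def counit_one)
  then have "\<xi> ^ (2 * b) = 1"
    using alpha_g_pow[of "2 * b"] alpha_g_pow[of 0] by (simp add: b(2) nat_pow_mult mult_2)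
  then have "int N dvd int (2 * b)" by (simp only: power_int_of_nat \<xi>_eq_one_iff[symmetric])
  then have "N dvd 2 * b" by (simp only: int_dvd_int_iff)
  then obtain k where k: "2 * b = N * k" by (auto simp: dvd_def)
  then have "N * k < N * 2" using b(1) by linarith
  then have "k < 2" by simp
  then consider "k = 0" | "k = 1" by linarith
  then show ?thesis
  proof cases
    case 1
    then show ?thesis using k t(3) tb \<chi>1 b(2) by simp
  next
    case 2
    then have "b = N div 2" "even N" using k by (simp, metis dvd_triv_left mult.right_neutral)
    then show ?thesis using n t(3) tb \<chi>1 b(2) by simp
  qed
qed

end

theorem theorem4p7:
  fixes H :: "('k::alg_closed_field, 'a::ab_group_add) bialg"
    and m n :: nat and q \<xi> :: 'k and g x :: 'a
  assumes "m \<ge> 2" and "n \<ge> 1" and "odd n"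
    and "\<not> CHAR('k) dvd m * n"
    and "primitive_root_of_unity n q"
    and "primitive_root_of_unity (m * n) \<xi>" and "\<xi> ^ m = q"
    and "radford_hopf_algebra H m n q g x"
  shows
    "let D = drinfeld_double H;
         R = double_R H;
         H' = dual_alg H;
         \<alpha> = radford_alpha H m n \<xi> g x;
         \<beta> = radford_beta H m n g x;
         u = drinfeld_element D R
     in u = scal D (1 / of_nat (m * n))
              (\<Sum>i<m * n. \<Sum>k<m * n. \<Sum>j<n.
                 scal D ((-1) ^ j * (1 / qfact q j) *
                         \<xi> powi (- int ((i + j) * k) - int (j * (j - 1) * m div 2)))
                   (bowtie H (\<alpha> [^]\<^bsub>H'\<^esub> (- int (m * j) - int k) \<otimes>\<^bsub>H'\<^esub> \<beta> [^]\<^bsub>H'\<^esub> j)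
                             (g [^]\<^bsub>H\<^esub> i \<otimes>\<^bsub>H\<^esub> x [^]\<^bsub>H\<^esub> j)))
      \<and> (odd m \<longrightarrow>
          (let v = u \<otimes>\<^bsub>D\<^esub> bowtie H (\<alpha> [^]\<^bsub>H'\<^esub> (m * (n + 1) div 2)) (g [^]\<^bsub>H\<^esub> ((n - 1) div 2))
           in {w. ribbon_element D R w} = {v}))
      \<and> (even m \<longrightarrow>
          (let v1 = u \<otimes>\<^bsub>D\<^esub> bowtie H (\<alpha> [^]\<^bsub>H'\<^esub> (m * (n + 1) div 2)) (g [^]\<^bsub>H\<^esub> ((n - 1) div 2));
               v2 = u \<otimes>\<^bsub>D\<^esub> bowtie H (\<alpha> [^]\<^bsub>H'\<^esub> (m * (n + 1) div 2)) (g [^]\<^bsub>H\<^esub> ((n * (m + 1) - 1) div 2))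
           in ribbon_element D R v1 \<and> ribbon_element D R v2
              \<and> (n \<noteq> 1 \<longrightarrow> {w. ribbon_element D R w} = {v1, v2})))"
proof -
  interpret radford_setting H m n q g x \<xi>
  proof (intro radford_setting.intro radford_setting_axioms.intro)
    show "of_nat (m * n) \<noteq> (0 :: 'k)" using assms(4) by (simp only: of_nat_eq_0_iff_char_dvd not_False_eq_True)
  qed (use assms in simp_all)
  let ?l = "\<lambda>b. bow (\<alpha> [^]\<^bsub>DA\<^esub> (m * (n + 1) div 2)) (g [^]\<^bsub>H\<^esub> b)"
  define b1 where "b1 = (n - 1) div 2"
  define b2 where "b2 = (n * (m + 1) - 1) div 2"
  have n1: "2 * b1 = n - 1" "Suc b1 = (n + 1) div 2" using assms(3) by (auto simp: b1_def elim!: oddE)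
  have r1: "ribbon_element D (double_R H) (u \<otimes>\<^bsub>D\<^esub> ?l b1)"
    by (rule ribbon_bow[OF assms(3)]) (simp_all only: n1)
  have b2: "b2 = b1 + N div 2" if "even m"
  proof -
    obtain c where c: "m = 2 * c" using \<open>even m\<close> by (elim evenE)
    have "n * (m + 1) - 1 = 2 * (n * c) + (n - 1)" using assms(2) by (simp add: c algebra_simps)
    then show ?thesis unfolding b2_def n1(1)[symmetric] by (simp add: c)
  qed
  have r2: "ribbon_element D (double_R H) (u \<otimes>\<^bsub>D\<^esub> ?l b2)" if ev: "even m"
  proof (rule ribbon_bow[OF assms(3)])
    obtain c where c: "m = 2 * c" using ev by (elim evenE)
    have "2 * b2 = (n - 1) + N" unfolding b2[OF ev] using n1(1) by (simp add: c)
    then show "2 * b2 mod N = (n - 1) mod N" by simp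
    have "Suc b2 = Suc b1 + n * c" unfolding b2[OF ev] by (simp add: c)
    then have "q ^ Suc b2 = q ^ Suc b1 * (q ^ n) ^ c" by (simp only: power_add power_mult)
    then show "q ^ Suc b2 = q ^ ((n + 1) div 2)" by (simp only: q_pow_n n1 power_one mult_1_right)
  qed
  have ch: "character (\<alpha> [^]\<^bsub>DA\<^esub> (m * (n + 1) div 2))"
  proof -
    have "m * (n + 1) div 2 = m * ((n + 1) div 2)" using assms(3) by (intro div_mult_swap[symmetric]) simp
    then show ?thesis using character_pow_closed[OF SD_u(1), of "(n + 1) div 2"] by (simp add: dual.nat_pow_pow)
  qed
  have shift: "(u \<otimes>\<^bsub>D\<^esub> ?l b) \<otimes>\<^bsub>D\<^esub> bow \<one>\<^bsub>DA\<^esub> (g [^]\<^bsub>H\<^esub> c) = u \<otimes>\<^bsub>D\<^esub> ?l (b + c)" for b c :: nat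
  proof -
    have "(u \<otimes>\<^bsub>D\<^esub> bow \<chi> (g [^]\<^bsub>H\<^esub> b)) \<otimes>\<^bsub>D\<^esub> bow \<one>\<^bsub>DA\<^esub> (g [^]\<^bsub>H\<^esub> c) = u \<otimes>\<^bsub>D\<^esub> bow \<chi> (g [^]\<^bsub>H\<^esub> (b + c))"
      if "character \<chi>" for \<chi>
      using that
      by (simp add: D.m_assoc bow_grouplike_mult[OF that grouplike_pow character_one grouplike_pow] nat_pow_mult)
    then show ?thesis using ch .
  qed
  have un: "w = u \<otimes>\<^bsub>D\<^esub> ?l b1 \<or> even m \<and> w = u \<otimes>\<^bsub>D\<^esub> ?l b2"
    if "ribbon_element D (double_R H) w" "odd m \<or> n \<noteq> 1" for w
    using ribbon_unique[OF assms(3) that(2) r1 that(1)] shift[of b1 0] shift[of b1 "N div 2"] b2 by auto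
  have ru: "drinfeld_element D (double_R H) = u" by (simp only: double_R_eq u_def)
  show ?thesis
    unfolding Let_def ru b1_def[symmetric] b2_def[symmetric]
  proof (intro conjI impI, rule u_formula)
    assume "odd m"
    then show "{w. ribbon_element D (double_R H) w} = {u \<otimes>\<^bsub>D\<^esub> ?l b1}" using r1 un by blast
  next
    assume "even m" and "n \<noteq> 1"
    then show "{w. ribbon_element D (double_R H) w} = {u \<otimes>\<^bsub>D\<^esub> ?l b1, u \<otimes>\<^bsub>D\<^esub> ?l b2}" using r1 r2 un by blast
  qed (rule r1, erule r2)
qed

end
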